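(* For every $1<p<\infty$ and every $0<\theta<1$, the extension sequence $$0\to o(\ell_p)(\theta)\xrightarrow{\,j\,} do(\ell_p)(\theta)\xrightarrow{\,q\,} o(\ell_p)(\theta)\to 0,\qquad j(y)=(0,y),\quad q(x,y)=x,$$ induced by complex interpolation of the couple $(\min(\ell_p),\max(\ell_p))$ at $\theta$ is completely singular and completely cosingular.
   Context: Operator spaces $X$ carry matrix norms on $M_n(X)$ (Ruan's axioms); quotients have $M_n(X/Y)=M_n(X)/M_n(Y)$. For a Banach space $X$: $\|x\|_{M_n(\min(X))}=\sup\{\|(f(x_{ij}))\|_{M_n}:f\in X^*,\|f\|\le1\}$ and $\|x\|_{M_n(\max(X))}=\inf\{\|A\|\|D\|\|B\|\}$ over all factorizations $x=ADB$ with $A,B$ scalar matrices and $D$ a diagonal matrix with entries in $X$, where $\|D\|$ is the maximum of the norms of the diagonal entries (the minimal and maximal operator space structures on $X$). Complex interpolation: for a compatible couple $(X_0,X_1)$ (both continuously and linearly embedded in a common Hausdorff topological vector space), $\Sigma=X_0+X_1$ with norm $\inf\{\|x_0\|_{X_0}+\|x_1\|_{X_1}:x=x_0+x_1\}$, $\mathbb S=\{0\le\mathrm{Re}\,z\le1\}$. $\mathcal F(X_0,X_1)$ is the Banach space of functions $f:\mathbb S\to\Sigma$ bounded and continuous on $\mathbb S$, analytic in its interior, with $f(it)\in X_0$, $f(1+it)\in X_1$ and $t\mapsto\|f(it)\|_{X_0}$, $t\mapsto\|f(1+it)\|_{X_1}$ bounded and continuous, with norm $\max\{\sup_t\|f(it)\|_{X_0},\sup_t\|f(1+it)\|_{X_1}\}$;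 for operator spaces, $M_n(\mathcal F(X_0,X_1))=\mathcal F(M_n(X_0),M_n(X_1))$. With $\delta_\theta(f)=f(\theta)$, $\delta_\theta'(f)=f'(\theta)$: $X_\theta=(X_0,X_1)_\theta=\mathcal F/\ker\delta_\theta$ and $dX_\theta=\mathcal F/(\ker\delta_\theta\cap\ker\delta_\theta')=\{(f(\theta),f'(\theta)):f\in\mathcal F\}$ with quotient operator space structures. $o(\ell_p)(\theta)=(\min(\ell_p),\max(\ell_p))_\theta$ (the couple being embedded in $\ell_p$ via the identity) and $do(\ell_p)(\theta)$ is the corresponding space $dX_\theta$. An extension sequence $0\to Y\xrightarrow{i}X\xrightarrow{q}Z\to0$ is a short exact sequence of operator spaces and completely bounded maps with $i$ a complete isomorphism onto its image and with $X/\ker q\to Z$ induced by $q$ a complete isomorphism. It is completely singular if $q$ is completely strictly singular, i.e. the restriction of $q$ to any infinite dimensional closed subspace of $X$ is not a complete isomorphism onto its image. It is completely cosingular if $i$ is completely strictly cosingular, i.e. whenever $E$ is an operator space and $r:X\to E$ is such that both $r$ and $r\circ i:Y\to E$ are complete quotient maps, $E$ is finite dimensional. Here a complete quotient map (complete surjection) is a completely bounded surjection whose induced map from the quotient by its kernel is a complete isomorphism. *)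

theory Defs
  imports
    "HOL-Analysis.Analysis"
    "HOL-Library.Function_Algebras"
    "Jordan_Normal_Form.Matrix"
begin

section \<open>Complex vector spaces, normed spaces and operator spaces\<close>

text \<open>
  All spaces are linear subspaces \<open>car\<close> of an ambient type carrying the addition (the exponent
  of \<open>\<ell>\<^sub>p\<close> cannot be a parameter of a type); \<open>scl\<close> is the complex scalar multiplication of the
  ambient type. The norms are only meaningful on \<open>car\<close>, respectively on square matrices of
  positive size with entries in \<open>car\<close>.
\<close>

record 'a cvs =
  car :: "'a set"
  scl :: "complex \<Rightarrow> 'a \<Rightarrow> 'a"

record 'a cns = "'a cvs" +
  nrm :: "'a \<Rightarrow> real"

record 'a opspace = "'a cvs" +
  mnorm :: "'a mat \<Rightarrow> real"

definition complex_vector_space :: "('a::ab_group_add, 'm) cvs_scheme \<Rightarrow> bool" where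
  "complex_vector_space V \<longleftrightarrow> vector_space (scl V) \<and> module.subspace (scl V) (car V)"

definition finite_dim :: "('a::ab_group_add, 'm) cvs_scheme \<Rightarrow> bool" where
  "finite_dim V \<longleftrightarrow> (\<exists>B. finite B \<and> car V = module.span (scl V) B)"

definition linear_map ::
    "('a::ab_group_add, 'm) cvs_scheme \<Rightarrow> ('b::ab_group_add, 'k) cvs_scheme \<Rightarrow> ('a \<Rightarrow> 'b) \<Rightarrow> bool"
  where
  "linear_map V W T \<longleftrightarrow>
     (\<forall>x\<in>car V. T x \<in> car W) \<and>
     (\<forall>x\<in>car V. \<forall>y\<in>car V. T (x + y) = T x + T y) \<and>
     (\<forall>c. \<forall>x\<in>car V. T (scl V c x) = scl W c (T x))"

definition mats :: "('a, 'm) cvs_scheme \<Rightarrow> nat \<Rightarrow> 'a mat set" where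
  "mats V n = {x \<in> carrier_mat n n. elements_mat x \<subseteq> car V}"

text \<open>The product \<open>\<alpha> x \<beta>\<close> of a matrix \<open>x\<close> over \<open>V\<close> with scalar matrices on both sides.\<close>

definition scalar_prods ::
    "('a::ab_group_add, 'm) cvs_scheme \<Rightarrow> complex mat \<Rightarrow> 'a mat \<Rightarrow> complex mat \<Rightarrow> 'a mat" where
  "scalar_prods V \<alpha> x \<beta> = mat (dim_row \<alpha>) (dim_col \<beta>)
     (\<lambda>(i, j). \<Sum>k<dim_row x. \<Sum>l<dim_col x. scl V (\<alpha> $$ (i, k) * \<beta> $$ (l, j)) (x $$ (k, l)))"

definition vec_l2norm :: "complex Matrix.vec \<Rightarrow> real" where
  "vec_l2norm v = L2_set (\<lambda>i. cmod (vec_index v i)) {..<dim_vec v}"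

definition scalar_mat_norm :: "complex mat \<Rightarrow> real" where
  "scalar_mat_norm \<alpha> =
     Sup {vec_l2norm (mult_mat_vec \<alpha> v) | v. v \<in> carrier_vec (dim_col \<alpha>) \<and> vec_l2norm v \<le> 1}"

definition normed_space_of :: "'a opspace \<Rightarrow> 'a cns" where
  "normed_space_of X = \<lparr>car = car X, scl = scl X, nrm = (\<lambda>x. mnorm X (mat 1 1 (\<lambda>_. x)))\<rparr>"

definition complete_norm :: "'a::ab_group_add cns \<Rightarrow> bool" where
  "complete_norm N \<longleftrightarrow>
     (\<forall>s. (\<forall>k. s k \<in> car N) \<and>
          (\<forall>e>0. \<exists>K. \<forall>k\<ge>K. \<forall>l\<ge>K. nrm N (s k - s l) < e) \<longrightarrow>
          (\<exists>x\<in>car N. (\<lambda>k. nrm N (s k - x)) \<longlonglongrightarrow> 0))"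

definition matrix_norms :: "'a::ab_group_add opspace \<Rightarrow> bool" where
  "matrix_norms X \<longleftrightarrow> (\<forall>n\<ge>1. \<forall>x\<in>mats X n.
     0 \<le> mnorm X x \<and>
     (mnorm X x = 0 \<longleftrightarrow> x = 0\<^sub>m n n) \<and>
     (\<forall>c. mnorm X (map_mat (scl X c) x) = cmod c * mnorm X x) \<and>
     (\<forall>y\<in>mats X n. mnorm X (x + y) \<le> mnorm X x + mnorm X y))"

definition ruan_axioms :: "'a::ab_group_add opspace \<Rightarrow> bool" where
  "ruan_axioms X \<longleftrightarrow>
     (\<forall>n\<ge>1. \<forall>m\<ge>1. \<forall>x\<in>mats X n. \<forall>y\<in>mats X m.
        mnorm X (four_block_mat x (0\<^sub>m n m) (0\<^sub>m m n) y) = max (mnorm X x) (mnorm X y)) \<and>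
     (\<forall>n\<ge>1. \<forall>m\<ge>1. \<forall>x\<in>mats X m. \<forall>\<alpha>\<in>carrier_mat n m. \<forall>\<beta>\<in>carrier_mat m n.
        mnorm X (scalar_prods X \<alpha> x \<beta>) \<le> scalar_mat_norm \<alpha> * mnorm X x * scalar_mat_norm \<beta>)"

text \<open>Operator spaces are complete, as usual; completeness of all \<open>M\<^sub>n(X)\<close> follows from \<open>n = 1\<close>.\<close>

definition operator_space :: "'a::ab_group_add opspace \<Rightarrow> bool" where
  "operator_space X \<longleftrightarrow> complex_vector_space X \<and> matrix_norms X \<and> ruan_axioms X \<and>
     complete_norm (normed_space_of X)"

definition closed_subspace :: "'a::ab_group_add opspace \<Rightarrow> 'a set \<Rightarrow> bool" where
  "closed_subspace X W \<longleftrightarrow> module.subspace (scl X) W \<and> W \<subseteq> car X \<and>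
     (\<forall>s. \<forall>x\<in>car X. (\<forall>k. s k \<in> W) \<and> (\<lambda>k. nrm (normed_space_of X) (s k - x)) \<longlonglongrightarrow> 0 \<longrightarrow> x \<in> W)"


section \<open>Completely bounded maps and quotients\<close>

definition completely_bounded ::
    "'a::ab_group_add opspace \<Rightarrow> 'b::ab_group_add opspace \<Rightarrow> ('a \<Rightarrow> 'b) \<Rightarrow> bool" where
  "completely_bounded X Y T \<longleftrightarrow> linear_map X Y T \<and>
     (\<exists>C. \<forall>n\<ge>1. \<forall>x\<in>mats X n. mnorm Y (map_mat T x) \<le> C * mnorm X x)"

definition complete_isomorphism ::
    "'a::ab_group_add opspace \<Rightarrow> 'b::ab_group_add opspace \<Rightarrow> ('a \<Rightarrow> 'b) \<Rightarrow> bool" where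
  "complete_isomorphism X Y T \<longleftrightarrow> bij_betw T (car X) (car Y) \<and>
     completely_bounded X Y T \<and> completely_bounded Y X (inv_into (car X) T)"

definition complete_isomorphism_onto_image ::
    "'a::ab_group_add opspace \<Rightarrow> 'b::ab_group_add opspace \<Rightarrow> ('a \<Rightarrow> 'b) \<Rightarrow> bool" where
  "complete_isomorphism_onto_image X Y T \<longleftrightarrow>
     complete_isomorphism X (Y\<lparr>car := T ` car X\<rparr>) T"

text \<open>
  The quotient \<open>X / ker T\<close> for a linear map \<open>T\<close> into a vector space with scalar multiplication
  \<open>s\<close>. The coset \<open>x + ker T\<close> is represented by the value \<open>T x\<close>, so that the elements of the
  quotient are those of \<open>T ` car X\<close>; the norm of \<open>M\<^sub>n(X) / M\<^sub>n(ker T)\<close> is the infimum of the norms of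
  the matrices in the coset, i.e. of those which \<open>T\<close> maps entrywise to the given matrix.
\<close>

definition quotient_by_ker :: "'a opspace \<Rightarrow> ('a \<Rightarrow> 'b) \<Rightarrow> (complex \<Rightarrow> 'b \<Rightarrow> 'b) \<Rightarrow> 'b opspace" where
  "quotient_by_ker X T s =
     \<lparr>car = T ` car X, scl = s,
      mnorm = (\<lambda>z. Inf {mnorm X x | x. x \<in> mats X (dim_row z) \<and> map_mat T x = z})\<rparr>"

text \<open>With the above representation of \<open>X / ker T\<close>, the map induced by \<open>T\<close> is the identity.\<close>

definition complete_quotient_map ::
    "'a::ab_group_add opspace \<Rightarrow> 'b::ab_group_add opspace \<Rightarrow> ('a \<Rightarrow> 'b) \<Rightarrow> bool" where
  "complete_quotient_map X Y T \<longleftrightarrow> completely_bounded X Y T \<and> T ` car X = car Y \<and>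
     complete_isomorphism (quotient_by_ker X T (scl Y)) Y (\<lambda>z. z)"


section \<open>Extension sequences, singularity and cosingularity\<close>

definition extension_sequence ::
    "'a::ab_group_add opspace \<Rightarrow> 'b::ab_group_add opspace \<Rightarrow> 'c::ab_group_add opspace \<Rightarrow>
     ('a \<Rightarrow> 'b) \<Rightarrow> ('b \<Rightarrow> 'c) \<Rightarrow> bool" where
  "extension_sequence Y X Z i q \<longleftrightarrow>
     operator_space Y \<and> operator_space X \<and> operator_space Z \<and>
     completely_bounded Y X i \<and> completely_bounded X Z q \<and>
     inj_on i (car Y) \<and> i ` car Y = {x \<in> car X. q x = 0} \<and> q ` car X = car Z \<and>
     complete_isomorphism_onto_image Y X i \<and> complete_quotient_map X Z q"

definition completely_strictly_singular ::
    "'a::ab_group_add opspace \<Rightarrow> 'b::ab_group_add opspace \<Rightarrow> ('a \<Rightarrow> 'b) \<Rightarrow> bool" where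
  "completely_strictly_singular X Z q \<longleftrightarrow>
     (\<forall>W. closed_subspace X W \<and> \<not> finite_dim (X\<lparr>car := W\<rparr>) \<longrightarrow>
          \<not> complete_isomorphism_onto_image (X\<lparr>car := W\<rparr>) Z q)"

text \<open>
  The operator space \<open>E\<close> ranges over all operator spaces inside the type \<open>'e\<close>; a definition cannot
  quantify over types, so \<open>'e\<close> is a parameter which has to be left arbitrary in theorems.
\<close>

definition completely_strictly_cosingular ::
    "'e::ab_group_add itself \<Rightarrow> 'a::ab_group_add opspace \<Rightarrow> 'b::ab_group_add opspace \<Rightarrow>
     ('a \<Rightarrow> 'b) \<Rightarrow> bool" where
  "completely_strictly_cosingular _ Y X i \<longleftrightarrow>
     (\<forall>(E::'e opspace) r. operator_space E \<and>
        complete_quotient_map X E r \<and> complete_quotient_map Y E (r \<circ> i) \<longrightarrow> finite_dim E)"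

definition completely_singular_sequence ::
    "'a::ab_group_add opspace \<Rightarrow> 'b::ab_group_add opspace \<Rightarrow> 'c::ab_group_add opspace \<Rightarrow>
     ('a \<Rightarrow> 'b) \<Rightarrow> ('b \<Rightarrow> 'c) \<Rightarrow> bool" where
  "completely_singular_sequence Y X Z i q \<longleftrightarrow>
     extension_sequence Y X Z i q \<and> completely_strictly_singular X Z q"

definition completely_cosingular_sequence ::
    "'e::ab_group_add itself \<Rightarrow>
     'a::ab_group_add opspace \<Rightarrow> 'b::ab_group_add opspace \<Rightarrow> 'c::ab_group_add opspace \<Rightarrow>
     ('a \<Rightarrow> 'b) \<Rightarrow> ('b \<Rightarrow> 'c) \<Rightarrow> bool" where
  "completely_cosingular_sequence e Y X Z i q \<longleftrightarrow>
     extension_sequence Y X Z i q \<and> completely_strictly_cosingular e Y X i"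


section \<open>Minimal and maximal operator space structures\<close>

definition dual_ball :: "'a::ab_group_add cns \<Rightarrow> ('a \<Rightarrow> complex) set" where
  "dual_ball N = {f. linear_map N \<lparr>car = UNIV, scl = (*)\<rparr> f \<and> (\<forall>x\<in>car N. cmod (f x) \<le> nrm N x)}"

definition min_os :: "'a::ab_group_add cns \<Rightarrow> 'a opspace" where
  "min_os N = \<lparr>car = car N, scl = scl N,
     mnorm = (\<lambda>x. SUP f\<in>dual_ball N. scalar_mat_norm (map_mat f x))\<rparr>"

definition max_os :: "'a::ab_group_add cns \<Rightarrow> 'a opspace" where
  "max_os N = \<lparr>car = car N, scl = scl N,
     mnorm = (\<lambda>x. Inf {scalar_mat_norm A * (MAX i\<in>{..<k}. nrm N (D $$ (i, i))) * scalar_mat_norm B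
       | A D B k. k \<ge> 1 \<and> A \<in> carrier_mat (dim_row x) k \<and> B \<in> carrier_mat k (dim_col x) \<and>
           D \<in> mats N k \<and> diagonal_mat D \<and> x = scalar_prods N A D B})\<rparr>"


section \<open>Complex interpolation\<close>

text \<open>
  A compatible couple is given by two operator spaces inside the same ambient type, with the same
  scalar multiplication.
\<close>

definition sum_space :: "'a::ab_group_add opspace \<Rightarrow> 'a opspace \<Rightarrow> 'a cns" where
  "sum_space X0 X1 =
     \<lparr>car = {a + b | a b. a \<in> car X0 \<and> b \<in> car X1}, scl = scl X0,
      nrm = (\<lambda>x. Inf {nrm (normed_space_of X0) a + nrm (normed_space_of X1) b | a b.
               a \<in> car X0 \<and> b \<in> car X1 \<and> x = a + b})\<rparr>"

definition strip :: "complex set" where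
  "strip = {z. 0 \<le> Re z \<and> Re z \<le> 1}"

definition norm_continuous_on :: "'a::ab_group_add cns \<Rightarrow> complex set \<Rightarrow> (complex \<Rightarrow> 'a) \<Rightarrow> bool" where
  "norm_continuous_on N S f \<longleftrightarrow> (\<forall>z\<in>S. ((\<lambda>w. nrm N (f w - f z)) \<longlongrightarrow> 0) (at z within S))"

definition has_complex_deriv ::
    "'a::ab_group_add cns \<Rightarrow> (complex \<Rightarrow> 'a) \<Rightarrow> 'a \<Rightarrow> complex \<Rightarrow> bool" where
  "has_complex_deriv N f d z \<longleftrightarrow> d \<in> car N \<and>
     ((\<lambda>w. nrm N (scl N (inverse (w - z)) (f w - f z) - d)) \<longlongrightarrow> 0) (at z)"

definition complex_deriv :: "'a::ab_group_add cns \<Rightarrow> (complex \<Rightarrow> 'a) \<Rightarrow> complex \<Rightarrow> 'a" where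
  "complex_deriv N f z = (THE d. has_complex_deriv N f d z)"

definition norm_analytic_on :: "'a::ab_group_add cns \<Rightarrow> complex set \<Rightarrow> (complex \<Rightarrow> 'a) \<Rightarrow> bool" where
  "norm_analytic_on N S f \<longleftrightarrow> (\<forall>z\<in>S. \<exists>d. has_complex_deriv N f d z)"

text \<open>
  The functions on \<open>strip\<close> are represented by functions on the whole plane vanishing off \<open>strip\<close>.
  A matrix of functions is identified with a matrix-valued function, and the matrix norms are those
  making \<open>M\<^sub>n(\<F>(X\<^sub>0, X\<^sub>1)) = \<F>(M\<^sub>n(X\<^sub>0), M\<^sub>n(X\<^sub>1))\<close> isometric.
\<close>

definition calderon_space ::
    "'a::ab_group_add opspace \<Rightarrow> 'a opspace \<Rightarrow> (complex \<Rightarrow> 'a) opspace" where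
  "calderon_space X0 X1 =
     \<lparr>car = {f. (\<forall>z. z \<notin> strip \<longrightarrow> f z = 0) \<and>
                (\<forall>z\<in>strip. f z \<in> car (sum_space X0 X1)) \<and>
                (\<exists>B. \<forall>z\<in>strip. nrm (sum_space X0 X1) (f z) \<le> B) \<and>
                norm_continuous_on (sum_space X0 X1) strip f \<and>
                norm_analytic_on (sum_space X0 X1) (interior strip) f \<and>
                (\<forall>t. f (Complex 0 t) \<in> car X0) \<and> (\<forall>t. f (Complex 1 t) \<in> car X1) \<and>
                bounded (range (\<lambda>t. nrm (normed_space_of X0) (f (Complex 0 t)))) \<and>
                continuous_on UNIV (\<lambda>t. nrm (normed_space_of X0) (f (Complex 0 t))) \<and>
                bounded (range (\<lambda>t. nrm (normed_space_of X1) (f (Complex 1 t)))) \<and>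
                continuous_on UNIV (\<lambda>t. nrm (normed_space_of X1) (f (Complex 1 t)))},
      scl = (\<lambda>c f z. scl X0 c (f z)),
      mnorm = (\<lambda>F. max (SUP t. mnorm X0 (map_mat (\<lambda>f. f (Complex 0 t)) F))
                       (SUP t. mnorm X1 (map_mat (\<lambda>f. f (Complex 1 t)) F)))\<rparr>"

text \<open>The quotients of the Calderon space by \<open>ker \<delta>\<^sub>\<theta>\<close> and by \<open>ker \<delta>\<^sub>\<theta> \<inter> ker \<delta>\<^sub>\<theta>'\<close>.\<close>

definition interpolation_space ::
    "'a::ab_group_add opspace \<Rightarrow> 'a opspace \<Rightarrow> real \<Rightarrow> 'a opspace" where
  "interpolation_space X0 X1 \<theta> =
     quotient_by_ker (calderon_space X0 X1) (\<lambda>f. f (complex_of_real \<theta>)) (scl X0)"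

definition derived_space ::
    "'a::ab_group_add opspace \<Rightarrow> 'a opspace \<Rightarrow> real \<Rightarrow> ('a \<times> 'a) opspace" where
  "derived_space X0 X1 \<theta> =
     quotient_by_ker (calderon_space X0 X1)
       (\<lambda>f. (f (complex_of_real \<theta>), complex_deriv (sum_space X0 X1) f (complex_of_real \<theta>)))
       (\<lambda>c (x, y). (scl X0 c x, scl X0 c y))"


section \<open>The spaces associated with \<open>\<ell>\<^sub>p\<close>\<close>

definition lp_space :: "real \<Rightarrow> (nat \<Rightarrow> complex) cns" where
  "lp_space p =
     \<lparr>car = {x. summable (\<lambda>n. cmod (x n) powr p)}, scl = (\<lambda>c x n. c * x n),
      nrm = (\<lambda>x. (\<Sum>n. cmod (x n) powr p) powr (1 / p))\<rparr>"

definition o_lp :: "real \<Rightarrow> real \<Rightarrow> (nat \<Rightarrow> complex) opspace" where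
  "o_lp p \<theta> = interpolation_space (min_os (lp_space p)) (max_os (lp_space p)) \<theta>"

definition do_lp :: "real \<Rightarrow> real \<Rightarrow> ((nat \<Rightarrow> complex) \<times> (nat \<Rightarrow> complex)) opspace" where
  "do_lp p \<theta> = derived_space (min_os (lp_space p)) (max_os (lp_space p)) \<theta>"

end

theory Submission
  imports "HOL-Complex_Analysis.Complex_Analysis" "HOL-Real_Asymp.Real_Asymp" Defs
begin

text \<open>
  Let \<open>X\<^sub>0 = min(\<ell>\<^sub>p)\<close> and \<open>X\<^sub>1 = max(\<ell>\<^sub>p)\<close>. Both carry the norm of \<open>\<ell>\<^sub>p\<close>, so the two structures differ on
  matrices only. The matrices that tell them apart are columns with entries \<open>x\<^sub>1, \<dots>, x\<^sub>n\<close> that behave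
  like unit vectors of \<open>\<ell>\<^sub>p\<close>, tested by functionals \<open>H(y) = \<Sum>\<^sub>i f\<^sub>i(y\<^sub>i\<^sub>0)\<close> of the first column of a matrix
  \<open>y\<close>, where the \<open>f\<^sub>i\<close> behave like the coordinate functionals. If \<open>N\<^sub>0, N\<^sub>1\<close> bound the norms of the column
  over \<open>X\<^sub>0, X\<^sub>1\<close> and \<open>K\<^sub>0, K\<^sub>1\<close> those of \<open>H\<close>, then these bounds can be chosen with
  \<open>K\<^sub>0 N\<^sub>0 = K\<^sub>1 N\<^sub>1 = 4 n\<close>, which is the order of \<open>H(x) = \<Sum>\<^sub>i f\<^sub>i(x\<^sub>i)\<close>, and with \<open>N\<^sub>1 / N\<^sub>0 = K\<^sub>0 / K\<^sub>1 = n\<^sup>g\<close> for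
  \<open>g = min (1/p) (1 - 1/p) > 0\<close> (\<open>column_estimates\<close>).

  The derived space sees the logarithm of this ratio. The function
  \<open>z \<mapsto> (N\<^sub>0 / N\<^sub>1)^(z - \<theta>) x\<close> shows that the column of the pairs \<open>(x\<^sub>i, - g ln n x\<^sub>i)\<close> has norm at
  most \<open>N\<^sub>0^(1 - \<theta>) N\<^sub>1^\<theta>\<close> in the derived space (\<open>extremal_function\<close>). In the other direction, the
  maximum principle and Cauchy's estimate, applied to \<open>(K\<^sub>0 / K\<^sub>1)^(z - \<theta>) H(F(z))\<close>, bound
  \<open>H(F'(\<theta>)) + g ln n H(F(\<theta>))\<close> by \<open>K\<^sub>0^(1 - \<theta>) K\<^sub>1^\<theta>\<close> times the norm of \<open>F\<close>, up to a constant
  (\<open>column_functional_calderon\<close>). The product of the two bounds is \<open>4 n\<close>.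

  Singularity. If \<open>q\<close> were a complete isomorphism on an infinite-dimensional closed subspace \<open>W\<close>, a
  gliding hump would produce such \<open>x\<^sub>i\<close> in \<open>q(W)\<close> (\<open>gliding_hump_vectors\<close>). The inverse of \<open>q\<close> lifts them
  to pairs \<open>(x\<^sub>i, b\<^sub>i)\<close> with \<open>b\<^sub>i\<close> bounded in \<open>\<ell>\<^sub>p\<close>, and complete boundedness yields
  \<open>|H(b) + g ln n H(x)| \<le> const n\<close>. As \<open>|H(b)| \<le> const n\<close> and \<open>H(x) \<ge> n/4\<close>, this fails for large
  \<open>n\<close> (\<open>lifted_columns_estimate\<close>).

  Cosingularity. Let \<open>r\<close> and \<open>T = r \<circ> j\<close> be complete quotient maps onto an infinite-dimensional \<open>E\<close>.
  Functionals on \<open>E\<close> that vanish on the images of the first unit vectors, composed with \<open>T\<close>, allow a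
  gliding hump for functionals: the \<open>f\<^sub>i\<close> can be chosen to depend on \<open>T y\<close> only
  (\<open>gliding_hump_functionals\<close>). The image under \<open>r\<close> of the extremal pairs \<open>(x\<^sub>i, - g ln n x\<^sub>i)\<close> lifts
  through \<open>T\<close> to a column \<open>w\<close> whose norm in the interpolation space is controlled; and
  \<open>H(w) = H(b) - g ln n H(x)\<close>, where \<open>T b\<^sub>i = r(x\<^sub>i, 0)\<close> with \<open>b\<^sub>i\<close> bounded. The maximum principle for
  \<open>(K\<^sub>0 / K\<^sub>1)^(z - \<theta>) H(F(z))\<close> gives \<open>|H(w)| \<le> const n\<close>, the same contradiction
  (\<open>quotient_columns_estimate\<close>).

  The sequence is exact with complete isomorphisms at both ends because a function on the strip that
  vanishes at \<open>\<theta>\<close> can be divided by \<open>z - \<theta>\<close>, and every function can be multiplied by a bounded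
  function with a simple zero at \<open>\<theta>\<close>. Statements on vector-valued functions are reduced to scalar
  ones by norming functionals; this is what the Hahn--Banach theorem is proved for.
\<close>

section \<open>Operator norms of scalar matrices\<close>

definition l2 :: "nat \<Rightarrow> (nat \<Rightarrow> complex) \<Rightarrow> real" where
  "l2 n u = L2_set (\<lambda>i. cmod (u i)) {..<n}"

text \<open>Operator norms are estimated through the bilinear form without conjugation; as vectors are
  functions on \<open>nat\<close>, matrices of different sizes need no conversion of their arguments.\<close>

definition bilin :: "complex mat \<Rightarrow> (nat \<Rightarrow> complex) \<Rightarrow> (nat \<Rightarrow> complex) \<Rightarrow> complex" where
  "bilin \<alpha> u v = (\<Sum>i<dim_row \<alpha>. \<Sum>j<dim_col \<alpha>. u i * \<alpha> $$ (i, j) * v j)"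

lemma l2_nonneg [simp]: "0 \<le> l2 n u"
  by (simp add: l2_def)

lemma l2_power2: "(l2 n u)\<^sup>2 = (\<Sum>i<n. (cmod (u i))\<^sup>2)"
  unfolding l2_def L2_set_def by (simp add: sum_nonneg)

lemma l2_cong: "(\<And>i. i < n \<Longrightarrow> u i = v i) \<Longrightarrow> l2 n u = l2 n v"
  unfolding l2_def by (rule L2_set_cong) auto

lemma l2_eq_0: "l2 n u = 0 \<Longrightarrow> i < n \<Longrightarrow> u i = 0"
  unfolding l2_def by (subst (asm) L2_set_eq_0_iff) auto

lemma l2_mono: "(\<And>i. i < n \<Longrightarrow> cmod (u i) \<le> cmod (v i)) \<Longrightarrow> l2 n u \<le> l2 n v"
  unfolding l2_def by (rule L2_set_mono) auto

lemma l2_scale: "l2 n (\<lambda>i. c * u i) = cmod c * l2 n u"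
  unfolding l2_def by (simp add: norm_mult L2_set_right_distrib)

lemma entry_le_l2: "i < n \<Longrightarrow> cmod (u i) \<le> l2 n u"
  unfolding l2_def by (rule member_le_L2_set) auto

lemma l2_add: "(l2 (n + m) u)\<^sup>2 = (l2 n u)\<^sup>2 + (l2 m (\<lambda>i. u (n + i)))\<^sup>2"
  unfolding l2_power2 by (induction m) auto

lemma l2_single: "i < n \<Longrightarrow> l2 n (\<lambda>k. if k = i then c else 0) = cmod c"
proof -
  assume "i < n"
  have "(l2 n (\<lambda>k. if k = i then c else 0))\<^sup>2 = (cmod c)\<^sup>2"
    unfolding l2_power2 using \<open>i < n\<close>
    by (simp add: if_distrib[of cmod] if_distrib[of "\<lambda>x. x\<^sup>2"] cong: if_cong)
  then show ?thesis by (simp add: power2_eq_iff_nonneg)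
qed

lemma Cauchy_Schwarz_l2: "cmod (\<Sum>i<n. u i * v i) \<le> l2 n u * l2 n v"
proof -
  have "cmod (\<Sum>i<n. u i * v i) \<le> (\<Sum>i<n. \<bar>cmod (u i)\<bar> * \<bar>cmod (v i)\<bar>)"
    by (rule order_trans[OF norm_sum]) (simp add: norm_mult)
  also have "\<dots> \<le> l2 n u * l2 n v"
    unfolding l2_def by (rule L2_set_mult_ineq)
  finally show ?thesis .
qed

text \<open>The converse of the Cauchy--Schwarz inequality: test with \<open>u = cnj w\<close>.\<close>

lemma l2_leI:
  assumes C: "0 \<le> C" and b: "\<And>u. cmod (\<Sum>i<n. u i * w i) \<le> C * l2 n u"
  shows "l2 n w \<le> C"
proof -
  have "(\<Sum>i<n. cnj (w i) * w i) = (\<Sum>i<n. complex_of_real ((cmod (w i))\<^sup>2))"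
    by (intro sum.cong refl) (metis complex_norm_square mult.commute)
  also have "\<dots> = complex_of_real ((l2 n w)\<^sup>2)"
    unfolding l2_power2 by simp
  finally have "(\<Sum>i<n. cnj (w i) * w i) = complex_of_real ((l2 n w)\<^sup>2)" .
  then have "(l2 n w)\<^sup>2 \<le> C * l2 n (\<lambda>i. cnj (w i))"
    using b[of "\<lambda>i. cnj (w i)"] by (metis norm_of_real abs_of_nonneg zero_le_power2)
  also have "l2 n (\<lambda>i. cnj (w i)) = l2 n w" by (simp add: l2_def)
  finally have "l2 n w * l2 n w \<le> C * l2 n w" by (simp add: power2_eq_square)
  then show ?thesis using C l2_nonneg[of n w] by (cases "l2 n w = 0") (auto simp: mult_le_cancel_right)
qed

lemma vec_l2norm_eq: "vec_l2norm v = l2 (dim_vec v) (vec_index v)"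
  by (simp add: vec_l2norm_def l2_def)

lemma vec_l2norm_mult_mat_vec:
  assumes "v \<in> carrier_vec (dim_col \<alpha>)"
  shows "vec_l2norm (mult_mat_vec \<alpha> v) =
    l2 (dim_row \<alpha>) (\<lambda>i. \<Sum>j<dim_col \<alpha>. \<alpha> $$ (i, j) * vec_index v j)"
  unfolding vec_l2norm_eq using assms
  by (auto intro!: l2_cong sum.cong simp: mult_mat_vec_def scalar_prod_def row_def lessThan_atLeast0)

lemma scalar_mat_norm_bdd:
  "bdd_above {vec_l2norm (mult_mat_vec \<alpha> v) | v. v \<in> carrier_vec (dim_col \<alpha>) \<and> vec_l2norm v \<le> 1}"
proof (rule bdd_aboveI)
  fix x assume "x \<in> {vec_l2norm (mult_mat_vec \<alpha> v) | v. v \<in> carrier_vec (dim_col \<alpha>) \<and> vec_l2norm v \<le> 1}"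
  then obtain v where v: "v \<in> carrier_vec (dim_col \<alpha>)" "vec_l2norm v \<le> 1" "x = vec_l2norm (mult_mat_vec \<alpha> v)"
    by auto
  have "cmod (vec_index v j) \<le> 1" if "j < dim_col \<alpha>" for j
    using v entry_le_l2[of j "dim_col \<alpha>" "vec_index v"] that by (simp add: vec_l2norm_eq)
  then have "cmod (\<Sum>j<dim_col \<alpha>. \<alpha> $$ (i, j) * vec_index v j) \<le> (\<Sum>j<dim_col \<alpha>. cmod (\<alpha> $$ (i, j)))" for i
    by (intro order_trans[OF norm_sum] sum_mono) (auto simp: norm_mult mult_left_le)
  then have "cmod (\<Sum>j<dim_col \<alpha>. \<alpha> $$ (i, j) * vec_index v j)
     \<le> cmod (complex_of_real (\<Sum>j<dim_col \<alpha>. cmod (\<alpha> $$ (i, j))))" for i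
    by (subst norm_of_real) (simp add: abs_of_nonneg sum_nonneg)
  then show "x \<le> l2 (dim_row \<alpha>) (\<lambda>i. complex_of_real (\<Sum>j<dim_col \<alpha>. cmod (\<alpha> $$ (i, j))))"
    unfolding v(3) vec_l2norm_mult_mat_vec[OF v(1)] by (intro l2_mono)
qed

lemma scalar_mat_norm_nonneg [simp]: "0 \<le> scalar_mat_norm \<alpha>"
proof -
  have "vec_l2norm (mult_mat_vec \<alpha> (0\<^sub>v (dim_col \<alpha>))) \<le> scalar_mat_norm \<alpha>"
    unfolding scalar_mat_norm_def
    by (rule cSup_upper[OF _ scalar_mat_norm_bdd])
       (auto simp: vec_l2norm_def intro!: exI[of _ "0\<^sub>v (dim_col \<alpha>)"] simp: L2_set_def)
  then show ?thesis unfolding vec_l2norm_eq using l2_nonneg order_trans by blast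
qed

lemma l2_mat_vec_le:
  "l2 (dim_row \<alpha>) (\<lambda>i. \<Sum>j<dim_col \<alpha>. \<alpha> $$ (i, j) * v j) \<le> scalar_mat_norm \<alpha> * l2 (dim_col \<alpha>) v"
proof (cases "l2 (dim_col \<alpha>) v = 0")
  case True
  then have "l2 (dim_row \<alpha>) (\<lambda>i. \<Sum>j<dim_col \<alpha>. \<alpha> $$ (i, j) * v j) = l2 (dim_row \<alpha>) (\<lambda>i. 0)"
    by (intro l2_cong sum.neutral) (auto dest: l2_eq_0)
  then show ?thesis using True by (simp add: l2_def L2_set_def)
next
  case False
  let ?m = "dim_col \<alpha>"
  define r where "r = l2 ?m v"
  have r: "r > 0" using False l2_nonneg[of ?m v] unfolding r_def by linarith
  let ?w = "Matrix.vec ?m (\<lambda>j. complex_of_real (1/r) * v j)"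
  have w: "?w \<in> carrier_vec ?m" by simp
  have "vec_l2norm ?w = l2 ?m (\<lambda>j. complex_of_real (1/r) * v j)"
    unfolding vec_l2norm_eq by (simp, rule l2_cong) simp
  also have "\<dots> = 1" unfolding l2_scale using r by (simp add: norm_divide r_def)
  finally have "vec_l2norm (mult_mat_vec \<alpha> ?w) \<le> scalar_mat_norm \<alpha>"
    unfolding scalar_mat_norm_def using w by (intro cSup_upper[OF _ scalar_mat_norm_bdd]) fastforce
  also have "vec_l2norm (mult_mat_vec \<alpha> ?w) = l2 (dim_row \<alpha>) (\<lambda>i. complex_of_real (1/r) * (\<Sum>j<?m. \<alpha> $$ (i, j) * v j))"
    unfolding vec_l2norm_mult_mat_vec[OF w] sum_distrib_left by (intro l2_cong sum.cong) auto
  finally have "(1/r) * l2 (dim_row \<alpha>) (\<lambda>i. \<Sum>j<?m. \<alpha> $$ (i, j) * v j) \<le> scalar_mat_norm \<alpha>"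
    unfolding l2_scale using r by (simp add: norm_divide)
  then show ?thesis using r by (simp add: field_simps r_def[symmetric])
qed

lemma bilin_eq: "bilin \<alpha> u v = (\<Sum>i<dim_row \<alpha>. u i * (\<Sum>j<dim_col \<alpha>. \<alpha> $$ (i, j) * v j))"
  unfolding bilin_def by (simp add: sum_distrib_left mult.assoc)

lemma bilin_eq': "bilin \<alpha> u v = (\<Sum>j<dim_col \<alpha>. (\<Sum>i<dim_row \<alpha>. u i * \<alpha> $$ (i, j)) * v j)"
  unfolding bilin_def by (subst sum.swap) (simp add: sum_distrib_right)

lemma bilin_le: "cmod (bilin \<alpha> u v) \<le> scalar_mat_norm \<alpha> * l2 (dim_row \<alpha>) u * l2 (dim_col \<alpha>) v"
proof -
  have "cmod (bilin \<alpha> u v) \<le> l2 (dim_row \<alpha>) u * l2 (dim_row \<alpha>) (\<lambda>i. \<Sum>j<dim_col \<alpha>. \<alpha> $$ (i, j) * v j)"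
    unfolding bilin_eq by (rule Cauchy_Schwarz_l2)
  also have "\<dots> \<le> l2 (dim_row \<alpha>) u * (scalar_mat_norm \<alpha> * l2 (dim_col \<alpha>) v)"
    by (intro mult_left_mono l2_mat_vec_le l2_nonneg)
  finally show ?thesis by (simp add: ac_simps)
qed

text \<open>Together with \<open>bilin_le\<close>, this determines the operator norm as the norm of the bilinear form.\<close>

lemma scalar_mat_norm_leI:
  assumes C: "0 \<le> C" and b: "\<And>u v. cmod (bilin \<alpha> u v) \<le> C * l2 (dim_row \<alpha>) u * l2 (dim_col \<alpha>) v"
  shows "scalar_mat_norm \<alpha> \<le> C"
  unfolding scalar_mat_norm_def
proof (rule cSup_least)
  show "{vec_l2norm (mult_mat_vec \<alpha> v) | v. v \<in> carrier_vec (dim_col \<alpha>) \<and> vec_l2norm v \<le> 1} \<noteq> {}"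
    by (auto intro!: exI[of _ "0\<^sub>v (dim_col \<alpha>)"] simp: vec_l2norm_def L2_set_def)
next
  fix x assume "x \<in> {vec_l2norm (mult_mat_vec \<alpha> v) | v. v \<in> carrier_vec (dim_col \<alpha>) \<and> vec_l2norm v \<le> 1}"
  then obtain v where v: "v \<in> carrier_vec (dim_col \<alpha>)" "vec_l2norm v \<le> 1" "x = vec_l2norm (mult_mat_vec \<alpha> v)"
    by auto
  have "x \<le> C * l2 (dim_col \<alpha>) (vec_index v)"
    unfolding v(3) vec_l2norm_mult_mat_vec[OF v(1)]
  proof (rule l2_leI)
    show "cmod (\<Sum>i<dim_row \<alpha>. u i * (\<Sum>j<dim_col \<alpha>. \<alpha> $$ (i, j) * vec_index v j))
        \<le> C * l2 (dim_col \<alpha>) (vec_index v) * l2 (dim_row \<alpha>) u" for u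
      using b[of u "vec_index v"] unfolding bilin_eq by (simp only: ac_simps)
  qed (use C in simp)
  also have "\<dots> \<le> C * 1" using v(1,2) C by (intro mult_left_mono) (auto simp: vec_l2norm_eq)
  finally show "x \<le> C" by simp
qed

lemma l2_vec_mat_le:
  "l2 (dim_col \<alpha>) (\<lambda>j. \<Sum>i<dim_row \<alpha>. u i * \<alpha> $$ (i, j)) \<le> scalar_mat_norm \<alpha> * l2 (dim_row \<alpha>) u"
proof (rule l2_leI)
  fix v
  show "cmod (\<Sum>j<dim_col \<alpha>. v j * (\<Sum>i<dim_row \<alpha>. u i * \<alpha> $$ (i, j))) \<le> scalar_mat_norm \<alpha> * l2 (dim_row \<alpha>) u * l2 (dim_col \<alpha>) v"
    using bilin_le[of \<alpha> u v] unfolding bilin_eq' by (simp add: mult.commute)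
qed simp

lemma entry_le_scalar_mat_norm:
  assumes "i < dim_row \<alpha>" "j < dim_col \<alpha>"
  shows "cmod (\<alpha> $$ (i, j)) \<le> scalar_mat_norm \<alpha>"
proof -
  let ?u = "\<lambda>k. if k = i then 1 else 0" and ?v = "\<lambda>k. if k = j then 1 else (0::complex)"
  have "bilin \<alpha> ?u ?v = \<alpha> $$ (i, j)"
    unfolding bilin_eq using assms by (simp add: sum.delta if_distrib[of "\<lambda>x. _ * x"] if_distrib[of "\<lambda>x. x * _"] cong: if_cong)
  then show ?thesis using bilin_le[of \<alpha> ?u ?v] assms by (simp add: l2_single)
qed

text \<open>Partial permutation matrices are the scalar coefficients that cut out or move blocks.\<close>

lemma scalar_mat_norm_partial_permutation:
  assumes "inj_on s {i. i < n \<and> s i < m}"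
  shows "scalar_mat_norm (mat n m (\<lambda>(i, j). if j = s i then 1 else 0)) \<le> 1"
    and "scalar_mat_norm (mat m n (\<lambda>(j, i). if j = s i then 1 else 0)) \<le> 1"
proof -
  let ?A = "{i. i < n \<and> s i < m}"
  have key: "cmod (\<Sum>i\<in>?A. u i * v (s i)) \<le> l2 n u * l2 m v" for u v
  proof -
    have "cmod (\<Sum>i\<in>?A. u i * v (s i)) \<le> (\<Sum>i\<in>?A. \<bar>cmod (u i)\<bar> * \<bar>cmod (v (s i))\<bar>)"
      by (rule order_trans[OF norm_sum]) (simp add: norm_mult)
    also have "\<dots> \<le> L2_set (\<lambda>i. cmod (u i)) ?A * L2_set (\<lambda>i. cmod (v (s i))) ?A"
      by (rule L2_set_mult_ineq)
    also have "L2_set (\<lambda>i. cmod (v (s i))) ?A = L2_set (\<lambda>i. cmod (v i)) (s ` ?A)"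
      unfolding L2_set_def using assms by (simp add: sum.reindex)
    also have "L2_set (\<lambda>i. cmod (u i)) ?A * L2_set (\<lambda>i. cmod (v i)) (s ` ?A) \<le> l2 n u * l2 m v"
      unfolding l2_def L2_set_def by (intro mult_mono real_sqrt_le_mono sum_mono2) (auto intro: sum_nonneg)
    finally show ?thesis .
  qed
  have 1: "bilin (mat n m (\<lambda>(i, j). if j = s i then 1 else 0)) u v = (\<Sum>i\<in>?A. u i * v (s i))" for u v
  proof -
    have "bilin (mat n m (\<lambda>(i, j). if j = s i then 1 else 0)) u v = (\<Sum>i<n. if s i < m then u i * v (s i) else 0)"
      unfolding bilin_eq
      by (intro sum.cong) (auto simp: if_distrib[of "\<lambda>x. x * _"] sum.delta cong: if_cong)
    also have "\<dots> = (\<Sum>i\<in>?A. u i * v (s i))"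
      by (subst sum.inter_filter[symmetric]) (auto intro!: sum.cong)
    finally show ?thesis .
  qed
  show "scalar_mat_norm (mat n m (\<lambda>(i, j). if j = s i then 1 else 0)) \<le> 1"
    by (rule scalar_mat_norm_leI) (use key in \<open>auto simp: 1\<close>)
  have 2: "bilin (mat m n (\<lambda>(j, i). if j = s i then 1 else 0)) u v = (\<Sum>i\<in>?A. v i * u (s i))" for u v
  proof -
    have "bilin (mat m n (\<lambda>(j, i). if j = s i then 1 else 0)) u v = (\<Sum>i<n. if s i < m then v i * u (s i) else 0)"
      unfolding bilin_eq'
      by (intro sum.cong) (auto simp: if_distrib[of "\<lambda>x. _ * x"] sum.delta cong: if_cong)
    also have "\<dots> = (\<Sum>i\<in>?A. v i * u (s i))"
      by (subst sum.inter_filter[symmetric]) (auto intro!: sum.cong)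
    finally show ?thesis .
  qed
  show "scalar_mat_norm (mat m n (\<lambda>(j, i). if j = s i then 1 else 0)) \<le> 1"
    by (rule scalar_mat_norm_leI) (use key in \<open>auto simp: 2 mult.commute\<close>)
qed

section \<open>Normed spaces and the Hahn--Banach theorem\<close>

locale cvs_locale =
  fixes V :: "'a::ab_group_add set" and s :: "complex \<Rightarrow> 'a \<Rightarrow> 'a"
  assumes vector_space_scale: "vector_space s"
    and subspace_carrier: "module.subspace s V"
begin

sublocale vs: vector_space s by (rule vector_space_scale)

lemmas carrier_zero = vs.subspace_0[OF subspace_carrier]
lemmas carrier_add = vs.subspace_add[OF subspace_carrier]
lemmas carrier_diff = vs.subspace_diff[OF subspace_carrier]
lemmas carrier_scale = vs.subspace_scale[OF subspace_carrier]
lemmas carrier_neg = vs.subspace_neg[OF subspace_carrier]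
lemmas carrier_sum = vs.subspace_sum[OF subspace_carrier]

definition sublinear :: "('a \<Rightarrow> real) \<Rightarrow> bool" where
  "sublinear g \<longleftrightarrow> (\<forall>x. x \<notin> V \<longrightarrow> g x = 0) \<and>
     (\<forall>x\<in>V. \<forall>y\<in>V. g (x + y) \<le> g x + g y) \<and>
     (\<forall>x\<in>V. \<forall>t\<ge>0. g (s (complex_of_real t) x) = t * g x)"

lemma sublinear_add: "sublinear g \<Longrightarrow> x \<in> V \<Longrightarrow> y \<in> V \<Longrightarrow> g (x + y) \<le> g x + g y"
  and sublinear_scale: "sublinear g \<Longrightarrow> x \<in> V \<Longrightarrow> t \<ge> 0 \<Longrightarrow> g (s (complex_of_real t) x) = t * g x"
  and sublinear_outside: "sublinear g \<Longrightarrow> x \<notin> V \<Longrightarrow> g x = 0"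
  by (simp_all add: sublinear_def)

lemma sublinear_zero: "sublinear g \<Longrightarrow> g 0 = 0"
  using sublinear_scale[of g 0 0] carrier_zero by simp

lemma sublinear_neg: "sublinear g \<Longrightarrow> x \<in> V \<Longrightarrow> 0 \<le> g x + g (- x)"
  using sublinear_zero[of g] sublinear_add[of g x "- x"] carrier_neg[of x] by simp

text \<open>Pushing a sublinear functional down along a ray. If \<open>g\<close> is minimal then the result is \<open>g\<close>
  again, and this says that \<open>g\<close> is additive.\<close>

definition ray_inf :: "('a \<Rightarrow> real) \<Rightarrow> 'a \<Rightarrow> 'a \<Rightarrow> real" where
  "ray_inf g x0 y = (if y \<in> V then (INF t\<in>{0..}. g (y + s (complex_of_real t) x0) - t * g x0) else 0)"

text \<open>The infimum is finite: \<open>g (t x0) \<le> g (y + t x0) + g (- y)\<close>.\<close>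

lemma ray_inf_bound:
  assumes g: "sublinear g" and x0: "x0 \<in> V" and y: "y \<in> V" and t: "t \<ge> 0"
  shows "- g (- y) \<le> g (y + s (complex_of_real t) x0) - t * g x0"
proof -
  let ?x = "s (complex_of_real t) x0"
  have "g ?x = g ((y + ?x) + (- y))" by simp
  also have "\<dots> \<le> g (y + ?x) + g (- y)"
    by (intro sublinear_add g carrier_add carrier_scale carrier_neg x0 y)
  also have "g ?x = t * g x0" by (rule sublinear_scale[OF g x0 t])
  finally show ?thesis by simp
qed

lemma ray_inf_le:
  assumes "sublinear g" "x0 \<in> V" "y \<in> V" "t \<ge> 0"
  shows "ray_inf g x0 y \<le> g (y + s (complex_of_real t) x0) - t * g x0"
proof -
  have "bdd_below ((\<lambda>t. g (y + s (complex_of_real t) x0) - t * g x0) ` {0..})"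
    using ray_inf_bound[OF assms(1-3)] by (intro bdd_belowI[of _ "- g (- y)"]) auto
  then show ?thesis unfolding ray_inf_def using assms by (auto intro: cINF_lower)
qed

lemma ray_inf_greatest:
  assumes "y \<in> V" "\<And>t. t \<ge> 0 \<Longrightarrow> b \<le> g (y + s (complex_of_real t) x0) - t * g x0"
  shows "b \<le> ray_inf g x0 y"
  unfolding ray_inf_def using assms by (auto intro!: cINF_greatest)

lemma sublinear_ray_inf:
  assumes g: "sublinear g" and x0: "x0 \<in> V"
  shows "sublinear (ray_inf g x0)"
  unfolding sublinear_def
proof (intro conjI ballI allI impI)
  fix x assume "x \<notin> V" then show "ray_inf g x0 x = 0" by (simp add: ray_inf_def)
next
  fix x y assume x: "x \<in> V" and y: "y \<in> V"
  have *: "ray_inf g x0 (x + y) \<le> (g (x + s (complex_of_real t) x0) - t * g x0) + (g (y + s (complex_of_real u) x0) - u * g x0)"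
    if "t \<ge> 0" "u \<ge> 0" for t u
  proof -
    have "ray_inf g x0 (x + y) \<le> g ((x + y) + s (complex_of_real (t + u)) x0) - (t + u) * g x0"
      using that x y by (intro ray_inf_le[OF g x0]) (auto intro: carrier_add)
    also have "(x + y) + s (complex_of_real (t + u)) x0 = (x + s (complex_of_real t) x0) + (y + s (complex_of_real u) x0)"
      by (simp add: vs.scale_left_distrib)
    also have "g \<dots> \<le> g (x + s (complex_of_real t) x0) + g (y + s (complex_of_real u) x0)"
      by (intro sublinear_add g carrier_add carrier_scale x0 x y)
    finally show ?thesis by (simp add: algebra_simps)
  qed
  have "ray_inf g x0 (x + y) - (g (y + s (complex_of_real u) x0) - u * g x0) \<le> ray_inf g x0 x" if "u \<ge> 0" for u
    using *[OF _ that] by (intro ray_inf_greatest[OF x]) (simp add: algebra_simps)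
  then have "ray_inf g x0 (x + y) - ray_inf g x0 x \<le> ray_inf g x0 y"
    by (intro ray_inf_greatest[OF y]) (simp add: algebra_simps)
  then show "ray_inf g x0 (x + y) \<le> ray_inf g x0 x + ray_inf g x0 y" by simp
next
  fix x and c :: real assume x: "x \<in> V" and c: "c \<ge> 0"
  show "ray_inf g x0 (s (complex_of_real c) x) = c * ray_inf g x0 x"
  proof (cases "c = 0")
    case True
    have "ray_inf g x0 0 \<le> g (0 + s (complex_of_real 0) x0) - 0 * g x0"
      by (rule ray_inf_le[OF g x0 carrier_zero]) simp
    moreover have "0 \<le> ray_inf g x0 0"
      by (rule ray_inf_greatest[OF carrier_zero]) (simp add: sublinear_scale[OF g x0])
    ultimately show ?thesis using True sublinear_zero[OF g] by simp
  next
    case False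
    then have c: "c > 0" using c by simp
    have eq: "g (s (complex_of_real c) x + s (complex_of_real (c * t)) x0) - (c * t) * g x0
       = c * (g (x + s (complex_of_real t) x0) - t * g x0)" if "t \<ge> 0" for t
    proof -
      have "s (complex_of_real c) x + s (complex_of_real (c * t)) x0 = s (complex_of_real c) (x + s (complex_of_real t) x0)"
        by (simp add: vs.scale_right_distrib)
      then have "g (s (complex_of_real c) x + s (complex_of_real (c * t)) x0) = c * g (x + s (complex_of_real t) x0)"
        using c by (simp only: sublinear_scale[OF g carrier_add[OF x carrier_scale[OF x0]]])
      then show ?thesis by (simp add: algebra_simps)
    qed
    show ?thesis
    proof (rule antisym)
      have "ray_inf g x0 (s (complex_of_real c) x) \<le> c * (g (x + s (complex_of_real t) x0) - t * g x0)" if "t \<ge> 0" for t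
        unfolding eq[OF that, symmetric] using that c by (intro ray_inf_le[OF g x0 carrier_scale[OF x]]) auto
      then have "ray_inf g x0 (s (complex_of_real c) x) / c \<le> ray_inf g x0 x"
        using c by (intro ray_inf_greatest[OF x]) (simp add: field_simps)
      then show "ray_inf g x0 (s (complex_of_real c) x) \<le> c * ray_inf g x0 x"
        using c by (simp add: field_simps)
      show "c * ray_inf g x0 x \<le> ray_inf g x0 (s (complex_of_real c) x)"
      proof (rule ray_inf_greatest[OF carrier_scale[OF x]])
        fix t :: real assume t: "t \<ge> 0"
        have "c * ray_inf g x0 x \<le> c * (g (x + s (complex_of_real (t / c)) x0) - (t / c) * g x0)"
          using t c by (intro mult_left_mono ray_inf_le[OF g x0 x]) auto
        also have "\<dots> = g (s (complex_of_real c) x + s (complex_of_real (c * (t / c))) x0) - (c * (t / c)) * g x0"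
          using t c by (intro eq[symmetric]) auto
        also have "c * (t / c) = t" using c by simp
        finally show "c * ray_inf g x0 x \<le> g (s (complex_of_real c) x + s (complex_of_real t) x0) - t * g x0" .
      qed
    qed
  qed
qed

lemma ray_inf_below:
  assumes g: "sublinear g" and x0: "x0 \<in> V"
  shows "ray_inf g x0 y \<le> g y"
proof (cases "y \<in> V")
  case True
  then show ?thesis using ray_inf_le[OF g x0 True, of 0] by simp
next
  case False
  then show ?thesis using g by (simp add: ray_inf_def sublinear_def)
qed

text \<open>Zorn's lemma; the pointwise infimum of a chain is sublinear, since for two members of the chain
  the smaller one serves both arguments in the triangle inequality.\<close>

lemma minimal_sublinear_exists:
  assumes p: "sublinear p"
  obtains g where "sublinear g" "g \<le> p" "\<And>h. sublinear h \<Longrightarrow> h \<le> g \<Longrightarrow> h = g"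
proof -
  let ?A = "{g. sublinear g \<and> g \<le> p}" and ?P = "\<lambda>f g :: 'a \<Rightarrow> real. g \<le> f"
  have "\<exists>m\<in>?A. \<forall>a\<in>?A. ?P m a \<longrightarrow> a = m"
  proof (rule predicate_Zorn)
    show "partial_order_on ?A (relation_of ?P ?A)"
      by (rule partial_order_on_relation_ofI) auto
    fix C assume C: "C \<in> Chains (relation_of ?P ?A)"
    then have CA: "C \<subseteq> ?A" and tot: "\<And>f g. f \<in> C \<Longrightarrow> g \<in> C \<Longrightarrow> f \<le> g \<or> g \<le> f"
      unfolding Chains_def relation_of_def by auto
    show "\<exists>u\<in>?A. \<forall>a\<in>C. u \<le> a"
    proof (cases "C = {}")
      case True
      then show ?thesis using p by auto
    next
      case False
      define u where "u x = (INF g\<in>C. g x)" for x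
      have bdd: "bdd_below ((\<lambda>g. g x) ` C)" for x
      proof (rule bdd_belowI[of _ "if x \<in> V then - p (- x) else 0"], clarsimp, intro conjI impI)
        fix g assume "g \<in> C" "x \<in> V"
        with CA have "sublinear g" "g (- x) \<le> p (- x)" by (auto simp: le_fun_def)
        then show "- p (- x) \<le> g x" using sublinear_neg[of g x] \<open>x \<in> V\<close> by simp
      next
        fix g assume "g \<in> C" "x \<notin> V"
        then show "0 \<le> g x" using CA by (auto simp: sublinear_def)
      qed
      have le: "u x \<le> g x" if "g \<in> C" for x g
        unfolding u_def by (rule cINF_lower[OF bdd that])
      have ge: "b \<le> u x" if "\<And>g. g \<in> C \<Longrightarrow> b \<le> g x" for x b
        unfolding u_def using False that by (intro cINF_greatest) auto
      have "sublinear u"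
        unfolding sublinear_def
      proof (intro conjI ballI allI impI)
        fix x assume "x \<notin> V"
        then have "g x = 0" if "g \<in> C" for g using that CA by (auto simp: sublinear_def)
        then have "(\<lambda>g. g x) ` C = {0}" using False by force
        then show "u x = 0" unfolding u_def by simp
      next
        fix x y assume x: "x \<in> V" and y: "y \<in> V"
        have *: "u (x + y) \<le> g x + h y" if "g \<in> C" "h \<in> C" for g h
        proof -
          have 1: "u (x + y) \<le> g x + g y" if "g \<in> C" for g
            using le[OF that, of "x + y"] sublinear_add[of g x y] that CA x y by force
          have "g y \<le> h y \<or> h x \<le> g x" using tot[OF that] by (auto simp: le_fun_def)
          then show ?thesis using 1[of g] 1[of h] that by linarith
        qed
        have "u (x + y) - h y \<le> u x" if "h \<in> C" for h
          using *[OF _ that] by (intro ge) (simp add: algebra_simps)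
        then have "u (x + y) - u x \<le> u y" by (intro ge) (simp add: algebra_simps)
        then show "u (x + y) \<le> u x + u y" by simp
      next
        fix x and t :: real assume x: "x \<in> V" and t: "t \<ge> 0"
        have hom: "g (s (complex_of_real t) x) = t * g x" if "g \<in> C" for g
          using that CA x t by (auto intro: sublinear_scale)
        show "u (s (complex_of_real t) x) = t * u x"
        proof (rule antisym)
          show "t * u x \<le> u (s (complex_of_real t) x)"
            using le t by (intro ge) (simp add: hom mult_left_mono)
          show "u (s (complex_of_real t) x) \<le> t * u x"
          proof (cases "t = 0")
            case True
            obtain g where "g \<in> C" using False by auto
            then show ?thesis using le[of g "s (complex_of_real t) x"] hom[of g] True by simp
          next
            case False
            then have "u (s (complex_of_real t) x) / t \<le> u x"
              using t le[of _ "s (complex_of_real t) x"] hom by (intro ge) (simp add: divide_le_eq mult.commute)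
            then show ?thesis using False t by (simp add: field_simps)
          qed
        qed
      qed
      moreover have "u \<le> p"
      proof -
        obtain g where "g \<in> C" using False by auto
        then have "u \<le> g" "g \<le> p" using le CA by (auto simp: le_fun_def)
        then show ?thesis by (rule order_trans)
      qed
      ultimately show ?thesis using le by (intro bexI[of _ u]) (auto simp: le_fun_def)
    qed
  qed
  then obtain m where m: "sublinear m" "m \<le> p" "\<And>a. sublinear a \<Longrightarrow> a \<le> p \<Longrightarrow> a \<le> m \<Longrightarrow> a = m" by auto
  have "h = m" if "sublinear h" "h \<le> m" for h
    using m(3)[OF that(1) order_trans[OF that(2) m(2)] that(2)] .
  then show ?thesis using that[of m] m(1,2) by blast
qed

text \<open>Minimality gives \<open>ray_inf g y = g\<close>, and the value \<open>t = 1\<close> in the infimum at \<open>x\<close> says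
  \<open>g x \<le> g (x + y) - g y\<close>.\<close>

lemma minimal_sublinear_additive:
  assumes g: "sublinear g" and min: "\<And>h. sublinear h \<Longrightarrow> h \<le> g \<Longrightarrow> h = g"
    and x: "x \<in> V" and y: "y \<in> V"
  shows "g (x + y) = g x + g y"
proof -
  have "ray_inf g y = g"
    by (rule min[OF sublinear_ray_inf[OF g y]]) (rule le_funI, rule ray_inf_below[OF g y])
  then have "g x \<le> g (x + y) - g y"
    using ray_inf_le[OF g y x, of 1] by simp
  moreover have "g (x + y) \<le> g x + g y" by (rule sublinear_add[OF g x y])
  ultimately show ?thesis by simp
qed

text \<open>A minimal sublinear functional below the seminorm is real linear, hence the real part of a complex
  linear functional. Starting from \<open>ray_inf p x0\<close> rather than from \<open>p\<close> forces equality at \<open>x0\<close>.\<close>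

theorem Hahn_Banach_seminorm:
  assumes hom: "\<And>c x. x \<in> V \<Longrightarrow> p (s c x) = cmod c * p x"
    and tri: "\<And>x y. x \<in> V \<Longrightarrow> y \<in> V \<Longrightarrow> p (x + y) \<le> p x + p y"
    and x0: "x0 \<in> V"
  obtains f where "\<And>x y. x \<in> V \<Longrightarrow> y \<in> V \<Longrightarrow> f (x + y) = f x + f y"
    and "\<And>c x. x \<in> V \<Longrightarrow> f (s c x) = c * f x"
    and "\<And>x. x \<in> V \<Longrightarrow> cmod (f x) \<le> p x"
    and "f x0 = complex_of_real (p x0)"
proof -
  define p' where "p' x = (if x \<in> V then p x else 0)" for x
  have p': "sublinear p'"
    unfolding sublinear_def p'_def using hom tri by (auto simp: carrier_add carrier_scale)
  let ?r = "ray_inf p' x0"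
  obtain g where g: "sublinear g" "g \<le> ?r" "\<And>h. sublinear h \<Longrightarrow> h \<le> g \<Longrightarrow> h = g"
    using minimal_sublinear_exists[OF sublinear_ray_inf[OF p' x0]] by blast
  have add: "g (x + y) = g x + g y" if "x \<in> V" "y \<in> V" for x y
    using minimal_sublinear_additive[OF g(1,3) that] by blast
  have neg: "g (- x) = - g x" if "x \<in> V" for x
    using add[OF that carrier_neg[OF that]] sublinear_zero[OF g(1)] by simp
  have le: "g x \<le> p x" if "x \<in> V" for x
    using le_funD[OF g(2), of x] ray_inf_below[OF p' x0, of x] that by (simp add: p'_def)
  have "g (- x0) \<le> ?r (- x0)" using g(2) by (rule le_funD)
  also have "\<dots> \<le> p' (- x0 + s (complex_of_real 1) x0) - 1 * p' x0"
    by (rule ray_inf_le[OF p' x0 carrier_neg[OF x0]]) simp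
  finally have "p x0 \<le> g x0" using neg[OF x0] sublinear_zero[OF p'] x0 by (simp add: p'_def)
  then have gx0: "g x0 = p x0" using le[OF x0] by simp
  have rhom: "g (s (complex_of_real t) x) = t * g x" if "x \<in> V" for t x
  proof (cases "t \<ge> 0")
    case True
    then show ?thesis using sublinear_scale[OF g(1) that] by simp
  next
    case False
    have "g (s (complex_of_real t) x) = g (- s (complex_of_real (- t)) x)" by simp
    also have "\<dots> = - g (s (complex_of_real (- t)) x)" by (intro neg carrier_scale that)
    also have "\<dots> = t * g x" using sublinear_scale[OF g(1) that, of "- t"] False by simp
    finally show ?thesis .
  qed
  define f where "f x = Complex (g x) (- g (s \<i> x))" for x
  have f_add: "f (x + y) = f x + f y" if "x \<in> V" "y \<in> V" for x y
    using that by (simp add: f_def add carrier_scale vs.scale_right_distrib complex_eq_iff)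
  have f_hom: "f (s c x) = c * f x" if x: "x \<in> V" for c x
  proof -
    have c: "c = complex_of_real (Re c) + \<i> * complex_of_real (Im c)" by (simp add: complex_eq)
    have ci: "s \<i> (s c x) = s (complex_of_real (- Im c)) x + s (complex_of_real (Re c)) (s \<i> x)"
    proof -
      have "s (\<i> * c) x = s (complex_of_real (- Im c) + complex_of_real (Re c) * \<i>) x"
        by (rule arg_cong[where f="\<lambda>c. s c x"]) (simp add: complex_eq_iff)
      then show ?thesis by (simp only: vs.scale_left_distrib vs.scale_scale)
    qed
    have cx: "s c x = s (complex_of_real (Re c)) x + s (complex_of_real (Im c)) (s \<i> x)"
    proof -
      have "s c x = s (complex_of_real (Re c) + complex_of_real (Im c) * \<i>) x"
        by (rule arg_cong[where f="\<lambda>c. s c x"]) (simp add: complex_eq_iff)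
      then show ?thesis by (simp only: vs.scale_left_distrib vs.scale_scale)
    qed
    have "g (s c x) = Re c * g x + Im c * g (s \<i> x)"
      by (subst cx) (simp only: add carrier_scale x rhom)
    moreover have "g (s \<i> (s c x)) = (- Im c) * g x + Re c * g (s \<i> x)"
      unfolding ci by (simp only: add carrier_scale x rhom)
    ultimately show ?thesis by (simp add: f_def complex_eq_iff algebra_simps)
  qed
  have f_le: "cmod (f x) \<le> p x" if x: "x \<in> V" for x
  proof (cases "f x = 0")
    case True
    have "0 \<le> p' x + p' (- x)" by (rule sublinear_neg[OF p' x])
    moreover have "p (- x) = p x" using hom[OF x, of "-1"] by simp
    ultimately show ?thesis using True x by (simp add: p'_def carrier_neg)
  next
    case False
    define u where "u = cnj (f x) / cmod (f x)"
    have u: "cmod u = 1" using False by (simp add: u_def norm_divide)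
    have "f (s u x) = u * f x" by (rule f_hom[OF x])
    also have "\<dots> = complex_of_real (cmod (f x))"
      using False complex_norm_square[of "f x"] by (simp add: u_def field_simps power2_eq_square)
    finally have "Re (f (s u x)) = cmod (f x)" by simp
    then have "cmod (f x) = g (s u x)" by (simp add: f_def)
    also have "\<dots> \<le> p (s u x)" by (intro le carrier_scale x)
    finally show ?thesis using hom[OF x, of u] u by simp
  qed
  have "f x0 = complex_of_real (p x0)"
  proof -
    have "Re (f x0) = p x0" by (simp add: f_def gx0)
    moreover have "cmod (f x0) \<le> p x0" by (rule f_le[OF x0])
    ultimately have "Im (f x0) = 0"
      using power_mono[of "cmod (f x0)" "p x0" 2] by (simp add: cmod_power2)
    then show ?thesis using \<open>Re (f x0) = p x0\<close> by (simp add: complex_eq_iff)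
  qed
  with f_add f_hom f_le show ?thesis by (rule that)
qed

end

section \<open>Scalar functions on the strip\<close>

lemma interior_strip: "interior strip = {z. 0 < Re z \<and> Re z < 1}"
proof -
  have "strip = {z. inner 1 z \<ge> 0} \<inter> {z. inner 1 z \<le> (1::real)}"
    by (auto simp: strip_def inner_complex_def)
  also have "interior \<dots> = {z. inner 1 z > 0} \<inter> {z. inner 1 z < (1::real)}"
    by (simp only: interior_Int interior_halfspace_ge[of "1::complex" 0] interior_halfspace_le[of "1::complex" 1] zero_neq_one[symmetric] not_False_eq_True)
  finally show ?thesis by (auto simp: inner_complex_def)
qed

lemma interior_strip_subset: "z \<in> interior strip \<Longrightarrow> z \<in> strip"
  using interior_subset by blast

lemma boundary_strip: "z \<in> strip \<Longrightarrow> z \<notin> interior strip \<Longrightarrow> z = Complex 0 (Im z) \<or> z = Complex 1 (Im z)"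
  unfolding interior_strip by (auto simp: strip_def complex_eq_iff)

lemma boundary_in_strip [simp]: "Complex 0 t \<in> strip" "Complex 1 t \<in> strip"
  by (auto simp: strip_def)

lemma strip_maximum_principle_box:
  assumes cont: "continuous_on strip h" and hol: "h holomorphic_on interior strip"
    and T: "T > \<bar>Im z0\<bar>" and z0: "z0 \<in> strip"
    and side: "\<And>t. cmod (h (Complex 0 t)) \<le> M" "\<And>t. cmod (h (Complex 1 t)) \<le> M"
    and top: "\<And>z. z \<in> strip \<Longrightarrow> \<bar>Im z\<bar> = T \<Longrightarrow> cmod (h z) \<le> M"
  shows "cmod (h z0) \<le> M"
proof (cases "z0 \<in> interior strip")
  case False
  then show ?thesis using boundary_strip[OF z0] side by metis
next
  case True
  define S where "S = box (Complex 0 (- T)) (Complex 1 T)"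
  have S: "S = {z. 0 < Re z \<and> Re z < 1 \<and> - T < Im z \<and> Im z < T}"
    by (auto simp: S_def in_box_complex_iff)
  have ne: "z0 \<in> S" using True T by (auto simp: S interior_strip)
  then have "S \<noteq> {}" by auto
  then have cl: "closure S = {z. 0 \<le> Re z \<and> Re z \<le> 1 \<and> - T \<le> Im z \<and> Im z \<le> T}"
    unfolding S_def by (subst closure_box) (auto simp: in_cbox_complex_iff)
  have "open S" unfolding S_def by (rule open_box)
  show ?thesis
  proof (rule maximum_modulus_frontier[of h S])
    show "h holomorphic_on interior S"
      using hol by (rule holomorphic_on_subset) (use \<open>open S\<close> in \<open>auto simp: interior_open S interior_strip\<close>)
    show "continuous_on (closure S) h"
      using cont by (rule continuous_on_subset) (auto simp: cl strip_def)
    show "bounded S" by (simp add: S_def)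
    fix z assume "z \<in> frontier S"
    then have z: "z \<in> closure S" "z \<notin> S" using \<open>open S\<close> by (auto simp: frontier_def interior_open)
    then consider "Re z = 0" | "Re z = 1" | "\<bar>Im z\<bar> = T" using z(1)[unfolded cl] z(2)[unfolded S] by fastforce
    then show "cmod (h z) \<le> M"
    proof cases
      case 1 then show ?thesis using side(1)[of "Im z"] by (metis complex.exhaust_sel)
    next
      case 2 then show ?thesis using side(2)[of "Im z"] by (metis complex.exhaust_sel)
    next
      case 3 then show ?thesis using z top[of z] by (auto simp: cl strip_def)
    qed
  qed (rule ne)
qed

text \<open>The factor \<open>exp (e * (z\<^sup>2 - 1))\<close> makes a bounded function small at both ends of the strip
  and tends to the constant one as \<open>e\<close> tends to zero.\<close>

theorem strip_maximum_principle:
  assumes cont: "continuous_on strip h" and hol: "h holomorphic_on interior strip"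
    and bd: "\<And>z. z \<in> strip \<Longrightarrow> cmod (h z) \<le> B"
    and side: "\<And>t. cmod (h (Complex 0 t)) \<le> M" "\<And>t. cmod (h (Complex 1 t)) \<le> M"
    and z0: "z0 \<in> strip"
  shows "cmod (h z0) \<le> M"
proof -
  have B: "B \<ge> 0" using bd[OF z0] norm_ge_zero order_trans by blast
  have M: "M \<ge> 0" using side(1)[of 0] norm_ge_zero order_trans by blast
  define k where "k e z = h z * exp (complex_of_real e * (z\<^sup>2 - 1))" for e z
  have nk: "cmod (k e z) = cmod (h z) * exp (e * ((Re z)\<^sup>2 - (Im z)\<^sup>2 - 1))" for e z
    by (simp add: k_def norm_mult power2_eq_square)
  have *: "cmod (k e z0) \<le> M + d" if e: "e > 0" and d: "d > 0" for e d
  proof -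
    have ev: "((\<lambda>t. B * exp (- e * t\<^sup>2)) \<longlongrightarrow> B * 0) at_top"
      using e by (intro tendsto_mult tendsto_const filterlim_compose[OF exp_at_bot]) real_asymp
    then have "eventually (\<lambda>t. B * exp (- e * t\<^sup>2) < d) at_top"
      using d by (intro order_tendstoD) auto
    then have "eventually (\<lambda>t. B * exp (- e * t\<^sup>2) < d \<and> t > \<bar>Im z0\<bar>) at_top"
      by (intro eventually_conj eventually_gt_at_top)
    then obtain T where T: "B * exp (- e * T\<^sup>2) < d" "T > \<bar>Im z0\<bar>"
      using eventually_happens'[of "at_top :: real filter"] by (auto simp: trivial_limit_at_top_linorder)
    have le: "cmod (k e z) \<le> cmod (h z)" if "(Re z)\<^sup>2 \<le> 1" for z
    proof -
      have "(Re z)\<^sup>2 - (Im z)\<^sup>2 - 1 \<le> 0" using that zero_le_power2[of "Im z"] by linarith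
      then have "e * ((Re z)\<^sup>2 - (Im z)\<^sup>2 - 1) \<le> 0" using e by (intro mult_nonneg_nonpos) auto
      then show ?thesis unfolding nk by (intro mult_left_le) auto
    qed
    show ?thesis
    proof (rule strip_maximum_principle_box[OF _ _ T(2) z0])
      show "continuous_on strip (k e)" unfolding k_def by (intro continuous_intros cont)
      show "k e holomorphic_on interior strip" unfolding k_def by (intro holomorphic_intros hol)
      show "cmod (k e (Complex 0 t)) \<le> M + d" for t
        using le[of "Complex 0 t"] side(1)[of t] d by simp
      show "cmod (k e (Complex 1 t)) \<le> M + d" for t
        using le[of "Complex 1 t"] side(2)[of t] d by simp
      fix z assume z: "z \<in> strip" "\<bar>Im z\<bar> = T"
      have "(Re z)\<^sup>2 \<le> 1" using z(1) by (auto simp: strip_def power_le_one)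
      moreover have "(Im z)\<^sup>2 = T\<^sup>2" using z(2) by (metis power2_abs)
      ultimately have "exp (e * ((Re z)\<^sup>2 - (Im z)\<^sup>2 - 1)) \<le> exp (- e * T\<^sup>2)"
        using mult_left_mono[of "(Re z)\<^sup>2 - (Im z)\<^sup>2 - 1" "- T\<^sup>2" e] e by simp
      then have "cmod (k e z) \<le> B * exp (- e * T\<^sup>2)"
        unfolding nk using bd[OF z(1)] B by (intro mult_mono) auto
      then show "cmod (k e z) \<le> M + d" using T(1) M by linarith
    qed
  qed
  have **: "cmod (k e z0) \<le> M" if "e > 0" for e
    using *[OF that] by (rule field_le_epsilon)
  have "((\<lambda>e. cmod (k e z0)) \<longlongrightarrow> cmod (k 0 z0)) (at_right 0)"
    unfolding k_def by (intro tendsto_intros)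
  moreover have "eventually (\<lambda>e. cmod (k e z0) \<le> M) (at_right 0)"
    using ** by (auto simp: eventually_at_right_field intro: exI[of _ 1])
  ultimately have "cmod (k 0 z0) \<le> M"
    by (intro tendsto_upperbound) auto
  then show ?thesis by (simp add: k_def)
qed

text \<open>The point of this Taylor estimate is that the constant depends on the bound \<open>B\<close> only, so that it is
  uniform over families of functions. The factor 3 leaves room for Cauchy's estimate of radius \<open>r\<close> at
  each point of \<open>cball z r\<close>.\<close>

lemma holomorphic_second_order:
  assumes hol: "h holomorphic_on ball z (3 * r)" and r: "r > 0"
    and bd: "\<And>w. w \<in> ball z (3 * r) \<Longrightarrow> cmod (h w) \<le> B"
    and w: "w \<in> cball z r"
  shows "cmod (h w - h z - deriv h z * (w - z)) \<le> 2 * B / r\<^sup>2 * (cmod (w - z))\<^sup>2"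
proof -
  have sub: "cball u r \<subseteq> ball z (3 * r)" if "u \<in> cball z r" for u
  proof
    fix v assume "v \<in> cball u r"
    then have "dist z v \<le> r + r" using that dist_triangle[of z v u] by (auto simp: dist_commute)
    then show "v \<in> ball z (3 * r)" using r by simp
  qed
  have der: "((deriv ^^ i) h has_field_derivative (deriv ^^ Suc i) h u) (at u within cball z r)"
    if "u \<in> cball z r" for i u
  proof -
    have "u \<in> ball z (3 * r)" using sub[OF that] r by (auto simp: subset_iff)
    then have "((deriv ^^ i) h has_field_derivative deriv ((deriv ^^ i) h) u) (at u)"
      by (intro holomorphic_derivI[OF holomorphic_higher_deriv[OF hol]]) auto
    then show ?thesis by (simp add: has_field_derivative_at_within)
  qed
  have bd2: "cmod ((deriv ^^ Suc 1) h u) \<le> 2 * B / r\<^sup>2" if u: "u \<in> cball z r" for u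
  proof -
    have "norm ((deriv ^^ 2) h u) \<le> fact 2 * B / r^2"
    proof (rule Cauchy_inequality[OF _ _ r])
      show "h holomorphic_on ball u r"
        using hol by (rule holomorphic_on_subset) (use sub[OF u] ball_subset_cball in blast)
      show "continuous_on (cball u r) h"
        using holomorphic_on_imp_continuous_on[OF hol] sub[OF u] by (rule continuous_on_subset)
      fix x assume "norm (u - x) = r"
      then show "norm (h x) \<le> B" using sub[OF u] by (intro bd) (auto simp: dist_norm subset_iff)
    qed
    then show ?thesis by (simp add: numeral_2_eq_2)
  qed
  have "cmod ((deriv ^^ 0) h w - (\<Sum>i\<le>1. (deriv ^^ i) h z * (w - z) ^ i / fact i)) \<le> 2 * B / r\<^sup>2 * cmod (w - z) ^ Suc 1 / fact 1"
    by (rule complex_Taylor[OF convex_cball der bd2]) (use w r in auto)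
  then show ?thesis by (simp add: power2_eq_square algebra_simps)
qed

section \<open>Banach spaces and functions on the strip\<close>

text \<open>Functions on the strip vanish off the strip, so that constants have to be cut off.\<close>

definition strip_const :: "'a::zero \<Rightarrow> complex \<Rightarrow> 'a" where
  "strip_const x z = (if z \<in> strip then x else 0)"

locale banach =
  fixes N :: "'a::ab_group_add cns"
  assumes cvs_N: "complex_vector_space N"
    and nrm_nonneg: "x \<in> car N \<Longrightarrow> 0 \<le> nrm N x"
    and nrm_eq_0: "x \<in> car N \<Longrightarrow> nrm N x = 0 \<Longrightarrow> x = 0"
    and nrm_scale: "x \<in> car N \<Longrightarrow> nrm N (scl N c x) = cmod c * nrm N x"
    and nrm_add: "x \<in> car N \<Longrightarrow> y \<in> car N \<Longrightarrow> nrm N (x + y) \<le> nrm N x + nrm N y"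
    and complete_N: "complete_norm N"
begin

sublocale cvs_locale "car N" "scl N"
  using cvs_N by (simp add: cvs_locale_def complex_vector_space_def)

lemma nrm_zero: "nrm N 0 = 0"
  using nrm_scale[OF carrier_zero, of 0] by simp

lemma nrm_minus: "x \<in> car N \<Longrightarrow> nrm N (- x) = nrm N x"
  using nrm_scale[of x "-1"] by simp

lemma nrm_diff_commute: "x \<in> car N \<Longrightarrow> y \<in> car N \<Longrightarrow> nrm N (x - y) = nrm N (y - x)"
  using nrm_minus[of "x - y"] by (simp add: carrier_diff)

lemma nrm_triangle: "x \<in> car N \<Longrightarrow> y \<in> car N \<Longrightarrow> z \<in> car N \<Longrightarrow> nrm N (x - z) \<le> nrm N (x - y) + nrm N (y - z)"
  using nrm_add[of "x - y" "y - z"] by (simp add: carrier_diff)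

lemma nrm_abs_diff: "x \<in> car N \<Longrightarrow> y \<in> car N \<Longrightarrow> \<bar>nrm N x - nrm N y\<bar> \<le> nrm N (x - y)"
  using nrm_add[of "x - y" y] nrm_add[of "y - x" x] nrm_diff_commute[of x y] by (simp add: carrier_diff abs_le_iff)

lemma nrm_sum: "(\<And>i. i \<in> I \<Longrightarrow> x i \<in> car N) \<Longrightarrow> nrm N (\<Sum>i\<in>I. x i) \<le> (\<Sum>i\<in>I. nrm N (x i))"
proof (induction I rule: infinite_finite_induct)
  case (insert i I)
  then show ?case using nrm_add[of "x i" "\<Sum>i\<in>I. x i"] by (auto simp: carrier_sum)
qed (auto simp: nrm_zero)

lemma dual_ball_iff: "f \<in> dual_ball N \<longleftrightarrow>
   (\<forall>x\<in>car N. \<forall>y\<in>car N. f (x + y) = f x + f y) \<and> (\<forall>c. \<forall>x\<in>car N. f (scl N c x) = c * f x) \<and>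
   (\<forall>x\<in>car N. cmod (f x) \<le> nrm N x)"
  by (auto simp: dual_ball_def linear_map_def)

lemma dual_add: "f \<in> dual_ball N \<Longrightarrow> x \<in> car N \<Longrightarrow> y \<in> car N \<Longrightarrow> f (x + y) = f x + f y"
  and dual_scale: "f \<in> dual_ball N \<Longrightarrow> x \<in> car N \<Longrightarrow> f (scl N c x) = c * f x"
  and dual_le: "f \<in> dual_ball N \<Longrightarrow> x \<in> car N \<Longrightarrow> cmod (f x) \<le> nrm N x"
  by (auto simp: dual_ball_iff)

lemma dual_zero: "f \<in> dual_ball N \<Longrightarrow> f 0 = 0"
  using dual_le[of f 0] by (simp add: carrier_zero nrm_zero)

lemma dual_diff: "f \<in> dual_ball N \<Longrightarrow> x \<in> car N \<Longrightarrow> y \<in> car N \<Longrightarrow> f (x - y) = f x - f y"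
  using dual_add[of f "x - y" y] by (simp add: carrier_diff)

lemma dual_sum: "f \<in> dual_ball N \<Longrightarrow> (\<And>i. i \<in> I \<Longrightarrow> x i \<in> car N) \<Longrightarrow> f (\<Sum>i\<in>I. x i) = (\<Sum>i\<in>I. f (x i))"
proof (induction I rule: infinite_finite_induct)
  case (insert i I)
  then show ?case by (simp add: dual_add carrier_sum)
qed (auto simp: dual_zero)

text \<open>With this lemma and its corollary \<open>nrm_leI\<close>, norm estimates for vector-valued functions follow from
  the scalar ones.\<close>

lemma norming_functional:
  assumes "x \<in> car N"
  obtains f where "f \<in> dual_ball N" "f x = complex_of_real (nrm N x)"
proof -
  obtain f where "\<And>x y. x \<in> car N \<Longrightarrow> y \<in> car N \<Longrightarrow> f (x + y) = f x + f y"
    and "\<And>c x. x \<in> car N \<Longrightarrow> f (scl N c x) = c * f x"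
    and "\<And>x. x \<in> car N \<Longrightarrow> cmod (f x) \<le> nrm N x"
    and "f x = complex_of_real (nrm N x)"
    using Hahn_Banach_seminorm[of "nrm N", OF nrm_scale nrm_add assms] by blast
  then show ?thesis using that[of f] by (simp add: dual_ball_iff)
qed

lemma nrm_leI:
  assumes "x \<in> car N" "\<And>f. f \<in> dual_ball N \<Longrightarrow> cmod (f x) \<le> C"
  shows "nrm N x \<le> C"
proof -
  obtain f where "f \<in> dual_ball N" "f x = complex_of_real (nrm N x)"
    using norming_functional[OF assms(1)] .
  then show ?thesis using assms(2)[of f] nrm_nonneg[OF assms(1)] by simp
qed

lemma completeD:
  assumes "\<And>k. s k \<in> car N" "\<And>e. e > 0 \<Longrightarrow> \<exists>K. \<forall>k\<ge>K. \<forall>l\<ge>K. nrm N (s k - s l) < e"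
  obtains x where "x \<in> car N" "(\<lambda>k. nrm N (s k - x)) \<longlonglongrightarrow> 0"
  using complete_N assms unfolding complete_norm_def by blast

lemma scalar_derivative:
  assumes d: "has_complex_deriv N f d z" and f: "\<And>w. f w \<in> car N" and \<phi>: "\<phi> \<in> dual_ball N"
  shows "((\<lambda>w. \<phi> (f w)) has_field_derivative \<phi> d) (at z)"
proof -
  have dN: "d \<in> car N" and lim: "((\<lambda>w. nrm N (scl N (inverse (w - z)) (f w - f z) - d)) \<longlongrightarrow> 0) (at z)"
    using d by (auto simp: has_complex_deriv_def)
  have "((\<lambda>w. (\<phi> (f w) - \<phi> (f z)) / (w - z) - \<phi> d) \<longlongrightarrow> 0) (at z)"
  proof (rule Lim_null_comparison[OF _ lim], intro always_eventually allI)
    fix w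
    have q: "scl N (inverse (w - z)) (f w - f z) \<in> car N"
      by (intro carrier_scale carrier_diff f)
    have "(\<phi> (f w) - \<phi> (f z)) / (w - z) - \<phi> d = \<phi> (scl N (inverse (w - z)) (f w - f z) - d)"
      using dual_diff[OF \<phi> q dN] dual_scale[OF \<phi> carrier_diff[OF f f]] dual_diff[OF \<phi> f f]
      by (simp add: divide_inverse mult.commute)
    then show "norm ((\<phi> (f w) - \<phi> (f z)) / (w - z) - \<phi> d) \<le> nrm N (scl N (inverse (w - z)) (f w - f z) - d)"
      using dual_le[OF \<phi>] q dN by (simp add: carrier_diff)
  qed
  then show ?thesis by (simp add: has_field_derivative_iff LIM_zero_iff)
qed

lemma complex_deriv_unique:
  assumes "has_complex_deriv N f d z" "has_complex_deriv N f d' z" "\<And>w. f w \<in> car N"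
  shows "d = d'"
proof -
  have c: "d \<in> car N" "d' \<in> car N" using assms by (auto simp: has_complex_deriv_def)
  have "nrm N (d - d') \<le> 0"
  proof (rule nrm_leI)
    fix \<phi> assume "\<phi> \<in> dual_ball N"
    then have "\<phi> d = \<phi> d'"
      using scalar_derivative[OF assms(1,3)] scalar_derivative[OF assms(2,3)] DERIV_unique by blast
    then show "cmod (\<phi> (d - d')) \<le> 0" using \<open>\<phi> \<in> dual_ball N\<close> c by (simp add: dual_diff)
  qed (auto intro: carrier_diff c)
  then have "nrm N (d - d') = 0" using nrm_nonneg[OF carrier_diff[OF c]] by simp
  then show ?thesis using nrm_eq_0[OF carrier_diff[OF c]] by simp
qed

lemma complex_deriv_eq:
  assumes "has_complex_deriv N f d z" "\<And>w. f w \<in> car N"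
  shows "complex_deriv N f z = d"
  unfolding complex_deriv_def using assms complex_deriv_unique by blast

text \<open>The difference quotients of a bounded weakly analytic function form a Cauchy family, since
  their scalar images do so uniformly over the dual unit ball.\<close>

lemma weakly_analytic_imp_has_complex_deriv:
  assumes r: "r > 0" and f: "\<And>w. f w \<in> car N"
    and bd: "\<And>w. w \<in> ball z (3 * r) \<Longrightarrow> nrm N (f w) \<le> B"
    and hol: "\<And>\<phi>. \<phi> \<in> dual_ball N \<Longrightarrow> (\<lambda>w. \<phi> (f w)) holomorphic_on ball z (3 * r)"
  shows "\<exists>d. has_complex_deriv N f d z"
proof -
  define C where "C = 2 * B / r\<^sup>2"
  have "0 \<le> B" using bd[of z] nrm_nonneg[OF f[of z]] r by simp
  then have C: "C \<ge> 0" by (simp add: C_def)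
  define q where "q w = scl N (inverse (w - z)) (f w - f z)" for w
  have q: "q w \<in> car N" for w unfolding q_def by (intro carrier_scale carrier_diff f)
  have \<phi>q: "cmod (\<phi> (q w) - deriv (\<lambda>w. \<phi> (f w)) z) \<le> C * cmod (w - z)"
    if \<phi>: "\<phi> \<in> dual_ball N" and w: "w \<in> cball z r" "w \<noteq> z" for \<phi> w
  proof -
    let ?h = "\<lambda>w. \<phi> (f w)"
    have "cmod (?h w - ?h z - deriv ?h z * (w - z)) \<le> C * (cmod (w - z))\<^sup>2"
      unfolding C_def
      by (rule holomorphic_second_order[OF hol[OF \<phi>] r _ w(1)]) (use dual_le[OF \<phi> f] bd in \<open>meson order_trans\<close>)
    moreover have "\<phi> (q w) - deriv ?h z = (?h w - ?h z - deriv ?h z * (w - z)) / (w - z)"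
    proof -
      have "\<phi> (q w) = (?h w - ?h z) / (w - z)"
        unfolding q_def using dual_scale[OF \<phi> carrier_diff[OF f f]] dual_diff[OF \<phi> f f]
        by (simp add: divide_inverse mult.commute)
      then show ?thesis using w(2) by (simp add: diff_divide_distrib)
    qed
    ultimately show ?thesis using w by (simp add: norm_divide divide_le_eq power2_eq_square)
  qed
  have qq: "nrm N (q w - q w') \<le> C * cmod (w - z) + C * cmod (w' - z)"
    if "w \<in> cball z r" "w \<noteq> z" "w' \<in> cball z r" "w' \<noteq> z" for w w'
  proof (rule nrm_leI)
    fix \<phi> assume \<phi>: "\<phi> \<in> dual_ball N"
    let ?d = "deriv (\<lambda>w. \<phi> (f w)) z"
    have "cmod (\<phi> (q w - q w')) = cmod ((\<phi> (q w) - ?d) - (\<phi> (q w') - ?d))"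
      using \<phi> q by (simp add: dual_diff)
    also have "\<dots> \<le> cmod (\<phi> (q w) - ?d) + cmod (\<phi> (q w') - ?d)" by (rule norm_triangle_ineq4)
    also have "\<dots> \<le> C * cmod (w - z) + C * cmod (w' - z)"
      using that \<phi> by (intro add_mono \<phi>q)
    finally show "cmod (\<phi> (q w - q w')) \<le> C * cmod (w - z) + C * cmod (w' - z)" .
  qed (intro carrier_diff q)
  define w where "w k = z + complex_of_real (r / real (Suc k))" for k
  have w: "w k \<in> cball z r" "w k \<noteq> z" "cmod (w k - z) = r / real (Suc k)" for k
    using r by (auto simp: w_def dist_norm norm_divide divide_le_eq simp del: of_nat_Suc)
  have wlim: "(\<lambda>k. C * (r / real (Suc k))) \<longlonglongrightarrow> 0"
    using tendsto_mult_right_zero[OF LIMSEQ_Suc[OF lim_const_over_n[of r]]] by simp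
  obtain d where d: "d \<in> car N" "(\<lambda>k. nrm N (q (w k) - d)) \<longlonglongrightarrow> 0"
  proof (rule completeD[of "\<lambda>k. q (w k)"])
    fix e :: real assume "e > 0"
    then have "eventually (\<lambda>k. C * (r / real (Suc k)) < e / 2) sequentially"
      using wlim by (intro order_tendstoD) auto
    then obtain K where "\<And>k. k \<ge> K \<Longrightarrow> C * (r / real (Suc k)) < e / 2"
      by (auto simp: eventually_sequentially)
    then have "nrm N (q (w k) - q (w l)) < e" if "k \<ge> K" "l \<ge> K" for k l
      using qq[OF w(1,2) w(1,2), of k l] that unfolding w(3) by (smt (verit) field_sum_of_halves)
    then show "\<exists>K. \<forall>k\<ge>K. \<forall>l\<ge>K. nrm N (q (w k) - q (w l)) < e" by blast
  qed (use q in auto)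
  have le: "nrm N (q u - d) \<le> C * cmod (u - z)" if "u \<in> cball z r" "u \<noteq> z" for u
  proof -
    have "nrm N (q u - d) \<le> C * cmod (u - z) + C * (r / real (Suc k)) + nrm N (q (w k) - d)" for k
      using nrm_triangle[OF q q d(1), of u "w k"] qq[OF that w(1,2), of k, unfolded w(3)] by linarith
    moreover have "(\<lambda>k. C * cmod (u - z) + C * (r / real (Suc k)) + nrm N (q (w k) - d)) \<longlonglongrightarrow> C * cmod (u - z) + 0 + 0"
      by (intro tendsto_add tendsto_const wlim d(2))
    ultimately show ?thesis by (intro tendsto_lowerbound[of _ _ sequentially]) auto
  qed
  have "((\<lambda>w. nrm N (q w - d)) \<longlongrightarrow> 0) (at z)"
  proof (rule Lim_null_comparison)
    show "eventually (\<lambda>w. norm (nrm N (q w - d)) \<le> C * cmod (w - z)) (at z)"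
      unfolding eventually_at using r le nrm_nonneg[OF carrier_diff[OF q d(1)]]
      by (intro exI[of _ r]) (auto simp: dist_commute)
    show "((\<lambda>w. C * cmod (w - z)) \<longlongrightarrow> 0) (at z)" by (auto intro!: tendsto_eq_intros)
  qed
  then show ?thesis using d(1) unfolding has_complex_deriv_def q_def by blast
qed

text \<open>For a couple of operator space structures on one Banach space, these are exactly the elements of the
  Calderon space (\<open>calderon_car\<close>).\<close>

definition strip_fun :: "(complex \<Rightarrow> 'a) \<Rightarrow> bool" where
  "strip_fun f \<longleftrightarrow> (\<forall>z. z \<notin> strip \<longrightarrow> f z = 0) \<and> (\<forall>z. f z \<in> car N) \<and>
     (\<exists>B. \<forall>z\<in>strip. nrm N (f z) \<le> B) \<and> norm_continuous_on N strip f \<and>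
     norm_analytic_on N (interior strip) f"

lemma strip_fun_outside: "strip_fun f \<Longrightarrow> z \<notin> strip \<Longrightarrow> f z = 0"
  and strip_fun_carrier: "strip_fun f \<Longrightarrow> f z \<in> car N"
  and strip_fun_bounded: "strip_fun f \<Longrightarrow> \<exists>B. \<forall>z\<in>strip. nrm N (f z) \<le> B"
  and strip_fun_cont: "strip_fun f \<Longrightarrow> z \<in> strip \<Longrightarrow> ((\<lambda>w. nrm N (f w - f z)) \<longlongrightarrow> 0) (at z within strip)"
  by (auto simp: strip_fun_def norm_continuous_on_def)

lemma strip_fun_deriv:
  assumes f: "strip_fun f" and z: "z \<in> interior strip"
  shows "has_complex_deriv N f (complex_deriv N f z) z"
proof -
  obtain d where "has_complex_deriv N f d z" using f z by (auto simp: strip_fun_def norm_analytic_on_def)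
  then show ?thesis using complex_deriv_eq[of f d z] strip_fun_carrier[OF f] by simp
qed

lemma strip_fun_deriv_carrier: "strip_fun f \<Longrightarrow> z \<in> interior strip \<Longrightarrow> complex_deriv N f z \<in> car N"
  using strip_fun_deriv by (auto simp: has_complex_deriv_def)

lemma dual_strip_fun_deriv:
  "strip_fun f \<Longrightarrow> \<phi> \<in> dual_ball N \<Longrightarrow> z \<in> interior strip \<Longrightarrow>
    ((\<lambda>w. \<phi> (f w)) has_field_derivative \<phi> (complex_deriv N f z)) (at z)"
  by (intro scalar_derivative strip_fun_deriv strip_fun_carrier)

lemma dual_strip_fun_holomorphic:
  "strip_fun f \<Longrightarrow> \<phi> \<in> dual_ball N \<Longrightarrow> (\<lambda>w. \<phi> (f w)) holomorphic_on interior strip"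
  using dual_strip_fun_deriv by (subst holomorphic_on_open) auto

lemma dual_strip_fun_continuous:
  assumes f: "strip_fun f" and \<phi>: "\<phi> \<in> dual_ball N"
  shows "continuous_on strip (\<lambda>w. \<phi> (f w))"
  unfolding continuous_on
proof
  fix z assume z: "z \<in> strip"
  have "((\<lambda>w. \<phi> (f w) - \<phi> (f z)) \<longlongrightarrow> 0) (at z within strip)"
    by (rule Lim_null_comparison[OF _ strip_fun_cont[OF f z]])
      (use dual_le[OF \<phi>] strip_fun_carrier[OF f] dual_diff[OF \<phi>] carrier_diff in \<open>auto intro!: always_eventually simp flip: dual_diff[OF \<phi>]\<close>)
  then show "((\<lambda>w. \<phi> (f w)) \<longlongrightarrow> \<phi> (f z)) (at z within strip)" by (simp add: LIM_zero_iff)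
qed

lemma strip_fun_nrm_continuous:
  assumes f: "strip_fun f"
  shows "continuous_on strip (\<lambda>w. nrm N (f w))"
  unfolding continuous_on
proof
  fix z assume z: "z \<in> strip"
  have "((\<lambda>w. nrm N (f w) - nrm N (f z)) \<longlongrightarrow> 0) (at z within strip)"
    by (rule Lim_null_comparison[OF _ strip_fun_cont[OF f z]])
      (use nrm_abs_diff strip_fun_carrier[OF f] in \<open>auto intro!: always_eventually\<close>)
  then show "((\<lambda>w. nrm N (f w)) \<longlongrightarrow> nrm N (f z)) (at z within strip)" by (simp add: LIM_zero_iff)
qed

lemma complex_deriv_imp_cont:
  assumes d: "has_complex_deriv N f d z" and f: "\<And>w. f w \<in> car N"
  shows "((\<lambda>w. nrm N (f w - f z)) \<longlongrightarrow> 0) (at z)"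
proof -
  have dN: "d \<in> car N" and lim: "((\<lambda>w. nrm N (scl N (inverse (w - z)) (f w - f z) - d)) \<longlongrightarrow> 0) (at z)"
    using d by (auto simp: has_complex_deriv_def)
  let ?q = "\<lambda>w. scl N (inverse (w - z)) (f w - f z)"
  have q: "?q w \<in> car N" for w by (intro carrier_scale carrier_diff f)
  show ?thesis
  proof (rule Lim_null_comparison)
    show "((\<lambda>w. cmod (w - z) * (nrm N (?q w - d) + nrm N d)) \<longlongrightarrow> 0) (at z)"
    proof -
      have "((\<lambda>w. cmod (w - z) * (nrm N (?q w - d) + nrm N d)) \<longlongrightarrow> cmod (z - z) * (0 + nrm N d)) (at z)"
        by (intro tendsto_intros lim)
      then show ?thesis by simp
    qed
    have "norm (nrm N (f w - f z)) \<le> cmod (w - z) * (nrm N (?q w - d) + nrm N d)" if "w \<noteq> z" for w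
    proof -
      have "f w - f z = scl N (w - z) (?q w)" using that by simp
      then have "nrm N (f w - f z) = cmod (w - z) * nrm N (?q w)" using nrm_scale[OF q] by metis
      also have "nrm N (?q w) \<le> nrm N (?q w - d) + nrm N d"
        using nrm_add[OF carrier_diff[OF q dN] dN, of w] by simp
      finally show ?thesis using nrm_nonneg[OF carrier_diff[OF f f], of w z] by (simp add: mult_left_mono)
    qed
    then show "eventually (\<lambda>w. norm (nrm N (f w - f z)) \<le> cmod (w - z) * (nrm N (?q w - d) + nrm N d)) (at z)"
      by (auto simp: eventually_at_filter)
  qed
qed

text \<open>In the interior, scalar holomorphy suffices both for analyticity and for continuity; continuity needs
  to be verified on the boundary lines only.\<close>

lemma strip_funI:
  assumes out: "\<And>z. z \<notin> strip \<Longrightarrow> f z = 0"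
    and f: "\<And>z. f z \<in> car N"
    and bd: "\<And>z. z \<in> strip \<Longrightarrow> nrm N (f z) \<le> B"
    and cont: "\<And>z. z \<in> strip \<Longrightarrow> z \<notin> interior strip \<Longrightarrow> ((\<lambda>w. nrm N (f w - f z)) \<longlongrightarrow> 0) (at z within strip)"
    and hol: "\<And>\<phi>. \<phi> \<in> dual_ball N \<Longrightarrow> (\<lambda>w. \<phi> (f w)) holomorphic_on interior strip"
  shows "strip_fun f"
proof -
  have an: "\<exists>d. has_complex_deriv N f d z" if z: "z \<in> interior strip" for z
  proof -
    obtain e where e: "e > 0" "ball z e \<subseteq> interior strip"
      using z open_contains_ball[of "interior strip"] by auto
    have e3: "3 * (e / 3) = e" by simp
    show ?thesis
    proof (rule weakly_analytic_imp_has_complex_deriv[of "e / 3" f z B])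
      show "nrm N (f w) \<le> B" if "w \<in> ball z (3 * (e / 3))" for w
        using that e interior_strip_subset unfolding e3 by (intro bd) blast
      show "(\<lambda>w. \<phi> (f w)) holomorphic_on ball z (3 * (e / 3))" if "\<phi> \<in> dual_ball N" for \<phi>
        using hol[OF that] e(2) unfolding e3 by (rule holomorphic_on_subset)
    qed (use e f in auto)
  qed
  have "((\<lambda>w. nrm N (f w - f z)) \<longlongrightarrow> 0) (at z within strip)" if "z \<in> strip" for z
  proof (cases "z \<in> interior strip")
    case True
    then obtain d where "has_complex_deriv N f d z" using an by blast
    then have "((\<lambda>w. nrm N (f w - f z)) \<longlongrightarrow> 0) (at z)" using f by (rule complex_deriv_imp_cont)
    then show ?thesis by (rule tendsto_within_subset) simp
  next
    case False
    then show ?thesis by (rule cont[OF that])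
  qed
  then show ?thesis
    unfolding strip_fun_def norm_continuous_on_def norm_analytic_on_def using out f bd an by blast
qed

lemma strip_fun_le:
  assumes f: "strip_fun f" and z: "z \<in> strip"
    and M: "\<And>t. nrm N (f (Complex 0 t)) \<le> M" "\<And>t. nrm N (f (Complex 1 t)) \<le> M"
  shows "nrm N (f z) \<le> M"
proof (rule nrm_leI)
  fix \<phi> assume \<phi>: "\<phi> \<in> dual_ball N"
  obtain B where B: "\<And>z. z \<in> strip \<Longrightarrow> nrm N (f z) \<le> B" using strip_fun_bounded[OF f] by blast
  have le: "cmod (\<phi> (f w)) \<le> nrm N (f w)" for w by (rule dual_le[OF \<phi> strip_fun_carrier[OF f]])
  show "cmod (\<phi> (f z)) \<le> M"
    by (rule strip_maximum_principle[OF dual_strip_fun_continuous[OF f \<phi>] dual_strip_fun_holomorphic[OF f \<phi>] _ _ _ z, of B])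
      (use le B M in \<open>meson order_trans\<close>)+
qed (rule strip_fun_carrier[OF f])

text \<open>Cauchy's estimate.\<close>

lemma strip_fun_deriv_le:
  assumes f: "strip_fun f" and r: "r > 0" "cball z r \<subseteq> interior strip"
    and M: "\<And>z. z \<in> strip \<Longrightarrow> nrm N (f z) \<le> M"
  shows "nrm N (complex_deriv N f z) \<le> M / r"
proof -
  have z: "z \<in> interior strip" using r by (auto simp: subset_iff)
  show ?thesis
  proof (rule nrm_leI)
    fix \<phi> assume \<phi>: "\<phi> \<in> dual_ball N"
    have hol: "(\<lambda>w. \<phi> (f w)) holomorphic_on cball z r"
      using dual_strip_fun_holomorphic[OF f \<phi>] r(2) by (rule holomorphic_on_subset)
    have "norm ((deriv ^^ 1) (\<lambda>w. \<phi> (f w)) z) \<le> fact 1 * M / r ^ 1"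
    proof (rule Cauchy_inequality[OF _ _ r(1)])
      show "(\<lambda>w. \<phi> (f w)) holomorphic_on ball z r" using hol by (rule holomorphic_on_subset) auto
      show "continuous_on (cball z r) (\<lambda>w. \<phi> (f w))" by (rule holomorphic_on_imp_continuous_on[OF hol])
      fix x assume "cmod (z - x) = r"
      then have "x \<in> strip" using r(2) interior_strip_subset by (auto simp: dist_norm subset_iff)
      then show "cmod (\<phi> (f x)) \<le> M" using dual_le[OF \<phi> strip_fun_carrier[OF f], of x] M[of x] by linarith
    qed
    then show "cmod (\<phi> (complex_deriv N f z)) \<le> M / r"
      using DERIV_imp_deriv[OF dual_strip_fun_deriv[OF f \<phi> z]] by simp
  qed (rule strip_fun_deriv_carrier[OF f z])
qed

lemma strip_fun_add:
  assumes f: "strip_fun f" and g: "strip_fun g"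
  shows "strip_fun (\<lambda>z. f z + g z)"
proof -
  obtain A where A: "\<And>z. z \<in> strip \<Longrightarrow> nrm N (f z) \<le> A" using strip_fun_bounded[OF f] by blast
  obtain B where B: "\<And>z. z \<in> strip \<Longrightarrow> nrm N (g z) \<le> B" using strip_fun_bounded[OF g] by blast
  note c = strip_fun_carrier[OF f] strip_fun_carrier[OF g]
  show ?thesis
  proof (rule strip_funI[of _ "A + B"])
    fix z assume z: "z \<in> strip"
    show "nrm N (f z + g z) \<le> A + B" using nrm_add[OF c, of z z] A[OF z] B[OF z] by simp
    show "((\<lambda>w. nrm N (f w + g w - (f z + g z))) \<longlongrightarrow> 0) (at z within strip)"
    proof (rule Lim_null_comparison)
      show "((\<lambda>w. nrm N (f w - f z) + nrm N (g w - g z)) \<longlongrightarrow> 0) (at z within strip)"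
        using tendsto_add[OF strip_fun_cont[OF f z] strip_fun_cont[OF g z]] by simp
      have "norm (nrm N (f w + g w - (f z + g z))) \<le> nrm N (f w - f z) + nrm N (g w - g z)" for w
        using nrm_add[of "f w - f z" "g w - g z"] nrm_nonneg[of "f w + g w - (f z + g z)"] c
        by (simp add: carrier_add carrier_diff algebra_simps)
      then show "eventually (\<lambda>w. norm (nrm N (f w + g w - (f z + g z))) \<le> nrm N (f w - f z) + nrm N (g w - g z)) (at z within strip)"
        by simp
    qed
  next
    fix \<phi> assume \<phi>: "\<phi> \<in> dual_ball N"
    have "(\<lambda>w. \<phi> (f w) + \<phi> (g w)) holomorphic_on interior strip"
      by (intro holomorphic_on_add dual_strip_fun_holomorphic f g \<phi>)
    then show "(\<lambda>w. \<phi> (f w + g w)) holomorphic_on interior strip" using \<phi> c by (simp add: dual_add)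
  qed (use c in \<open>auto intro: carrier_add simp: strip_fun_outside[OF f] strip_fun_outside[OF g]\<close>)
qed

lemma mult_cont:
  assumes f: "\<And>w. f w \<in> car N" and cf: "((\<lambda>w. nrm N (f w - f z)) \<longlongrightarrow> 0) (at z within S)"
    and cg: "(g \<longlongrightarrow> g z) (at z within S)"
  shows "((\<lambda>w. nrm N (scl N (g w) (f w) - scl N (g z) (f z))) \<longlongrightarrow> 0) (at z within S)"
proof (rule Lim_null_comparison)
  have "((\<lambda>w. g w - g z) \<longlongrightarrow> 0) (at z within S)" using cg by (simp add: LIM_zero_iff)
  then have "((\<lambda>w. cmod (g w) * nrm N (f w - f z) + cmod (g w - g z) * nrm N (f z)) \<longlongrightarrow> cmod (g z) * 0 + cmod 0 * nrm N (f z)) (at z within S)"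
    by (intro tendsto_intros cf cg)
  then show "((\<lambda>w. cmod (g w) * nrm N (f w - f z) + cmod (g w - g z) * nrm N (f z)) \<longlongrightarrow> 0) (at z within S)" by simp
  have "norm (nrm N (scl N (g w) (f w) - scl N (g z) (f z))) \<le> cmod (g w) * nrm N (f w - f z) + cmod (g w - g z) * nrm N (f z)" for w
  proof -
    have "scl N (g w) (f w) - scl N (g z) (f z) = scl N (g w) (f w - f z) + scl N (g w - g z) (f z)"
      by (simp add: vs.scale_left_diff_distrib vs.scale_right_diff_distrib)
    then have "nrm N (scl N (g w) (f w) - scl N (g z) (f z)) \<le> cmod (g w) * nrm N (f w - f z) + cmod (g w - g z) * nrm N (f z)"
      using nrm_add[of "scl N (g w) (f w - f z)" "scl N (g w - g z) (f z)"] f by (simp add: carrier_scale carrier_diff nrm_scale)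
    then show ?thesis using nrm_nonneg[of "scl N (g w) (f w) - scl N (g z) (f z)"] f by (simp add: carrier_scale carrier_diff)
  qed
  then show "eventually (\<lambda>w. norm (nrm N (scl N (g w) (f w) - scl N (g z) (f z))) \<le> cmod (g w) * nrm N (f w - f z) + cmod (g w - g z) * nrm N (f z)) (at z within S)"
    by simp
qed

lemma strip_fun_mult:
  assumes f: "strip_fun f" and cg: "continuous_on strip g" and hg: "g holomorphic_on interior strip"
    and bg: "\<And>z. z \<in> strip \<Longrightarrow> cmod (g z) \<le> A"
  shows "strip_fun (\<lambda>z. scl N (g z) (f z))"
proof -
  obtain B where B: "\<And>z. z \<in> strip \<Longrightarrow> nrm N (f z) \<le> B" using strip_fun_bounded[OF f] by blast
  note c = strip_fun_carrier[OF f]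
  show ?thesis
  proof (rule strip_funI[of _ "A * B"])
    fix z assume z: "z \<in> strip"
    have "0 \<le> A" using bg[OF z] norm_ge_zero order_trans by blast
    then show "nrm N (scl N (g z) (f z)) \<le> A * B"
      using bg[OF z] B[OF z] nrm_nonneg[OF c] by (simp add: nrm_scale c mult_mono)
    show "((\<lambda>w. nrm N (scl N (g w) (f w) - scl N (g z) (f z))) \<longlongrightarrow> 0) (at z within strip)"
      using cg z by (intro mult_cont c strip_fun_cont[OF f z]) (auto simp: continuous_on)
  next
    fix \<phi> assume \<phi>: "\<phi> \<in> dual_ball N"
    have "(\<lambda>w. g w * \<phi> (f w)) holomorphic_on interior strip"
      by (intro holomorphic_on_mult dual_strip_fun_holomorphic f \<phi> hg)
    then show "(\<lambda>w. \<phi> (scl N (g w) (f w))) holomorphic_on interior strip" using \<phi> c by (simp add: dual_scale)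
  qed (use c in \<open>auto intro: carrier_scale simp: strip_fun_outside[OF f]\<close>)
qed



lemma strip_fun_const:
  assumes x: "x \<in> car N"
  shows "strip_fun (strip_const x)"
proof (rule strip_funI[of _ "nrm N x"])
  show "((\<lambda>w. nrm N (strip_const x w - strip_const x z)) \<longlongrightarrow> 0) (at z within strip)" if "z \<in> strip" for z
    using that by (intro tendsto_eventually) (auto simp: eventually_at_filter strip_const_def nrm_zero)
  show "(\<lambda>w. \<phi> (strip_const x w)) holomorphic_on interior strip" for \<phi>
    by (rule holomorphic_transform[of "\<lambda>_. \<phi> x"]) (auto simp: strip_const_def dest: interior_strip_subset)
qed (use x carrier_zero in \<open>auto simp: strip_const_def\<close>)

lemma strip_fun_mult_deriv:
  assumes f: "strip_fun f" and fg: "strip_fun (\<lambda>z. scl N (g z) (f z))" and z: "z \<in> interior strip"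
    and g: "(g has_field_derivative g') (at z)"
  shows "complex_deriv N (\<lambda>z. scl N (g z) (f z)) z = scl N g' (f z) + scl N (g z) (complex_deriv N f z)"
    (is "?l = ?r")
proof -
  note c = strip_fun_carrier[OF f] strip_fun_deriv_carrier[OF f z] strip_fun_deriv_carrier[OF fg z]
  have "nrm N (?l - ?r) \<le> 0"
  proof (rule nrm_leI)
    fix \<phi> assume \<phi>: "\<phi> \<in> dual_ball N"
    have "((\<lambda>w. g w * \<phi> (f w)) has_field_derivative g' * \<phi> (f z) + \<phi> (complex_deriv N f z) * g z) (at z)"
      by (rule DERIV_mult'[THEN DERIV_cong]) (use g dual_strip_fun_deriv[OF f \<phi> z] in \<open>auto simp: algebra_simps\<close>)
    moreover have "((\<lambda>w. g w * \<phi> (f w)) has_field_derivative \<phi> ?l) (at z)"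
      using dual_strip_fun_deriv[OF fg \<phi> z] \<phi> c by (simp add: dual_scale)
    ultimately have "\<phi> ?l = g' * \<phi> (f z) + \<phi> (complex_deriv N f z) * g z" using DERIV_unique by blast
    then show "cmod (\<phi> (?l - ?r)) \<le> 0" using \<phi> c
      by (simp add: dual_diff dual_add dual_scale carrier_add carrier_scale)
  qed (intro carrier_add carrier_scale carrier_diff c)
  then have "nrm N (?l - ?r) = 0" using nrm_nonneg[of "?l - ?r"] c by (simp add: carrier_add carrier_scale carrier_diff)
  then show ?thesis using nrm_eq_0[of "?l - ?r"] c by (simp add: carrier_add carrier_scale carrier_diff)
qed

lemma strip_fun_add_deriv:
  assumes f: "strip_fun f" and g: "strip_fun g" and z: "z \<in> interior strip"
  shows "complex_deriv N (\<lambda>z. f z + g z) z = complex_deriv N f z + complex_deriv N g z"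
    (is "?l = ?r")
proof -
  note fg = strip_fun_add[OF f g]
  note c = strip_fun_carrier[OF f] strip_fun_carrier[OF g] strip_fun_deriv_carrier[OF f z]
     strip_fun_deriv_carrier[OF g z] strip_fun_deriv_carrier[OF fg z]
  have "nrm N (?l - ?r) \<le> 0"
  proof (rule nrm_leI)
    fix \<phi> assume \<phi>: "\<phi> \<in> dual_ball N"
    have "((\<lambda>w. \<phi> (f w) + \<phi> (g w)) has_field_derivative \<phi> (complex_deriv N f z) + \<phi> (complex_deriv N g z)) (at z)"
      by (intro DERIV_add dual_strip_fun_deriv f g \<phi> z)
    moreover have "((\<lambda>w. \<phi> (f w) + \<phi> (g w)) has_field_derivative \<phi> ?l) (at z)"
      using dual_strip_fun_deriv[OF fg \<phi> z] \<phi> c by (simp add: dual_add)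
    ultimately have "\<phi> ?l = \<phi> (complex_deriv N f z) + \<phi> (complex_deriv N g z)" using DERIV_unique by blast
    then show "cmod (\<phi> (?l - ?r)) \<le> 0" using \<phi> c by (simp add: dual_diff dual_add carrier_add)
  qed (intro carrier_add carrier_diff c)
  then have "nrm N (?l - ?r) = 0" using nrm_nonneg[of "?l - ?r"] c by (simp add: carrier_add carrier_diff)
  then show ?thesis using nrm_eq_0[of "?l - ?r"] c by (simp add: carrier_add carrier_diff)
qed

text \<open>Dividing out a zero: the quotient is weakly analytic at the zero, hence analytic.\<close>

lemma strip_fun_divide_zero:
  assumes f: "strip_fun f" and z0: "z0 \<in> interior strip" and f0: "f z0 = 0"
  shows "strip_fun (\<lambda>z. if z = z0 then complex_deriv N f z0 else scl N (inverse (z - z0)) (f z))"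
    (is "strip_fun ?g")
proof -
  obtain r where r: "r > 0" "ball z0 r \<subseteq> interior strip"
    using z0 open_contains_ball[of "interior strip"] by auto
  obtain B where B: "\<And>z. z \<in> strip \<Longrightarrow> nrm N (f z) \<le> B" using strip_fun_bounded[OF f] by blast
  note c = strip_fun_carrier[OF f] strip_fun_deriv_carrier[OF f z0]
  have "((\<lambda>w. nrm N (scl N (inverse (w - z0)) (f w - 0) - complex_deriv N f z0)) \<longlongrightarrow> 0) (at z0)"
    using strip_fun_deriv[OF f z0] by (simp add: has_complex_deriv_def f0)
  then have lim: "((\<lambda>w. nrm N (?g w - ?g z0)) \<longlongrightarrow> 0) (at z0)"
    by (rule Lim_transform_eventually) (auto simp: eventually_at_filter)
  then have "eventually (\<lambda>w. nrm N (?g w - ?g z0) < 1) (at z0)" by (rule order_tendstoD) simp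
  then obtain d where d: "d > 0" "\<And>w. w \<noteq> z0 \<Longrightarrow> dist w z0 < d \<Longrightarrow> nrm N (?g w - ?g z0) < 1"
    unfolding eventually_at by auto
  have g: "?g z \<in> car N" for z using c by (auto intro: carrier_scale)
  have "0 \<le> B" using B[of z0] interior_strip_subset[OF z0] by (simp add: f0 nrm_zero)
  show ?thesis
  proof (rule strip_funI[of _ "(1 + nrm N (?g z0)) + B / d"])
    fix z assume z: "z \<in> strip"
    show "nrm N (?g z) \<le> (1 + nrm N (?g z0)) + B / d"
    proof (cases "dist z z0 < d")
      case True
      have "nrm N (?g z - ?g z0) \<le> 1"
        using d(2)[of z] True by (cases "z = z0") (auto simp: nrm_zero intro: less_imp_le)
      then have "nrm N (?g z) \<le> 1 + nrm N (?g z0)" using nrm_add[OF carrier_diff[OF g g] g, of z z0 z0] by simp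
      then show ?thesis using \<open>0 \<le> B\<close> d(1) by (simp add: add_increasing2)
    next
      case False
      then have "z \<noteq> z0" using d(1) by auto
      then have "nrm N (?g z) = nrm N (f z) / dist z z0" using c
        by (simp add: nrm_scale norm_inverse dist_norm divide_inverse)
      also have "\<dots> \<le> B / d"
        using False d(1) B[OF z] nrm_nonneg[OF c(1)] by (intro frac_le) (auto simp: \<open>0 \<le> B\<close>)
      finally show ?thesis using nrm_nonneg[OF g, of z0] by linarith
    qed
    assume nz: "z \<notin> interior strip"
    then have zz: "z \<noteq> z0" using z0 by auto
    have "((\<lambda>w. nrm N (scl N (inverse (w - z0)) (f w) - scl N (inverse (z - z0)) (f z))) \<longlongrightarrow> 0) (at z within strip)"
      by (rule mult_cont[where g = "\<lambda>w. inverse (w - z0)", OF c(1) strip_fun_cont[OF f z]])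
        (use zz in \<open>auto intro!: tendsto_intros\<close>)
    moreover have "eventually (\<lambda>w. w \<noteq> z0) (at z within strip)"
      using zz by (auto simp: eventually_at intro!: exI[of _ "dist z z0"] simp: dist_commute)
    ultimately show "((\<lambda>w. nrm N (?g w - ?g z)) \<longlongrightarrow> 0) (at z within strip)"
      by (elim Lim_transform_eventually eventually_mono) (use zz in simp)
  next
    fix \<phi> assume \<phi>: "\<phi> \<in> dual_ball N"
    let ?h = "\<lambda>w. \<phi> (f w)"
    have "(\<lambda>z. if z = z0 then deriv ?h z0 else (?h z - ?h z0) / (z - z0)) holomorphic_on interior strip"
      by (rule pole_lemma_open[OF dual_strip_fun_holomorphic[OF f \<phi>] open_interior])
    moreover have "deriv ?h z0 = \<phi> (complex_deriv N f z0)"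
      by (rule DERIV_imp_deriv[OF dual_strip_fun_deriv[OF f \<phi> z0]])
    moreover have "?h z0 = 0" by (simp add: f0 dual_zero[OF \<phi>])
    ultimately show "(\<lambda>w. \<phi> (?g w)) holomorphic_on interior strip"
      by (elim holomorphic_transform) (use \<phi> c in \<open>auto simp: dual_scale field_simps\<close>)
  qed (use g z0 interior_strip_subset in \<open>auto simp: strip_fun_outside[OF f]\<close>)
qed

text \<open>Holomorphy survives the limit because weak holomorphy does.\<close>

lemma strip_fun_uniform_limit:
  fixes f :: "nat \<Rightarrow> complex \<Rightarrow> 'a"
  assumes f: "\<And>k. strip_fun (f k)" and g: "\<And>z. g z \<in> car N" "\<And>z. z \<notin> strip \<Longrightarrow> g z = 0"
    and lim: "\<And>e. e > 0 \<Longrightarrow> \<exists>K. \<forall>k\<ge>K. \<forall>z\<in>strip. nrm N (f k z - g z) \<le> e"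
  shows "strip_fun g"
proof -
  note c = strip_fun_carrier[OF f] g(1)
  obtain K where K: "\<And>k z. k \<ge> K \<Longrightarrow> z \<in> strip \<Longrightarrow> nrm N (f k z - g z) \<le> 1" using lim[of 1] by auto
  obtain B where B: "\<And>z. z \<in> strip \<Longrightarrow> nrm N (f K z) \<le> B" using strip_fun_bounded[OF f] by blast
  show ?thesis
  proof (rule strip_funI[of _ "B + 1"])
    fix z assume z: "z \<in> strip"
    show "nrm N (g z) \<le> B + 1"
    proof -
      have "nrm N (g z) \<le> nrm N (f K z) + nrm N (g z - f K z)"
        using nrm_add[of "f K z" "g z - f K z"] c by (simp add: carrier_diff)
      then show ?thesis using B[OF z] K[OF le_refl z] nrm_diff_commute[OF c, of K z z] by linarith
    qed
    show "((\<lambda>w. nrm N (g w - g z)) \<longlongrightarrow> 0) (at z within strip)"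
    proof (rule tendstoI)
      fix e :: real assume e: "e > 0"
      obtain k where k: "\<And>w. w \<in> strip \<Longrightarrow> nrm N (f k w - g w) \<le> e / 3" using lim[of "e / 3"] e by auto
      have "eventually (\<lambda>w. nrm N (f k w - f k z) < e / 3) (at z within strip)"
        using strip_fun_cont[OF f z] e by (intro order_tendstoD) auto
      moreover have "eventually (\<lambda>w. w \<in> strip) (at z within strip)" by (auto simp: eventually_at_filter)
      ultimately show "eventually (\<lambda>w. dist (nrm N (g w - g z)) 0 < e) (at z within strip)"
      proof eventually_elim
        case (elim w)
        have "nrm N (g w - g z) \<le> nrm N (g w - f k w) + (nrm N (f k w - f k z) + nrm N (f k z - g z))"
          using nrm_triangle[of "g w" "f k w" "g z"] nrm_triangle[of "f k w" "f k z" "g z"] c by simp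
        also have "nrm N (g w - f k w) = nrm N (f k w - g w)" by (intro nrm_diff_commute c)
        finally show ?case using k[OF elim(2)] k[OF z] elim(1) nrm_nonneg[OF carrier_diff[OF c(2) c(2)], of w z] by simp
      qed
    qed
  next
    fix \<phi> assume \<phi>: "\<phi> \<in> dual_ball N"
    show "(\<lambda>w. \<phi> (g w)) holomorphic_on interior strip"
    proof (rule holomorphic_uniform_sequence[OF open_interior, of "\<lambda>k w. \<phi> (f k w)"])
      show "(\<lambda>w. \<phi> (f k w)) holomorphic_on interior strip" for k by (rule dual_strip_fun_holomorphic[OF f \<phi>])
      fix x assume "x \<in> interior strip"
      then obtain d where d: "d > 0" "cball x d \<subseteq> interior strip"
        using open_contains_cball[of "interior strip"] by auto
      have "uniform_limit (cball x d) (\<lambda>k w. \<phi> (f k w)) (\<lambda>w. \<phi> (g w)) sequentially"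
      proof (rule uniform_limitI)
        fix e :: real assume e: "e > 0"
        obtain K where K: "\<And>k w. k \<ge> K \<Longrightarrow> w \<in> strip \<Longrightarrow> nrm N (f k w - g w) \<le> e / 2" using lim[of "e / 2"] e by auto
        have "dist (\<phi> (f k w)) (\<phi> (g w)) < e" if "k \<ge> K" "w \<in> cball x d" for k w
        proof -
          have "w \<in> strip" using that d(2) interior_strip_subset by blast
          then have "cmod (\<phi> (f k w - g w)) \<le> e / 2"
            using dual_le[OF \<phi> carrier_diff[OF c], of k w w] K[of k w] that(1) by linarith
          then show ?thesis using e \<phi> c by (simp add: dist_norm dual_diff)
        qed
        then show "\<forall>\<^sub>F k in sequentially. \<forall>w\<in>cball x d. dist (\<phi> (f k w)) (\<phi> (g w)) < e"
          unfolding eventually_sequentially by (intro exI[of _ K]) auto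
      qed
      then show "\<exists>d>0. cball x d \<subseteq> interior strip \<and> uniform_limit (cball x d) (\<lambda>k w. \<phi> (f k w)) (\<lambda>w. \<phi> (g w)) sequentially"
        using d by blast
    qed
  qed (use g in auto)
qed

end

section \<open>Operator spaces\<close>

text \<open>Elements of \<open>X\<close> are treated as matrices of size \<open>1\<close>; rewriting this size to \<open>Suc 0\<close> would hide
  them from the lemmas about matrices of size \<open>n \<ge> 1\<close>.\<close>

declare One_nat_def [simp del]

lemma mats_iff: "x \<in> mats V n \<longleftrightarrow> x \<in> carrier_mat n n \<and> (\<forall>i<n. \<forall>j<n. x $$ (i, j) \<in> car V)"
  unfolding mats_def using elements_matD[of _ x] by (auto simp: subset_iff)

lemma lessThan_1: "{..<1::nat} = {0}"
  by auto

lemma matsI: "(\<And>i j. i < n \<Longrightarrow> j < n \<Longrightarrow> f (i, j) \<in> car V) \<Longrightarrow> mat n n f \<in> mats V n"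
  by (auto simp: mats_iff)

lemma matsD: "x \<in> mats V n \<Longrightarrow> i < n \<Longrightarrow> j < n \<Longrightarrow> x $$ (i, j) \<in> car V"
  and mats_carrier: "x \<in> mats V n \<Longrightarrow> x \<in> carrier_mat n n"
  and mats_dim: "x \<in> mats V n \<Longrightarrow> dim_row x = n" "x \<in> mats V n \<Longrightarrow> dim_col x = n"
  by (auto simp: mats_iff)

text \<open>Submatrices, and matrices with a single entry, arise by multiplication with partial permutation
  matrices. Ruan's second axiom therefore controls them.\<close>

lemma scalar_prods_select:
  assumes V: "vector_space (scl V)" and x: "x \<in> carrier_mat n n"
    and st: "\<And>i. i < m \<Longrightarrow> s i < n" "\<And>i. i < m \<Longrightarrow> t i < n"
  shows "scalar_prods V (mat m n (\<lambda>(i, k). if k = s i then 1 else 0)) x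
           (mat n m (\<lambda>(l, j). if l = t j then 1 else 0)) = mat m m (\<lambda>(i, j). x $$ (s i, t j))"
proof -
  interpret vector_space "scl V" by (rule V)
  have "(\<Sum>k<n. \<Sum>l<n. scl V ((if k = s i then 1 else 0) * (if l = t j then 1 else 0)) (x $$ (k, l))) = x $$ (s i, t j)"
    if "i < m" "j < m" for i j
  proof -
    have "(\<Sum>l<n. scl V ((if k = s i then 1 else 0) * (if l = t j then 1 else 0)) (x $$ (k, l)))
       = (if k = s i then x $$ (k, t j) else 0)" for k
      by (simp add: if_distrib[of "\<lambda>c. scl V c _"] st that cong: if_cong)
    then show ?thesis by (simp add: st that)
  qed
  then show ?thesis using x by (auto simp: scalar_prods_def)
qed

lemma scalar_prods_place:
  assumes V: "vector_space (scl V)" and ij: "i < n" "j < n"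
  shows "scalar_prods V (mat n 1 (\<lambda>(k, _). if k = i then 1 else 0)) (mat 1 1 (\<lambda>_. x))
           (mat 1 n (\<lambda>(_, l). if l = j then 1 else 0)) = mat n n (\<lambda>(k, l). if k = i \<and> l = j then x else 0)"
proof -
  interpret vector_space "scl V" by (rule V)
  show ?thesis by (auto simp: scalar_prods_def lessThan_1)
qed

lemma scalar_prods_scl_cong: "scl V = scl W \<Longrightarrow> scalar_prods V = scalar_prods W"
  by (simp add: scalar_prods_def fun_eq_iff)

locale opspace =
  fixes X :: "'a::ab_group_add opspace"
  assumes operator_space: "operator_space X"
begin

sublocale cvs_locale "car X" "scl X"
  using operator_space by (simp add: cvs_locale_def operator_space_def complex_vector_space_def)

lemma mnorm_nonneg: "n \<ge> 1 \<Longrightarrow> x \<in> mats X n \<Longrightarrow> 0 \<le> mnorm X x"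
  and mnorm_eq_0: "n \<ge> 1 \<Longrightarrow> x \<in> mats X n \<Longrightarrow> mnorm X x = 0 \<longleftrightarrow> x = 0\<^sub>m n n"
  and mnorm_scale: "n \<ge> 1 \<Longrightarrow> x \<in> mats X n \<Longrightarrow> mnorm X (map_mat (scl X c) x) = cmod c * mnorm X x"
  and mnorm_add: "n \<ge> 1 \<Longrightarrow> x \<in> mats X n \<Longrightarrow> y \<in> mats X n \<Longrightarrow> mnorm X (x + y) \<le> mnorm X x + mnorm X y"
proof -
  have M: "matrix_norms X" using operator_space by (simp add: operator_space_def)
  note M = M[unfolded matrix_norms_def, rule_format]
  show "n \<ge> 1 \<Longrightarrow> x \<in> mats X n \<Longrightarrow> 0 \<le> mnorm X x" using M[of n x] by blast
  show "n \<ge> 1 \<Longrightarrow> x \<in> mats X n \<Longrightarrow> mnorm X x = 0 \<longleftrightarrow> x = 0\<^sub>m n n" using M[of n x] by blast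
  show "n \<ge> 1 \<Longrightarrow> x \<in> mats X n \<Longrightarrow> mnorm X (map_mat (scl X c) x) = cmod c * mnorm X x" using M[of n x] by blast
  show "n \<ge> 1 \<Longrightarrow> x \<in> mats X n \<Longrightarrow> y \<in> mats X n \<Longrightarrow> mnorm X (x + y) \<le> mnorm X x + mnorm X y"
    using M[of n x] by blast
qed

lemma mnorm_block: "n \<ge> 1 \<Longrightarrow> m \<ge> 1 \<Longrightarrow> x \<in> mats X n \<Longrightarrow> y \<in> mats X m \<Longrightarrow>
    mnorm X (four_block_mat x (0\<^sub>m n m) (0\<^sub>m m n) y) = max (mnorm X x) (mnorm X y)"
  and mnorm_scalar_prods: "n \<ge> 1 \<Longrightarrow> m \<ge> 1 \<Longrightarrow> x \<in> mats X m \<Longrightarrow> \<alpha> \<in> carrier_mat n m \<Longrightarrow> \<beta> \<in> carrier_mat m n \<Longrightarrow>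
    mnorm X (scalar_prods X \<alpha> x \<beta>) \<le> scalar_mat_norm \<alpha> * mnorm X x * scalar_mat_norm \<beta>"
proof -
  have "ruan_axioms X" using operator_space by (simp add: operator_space_def)
  note M = this[unfolded ruan_axioms_def]
  show "n \<ge> 1 \<Longrightarrow> m \<ge> 1 \<Longrightarrow> x \<in> mats X n \<Longrightarrow> y \<in> mats X m \<Longrightarrow>
    mnorm X (four_block_mat x (0\<^sub>m n m) (0\<^sub>m m n) y) = max (mnorm X x) (mnorm X y)"
    using conjunct1[OF M] by blast
  show "n \<ge> 1 \<Longrightarrow> m \<ge> 1 \<Longrightarrow> x \<in> mats X m \<Longrightarrow> \<alpha> \<in> carrier_mat n m \<Longrightarrow> \<beta> \<in> carrier_mat m n \<Longrightarrow>
    mnorm X (scalar_prods X \<alpha> x \<beta>) \<le> scalar_mat_norm \<alpha> * mnorm X x * scalar_mat_norm \<beta>"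
    using conjunct2[OF M] by blast
qed

lemma mnorm_scalar_prods_contraction:
  assumes "n \<ge> 1" "m \<ge> 1" "x \<in> mats X m" "\<alpha> \<in> carrier_mat n m" "\<beta> \<in> carrier_mat m n"
    "scalar_mat_norm \<alpha> \<le> 1" "scalar_mat_norm \<beta> \<le> 1"
  shows "mnorm X (scalar_prods X \<alpha> x \<beta>) \<le> mnorm X x"
proof -
  have "scalar_mat_norm \<alpha> * mnorm X x * scalar_mat_norm \<beta> \<le> 1 * mnorm X x * 1"
    using assms mnorm_nonneg[of m x] by (intro mult_mono) auto
  then show ?thesis using mnorm_scalar_prods[OF assms(1-5)] by simp
qed

lemma mnorm_select:
  assumes n: "n \<ge> 1" and m: "m \<ge> 1" and x: "x \<in> mats X n"
    and s: "inj_on s {..<m}" "\<And>i. i < m \<Longrightarrow> s i < n"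
    and t: "inj_on t {..<m}" "\<And>i. i < m \<Longrightarrow> t i < n"
  shows "mnorm X (mat m m (\<lambda>(i, j). x $$ (s i, t j))) \<le> mnorm X x"
proof -
  have "inj_on s {i. i < m \<and> s i < n}" "inj_on t {i. i < m \<and> t i < n}"
    using s t by (auto intro: inj_on_subset)
  moreover have "scalar_prods X (mat m n (\<lambda>(i, k). if k = s i then 1 else 0)) x
      (mat n m (\<lambda>(l, j). if l = t j then 1 else 0)) = mat m m (\<lambda>(i, j). x $$ (s i, t j))"
    by (rule scalar_prods_select[OF vector_space_scale mats_carrier[OF x]]) (use s t in auto)
  ultimately show ?thesis
    using mnorm_scalar_prods_contraction[OF m n x _ _ scalar_mat_norm_partial_permutation(1)[of s m n] scalar_mat_norm_partial_permutation(2)[of t m n]]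
    by simp
qed

lemma entry_le_mnorm:
  assumes "n \<ge> 1" "x \<in> mats X n" "i < n" "j < n"
  shows "mnorm X (mat 1 1 (\<lambda>_. x $$ (i, j))) \<le> mnorm X x"
  using mnorm_select[OF assms(1) _ assms(2), of 1 "\<lambda>_. i" "\<lambda>_. j"] assms
  by (simp add: inj_on_def split_def)

lemma mnorm_place:
  assumes "n \<ge> 1" "x \<in> car X" "i < n" "j < n"
  shows "mnorm X (mat n n (\<lambda>(k, l). if k = i \<and> l = j then x else 0)) \<le> mnorm X (mat 1 1 (\<lambda>_. x))"
proof -
  have "scalar_mat_norm (mat n 1 (\<lambda>(k, _). if k = i then 1 else 0)) \<le> 1"
    "scalar_mat_norm (mat 1 n (\<lambda>(_, l). if l = j then 1 else 0)) \<le> 1"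
    using scalar_mat_norm_partial_permutation(2)[of "\<lambda>_. i" 1 n]
      scalar_mat_norm_partial_permutation(1)[of "\<lambda>_. j" 1 n] by (auto simp: inj_on_def)
  then have "mnorm X (scalar_prods X (mat n 1 (\<lambda>(k, _). if k = i then 1 else 0)) (mat 1 1 (\<lambda>_. x))
           (mat 1 n (\<lambda>(_, l). if l = j then 1 else 0))) \<le> mnorm X (mat 1 1 (\<lambda>_. x))"
    using assms by (intro mnorm_scalar_prods_contraction[of n 1]) (auto simp: mats_iff)
  then show ?thesis unfolding scalar_prods_place[where V = X, OF vector_space_scale assms(3,4)] .
qed

text \<open>The matrix norms are equivalent to the sum of the norms of the entries, though not uniformly in the
  size. This is what makes suprema over the boundary of the strip finite.\<close>

lemma mnorm_le_sum:
  assumes n: "n \<ge> 1" and x: "x \<in> mats X n"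
  shows "mnorm X x \<le> (\<Sum>i<n. \<Sum>j<n. mnorm X (mat 1 1 (\<lambda>_. x $$ (i, j))))"
proof -
  let ?y = "\<lambda>P. mat n n (\<lambda>p. if p \<in> P then x $$ p else 0)"
  let ?m = "\<lambda>p. mnorm X (mat 1 1 (\<lambda>_. x $$ p))"
  have y: "?y P \<in> mats X n" for P using x by (intro matsI) (auto simp: matsD carrier_zero)
  have "mnorm X (?y P) \<le> (\<Sum>p\<in>P. ?m p)" if "finite P" "P \<subseteq> {..<n} \<times> {..<n}" for P
    using that
  proof (induction P)
    case empty
    have "?y {} = 0\<^sub>m n n" by auto
    then have 0: "mnorm X (?y {}) = 0" using mnorm_eq_0[OF n y[of "{}"]] by blast
    show ?case by (subst 0) simp
  next
    case (insert p P)
    obtain i j where p: "p = (i, j)" "i < n" "j < n" using insert.prems by auto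
    let ?e = "mat n n (\<lambda>(k, l). if k = i \<and> l = j then x $$ (i, j) else 0)"
    have "?e \<in> mats X n" using matsD[OF x p(2,3)] carrier_zero by (auto intro!: matsI)
    moreover have "?y (insert p P) = ?e + ?y P"
      using insert.hyps p by auto
    ultimately have "mnorm X (?y (insert p P)) \<le> mnorm X ?e + mnorm X (?y P)"
      using mnorm_add[OF n _ y, of ?e P] by simp
    also have "\<dots> \<le> ?m (i, j) + (\<Sum>p\<in>P. ?m p)"
      using insert p matsD[OF x p(2,3)] by (intro add_mono mnorm_place n) auto
    finally show ?case using insert.hyps p by simp
  qed
  from this[of "{..<n} \<times> {..<n}"] have "mnorm X (?y ({..<n} \<times> {..<n})) \<le> (\<Sum>i<n. \<Sum>j<n. ?m (i, j))"
    by (simp add: sum.cartesian_product)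
  also have "?y ({..<n} \<times> {..<n}) = x" using mats_carrier[OF x] by auto
  finally show ?thesis .
qed

abbreviation "NX \<equiv> normed_space_of X"

lemma NX_simps [simp]: "car NX = car X" "scl NX = scl X" "nrm NX x = mnorm X (mat 1 1 (\<lambda>_. x))"
  by (simp_all add: normed_space_of_def)

lemma one_by_one_mats: "x \<in> car X \<Longrightarrow> mat 1 1 (\<lambda>_. x) \<in> mats X 1"
  by (auto intro: matsI)

sublocale norm: banach NX
proof
  show "complex_vector_space NX" "complete_norm NX"
    using operator_space by (simp_all add: operator_space_def complex_vector_space_def)
  fix x y :: 'a and c assume "x \<in> car NX"
  then have x: "mat 1 1 (\<lambda>_. x) \<in> mats X 1" by (simp add: one_by_one_mats)
  show "0 \<le> nrm NX x" using mnorm_nonneg[OF _ x] by simp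
  show "x = 0" if "nrm NX x = 0"
  proof -
    have "mat 1 1 (\<lambda>_. x) = 0\<^sub>m 1 1" using mnorm_eq_0[OF _ x] that by simp
    then have "mat 1 1 (\<lambda>_. x) $$ (0, 0) = 0\<^sub>m 1 1 $$ (0, 0)" by simp
    then show ?thesis by simp
  qed
  have "map_mat (scl X c) (mat 1 1 (\<lambda>_. x)) = mat 1 1 (\<lambda>_. scl X c x)" by auto
  then show "nrm NX (scl NX c x) = cmod c * nrm NX x" using mnorm_scale[OF _ x, of c] by simp
  assume "y \<in> car NX"
  then have y: "mat 1 1 (\<lambda>_. y) \<in> mats X 1" by (simp add: one_by_one_mats)
  have "mat 1 1 (\<lambda>_. x) + mat 1 1 (\<lambda>_. y) = mat 1 1 (\<lambda>_. x + y)" by auto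
  then show "nrm NX (x + y) \<le> nrm NX x + nrm NX y" using mnorm_add[OF _ x y] by simp
qed

end

lemma sum_fun_apply: "(\<Sum>i\<in>I. f i) z = (\<Sum>i\<in>I. f i z)"
  by (induction I rule: infinite_finite_induct) auto

section \<open>The Calderon space is an operator space\<close>

text \<open>The couples of interest induce the same norm on \<open>M\<^sub>1\<close>. Then the sum space is the common Banach
  space isometrically, and the conditions that define the Calderon space refer to its norm only.\<close>

locale couple = banach N for N :: "'a::ab_group_add cns" +
  fixes X0 X1 :: "'a opspace"
  assumes op0: "operator_space X0" and op1: "operator_space X1"
    and car0 [simp]: "car X0 = car N" and car1 [simp]: "car X1 = car N"
    and scl0 [simp]: "scl X0 = scl N" and scl1 [simp]: "scl X1 = scl N"
    and nrm0 [simp]: "x \<in> car N \<Longrightarrow> mnorm X0 (mat 1 1 (\<lambda>_. x)) = nrm N x"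
    and nrm1 [simp]: "x \<in> car N \<Longrightarrow> mnorm X1 (mat 1 1 (\<lambda>_. x)) = nrm N x"
begin

sublocale X0: opspace X0 by unfold_locales (rule op0)
sublocale X1: opspace X1 by unfold_locales (rule op1)

abbreviation "CX \<equiv> calderon_space X0 X1"
abbreviation "\<Sigma> \<equiv> sum_space X0 X1"

lemma sum_space_car [simp]: "car \<Sigma> = car N"
  using carrier_add carrier_zero by (auto simp: sum_space_def) (metis add.right_neutral)

lemma sum_space_scl [simp]: "scl \<Sigma> = scl N"
  by (simp add: sum_space_def)

text \<open>The decomposition \<open>x = x + 0\<close> is optimal by the triangle inequality.\<close>

lemma sum_space_nrm [simp]:
  assumes x: "x \<in> car N"
  shows "nrm \<Sigma> x = nrm N x"
proof -
  let ?S = "{mnorm X0 (mat 1 1 (\<lambda>_. a)) + mnorm X1 (mat 1 1 (\<lambda>_. b)) | a b. a \<in> car N \<and> b \<in> car N \<and> x = a + b}"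
  have eq: "nrm \<Sigma> x = Inf ?S" by (simp add: sum_space_def normed_space_of_def)
  have lb: "nrm N x \<le> u" if "u \<in> ?S" for u using that nrm_add by (auto simp: nrm0 nrm1)
  show ?thesis unfolding eq
  proof (rule antisym)
    have "nrm N x = mnorm X0 (mat 1 1 (\<lambda>_. x)) + mnorm X1 (mat 1 1 (\<lambda>_. 0))"
      using x carrier_zero by (simp add: nrm_zero)
    moreover have "x = x + 0" by simp
    ultimately have mem: "nrm N x \<in> ?S" using x carrier_zero by blast
    then show "Inf ?S \<le> nrm N x" using lb by (intro cInf_lower bdd_belowI[of _ "nrm N x"])
    show "nrm N x \<le> Inf ?S"
      using mem lb by (intro cInf_greatest) auto
  qed
qed

lemma sum_space_deriv:
  assumes "\<And>w. f w \<in> car N"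
  shows "has_complex_deriv \<Sigma> f d z \<longleftrightarrow> has_complex_deriv N f d z"
proof (cases "d \<in> car N")
  case True
  then have "nrm \<Sigma> (scl N (inverse (w - z)) (f w - f z) - d) = nrm N (scl N (inverse (w - z)) (f w - f z) - d)" for w
    using assms by (simp add: carrier_diff carrier_scale)
  then show ?thesis using True by (simp add: has_complex_deriv_def)
qed (simp add: has_complex_deriv_def)

lemma sum_space_complex_deriv:
  "(\<And>w. f w \<in> car N) \<Longrightarrow> complex_deriv \<Sigma> f z = complex_deriv N f z"
  by (simp add: complex_deriv_def sum_space_deriv)

lemma calderon_car: "car CX = {f. strip_fun f}"
proof -
  have bd: "continuous_on UNIV (\<lambda>t. nrm N (f (Complex c t))) \<and> bounded (range (\<lambda>t. nrm N (f (Complex c t))))"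
    if f: "strip_fun f" and c: "c = 0 \<or> c = 1" for c f
  proof
    have s: "Complex c t \<in> strip" for t using c by auto
    have "continuous_on UNIV (\<lambda>t. Complex c t)" unfolding Complex_eq by (intro continuous_intros)
    then show "continuous_on UNIV (\<lambda>t. nrm N (f (Complex c t)))"
      using continuous_on_compose2[OF strip_fun_nrm_continuous[OF f], of UNIV "\<lambda>t. Complex c t"] s by auto
    obtain B where "\<And>z. z \<in> strip \<Longrightarrow> nrm N (f z) \<le> B" using strip_fun_bounded[OF f] by blast
    then show "bounded (range (\<lambda>t. nrm N (f (Complex c t))))"
      using s nrm_nonneg[OF strip_fun_carrier[OF f]] by (intro boundedI[of _ B]) auto
  qed
  have cong: "norm_continuous_on \<Sigma> strip f = norm_continuous_on N strip f"
      "norm_analytic_on \<Sigma> (interior strip) f = norm_analytic_on N (interior strip) f"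
    if f: "\<And>w. f w \<in> car N" for f
    by (simp_all add: norm_continuous_on_def norm_analytic_on_def f carrier_diff sum_space_deriv[OF f])
  have all: "\<And>w. f w \<in> car N" if "\<forall>z. z \<notin> strip \<longrightarrow> f z = 0" "\<forall>z\<in>strip. f z \<in> car N" for f
    using that carrier_zero by metis
  have "f \<in> car CX \<longleftrightarrow> strip_fun f" for f
  proof
    assume f: "f \<in> car CX"
    then have "\<forall>z. z \<notin> strip \<longrightarrow> f z = 0" "\<forall>z\<in>strip. f z \<in> car N" by (simp_all add: calderon_space_def)
    then have c: "\<And>w. f w \<in> car N" by (rule all)
    then show "strip_fun f" using f by (simp add: calderon_space_def strip_fun_def cong[OF c])
  next
    assume f: "strip_fun f"
    note c = strip_fun_carrier[OF f]
    show "f \<in> car CX" using f bd[OF f, of 0] bd[OF f, of 1]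
      by (simp add: calderon_space_def strip_fun_def cong[OF c] normed_space_of_def c)
  qed
  then show ?thesis by auto
qed

lemma calderon_scl: "scl CX = (\<lambda>c f z. scl N c (f z))"
  by (simp add: calderon_space_def)

abbreviation ev :: "complex \<Rightarrow> (complex \<Rightarrow> 'a) mat \<Rightarrow> 'a mat" where
  "ev z F \<equiv> map_mat (\<lambda>f. f z) F"

lemma calderon_mnorm:
  "mnorm CX F = max (SUP t. mnorm X0 (ev (Complex 0 t) F)) (SUP t. mnorm X1 (ev (Complex 1 t) F))"
  by (simp add: calderon_space_def)

lemma matsC_iff: "F \<in> mats CX n \<longleftrightarrow> F \<in> carrier_mat n n \<and> (\<forall>i<n. \<forall>j<n. strip_fun (F $$ (i, j)))"
  by (simp add: mats_iff calderon_car)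

lemma ev_mats:
  assumes "F \<in> mats CX n"
  shows "ev z F \<in> mats N n" "ev z F \<in> mats X0 n" "ev z F \<in> mats X1 n"
  using assms unfolding matsC_iff by (auto simp: mats_iff strip_fun_carrier)

lemma calderon_bdd:
  assumes F: "F \<in> mats CX n" and n: "n \<ge> 1"
  shows "bdd_above (range (\<lambda>t. mnorm X0 (ev (Complex 0 t) F)))"
    "bdd_above (range (\<lambda>t. mnorm X1 (ev (Complex 1 t) F)))"
proof -
  have "\<exists>B. \<forall>z\<in>strip. nrm N ((F $$ (i, j)) z) \<le> B" if "i < n" "j < n" for i j
    using F strip_fun_bounded[of "F $$ (i, j)"] that by (simp add: matsC_iff)
  then have "\<forall>i j. \<exists>B. i < n \<longrightarrow> j < n \<longrightarrow> (\<forall>z\<in>strip. nrm N ((F $$ (i, j)) z) \<le> B)"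
    by meson
  then obtain B where B: "\<And>i j z. i < n \<Longrightarrow> j < n \<Longrightarrow> z \<in> strip \<Longrightarrow> nrm N ((F $$ (i, j)) z) \<le> B i j" by metis
  have e: "(ev z F) $$ (i, j) = (F $$ (i, j)) z" "(F $$ (i, j)) z \<in> car N" if "i < n" "j < n" for i j z
    using F that by (auto simp: matsC_iff strip_fun_carrier)
  have "mnorm X0 (ev (Complex 0 t) F) \<le> (\<Sum>i<n. \<Sum>j<n. B i j)" for t
    by (rule order_trans[OF X0.mnorm_le_sum[OF n ev_mats(2)[OF F]]]) (auto intro!: sum_mono B simp: e)
  then show "bdd_above (range (\<lambda>t. mnorm X0 (ev (Complex 0 t) F)))" by (rule bdd_aboveI2)
  have "mnorm X1 (ev (Complex 1 t) F) \<le> (\<Sum>i<n. \<Sum>j<n. B i j)" for t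
    by (rule order_trans[OF X1.mnorm_le_sum[OF n ev_mats(3)[OF F]]]) (auto intro!: sum_mono B simp: e)
  then show "bdd_above (range (\<lambda>t. mnorm X1 (ev (Complex 1 t) F)))" by (rule bdd_aboveI2)
qed

lemma calderon_mnorm_ge:
  assumes "F \<in> mats CX n" "n \<ge> 1"
  shows "mnorm X0 (ev (Complex 0 t) F) \<le> mnorm CX F" "mnorm X1 (ev (Complex 1 t) F) \<le> mnorm CX F"
  unfolding calderon_mnorm
  by (rule max.coboundedI1, rule cSUP_upper[OF _ calderon_bdd(1)[OF assms]], simp)
     (rule max.coboundedI2, rule cSUP_upper[OF _ calderon_bdd(2)[OF assms]], simp)

lemma calderon_mnorm_leI:
  assumes "\<And>t. mnorm X0 (ev (Complex 0 t) F) \<le> M" "\<And>t. mnorm X1 (ev (Complex 1 t) F) \<le> M"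
  shows "mnorm CX F \<le> M"
  unfolding calderon_mnorm using assms by (auto intro!: cSUP_least)

text \<open>The matrix norm looks at the boundary only; the maximum principle extends the bound to the strip.\<close>

lemma calderon_entry_le:
  assumes F: "F \<in> mats CX n" and n: "n \<ge> 1" and ij: "i < n" "j < n" and z: "z \<in> strip"
  shows "nrm N ((F $$ (i, j)) z) \<le> mnorm CX F"
proof -
  have f: "strip_fun (F $$ (i, j))" using F ij by (auto simp: matsC_iff)
  have e: "(ev z F) $$ (i, j) = (F $$ (i, j)) z" for z using F ij by (auto simp: matsC_iff)
  show ?thesis
  proof (rule strip_fun_le[OF f z])
    show "nrm N ((F $$ (i, j)) (Complex 0 t)) \<le> mnorm CX F" for t
      using X0.entry_le_mnorm[OF n ev_mats(2)[OF F] ij, of "Complex 0 t"] calderon_mnorm_ge(1)[OF F n, of t]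
      by (simp add: e strip_fun_carrier[OF f])
    show "nrm N ((F $$ (i, j)) (Complex 1 t)) \<le> mnorm CX F" for t
      using X1.entry_le_mnorm[OF n ev_mats(3)[OF F] ij, of "Complex 1 t"] calderon_mnorm_ge(2)[OF F n, of t]
      by (simp add: e strip_fun_carrier[OF f])
  qed
qed

lemma ev_one_by_one: "ev z (mat 1 1 (\<lambda>_. f)) = mat 1 1 (\<lambda>_. f z)"
  by auto

lemma calderon_nrm_le_iff:
  assumes f: "strip_fun f"
  shows "mnorm CX (mat 1 1 (\<lambda>_. f)) \<le> M \<longleftrightarrow> (\<forall>z\<in>strip. nrm N (f z) \<le> M)"
proof
  have F: "mat 1 1 (\<lambda>_. f) \<in> mats CX 1" using f by (auto simp: matsC_iff)
  assume "mnorm CX (mat 1 1 (\<lambda>_. f)) \<le> M"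
  then show "\<forall>z\<in>strip. nrm N (f z) \<le> M"
    using calderon_entry_le[OF F, of 0 0] by fastforce
next
  assume "\<forall>z\<in>strip. nrm N (f z) \<le> M"
  then show "mnorm CX (mat 1 1 (\<lambda>_. f)) \<le> M"
    by (intro calderon_mnorm_leI) (simp_all only: ev_one_by_one nrm0 nrm1 strip_fun_carrier[OF f] boundary_in_strip)
qed

lemma vector_space_fun_scale:
  "vector_space (\<lambda>c (f :: complex \<Rightarrow> 'a) z. scl N c (f z))"
  by unfold_locales (auto simp: fun_eq_iff vs.scale_right_distrib vs.scale_left_distrib)

lemma strip_fun_scale: "strip_fun f \<Longrightarrow> strip_fun (\<lambda>z. scl N c (f z))"
  by (rule strip_fun_mult[of f _ "cmod c"]) auto

lemma strip_fun_zero: "strip_fun 0"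
proof -
  have "strip_const (0 :: 'a) = 0" by (auto simp: strip_const_def fun_eq_iff)
  then show ?thesis using strip_fun_const[OF carrier_zero] by simp
qed

lemma strip_fun_diff:
  assumes "strip_fun f" "strip_fun g"
  shows "strip_fun (f - g)"
proof -
  have "f - g = (\<lambda>z. f z + scl N (-1) (g z))" by (auto simp: fun_eq_iff)
  then show ?thesis using strip_fun_add[OF assms(1) strip_fun_scale[OF assms(2), of "-1"]] by simp
qed

lemma calderon_cvs: "complex_vector_space CX"
proof -
  interpret C: vector_space "\<lambda>c (f :: complex \<Rightarrow> 'a) z. scl N c (f z)" by (rule vector_space_fun_scale)
  have "f + g = (\<lambda>z. f z + g z)" for f g :: "complex \<Rightarrow> 'a" by auto
  then have "C.subspace {f. strip_fun f}"
    unfolding C.subspace_def using strip_fun_zero strip_fun_add strip_fun_scale by auto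
  then show ?thesis
    unfolding complex_vector_space_def calderon_car calderon_scl using vector_space_fun_scale by blast
qed

lemma ev_add: "F \<in> carrier_mat n n \<Longrightarrow> G \<in> carrier_mat n n \<Longrightarrow> ev z (F + G) = ev z F + ev z G"
  by auto

lemma ev_scale: "ev z (map_mat (scl CX c) F) = map_mat (scl N c) (ev z F)"
  by (auto simp: calderon_scl)

lemma ev_scalar_prods: "ev z (scalar_prods CX \<alpha> F \<beta>) = scalar_prods N \<alpha> (ev z F) \<beta>"
  by (auto simp: scalar_prods_def sum_fun_apply calderon_scl)

lemma ev_block:
  assumes "F \<in> carrier_mat n n" "G \<in> carrier_mat m m"
  shows "ev z (four_block_mat F (0\<^sub>m n m) (0\<^sub>m m n) G) = four_block_mat (ev z F) (0\<^sub>m n m) (0\<^sub>m m n) (ev z G)"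
  using assms by (auto simp: four_block_mat_def Let_def)

lemma calderon_matrix_norms: "matrix_norms CX"
  unfolding matrix_norms_def
proof (intro allI impI ballI conjI)
  fix n :: nat and F assume n: "n \<ge> 1" and F: "F \<in> mats CX n"
  note ge = calderon_mnorm_ge[OF F n]
  show nn: "0 \<le> mnorm CX F" using ge(1)[of 0] X0.mnorm_nonneg[OF n ev_mats(2)[OF F]] by (meson order_trans)
  show "(mnorm CX F = 0) = (F = 0\<^sub>m n n)"
  proof
    assume 0: "mnorm CX F = 0"
    show "F = 0\<^sub>m n n"
    proof (rule eq_matI)
      fix i j assume ij: "i < dim_row (0\<^sub>m n n :: (complex \<Rightarrow> 'a) mat)" "j < dim_col (0\<^sub>m n n :: (complex \<Rightarrow> 'a) mat)"
      have f: "strip_fun (F $$ (i, j))" using F ij by (auto simp: matsC_iff)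
      have "(F $$ (i, j)) z = 0" for z
      proof (cases "z \<in> strip")
        case True
        then have "nrm N ((F $$ (i, j)) z) \<le> 0" using calderon_entry_le[OF F n _ _ True, of i j] ij 0 by simp
        then show ?thesis using nrm_nonneg[OF strip_fun_carrier[OF f], of z] nrm_eq_0[OF strip_fun_carrier[OF f], of z] by linarith
      qed (rule strip_fun_outside[OF f])
      then show "F $$ (i, j) = 0\<^sub>m n n $$ (i, j)" using ij by (auto simp: fun_eq_iff)
    qed (use F in \<open>auto simp: matsC_iff\<close>)
  next
    assume 0: "F = 0\<^sub>m n n"
    then have "ev z F = 0\<^sub>m n n" for z by auto
    then have "mnorm CX F \<le> 0"
      using X0.mnorm_eq_0[OF n ev_mats(2)[OF F]] X1.mnorm_eq_0[OF n ev_mats(3)[OF F]] by (intro calderon_mnorm_leI) auto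
    then show "mnorm CX F = 0" using nn by simp
  qed
  have le: "mnorm CX (map_mat (scl CX c) F) \<le> cmod c * mnorm CX F" if "n \<ge> 1" "F \<in> mats CX n" for c F
    using calderon_mnorm_ge[OF that(2,1)] X0.mnorm_scale[OF n ev_mats(2)[OF that(2)], of c] X1.mnorm_scale[OF n ev_mats(3)[OF that(2)], of c]
    by (intro calderon_mnorm_leI) (simp_all add: ev_scale mult_left_mono)
  have cF: "map_mat (scl CX c) F \<in> mats CX n" for c
    using F by (auto simp: matsC_iff calderon_scl strip_fun_scale)
  fix c
  show "mnorm CX (map_mat (scl CX c) F) = cmod c * mnorm CX F"
  proof (cases "c = 0")
    case True
    have "map_mat (scl CX c) F = 0\<^sub>m n n" using F True by (auto simp: calderon_scl matsC_iff fun_eq_iff)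
    then have "ev z (map_mat (scl CX c) F) = 0\<^sub>m n n" for z by auto
    then have "mnorm CX (map_mat (scl CX c) F) = 0"
      using X0.mnorm_eq_0[OF n ev_mats(2)[OF cF[of c]]] X1.mnorm_eq_0[OF n ev_mats(3)[OF cF[of c]]]
      by (simp add: calderon_mnorm)
    then show ?thesis using True by simp
  next
    case False
    have "map_mat (scl CX (inverse c)) (map_mat (scl CX c) F) = F"
      using False by (intro eq_matI) (auto simp: calderon_scl)
    then have "mnorm CX F \<le> cmod (inverse c) * mnorm CX (map_mat (scl CX c) F)"
      using le[OF n cF[of c], of "inverse c"] by simp
    then have "cmod c * mnorm CX F \<le> mnorm CX (map_mat (scl CX c) F)" using False by (simp add: norm_divide field_simps)
    then show ?thesis using le[OF n F, of c] by simp
  qed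
next
  fix n :: nat and F G assume n: "n \<ge> 1" and F: "F \<in> mats CX n" and G: "G \<in> mats CX n"
  have "ev z (F + G) = ev z F + ev z G" for z using F G by (intro ev_add[of _ n]) (auto simp: matsC_iff)
  note ev = this
  show "mnorm CX (F + G) \<le> mnorm CX F + mnorm CX G"
  proof (rule calderon_mnorm_leI; unfold ev)
    show "mnorm X0 (ev (Complex 0 t) F + ev (Complex 0 t) G) \<le> mnorm CX F + mnorm CX G" for t
      by (rule order_trans[OF X0.mnorm_add[OF n ev_mats(2)[OF F] ev_mats(2)[OF G]] add_mono])
        (rule calderon_mnorm_ge[OF F n] calderon_mnorm_ge[OF G n])+
    show "mnorm X1 (ev (Complex 1 t) F + ev (Complex 1 t) G) \<le> mnorm CX F + mnorm CX G" for t
      by (rule order_trans[OF X1.mnorm_add[OF n ev_mats(3)[OF F] ev_mats(3)[OF G]] add_mono])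
        (rule calderon_mnorm_ge[OF F n] calderon_mnorm_ge[OF G n])+
  qed
qed

lemma calderon_ruan: "ruan_axioms CX"
  unfolding ruan_axioms_def
proof (intro conjI allI impI ballI)
  fix n m :: nat and F G assume n: "n \<ge> 1" and m: "m \<ge> 1" and F: "F \<in> mats CX n" and G: "G \<in> mats CX m"
  let ?H = "four_block_mat F (0\<^sub>m n m) (0\<^sub>m m n) G"
  have H: "?H \<in> mats CX (n + m)"
    using F G strip_fun_zero by (auto simp: matsC_iff four_block_mat_def Let_def)
  have ev: "ev z ?H = four_block_mat (ev z F) (0\<^sub>m n m) (0\<^sub>m m n) (ev z G)" for z
    using F G by (intro ev_block) (auto simp: matsC_iff)
  have e0: "mnorm X0 (ev z ?H) = max (mnorm X0 (ev z F)) (mnorm X0 (ev z G))" for z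
    unfolding ev by (rule X0.mnorm_block[OF n m ev_mats(2)[OF F] ev_mats(2)[OF G]])
  have e1: "mnorm X1 (ev z ?H) = max (mnorm X1 (ev z F)) (mnorm X1 (ev z G))" for z
    unfolding ev by (rule X1.mnorm_block[OF n m ev_mats(3)[OF F] ev_mats(3)[OF G]])
  show "mnorm CX ?H = max (mnorm CX F) (mnorm CX G)"
  proof (rule antisym)
    show "mnorm CX ?H \<le> max (mnorm CX F) (mnorm CX G)"
      using calderon_mnorm_ge[OF F n] calderon_mnorm_ge[OF G m]
      by (intro calderon_mnorm_leI) (simp_all only: e0 e1 max.mono)
    have H1: "n + m \<ge> 1" using n by simp
    have "mnorm CX F \<le> mnorm CX ?H" "mnorm CX G \<le> mnorm CX ?H"
      using calderon_mnorm_ge[OF H H1] by (auto intro!: calderon_mnorm_leI simp: e0 e1)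
    then show "max (mnorm CX F) (mnorm CX G) \<le> mnorm CX ?H" by simp
  qed
next
  fix n m :: nat and F and \<alpha> \<beta> :: "complex mat" assume n: "n \<ge> 1" and m: "m \<ge> 1" and F: "F \<in> mats CX m"
    and ab: "\<alpha> \<in> carrier_mat n m" "\<beta> \<in> carrier_mat m n"
  have "scalar_mat_norm \<alpha> * u * scalar_mat_norm \<beta> \<le> scalar_mat_norm \<alpha> * mnorm CX F * scalar_mat_norm \<beta>"
    if "u \<le> mnorm CX F" for u
    using that by (intro mult_right_mono mult_left_mono) auto
  then show "mnorm CX (scalar_prods CX \<alpha> F \<beta>) \<le> scalar_mat_norm \<alpha> * mnorm CX F * scalar_mat_norm \<beta>"
    using X0.mnorm_scalar_prods[OF n m ev_mats(2)[OF F] ab] X1.mnorm_scalar_prods[OF n m ev_mats(3)[OF F] ab]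
      calderon_mnorm_ge[OF F m] scalar_prods_scl_cong[of X0 N, OF scl0] scalar_prods_scl_cong[of X1 N, OF scl1]
    by (intro calderon_mnorm_leI) (simp_all only: ev_scalar_prods, (meson order_trans)+)
qed

text \<open>On \<open>M\<^sub>1\<close> the norm is the supremum norm over the strip (\<open>calderon_nrm_le_iff\<close>), so that Cauchy sequences
  converge uniformly.\<close>

lemma calderon_complete: "complete_norm (normed_space_of CX)"
  unfolding complete_norm_def
proof (intro allI impI, elim conjE)
  fix f :: "nat \<Rightarrow> complex \<Rightarrow> 'a" assume fc: "\<forall>k. f k \<in> car (normed_space_of CX)"
    and cauchy: "\<forall>e>0. \<exists>K. \<forall>k\<ge>K. \<forall>l\<ge>K. nrm (normed_space_of CX) (f k - f l) < e"
  have f: "strip_fun (f k)" for k using fc by (simp add: normed_space_of_def calderon_car)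
  have cauchy': "\<exists>K. \<forall>k\<ge>K. \<forall>l\<ge>K. mnorm CX (mat 1 1 (\<lambda>_. f k - f l)) < e" if "e > 0" for e
    using cauchy that by (simp add: normed_space_of_def)
  note c = strip_fun_carrier[OF f]
  have unif: "\<exists>K. \<forall>k\<ge>K. \<forall>l\<ge>K. \<forall>z\<in>strip. nrm N (f k z - f l z) \<le> e" if e: "e > 0" for e
  proof -
    obtain K where "\<forall>k\<ge>K. \<forall>l\<ge>K. mnorm CX (mat 1 1 (\<lambda>_. f k - f l)) < e"
      using cauchy'[OF e] by (rule exE)
    then have K: "mnorm CX (mat 1 1 (\<lambda>_. f k - f l)) < e" if "k \<ge> K" "l \<ge> K" for k l using that by simp
    have "nrm N (f k z - f l z) \<le> e" if "k \<ge> K" "l \<ge> K" "z \<in> strip" for k l z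
      using calderon_nrm_le_iff[OF strip_fun_diff[OF f f], of k l e] K[OF that(1,2)] that(3) by simp
    then show ?thesis by blast
  qed
  have "\<exists>x\<in>car N. (\<lambda>k. nrm N (f k z - x)) \<longlonglongrightarrow> 0" if z: "z \<in> strip" for z
  proof (rule completeD[of "\<lambda>k. f k z"])
    fix e :: real assume "e > 0"
    then obtain K where "\<forall>k\<ge>K. \<forall>l\<ge>K. \<forall>z\<in>strip. nrm N (f k z - f l z) \<le> e / 2" using unif[of "e / 2"] by auto
    then have "\<forall>k\<ge>K. \<forall>l\<ge>K. nrm N (f k z - f l z) < e" using z \<open>e > 0\<close> by fastforce
    then show "\<exists>K. \<forall>k\<ge>K. \<forall>l\<ge>K. nrm N (f k z - f l z) < e" by blast
  qed (use c in auto)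
  then obtain g0 where g0: "\<And>z. z \<in> strip \<Longrightarrow> g0 z \<in> car N" "\<And>z. z \<in> strip \<Longrightarrow> (\<lambda>k. nrm N (f k z - g0 z)) \<longlonglongrightarrow> 0"
    by metis
  define g where "g z = (if z \<in> strip then g0 z else 0)" for z
  have g: "g z \<in> car N" for z using g0 carrier_zero by (auto simp: g_def)
  have lim: "\<exists>K. \<forall>k\<ge>K. \<forall>z\<in>strip. nrm N (f k z - g z) \<le> e" if e: "e > 0" for e
  proof -
    obtain K where K: "\<And>k l z. k \<ge> K \<Longrightarrow> l \<ge> K \<Longrightarrow> z \<in> strip \<Longrightarrow> nrm N (f k z - f l z) \<le> e" using unif[OF e] by blast
    have "nrm N (f k z - g z) \<le> e" if k: "k \<ge> K" and z: "z \<in> strip" for k z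
    proof -
      have "(\<lambda>l. e + nrm N (f l z - g z)) \<longlonglongrightarrow> e + 0"
        using g0(2)[OF z] z by (intro tendsto_add tendsto_const) (simp add: g_def)
      moreover have "eventually (\<lambda>l. nrm N (f k z - g z) \<le> e + nrm N (f l z - g z)) sequentially"
        using nrm_triangle[OF c c g] K[OF k _ z] unfolding eventually_sequentially by (intro exI[of _ K]) (metis add_right_mono order_trans)
      ultimately have "nrm N (f k z - g z) \<le> e + 0" by (intro tendsto_lowerbound[of _ _ sequentially]) auto
      then show ?thesis by simp
    qed
    then show ?thesis by blast
  qed
  have sg: "strip_fun g" by (rule strip_fun_uniform_limit[OF f g _ lim]) (simp_all add: g_def)
  have "(\<lambda>k. mnorm CX (mat 1 1 (\<lambda>_. f k - g))) \<longlonglongrightarrow> 0"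
  proof (rule LIMSEQ_I)
    fix e :: real assume "e > 0"
    then obtain K where K: "\<And>k z. k \<ge> K \<Longrightarrow> z \<in> strip \<Longrightarrow> nrm N (f k z - g z) \<le> e / 2" using lim[of "e / 2"] by auto
    have "mnorm CX (mat 1 1 (\<lambda>_. f k - g)) \<le> e / 2" if "k \<ge> K" for k
      using calderon_nrm_le_iff[OF strip_fun_diff[OF f sg], of k "e / 2"] K[OF that] by (simp del: le_divide_eq_numeral1)
    moreover have "0 \<le> mnorm CX (mat 1 1 (\<lambda>_. f k - g))" for k
      using calderon_matrix_norms strip_fun_diff[OF f sg] unfolding matrix_norms_def
      by (auto simp: matsC_iff elim!: allE[of _ 1])
    ultimately show "\<exists>no. \<forall>k\<ge>no. norm (mnorm CX (mat 1 1 (\<lambda>_. f k - g)) - 0) < e"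
      using \<open>e > 0\<close> by (intro exI[of _ K]) fastforce
  qed
  then show "\<exists>x\<in>car (normed_space_of CX). (\<lambda>k. nrm (normed_space_of CX) (f k - x)) \<longlonglongrightarrow> 0"
    using sg by (intro bexI[of _ g]) (auto simp: normed_space_of_def calderon_car)
qed

theorem calderon_operator_space: "operator_space CX"
  unfolding operator_space_def
  using calderon_cvs calderon_matrix_norms calderon_ruan calderon_complete by blast

end

section \<open>Quotients of operator spaces\<close>

lemma (in opspace) scalar_prods_mats:
  assumes "x \<in> mats X m" "\<alpha> \<in> carrier_mat n m" "\<beta> \<in> carrier_mat m n"
  shows "scalar_prods X \<alpha> x \<beta> \<in> mats X n"
  using assms by (auto simp: mats_iff scalar_prods_def intro!: carrier_sum carrier_scale)

lemma (in opspace) mats_add: "x \<in> mats X n \<Longrightarrow> y \<in> mats X n \<Longrightarrow> x + y \<in> mats X n"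
  by (auto simp: mats_iff carrier_add)

lemma (in opspace) mats_scale: "x \<in> mats X n \<Longrightarrow> map_mat (scl X c) x \<in> mats X n"
  by (auto simp: mats_iff carrier_scale)

lemma (in opspace) mats_block:
  "x \<in> mats X n \<Longrightarrow> y \<in> mats X m \<Longrightarrow> four_block_mat x (0\<^sub>m n m) (0\<^sub>m m n) y \<in> mats X (n + m)"
  by (auto simp: mats_iff four_block_mat_def Let_def carrier_zero)

text \<open>The quotient by \<open>ker T\<close> is represented on the range of \<open>T\<close>. The last assumption says that the kernel is
  closed, i.e. that the quotient norms are definite.\<close>

locale quotient = opspace X for X :: "'a::ab_group_add opspace" +
  fixes T :: "'a \<Rightarrow> 'b::ab_group_add" and s :: "complex \<Rightarrow> 'b \<Rightarrow> 'b"
  assumes vector_space_s: "vector_space s"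
    and T_add: "x \<in> car X \<Longrightarrow> y \<in> car X \<Longrightarrow> T (x + y) = T x + T y"
    and T_scale: "x \<in> car X \<Longrightarrow> T (scl X c x) = s c (T x)"
    and ker_closed: "(\<And>k. w k \<in> car X) \<Longrightarrow> (\<And>k. T (w k) = 0) \<Longrightarrow> x \<in> car X \<Longrightarrow>
      (\<lambda>k. mnorm X (mat 1 1 (\<lambda>_. w k - x))) \<longlonglongrightarrow> 0 \<Longrightarrow> T x = 0"
begin

abbreviation "Q \<equiv> quotient_by_ker X T s"

sublocale s: vector_space s by (rule vector_space_s)

lemma Q_simps [simp]: "car Q = T ` car X" "scl Q = s"
  by (simp_all add: quotient_by_ker_def)

lemma T_zero: "T 0 = 0"
  using T_scale[OF carrier_zero, of 0] by simp

lemma T_diff: "x \<in> car X \<Longrightarrow> y \<in> car X \<Longrightarrow> T (x - y) = T x - T y"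
  using T_add[of "x - y" y] by (simp add: carrier_diff)

lemma T_sum: "(\<And>i. i \<in> I \<Longrightarrow> x i \<in> car X) \<Longrightarrow> T (\<Sum>i\<in>I. x i) = (\<Sum>i\<in>I. T (x i))"
proof (induction I rule: infinite_finite_induct)
  case (insert i I)
  then show ?case by (simp add: T_add carrier_sum)
qed (auto simp: T_zero)

lemma Q_mnorm: "z \<in> mats Q n \<Longrightarrow> mnorm Q z = Inf {mnorm X x | x. x \<in> mats X n \<and> map_mat T x = z}"
  by (simp add: quotient_by_ker_def mats_dim)

lemma map_mats: "x \<in> mats X n \<Longrightarrow> map_mat T x \<in> mats Q n"
  by (auto simp: mats_iff)

lemma lift_exists:
  assumes "z \<in> mats Q n"
  obtains x where "x \<in> mats X n" "map_mat T x = z"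
proof -
  have "\<exists>y\<in>car X. T y = z $$ p" if "fst p < n" "snd p < n" for p
    using matsD[OF assms, of "fst p" "snd p"] that by auto
  then obtain f where f: "\<And>p. fst p < n \<Longrightarrow> snd p < n \<Longrightarrow> f p \<in> car X \<and> T (f p) = z $$ p" by metis
  have "mat n n f \<in> mats X n" using f by (intro matsI) auto
  moreover have "map_mat T (mat n n f) = z" using f mats_dim[OF assms] by (intro eq_matI) auto
  ultimately show ?thesis by (rule that)
qed

lemma Q_bdd: "n \<ge> 1 \<Longrightarrow> bdd_below {mnorm X x | x. x \<in> mats X n \<and> map_mat T x = z}"
  using mnorm_nonneg by (auto intro!: bdd_belowI[of _ 0])

lemma Q_mnorm_le: "n \<ge> 1 \<Longrightarrow> x \<in> mats X n \<Longrightarrow> mnorm Q (map_mat T x) \<le> mnorm X x"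
  unfolding Q_mnorm[OF map_mats] by (rule cInf_lower[OF _ Q_bdd]) auto

lemma Q_mnorm_geI:
  assumes z: "z \<in> mats Q n" and "\<And>x. x \<in> mats X n \<Longrightarrow> map_mat T x = z \<Longrightarrow> M \<le> mnorm X x"
  shows "M \<le> mnorm Q z"
  unfolding Q_mnorm[OF z] using lift_exists[OF z] assms(2) by (intro cInf_greatest) auto

lemma Q_lift_less:
  assumes n: "n \<ge> 1" and z: "z \<in> mats Q n" and M: "mnorm Q z < M"
  obtains x where "x \<in> mats X n" "map_mat T x = z" "mnorm X x < M"
proof -
  have "{mnorm X x | x. x \<in> mats X n \<and> map_mat T x = z} \<noteq> {}" using lift_exists[OF z] by blast
  then have "\<exists>u\<in>{mnorm X x | x. x \<in> mats X n \<and> map_mat T x = z}. u < M"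
    using M Q_bdd[OF n, of z] unfolding Q_mnorm[OF z] by (subst (asm) cInf_less_iff) auto
  then show ?thesis using that by blast
qed

lemma Q_mnorm_leI:
  assumes n: "n \<ge> 1" and z: "z \<in> mats Q n"
    and "\<And>e. e > 0 \<Longrightarrow> \<exists>x\<in>mats X n. map_mat T x = z \<and> mnorm X x \<le> M + e"
  shows "mnorm Q z \<le> M"
proof (rule field_le_epsilon)
  fix e :: real assume "e > 0"
  then obtain x where "x \<in> mats X n" "map_mat T x = z" "mnorm X x \<le> M + e" using assms(3) by blast
  then show "mnorm Q z \<le> M + e" using Q_mnorm_le[OF n, of x] by simp
qed

lemma map_T_scalar_prods:
  assumes "x \<in> mats X m" "\<alpha> \<in> carrier_mat n m" "\<beta> \<in> carrier_mat m n"
  shows "map_mat T (scalar_prods X \<alpha> x \<beta>) = scalar_prods Q \<alpha> (map_mat T x) \<beta>"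
proof -
  have "T (\<Sum>k<m. \<Sum>l<m. f k l) = (\<Sum>k<m. \<Sum>l<m. T (f k l))"
    if f: "\<And>k l. k < m \<Longrightarrow> l < m \<Longrightarrow> f k l \<in> car X" for f
  proof -
    have "T (\<Sum>k<m. \<Sum>l<m. f k l) = (\<Sum>k<m. T (\<Sum>l<m. f k l))"
      by (rule T_sum) (auto intro!: carrier_sum f)
    also have "\<dots> = (\<Sum>k<m. \<Sum>l<m. T (f k l))" by (intro sum.cong refl T_sum f) auto
    finally show ?thesis .
  qed
  then show ?thesis using assms
    by (intro eq_matI) (auto simp: scalar_prods_def mats_iff T_scale carrier_scale)
qed

lemma map_T_add: "x \<in> mats X n \<Longrightarrow> y \<in> mats X n \<Longrightarrow> map_mat T (x + y) = map_mat T x + map_mat T y"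
  by (intro eq_matI) (auto simp: mats_iff T_add)

lemma map_T_scale: "x \<in> mats X n \<Longrightarrow> map_mat T (map_mat (scl X c) x) = map_mat (s c) (map_mat T x)"
  by (intro eq_matI) (auto simp: mats_iff T_scale)

lemma map_T_block:
  assumes "x \<in> mats X n" "y \<in> mats X m"
  shows "map_mat T (four_block_mat x (0\<^sub>m n m) (0\<^sub>m m n) y) = four_block_mat (map_mat T x) (0\<^sub>m n m) (0\<^sub>m m n) (map_mat T y)"
  using assms by (intro eq_matI) (auto simp: mats_iff T_zero four_block_mat_def Let_def)

lemma Q_cvs: "complex_vector_space Q"
proof -
  have "s.subspace (T ` car X)"
    unfolding s.subspace_def
  proof (intro conjI ballI allI)
    show "0 \<in> T ` car X" using T_zero carrier_zero by (metis imageI)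
    show "a + b \<in> T ` car X" if "a \<in> T ` car X" "b \<in> T ` car X" for a b
      using that T_add carrier_add by (auto simp: image_iff) metis
    show "s c a \<in> T ` car X" if "a \<in> T ` car X" for c a
      using that T_scale carrier_scale by (auto simp: image_iff) metis
  qed
  then show ?thesis unfolding complex_vector_space_def Q_simps using vector_space_s by blast
qed

lemma Q_mnorm_nonneg: "n \<ge> 1 \<Longrightarrow> z \<in> mats Q n \<Longrightarrow> 0 \<le> mnorm Q z"
  by (rule Q_mnorm_geI) (auto intro: mnorm_nonneg)

lemma Q_mnorm_zero: "n \<ge> 1 \<Longrightarrow> mnorm Q (0\<^sub>m n n) = 0"
proof -
  assume n: "n \<ge> 1"
  have 0: "0\<^sub>m n n \<in> mats X n" by (auto simp: mats_iff carrier_zero)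
  have "map_mat T (0\<^sub>m n n) = 0\<^sub>m n n" by (auto simp: T_zero)
  then show ?thesis using Q_mnorm_le[OF n 0] Q_mnorm_nonneg[OF n map_mats[OF 0]] mnorm_eq_0[OF n 0] by simp
qed

text \<open>Liftings of \<open>z\<close> with norms tending to zero differ from a fixed one by elements of the kernel, which
  converge to that lifting; hence it lies in the kernel.\<close>

lemma Q_mnorm_definite:
  assumes n: "n \<ge> 1" and z: "z \<in> mats Q n" and 0: "mnorm Q z = 0"
  shows "z = 0\<^sub>m n n"
proof -
  have "\<exists>x. x \<in> mats X n \<and> map_mat T x = z \<and> mnorm X x < inverse (real (Suc k))" for k
    using Q_lift_less[OF n z, of "inverse (real (Suc k))"] 0 by auto
  then obtain x where x: "\<And>k. x k \<in> mats X n" "\<And>k. map_mat T (x k) = z" "\<And>k. mnorm X (x k) < inverse (real (Suc k))"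
    by metis
  have "T (x 0 $$ (i, j)) = 0" if ij: "i < n" "j < n" for i j
  proof (rule ker_closed[of "\<lambda>k. x 0 $$ (i, j) - x k $$ (i, j)"])
    have T: "T (x k $$ (i, j)) = z $$ (i, j)" for k
      using arg_cong[OF x(2)[of k], of "\<lambda>m. m $$ (i, j)"] mats_dim[OF x(1)[of k]] ij by simp
    have c: "x k $$ (i, j) \<in> car X" for k by (rule matsD[OF x(1) ij])
    show "x 0 $$ (i, j) \<in> car X" "x 0 $$ (i, j) - x k $$ (i, j) \<in> car X" "T (x 0 $$ (i, j) - x k $$ (i, j)) = 0" for k
      using c T by (simp_all add: carrier_diff T_diff)
    have "mnorm X (mat 1 1 (\<lambda>_. x 0 $$ (i, j) - x k $$ (i, j) - x 0 $$ (i, j))) = mnorm X (mat 1 1 (\<lambda>_. x k $$ (i, j)))" for k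
      using norm.nrm_minus[of "x k $$ (i, j)"] c by simp
    moreover have "(\<lambda>k. mnorm X (mat 1 1 (\<lambda>_. x k $$ (i, j)))) \<longlonglongrightarrow> 0"
    proof (rule Lim_null_comparison[OF _ LIMSEQ_inverse_real_of_nat], intro always_eventually allI)
      fix k
      show "norm (mnorm X (mat 1 1 (\<lambda>_. x k $$ (i, j)))) \<le> inverse (real (Suc k))"
        using entry_le_mnorm[OF n x(1) ij, of k] x(3)[of k] norm.nrm_nonneg[of "x k $$ (i, j)"] c by simp
    qed
    ultimately show "(\<lambda>k. mnorm X (mat 1 1 (\<lambda>_. x 0 $$ (i, j) - x k $$ (i, j) - x 0 $$ (i, j)))) \<longlonglongrightarrow> 0" by simp
  qed
  then show ?thesis using x(2)[of 0] mats_dim[OF x(1)[of 0]] by (intro eq_matI) auto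
qed

lemma Q_mnorm_add:
  assumes n: "n \<ge> 1" and z: "z \<in> mats Q n" and w: "w \<in> mats Q n"
  shows "mnorm Q (z + w) \<le> mnorm Q z + mnorm Q w"
proof -
  obtain x0 y0 where "x0 \<in> mats X n" "map_mat T x0 = z" "y0 \<in> mats X n" "map_mat T y0 = w"
    using lift_exists[OF z] lift_exists[OF w] by metis
  then have zw: "z + w \<in> mats Q n" using map_mats[OF mats_add[of x0 n y0]] map_T_add[of x0 n y0] by simp
  show ?thesis
  proof (rule Q_mnorm_leI[OF n zw])
    fix e :: real assume "e > 0"
    obtain x where x: "x \<in> mats X n" "map_mat T x = z" "mnorm X x < mnorm Q z + e / 2"
      using Q_lift_less[OF n z, of "mnorm Q z + e / 2"] \<open>e > 0\<close> by auto
    obtain y where y: "y \<in> mats X n" "map_mat T y = w" "mnorm X y < mnorm Q w + e / 2"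
      using Q_lift_less[OF n w, of "mnorm Q w + e / 2"] \<open>e > 0\<close> by auto
    show "\<exists>x\<in>mats X n. map_mat T x = z + w \<and> mnorm X x \<le> mnorm Q z + mnorm Q w + e"
      using x y mnorm_add[OF n x(1) y(1)] by (intro bexI[of _ "x + y"]) (auto simp: map_T_add[OF x(1) y(1)] mats_add)
  qed
qed

lemma Q_mnorm_scale_le:
  assumes n: "n \<ge> 1" and z: "z \<in> mats Q n"
  shows "mnorm Q (map_mat (s c) z) \<le> cmod c * mnorm Q z"
proof (cases "c = 0")
  case True
  have "map_mat (s c) z = 0\<^sub>m n n" using z True by (auto simp: mats_iff)
  then show ?thesis using True Q_mnorm_zero[OF n] by simp
next
  case False
  obtain x0 where "x0 \<in> mats X n" "map_mat T x0 = z" using lift_exists[OF z] by blast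
  then have cz: "map_mat (s c) z \<in> mats Q n" using map_mats[OF mats_scale[of x0 n c]] map_T_scale[of x0 n c] by simp
  show ?thesis
  proof (rule Q_mnorm_leI[OF n cz])
    fix e :: real assume "e > 0"
    then have "e / cmod c > 0" using False by simp
    then obtain x where x: "x \<in> mats X n" "map_mat T x = z" "mnorm X x < mnorm Q z + e / cmod c"
      using Q_lift_less[OF n z, of "mnorm Q z + e / cmod c"] by auto
    have "mnorm X (map_mat (scl X c) x) \<le> cmod c * (mnorm Q z + e / cmod c)"
      unfolding mnorm_scale[OF n x(1)] using x(3) by (intro mult_left_mono) auto
    also have "\<dots> = cmod c * mnorm Q z + e" using False by (simp add: field_simps)
    finally show "\<exists>x\<in>mats X n. map_mat T x = map_mat (s c) z \<and> mnorm X x \<le> cmod c * mnorm Q z + e"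
      using x(1,2) by (intro bexI[of _ "map_mat (scl X c) x"]) (auto simp: map_T_scale[OF x(1)] mats_scale)
  qed
qed

lemma Q_matrix_norms: "matrix_norms Q"
  unfolding matrix_norms_def
proof (intro allI impI ballI conjI)
  fix n :: nat and z assume n: "n \<ge> 1" and z: "z \<in> mats Q n"
  show "0 \<le> mnorm Q z" by (rule Q_mnorm_nonneg[OF n z])
  show "(mnorm Q z = 0) = (z = 0\<^sub>m n n)" using Q_mnorm_definite[OF n z] Q_mnorm_zero[OF n] by auto
  fix c
  show "mnorm Q (map_mat (scl Q c) z) = cmod c * mnorm Q z"
  proof (cases "c = 0")
    case True
    then show ?thesis using Q_mnorm_scale_le[OF n z, of c] Q_mnorm_zero[OF n] z
      by (auto simp: mats_iff intro!: arg_cong[of _ "0\<^sub>m n n" "mnorm Q", THEN trans])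
  next
    case False
    obtain x0 where "x0 \<in> mats X n" "map_mat T x0 = z" using lift_exists[OF z] by blast
    then have cz: "map_mat (s c) z \<in> mats Q n" using map_mats[OF mats_scale[of x0 n c]] map_T_scale[of x0 n c] by simp
    have "map_mat (s (inverse c)) (map_mat (s c) z) = z" using False by (intro eq_matI) auto
    then have "mnorm Q z \<le> cmod (inverse c) * mnorm Q (map_mat (s c) z)"
      using Q_mnorm_scale_le[OF n cz, of "inverse c"] by simp
    then have "cmod c * mnorm Q z \<le> mnorm Q (map_mat (s c) z)" using False by (simp add: norm_divide field_simps)
    then show ?thesis using Q_mnorm_scale_le[OF n z, of c] by simp
  qed
next
  fix n :: nat and z w assume "n \<ge> 1" "z \<in> mats Q n" "w \<in> mats Q n"
  then show "mnorm Q (z + w) \<le> mnorm Q z + mnorm Q w" by (rule Q_mnorm_add)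
qed

lemma Q_scalar_prods:
  assumes n: "n \<ge> 1" and m: "m \<ge> 1" and z: "z \<in> mats Q m"
    and \<alpha>: "\<alpha> \<in> carrier_mat n m" and \<beta>: "\<beta> \<in> carrier_mat m n"
  shows "mnorm Q (scalar_prods Q \<alpha> z \<beta>) \<le> scalar_mat_norm \<alpha> * mnorm Q z * scalar_mat_norm \<beta>"
proof -
  let ?C = "scalar_mat_norm \<alpha> * scalar_mat_norm \<beta>"
  have C: "?C \<ge> 0" by simp
  obtain x0 where x0: "x0 \<in> mats X m" "map_mat T x0 = z" using lift_exists[OF z] by blast
  have az: "scalar_prods Q \<alpha> z \<beta> \<in> mats Q n"
    using map_mats[OF scalar_prods_mats[OF x0(1) \<alpha> \<beta>]] map_T_scalar_prods[OF x0(1) \<alpha> \<beta>] x0(2) by simp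
  have "mnorm Q (scalar_prods Q \<alpha> z \<beta>) \<le> ?C * mnorm Q z"
  proof (rule Q_mnorm_leI[OF n az])
    fix e :: real assume e: "e > 0"
    then have "e / (?C + 1) > 0" using C by (intro divide_pos_pos) linarith+
    then obtain x where x: "x \<in> mats X m" "map_mat T x = z" "mnorm X x < mnorm Q z + e / (?C + 1)"
      using Q_lift_less[OF m z, of "mnorm Q z + e / (?C + 1)"] by auto
    have "mnorm X (scalar_prods X \<alpha> x \<beta>) \<le> ?C * mnorm X x"
      using mnorm_scalar_prods[OF n m x(1) \<alpha> \<beta>] by (simp add: ac_simps)
    also have "\<dots> \<le> ?C * (mnorm Q z + e / (?C + 1))" using x(3) C by (intro mult_left_mono) auto
    also have "\<dots> \<le> ?C * mnorm Q z + e"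
    proof -
      have "?C / (?C + 1) \<le> 1" using C by (subst divide_le_eq_1_pos) linarith+
      then have "e * (?C / (?C + 1)) \<le> e * 1" using e by (intro mult_left_mono) auto
      then show ?thesis by (simp add: distrib_left mult.commute)
    qed
    finally show "\<exists>y\<in>mats X n. map_mat T y = scalar_prods Q \<alpha> z \<beta> \<and> mnorm X y \<le> ?C * mnorm Q z + e"
      using x(2) by (intro bexI[of _ "scalar_prods X \<alpha> x \<beta>"]) (auto simp: map_T_scalar_prods[OF x(1) \<alpha> \<beta>] scalar_prods_mats[OF x(1) \<alpha> \<beta>])
  qed
  then show ?thesis by (simp add: ac_simps)
qed

text \<open>For the lower bound, any lifting of the block matrix contains liftings of the blocks as submatrices.\<close>

lemma Q_block:
  assumes n: "n \<ge> 1" and m: "m \<ge> 1" and z: "z \<in> mats Q n" and w: "w \<in> mats Q m"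
  shows "mnorm Q (four_block_mat z (0\<^sub>m n m) (0\<^sub>m m n) w) = max (mnorm Q z) (mnorm Q w)"
proof -
  let ?B = "four_block_mat z (0\<^sub>m n m) (0\<^sub>m m n) w"
  obtain x0 y0 where xy0: "x0 \<in> mats X n" "map_mat T x0 = z" "y0 \<in> mats X m" "map_mat T y0 = w"
    using lift_exists[OF z] lift_exists[OF w] by metis
  have B: "?B \<in> mats Q (n + m)"
    using map_mats[OF mats_block[OF xy0(1,3)]] map_T_block[OF xy0(1,3)] xy0 by simp
  have nm: "n + m \<ge> 1" using n by simp
  show ?thesis
  proof (rule antisym)
    show "mnorm Q ?B \<le> max (mnorm Q z) (mnorm Q w)"
    proof (rule Q_mnorm_leI[OF nm B])
      fix e :: real assume e: "e > 0"
      obtain x where x: "x \<in> mats X n" "map_mat T x = z" "mnorm X x < mnorm Q z + e"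
        using Q_lift_less[OF n z, of "mnorm Q z + e"] e by auto
      obtain y where y: "y \<in> mats X m" "map_mat T y = w" "mnorm X y < mnorm Q w + e"
        using Q_lift_less[OF m w, of "mnorm Q w + e"] e by auto
      show "\<exists>x\<in>mats X (n + m). map_mat T x = ?B \<and> mnorm X x \<le> max (mnorm Q z) (mnorm Q w) + e"
        using x y by (intro bexI[OF _ mats_block[OF x(1) y(1)]])
          (auto simp: map_T_block[OF x(1) y(1)] mnorm_block[OF n m x(1) y(1)])
    qed
    have "mnorm Q z \<le> mnorm Q ?B"
    proof (rule Q_mnorm_geI[OF B])
      fix u assume u: "u \<in> mats X (n + m)" "map_mat T u = ?B"
      let ?v = "mat n n (\<lambda>(i, j). u $$ (i, j))"
      have v: "?v \<in> mats X n" using u(1) by (intro matsI) (auto intro: matsD)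
      have T: "T (u $$ (i, j)) = ?B $$ (i, j)" if "i < n + m" "j < n + m" for i j
        using arg_cong[OF u(2), of "\<lambda>M. M $$ (i, j)"] mats_dim[OF u(1)] that by simp
      have "map_mat T ?v = z"
        using T mats_dim[OF z] by (intro eq_matI) (auto simp: four_block_mat_def Let_def)
      then have "mnorm Q z \<le> mnorm X ?v" using Q_mnorm_le[OF n v] by simp
      also have "\<dots> \<le> mnorm X u" using mnorm_select[OF nm n u(1), of "\<lambda>i. i" "\<lambda>i. i"] by simp
      finally show "mnorm Q z \<le> mnorm X u" .
    qed
    moreover have "mnorm Q w \<le> mnorm Q ?B"
    proof (rule Q_mnorm_geI[OF B])
      fix u assume u: "u \<in> mats X (n + m)" "map_mat T u = ?B"
      let ?v = "mat m m (\<lambda>(i, j). u $$ (n + i, n + j))"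
      have v: "?v \<in> mats X m" using u(1) by (intro matsI) (auto intro: matsD)
      have T: "T (u $$ (i, j)) = ?B $$ (i, j)" if "i < n + m" "j < n + m" for i j
        using arg_cong[OF u(2), of "\<lambda>M. M $$ (i, j)"] mats_dim[OF u(1)] that by simp
      have "map_mat T ?v = w"
        using T mats_dim[OF z] mats_dim[OF w] by (intro eq_matI) (auto simp: four_block_mat_def Let_def)
      then have "mnorm Q w \<le> mnorm X ?v" using Q_mnorm_le[OF m v] by simp
      also have "\<dots> \<le> mnorm X u" using mnorm_select[OF nm m u(1), of "\<lambda>i. n + i" "\<lambda>i. n + i"] by simp
      finally show "mnorm Q w \<le> mnorm X u" .
    qed
    ultimately show "max (mnorm Q z) (mnorm Q w) \<le> mnorm Q ?B" by simp
  qed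
qed

lemma Q_ruan: "ruan_axioms Q"
  unfolding ruan_axioms_def using Q_block Q_scalar_prods by blast

lemma Q_one_lift:
  assumes a: "a \<in> car Q" and M: "mnorm Q (mat 1 1 (\<lambda>_. a)) < M"
  obtains x where "x \<in> car X" "T x = a" "mnorm X (mat 1 1 (\<lambda>_. x)) < M"
proof -
  have "mat 1 1 (\<lambda>_. a) \<in> mats Q 1" using a by (intro matsI) auto
  then obtain y where y: "y \<in> mats X 1" "map_mat T y = mat 1 1 (\<lambda>_. a)" "mnorm X y < M"
    using Q_lift_less[OF _ _ M] by blast
  have "mat 1 1 (\<lambda>_. y $$ (0, 0)) = y" using mats_dim[OF y(1)] by (intro eq_matI) auto
  moreover have "T (y $$ (0, 0)) = a"
    using arg_cong[OF y(2), of "\<lambda>m. m $$ (0, 0)"] mats_dim[OF y(1)] by simp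
  ultimately show ?thesis using y matsD[OF y(1), of 0 0] by (intro that[of "y $$ (0, 0)"]) auto
qed

lemma Q_one_le: "x \<in> car X \<Longrightarrow> mnorm Q (mat 1 1 (\<lambda>_. T x)) \<le> mnorm X (mat 1 1 (\<lambda>_. x))"
proof -
  assume "x \<in> car X"
  then have x: "mat 1 1 (\<lambda>_. x) \<in> mats X 1" by (rule one_by_one_mats)
  have "map_mat T (mat 1 1 (\<lambda>_. x)) = mat 1 1 (\<lambda>_. T x)" by auto
  then show ?thesis using Q_mnorm_le[OF _ x] by simp
qed

text \<open>A Cauchy sequence in the quotient has a subsequence with summable steps, which lift to a
  Cauchy sequence of partial sums.\<close>

lemma Q_complete: "complete_norm (normed_space_of Q)"
  unfolding complete_norm_def
proof (intro allI impI, elim conjE)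
  fix z :: "nat \<Rightarrow> 'b" assume zc: "\<forall>k. z k \<in> car (normed_space_of Q)"
    and cauchy0: "\<forall>e>0. \<exists>K. \<forall>k\<ge>K. \<forall>l\<ge>K. nrm (normed_space_of Q) (z k - z l) < e"
  let ?q = "\<lambda>a. mnorm Q (mat 1 1 (\<lambda>_. a))" and ?x = "\<lambda>a. mnorm X (mat 1 1 (\<lambda>_. a))"
  interpret sq: cvs_locale "car Q" "scl Q"
    using Q_cvs by (simp add: cvs_locale_def complex_vector_space_def)
  have z: "z k \<in> car Q" for k using zc by (simp add: normed_space_of_def)
  have cauchy: "\<exists>K. \<forall>k\<ge>K. \<forall>l\<ge>K. ?q (z k - z l) < e" if "e > 0" for e
    using cauchy0 that by (simp add: normed_space_of_def)
  have tri: "?q (a + b) \<le> ?q a + ?q b" if "a \<in> car Q" "b \<in> car Q" for a b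
  proof -
    have "mat 1 1 (\<lambda>_. a) + mat 1 1 (\<lambda>_. b) = mat 1 1 (\<lambda>_. a + b)" by auto
    then show ?thesis using Q_mnorm_add[of 1 "mat 1 1 (\<lambda>_. a)" "mat 1 1 (\<lambda>_. b)"] that by (auto simp: mats_iff)
  qed
  have "\<forall>j. \<exists>K. \<forall>k\<ge>K. \<forall>l\<ge>K. ?q (z k - z l) < (1/2)^j" using cauchy by simp
  then obtain K where K: "\<And>j k l. k \<ge> K j \<Longrightarrow> l \<ge> K j \<Longrightarrow> ?q (z k - z l) < (1/2)^j" by metis
  \<comment> \<open>Partial sums make the indices increasing while \<open>K j \<le> n j\<close> remains true.\<close>
  define n where "n j = (\<Sum>i\<le>j. K i)" for j
  have nK1: "K j \<le> n j" for j unfolding n_def by (rule member_le_sum) auto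
  have nK: "K j \<le> n j" "K j \<le> n (Suc j)" for j using nK1[of j] by (auto simp: n_def)
  have "\<exists>x. x \<in> car X \<and> T x = z (n (Suc j)) - z (n j) \<and> ?x x < (1/2)^j" for j
    by (rule Q_one_lift[OF sq.carrier_diff[OF z z, of "n (Suc j)" "n j"] K[OF nK(2,1)[of j]]]) blast
  then obtain w where w: "\<And>j. w j \<in> car X" "\<And>j. T (w j) = z (n (Suc j)) - z (n j)" "\<And>j. ?x (w j) < (1/2)^j"
    by metis
  define S where "S j = (\<Sum>i<j. w i)" for j
  have S: "S j \<in> car X" for j unfolding S_def by (intro carrier_sum w)
  have TS: "T (S j) = z (n j) - z (n 0)" for j
  proof -
    have "T (S j) = (\<Sum>i<j. z (n (Suc i)) - z (n i))"
      unfolding S_def by (subst T_sum) (auto simp: w)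
    also have "\<dots> = z (n j) - z (n 0)" by (induction j) auto
    finally show ?thesis .
  qed
  have step: "?x (S k - S j) \<le> 2 * (1/2)^j" if "j \<le> k" for j k
  proof -
    have "S k - S j = (\<Sum>i\<in>{j..<k}. w i)"
      unfolding S_def using that by (simp add: sum_diff_nat_ivl lessThan_atLeast0)
    then have "?x (S k - S j) \<le> (\<Sum>i\<in>{j..<k}. ?x (w i))"
      using norm.nrm_sum[of "{j..<k}" w] w(1) by simp
    also have "\<dots> \<le> (\<Sum>i\<in>{j..<k}. (1/2)^i)" using w(3) by (intro sum_mono less_imp_le)
    also have "\<dots> = 2 * (1/2)^j - 2 * (1/2)^k"
      using that by (induction k rule: dec_induct) auto
    also have "\<dots> \<le> 2 * (1/2)^j" by simp
    finally show ?thesis .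
  qed
  have lim2: "(\<lambda>j. 2 * (1/2::real)^j) \<longlonglongrightarrow> 0" by real_asymp
  obtain y where y: "y \<in> car X" "(\<lambda>j. ?x (S j - y)) \<longlonglongrightarrow> 0"
  proof (rule norm.completeD[of S, unfolded NX_simps])
    fix e :: real assume "e > 0"
    then have "eventually (\<lambda>j. 2 * (1/2::real)^j < e) sequentially" using lim2 by (intro order_tendstoD)
    then obtain J where J: "\<And>j. j \<ge> J \<Longrightarrow> 2 * (1/2::real)^j < e" by (auto simp: eventually_sequentially)
    have "?x (S k - S l) < e" if "k \<ge> J" "l \<ge> J" for k l
      using step[of l k] step[of k l] J[OF that(1)] J[OF that(2)] norm.nrm_diff_commute[of "S k" "S l"] S
      by (cases "l \<le> k") auto
    then show "\<exists>K. \<forall>k\<ge>K. \<forall>l\<ge>K. ?x (S k - S l) < e" by blast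
  qed (use S in auto)
  define a where "a = z (n 0) + T y"
  have a: "a \<in> car Q" unfolding a_def using z y(1) by (intro sq.carrier_add) auto
  have sub: "?q (z (n j) - a) \<le> ?x (S j - y)" for j
  proof -
    have "z (n j) - a = T (S j - y)" by (simp add: T_diff S y(1) TS a_def)
    then show ?thesis using Q_one_le[OF carrier_diff[OF S y(1)]] by simp
  qed
  have nn: "0 \<le> ?q b" if "b \<in> car Q" for b using that by (intro Q_mnorm_nonneg) (auto simp: mats_iff)
  have "(\<lambda>k. ?q (z k - a)) \<longlonglongrightarrow> 0"
  proof (rule LIMSEQ_I)
    fix e :: real assume e: "e > 0"

    have "eventually (\<lambda>j. ?x (S j - y) < e / 2) sequentially" using y(2) e by (intro order_tendstoD) auto
    then have "eventually (\<lambda>j. ?x (S j - y) < e / 2 \<and> (1/2::real)^j < e/2) sequentially"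
    proof (rule eventually_conj)
      have "(\<lambda>j. (1/2::real)^j) \<longlonglongrightarrow> 0" by real_asymp
      then show "eventually (\<lambda>j. (1/2::real)^j < e/2) sequentially" using e by (intro order_tendstoD) auto
    qed
    then obtain j where j: "?x (S j - y) < e / 2" "(1/2::real)^j < e/2"
      using eventually_happens'[OF sequentially_bot] by blast
    have "?q (z k - a) < e" if k: "k \<ge> K j" for k
    proof -
      have "?q (z k - a) \<le> ?q (z k - z (n j)) + ?q (z (n j) - a)"
        using tri[OF sq.carrier_diff[OF z z] sq.carrier_diff[OF z a], of k "n j" "n j"] by simp
      then show ?thesis using K[OF k nK(1)] sub[of j] j by linarith
    qed
    then show "\<exists>no. \<forall>k\<ge>no. norm (?q (z k - a) - 0) < e"
      using nn[OF sq.carrier_diff[OF z a]] by (intro exI[of _ "K j"]) auto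
  qed
  then show "\<exists>x\<in>car (normed_space_of Q). (\<lambda>k. nrm (normed_space_of Q) (z k - x)) \<longlonglongrightarrow> 0"
    using a by (intro bexI[of _ a]) (auto simp: normed_space_of_def)
qed

theorem quotient_operator_space: "operator_space Q"
  unfolding operator_space_def using Q_cvs Q_matrix_norms Q_ruan Q_complete by blast

end

section \<open>The extension sequence of an interpolation scale\<close>

lemma completely_boundedI:
  assumes "\<And>x. x \<in> car X \<Longrightarrow> T x \<in> car Y"
    and "\<And>x y. x \<in> car X \<Longrightarrow> y \<in> car X \<Longrightarrow> T (x + y) = T x + T y"
    and "\<And>c x. x \<in> car X \<Longrightarrow> T (scl X c x) = scl Y c (T x)"
    and "\<And>n x. n \<ge> 1 \<Longrightarrow> x \<in> mats X n \<Longrightarrow> mnorm Y (map_mat T x) \<le> C * mnorm X x"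
  shows "completely_bounded X Y T"
  using assms unfolding completely_bounded_def linear_map_def by blast

locale interpolation = couple N X0 X1 for N :: "'a::ab_group_add cns" and X0 X1 +
  fixes \<theta> :: real
  assumes \<theta>0: "0 < \<theta>" and \<theta>1: "\<theta> < 1"
begin

abbreviation "tt \<equiv> complex_of_real \<theta>"

lemma tt_interior: "tt \<in> interior strip"
  using \<theta>0 \<theta>1 by (simp add: interior_strip)

lemma tt_strip [simp]: "tt \<in> strip"
  using tt_interior interior_strip_subset by blast

text \<open>A radius for Cauchy's estimate at \<open>\<theta>\<close>; halving keeps the closed disc inside the open strip.\<close>

definition "rad = min \<theta> (1 - \<theta>) / 2"

lemma rad_pos: "rad > 0"
  using \<theta>0 \<theta>1 by (simp add: rad_def)

lemma rad_cball: "cball tt rad \<subseteq> interior strip"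
proof
  fix z assume "z \<in> cball tt rad"
  then have "\<bar>Re (tt - z)\<bar> \<le> rad" using abs_Re_le_cmod[of "tt - z"] by (simp add: dist_norm)
  then have "\<bar>\<theta> - Re z\<bar> \<le> rad" by simp
  moreover have "rad \<le> \<theta> / 2" "rad \<le> (1 - \<theta>) / 2" by (auto simp: rad_def)
  ultimately have "\<theta> - Re z \<le> \<theta> / 2" "Re z - \<theta> \<le> (1 - \<theta>) / 2" by linarith+
  then have "0 < Re z" "Re z < 1" using \<theta>0 \<theta>1 by (auto simp: field_simps)
  then show "z \<in> interior strip" by (simp add: interior_strip)
qed

sublocale CX: opspace CX
  by unfold_locales (rule calderon_operator_space)

abbreviation "jet \<equiv> \<lambda>f. (f tt, complex_deriv \<Sigma> f tt)"

lemma jet_eq: "strip_fun f \<Longrightarrow> jet f = (f tt, complex_deriv N f tt)"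
  by (simp add: sum_space_complex_deriv strip_fun_carrier)

lemma calderon_bounds:
  assumes f: "strip_fun f"
  shows "nrm N (f tt) \<le> mnorm CX (mat 1 1 (\<lambda>_. f))"
    and "nrm N (complex_deriv N f tt) \<le> mnorm CX (mat 1 1 (\<lambda>_. f)) / rad"
proof -
  have *: "\<forall>z\<in>strip. nrm N (f z) \<le> mnorm CX (mat 1 1 (\<lambda>_. f))"
    using calderon_nrm_le_iff[OF f] by blast
  then show "nrm N (f tt) \<le> mnorm CX (mat 1 1 (\<lambda>_. f))" by simp
  show "nrm N (complex_deriv N f tt) \<le> mnorm CX (mat 1 1 (\<lambda>_. f)) / rad"
    using * by (intro strip_fun_deriv_le[OF f rad_pos rad_cball]) auto
qed

lemma plus_fun_eta: "f + g = (\<lambda>z. f z + g z)" for f g :: "'x \<Rightarrow> 'y::plus"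
  by (simp add: fun_eq_iff)

lemma complex_deriv_scale:
  assumes f: "strip_fun f"
  shows "complex_deriv N (\<lambda>z. scl N c (f z)) tt = scl N c (complex_deriv N f tt)"
  using strip_fun_mult_deriv[OF f strip_fun_scale[OF f] tt_interior, of c 0] by simp

lemma vector_space_pair: "vector_space (\<lambda>c (x, y). (scl N c x, scl N c y))"
  by unfold_locales (auto simp: vs.scale_right_distrib vs.scale_left_distrib)

text \<open>The value and the derivative of a function at \<open>\<theta>\<close> are bounded by its norm, so that the kernels of the two
  quotient maps are closed.\<close>

lemma strip_fun_limit_zero:
  assumes w: "\<And>k. strip_fun (w k)" and f: "strip_fun f"
    and lim: "(\<lambda>k. mnorm CX (mat 1 1 (\<lambda>_. w k - f))) \<longlonglongrightarrow> 0"
  shows "\<forall>k. w k tt = 0 \<Longrightarrow> f tt = 0"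
    and "\<forall>k. complex_deriv N (w k) tt = 0 \<Longrightarrow> complex_deriv N f tt = 0"
proof -
  have d: "strip_fun (w k - f)" for k by (rule strip_fun_diff[OF w f])
  have z: "x = 0" if "x \<in> car N" "\<And>k. nrm N x \<le> C * mnorm CX (mat 1 1 (\<lambda>_. w k - f))" for x C
  proof -
    have "nrm N x \<le> 0"
      using that(2) by (intro tendsto_lowerbound[OF tendsto_mult_right_zero[OF lim, of C]]) auto
    then show ?thesis using nrm_nonneg[OF that(1)] nrm_eq_0[OF that(1)] by simp
  qed
  show "f tt = 0" if 0: "\<forall>k. w k tt = 0"
  proof (rule z[of _ 1])
    show "f tt \<in> car N" by (rule strip_fun_carrier[OF f])
    show "nrm N (f tt) \<le> 1 * mnorm CX (mat 1 1 (\<lambda>_. w k - f))" for k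
      using calderon_bounds(1)[OF d, of k] nrm_minus[OF strip_fun_carrier[OF f]] by (simp add: 0)
  qed
  show "complex_deriv N f tt = 0" if 0: "\<forall>k. complex_deriv N (w k) tt = 0"
  proof (rule z[of _ "1 / rad"])
    show c: "complex_deriv N f tt \<in> car N" by (rule strip_fun_deriv_carrier[OF f tt_interior])
    fix k
    have "w k = (\<lambda>z. (w k - f) z + f z)" by auto
    then have "complex_deriv N (w k) tt = complex_deriv N (w k - f) tt + complex_deriv N f tt"
      using strip_fun_add_deriv[OF d f tt_interior, of k] by simp
    then have "complex_deriv N (w k - f) tt = - complex_deriv N f tt"
      using 0 by (simp add: eq_neg_iff_add_eq_0)
    then show "nrm N (complex_deriv N f tt) \<le> 1 / rad * mnorm CX (mat 1 1 (\<lambda>_. w k - f))"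
      using calderon_bounds(2)[OF d, of k] nrm_minus[OF c] by simp
  qed
qed

sublocale I: quotient CX "\<lambda>f. f tt" "scl N"
proof (intro quotient.intro quotient_axioms.intro CX.opspace_axioms)
  show "vector_space (scl N)" by (rule vector_space_scale)
next
  fix w :: "nat \<Rightarrow> complex \<Rightarrow> 'a" and f
  assume "\<And>k. w k \<in> car CX" "\<And>k. w k tt = 0" "f \<in> car CX"
    "(\<lambda>k. mnorm CX (mat 1 1 (\<lambda>_. w k - f))) \<longlonglongrightarrow> 0"
  then show "f tt = 0" using strip_fun_limit_zero(1)[of w f] by (simp add: calderon_car)
qed (auto simp: calderon_scl)

sublocale D: quotient CX jet "\<lambda>c (x, y). (scl N c x, scl N c y)"
proof (intro quotient.intro quotient_axioms.intro CX.opspace_axioms)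
  show "vector_space (\<lambda>c (x, y). (scl N c x, scl N c y))" by (rule vector_space_pair)
next
  fix f g assume "f \<in> car CX" "g \<in> car CX"
  then have fg: "strip_fun f" "strip_fun g" "strip_fun (f + g)"
    by (simp_all add: calderon_car strip_fun_add plus_fun_eta)
  show "jet (f + g) = jet f + jet g"
    unfolding jet_eq[OF fg(1)] jet_eq[OF fg(2)] jet_eq[OF fg(3)]
    using strip_fun_add_deriv[OF fg(1,2) tt_interior] by (simp add: plus_fun_eta)
next
  fix f c assume "f \<in> car CX"
  then have f: "strip_fun f" by (simp add: calderon_car)
  show "jet (scl CX c f) = (case jet f of (x, y) \<Rightarrow> (scl N c x, scl N c y))"
    using complex_deriv_scale[OF f, of c] jet_eq[OF strip_fun_scale[OF f], of c]
    by (simp add: calderon_scl jet_eq[OF f])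
next
  fix w :: "nat \<Rightarrow> complex \<Rightarrow> 'a" and f
  assume w: "\<And>k. w k \<in> car CX" and 0: "\<And>k. jet (w k) = 0" and f: "f \<in> car CX"
    and lim: "(\<lambda>k. mnorm CX (mat 1 1 (\<lambda>_. w k - f))) \<longlonglongrightarrow> 0"
  have w': "strip_fun (w k)" for k using w by (simp add: calderon_car)
  have f': "strip_fun f" using f by (simp add: calderon_car)
  have "w k tt = 0" "complex_deriv N (w k) tt = 0" for k
    using 0[of k] unfolding jet_eq[OF w'] by (simp_all add: zero_prod_def)
  then show "jet f = 0"
    using strip_fun_limit_zero[OF w' f' lim] unfolding jet_eq[OF f'] by (simp add: zero_prod_def)
qed

abbreviation "XT \<equiv> interpolation_space X0 X1 \<theta>"
abbreviation "DX \<equiv> derived_space X0 X1 \<theta>"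

lemma XT_Q: "XT = I.Q" and DX_Q: "DX = D.Q"
  by (simp_all add: interpolation_space_def derived_space_def)

sublocale XT: opspace XT
  by unfold_locales (simp add: XT_Q I.quotient_operator_space)

sublocale DX: opspace DX
  by unfold_locales (simp add: DX_Q D.quotient_operator_space)

lemma XT_car [simp]: "car XT = car N"
proof -
  have "x \<in> (\<lambda>f. f tt) ` {f. strip_fun f}" if "x \<in> car N" for x
    using strip_fun_const[OF that] by (intro image_eqI[where x = "strip_const x"]) (simp_all add: strip_const_def)
  then show ?thesis by (auto simp: XT_Q calderon_car strip_fun_carrier)
qed

lemma XT_scl [simp]: "scl XT = scl N"
  by (simp add: XT_Q)

lemma DX_scl [simp]: "scl DX = (\<lambda>c (x, y). (scl N c x, scl N c y))"
  by (simp add: DX_Q)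

lemma DX_car: "car DX = jet ` {f. strip_fun f}"
  by (simp add: DX_Q calderon_car)

lemma DX_car_subset: "(x, y) \<in> car DX \<Longrightarrow> x \<in> car N \<and> y \<in> car N"
  unfolding DX_car using jet_eq strip_fun_carrier strip_fun_deriv_carrier[OF _ tt_interior] by auto

lemma calderon_mult:
  assumes F: "F \<in> mats CX n" and n: "n \<ge> 1"
    and cg: "continuous_on strip g" and hg: "g holomorphic_on interior strip"
    and bg: "\<And>z. z \<in> strip \<Longrightarrow> cmod (g z) \<le> A"
  shows "map_mat (\<lambda>f z. scl N (g z) (f z)) F \<in> mats CX n"
    and "\<And>z. ev z (map_mat (\<lambda>f z. scl N (g z) (f z)) F) = map_mat (scl N (g z)) (ev z F)"
    and "mnorm CX (map_mat (\<lambda>f z. scl N (g z) (f z)) F) \<le> A * mnorm CX F"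
proof -
  show "map_mat (\<lambda>f z. scl N (g z) (f z)) F \<in> mats CX n"
    using F strip_fun_mult[OF _ cg hg bg] by (auto simp: matsC_iff)
  show ev: "ev z (map_mat (\<lambda>f z. scl N (g z) (f z)) F) = map_mat (scl N (g z)) (ev z F)" for z
    by auto
  have *: "cmod (g z) * u \<le> A * mnorm CX F" if "z \<in> strip" "0 \<le> u" "u \<le> mnorm CX F" for z u
    using that bg[OF that(1)] by (intro mult_mono) (auto intro: order_trans[OF norm_ge_zero])
  show "mnorm CX (map_mat (\<lambda>f z. scl N (g z) (f z)) F) \<le> A * mnorm CX F"
  proof (rule calderon_mnorm_leI; unfold ev)
    show "mnorm X0 (map_mat (scl N (g (Complex 0 t))) (ev (Complex 0 t) F)) \<le> A * mnorm CX F" for t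
      using X0.mnorm_scale[OF n ev_mats(2)[OF F]] X0.mnorm_nonneg[OF n ev_mats(2)[OF F]] calderon_mnorm_ge(1)[OF F n]
      by (simp add: *)
    show "mnorm X1 (map_mat (scl N (g (Complex 1 t))) (ev (Complex 1 t) F)) \<le> A * mnorm CX F" for t
      using X1.mnorm_scale[OF n ev_mats(3)[OF F]] X1.mnorm_nonneg[OF n ev_mats(3)[OF F]] calderon_mnorm_ge(2)[OF F n]
      by (simp add: *)
  qed
qed

text \<open>A bounded substitute for \<open>z - \<theta>\<close> with the same value and the same derivative at \<open>\<theta>\<close>; the pole
  \<open>\<theta> - 2\<close> is at distance at least one from the strip.\<close>

definition zero_fun :: "complex \<Rightarrow> complex" where
  "zero_fun z = 2 * (z - tt) / (z - tt + 2)"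

lemma zero_fun_props:
  "continuous_on strip zero_fun" "zero_fun holomorphic_on interior strip"
  "z \<in> strip \<Longrightarrow> cmod (zero_fun z) \<le> 6" "zero_fun tt = 0" "(zero_fun has_field_derivative 1) (at tt)"
proof -
  have re: "1 \<le> cmod (z - tt + 2)" if "z \<in> strip" for z
    using complex_Re_le_cmod[of "z - tt + 2"] that \<theta>1 by (auto simp: strip_def)
  then have ne: "z - tt + 2 \<noteq> 0" if "z \<in> strip" for z using that by fastforce
  show "continuous_on strip zero_fun" unfolding zero_fun_def using ne by (intro continuous_intros) auto
  show "zero_fun holomorphic_on interior strip"
    unfolding zero_fun_def using ne interior_strip_subset by (intro holomorphic_intros) auto
  show "cmod (zero_fun z) \<le> 6" if "z \<in> strip"
  proof -
    have "cmod (z - tt) \<le> cmod (z - tt + 2) + 2" using norm_triangle_ineq4[of "z - tt + 2" 2] by simp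
    then have "2 * cmod (z - tt) \<le> 6 * cmod (z - tt + 2)" using re[OF that] by simp
    moreover have "cmod (z - tt + 2) > 0" using re[OF that] by linarith
    moreover have "cmod (zero_fun z) = 2 * cmod (z - tt) / cmod (z - tt + 2)"
      unfolding zero_fun_def norm_divide norm_mult by simp
    ultimately show ?thesis by (simp add: divide_le_eq)
  qed
  show "zero_fun tt = 0" by (simp add: zero_fun_def)
  show "(zero_fun has_field_derivative 1) (at tt)"
    unfolding zero_fun_def by (auto intro!: derivative_eq_intros)
qed

lemma jet_zero_mult:
  assumes f: "strip_fun f"
  shows "strip_fun (\<lambda>z. scl N (zero_fun z) (f z))" "complex_deriv \<Sigma> (\<lambda>z. scl N (zero_fun z) (f z)) tt = f tt"
proof -
  show s: "strip_fun (\<lambda>z. scl N (zero_fun z) (f z))"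
    by (rule strip_fun_mult[OF f zero_fun_props(1,2,3)])
  show "complex_deriv \<Sigma> (\<lambda>z. scl N (zero_fun z) (f z)) tt = f tt"
    using jet_eq[OF s] strip_fun_mult_deriv[OF f s tt_interior zero_fun_props(5)]
    by (simp add: zero_fun_props(4))
qed

text \<open>If \<open>F(\<theta>) = z\<close>, then \<open>zero_fun F\<close> has the value \<open>0\<close> and the derivative \<open>z\<close> at \<open>\<theta>\<close>.\<close>

lemma DX_le:
  assumes z: "z \<in> mats XT n" and n: "n \<ge> 1"
  shows "map_mat (\<lambda>y. (0, y)) z \<in> mats DX n" "mnorm DX (map_mat (\<lambda>y. (0, y)) z) \<le> 6 * mnorm XT z"
proof -
  have *: "map_mat (\<lambda>y. (0, y)) z \<in> mats DX n \<and> mnorm DX (map_mat (\<lambda>y. (0, y)) z) \<le> 6 * mnorm CX F"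
    if F: "F \<in> mats CX n" "map_mat (\<lambda>f. f tt) F = z" for F
  proof -
    let ?G = "map_mat (\<lambda>f z. scl N (zero_fun z) (f z)) F"
    note G = calderon_mult[OF F(1) n zero_fun_props(1,2,3)]
    have e: "map_mat jet ?G = map_mat (\<lambda>y. (0, y)) z"
      unfolding F(2)[symmetric] using F(1) by (intro eq_matI) (auto simp: matsC_iff jet_zero_mult zero_fun_props(4))
    then show ?thesis using D.map_mats[OF G(1)] D.Q_mnorm_le[OF n G(1)] G(3) by (simp add: DX_Q)
  qed
  obtain F where "F \<in> mats CX n" "map_mat (\<lambda>f. f tt) F = z"
    using I.lift_exists[of z n] z by (auto simp: XT_Q)
  then show "map_mat (\<lambda>y. (0, y)) z \<in> mats DX n" using * by blast
  have "mnorm DX (map_mat (\<lambda>y. (0, y)) z) / 6 \<le> mnorm I.Q z"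
    using * by (intro I.Q_mnorm_geI) (use z in \<open>auto simp: XT_Q field_simps\<close>)
  then show "mnorm DX (map_mat (\<lambda>y. (0, y)) z) \<le> 6 * mnorm XT z" by (simp add: XT_Q)
qed

lemma jet_divide:
  assumes f: "strip_fun f" and 0: "f tt = 0"
  defines "g \<equiv> \<lambda>z. if z = tt then complex_deriv N f tt else scl N (inverse (z - tt)) (f z)"
  shows "strip_fun g" "g tt = complex_deriv N f tt"
  using strip_fun_divide_zero[OF f tt_interior 0] by (auto simp: g_def)

text \<open>If \<open>F(\<theta>) = 0\<close>, then \<open>F(w) / (w - \<theta>)\<close> takes the value \<open>F'(\<theta>)\<close> at \<open>\<theta>\<close>. The two constants are the
  inverse distances of \<open>\<theta>\<close> to the boundary lines.\<close>

lemma XT_le: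
  assumes z: "z \<in> mats DX n" and n: "n \<ge> 1" and fst0: "\<And>i j. i < n \<Longrightarrow> j < n \<Longrightarrow> fst (z $$ (i, j)) = 0"
  shows "mnorm XT (map_mat snd z) \<le> max (1 / \<theta>) (1 / (1 - \<theta>)) * mnorm DX z"
proof -
  let ?A = "max (1 / \<theta>) (1 / (1 - \<theta>))"
  have A: "?A > 0" using \<theta>0 by (simp add: less_max_iff_disj)
  have *: "mnorm XT (map_mat snd z) \<le> ?A * mnorm CX F"
    if F: "F \<in> mats CX n" "map_mat jet F = z" for F
  proof -
    let ?d = "\<lambda>f z. if z = tt then complex_deriv N f tt else scl N (inverse (z - tt)) (f z)"
    let ?G = "map_mat ?d F"
    have sf: "strip_fun (F $$ (i, j))" if "i < n" "j < n" for i j using F(1) that by (auto simp: matsC_iff)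
    have jet: "jet (F $$ (i, j)) = z $$ (i, j)" if "i < n" "j < n" for i j
      using F that by (auto simp: matsC_iff)
    have 0: "(F $$ (i, j)) tt = 0" if "i < n" "j < n" for i j
      using fst0[OF that] unfolding jet[OF that, symmetric] by simp
    have G: "?G \<in> mats CX n" using F(1) jet_divide(1)[OF sf 0] by (auto simp: matsC_iff)
    have e: "map_mat (\<lambda>f. f tt) ?G = map_mat snd z"
      unfolding F(2)[symmetric] using F(1) by (intro eq_matI) (auto simp: matsC_iff sum_space_complex_deriv strip_fun_carrier)
    have ev: "ev z ?G = map_mat (scl N (inverse (z - tt))) (ev z F)" if "z \<noteq> tt" for z
      using that by auto
    have b: "cmod (inverse (Complex 0 t - tt)) * u \<le> ?A * mnorm CX F" "cmod (inverse (Complex 1 t - tt)) * u \<le> ?A * mnorm CX F"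
      if "0 \<le> u" "u \<le> mnorm CX F" for t u
    proof -
      have "\<theta> \<le> cmod (Complex 0 t - tt)" using abs_Re_le_cmod[of "Complex 0 t - tt"] \<theta>0 by simp
      then have "cmod (inverse (Complex 0 t - tt)) \<le> 1 / \<theta>" using \<theta>0 by (simp add: norm_divide inverse_eq_divide frac_le)
      then show "cmod (inverse (Complex 0 t - tt)) * u \<le> ?A * mnorm CX F" using that A by (intro mult_mono) auto
      have "1 - \<theta> \<le> cmod (Complex 1 t - tt)" using abs_Re_le_cmod[of "Complex 1 t - tt"] \<theta>1 by simp
      then have "cmod (inverse (Complex 1 t - tt)) \<le> 1 / (1 - \<theta>)" using \<theta>1 by (simp add: norm_divide inverse_eq_divide frac_le)
      then show "cmod (inverse (Complex 1 t - tt)) * u \<le> ?A * mnorm CX F" using that A by (intro mult_mono) auto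
    qed
    have ne: "Complex 0 t \<noteq> tt" "Complex 1 t \<noteq> tt" for t using \<theta>0 \<theta>1 by (auto simp: complex_eq_iff)
    have "mnorm CX ?G \<le> ?A * mnorm CX F"
    proof (rule calderon_mnorm_leI; unfold ev[OF ne(1)] ev[OF ne(2)])
      show "mnorm X0 (map_mat (scl N (inverse (Complex 0 t - tt))) (ev (Complex 0 t) F)) \<le> ?A * mnorm CX F" for t
        using X0.mnorm_scale[OF n ev_mats(2)[OF F(1)]] b(1)[OF X0.mnorm_nonneg[OF n ev_mats(2)[OF F(1)]] calderon_mnorm_ge(1)[OF F(1) n]]
        by simp
      show "mnorm X1 (map_mat (scl N (inverse (Complex 1 t - tt))) (ev (Complex 1 t) F)) \<le> ?A * mnorm CX F" for t
        using X1.mnorm_scale[OF n ev_mats(3)[OF F(1)]] b(2)[OF X1.mnorm_nonneg[OF n ev_mats(3)[OF F(1)]] calderon_mnorm_ge(2)[OF F(1) n]]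
        by simp
    qed
    then show ?thesis using I.Q_mnorm_le[OF n G] e by (simp add: XT_Q)
  qed
  have "mnorm XT (map_mat snd z) / ?A \<le> mnorm D.Q z"
    using * by (intro D.Q_mnorm_geI) (use z A in \<open>auto simp: DX_Q divide_le_eq mult.commute\<close>)
  then show ?thesis using A by (simp add: DX_Q divide_le_eq mult.commute)
qed

lemma fst_le:
  assumes z: "z \<in> mats DX n" and n: "n \<ge> 1"
  shows "mnorm XT (map_mat (\<lambda>(x, y). x) z) \<le> mnorm DX z"
  unfolding DX_Q
proof (rule D.Q_mnorm_geI)
  show "z \<in> mats D.Q n" using z by (simp add: DX_Q)
  fix F assume F: "F \<in> mats CX n" "map_mat jet F = z"
  have "map_mat (\<lambda>f. f tt) F = map_mat (\<lambda>(x, y). x) z" unfolding F(2)[symmetric] by auto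
  then show "mnorm XT (map_mat (\<lambda>(x, y). x) z) \<le> mnorm CX F"
    using I.Q_mnorm_le[OF n F(1)] by (simp add: XT_Q)
qed

lemma zero_pair_car: "y \<in> car N \<Longrightarrow> (0, y) \<in> car DX"
proof -
  assume "y \<in> car N"
  then have "mat 1 1 (\<lambda>_. y) \<in> mats XT 1" by (auto intro: matsI)
  from DX_le(1)[OF this] have "map_mat (\<lambda>y. (0, y)) (mat 1 1 (\<lambda>_. y)) \<in> mats DX 1" by simp
  from matsD[OF this, of 0 0] show ?thesis by simp
qed

lemma fst_image: "(\<lambda>(x, y). x) ` car DX = car XT"
proof -
  have "(\<lambda>(x, y). x) ` car DX = (\<lambda>f. f tt) ` {f. strip_fun f}"
    unfolding DX_car by (auto simp: image_image)
  then show ?thesis by (simp add: XT_Q calderon_car)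
qed

lemma cb_j: "completely_bounded XT DX (\<lambda>y. (0, y))"
  by (rule completely_boundedI[where C = 6]) (auto simp: zero_pair_car DX_le)

lemma cb_q: "completely_bounded DX XT (\<lambda>(x, y). x)"
  by (rule completely_boundedI[where C = 1]) (auto simp: fst_le dest: DX_car_subset)

lemma j_isomorphism: "complete_isomorphism_onto_image XT DX (\<lambda>y. (0, y))"
proof -
  let ?j = "\<lambda>y. (0 :: 'a, y :: 'a)" and ?Y = "DX\<lparr>car := (\<lambda>y. (0, y)) ` car XT\<rparr>"
  have inj: "inj_on ?j (car XT)" by (auto simp: inj_on_def)
  have inv: "inv_into (car XT) ?j u = snd u" if "u \<in> ?j ` car XT" for u
    using that inv_into_f_f[OF inj] by auto
  have "completely_bounded XT ?Y ?j"
    using cb_j by (auto simp: completely_bounded_def linear_map_def mats_def)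
  moreover have "completely_bounded ?Y XT (inv_into (car XT) ?j)"
  proof (rule completely_boundedI[where C = "max (1 / \<theta>) (1 / (1 - \<theta>))"])
    fix n :: nat and z assume n: "n \<ge> 1" and z: "z \<in> mats ?Y n"
    have zD: "z \<in> mats DX n" using z zero_pair_car by (fastforce simp: mats_iff)
    have 0: "fst (z $$ (i, j)) = 0" if "i < n" "j < n" for i j using z that by (fastforce simp: mats_iff)
    have "map_mat (inv_into (car XT) ?j) z = map_mat snd z"
    proof (rule eq_matI)
      fix i j assume "i < dim_row (map_mat snd z)" "j < dim_col (map_mat snd z)"
      then have "z $$ (i, j) \<in> ?j ` car XT" "i < dim_row z" "j < dim_col z"
        using z by (auto simp: mats_iff simp del: XT_car)
      then show "map_mat (inv_into (car XT) ?j) z $$ (i, j) = map_mat snd z $$ (i, j)" using inv by simp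
    qed auto
    then show "mnorm XT (map_mat (inv_into (car XT) ?j) z) \<le> max (1 / \<theta>) (1 / (1 - \<theta>)) * mnorm ?Y z"
      using XT_le[OF zD n 0] by simp
  next
    fix x y and c assume x: "x \<in> car ?Y"
    then show "inv_into (car XT) ?j x \<in> car XT" using inv[of x] by auto
    have cx: "scl ?Y c x \<in> ?j ` car XT" using x by (auto simp: carrier_scale)
    then show "inv_into (car XT) ?j (scl ?Y c x) = scl XT c (inv_into (car XT) ?j x)"
      using x inv[OF cx] inv[of x] by auto
    assume y: "y \<in> car ?Y"
    have xy: "x + y \<in> ?j ` car XT" using x y by (auto simp: carrier_add)
    then show "inv_into (car XT) ?j (x + y) = inv_into (car XT) ?j x + inv_into (car XT) ?j y"
      using inv[OF xy] inv[of x] inv[of y] x y by simp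
  qed
  ultimately show ?thesis
    unfolding complete_isomorphism_onto_image_def complete_isomorphism_def using inj by (auto simp: bij_betw_def)
qed

sublocale q: quotient DX "\<lambda>(x, y). x" "scl N"
proof (intro quotient.intro quotient_axioms.intro DX.opspace_axioms vector_space_scale)
  fix w x assume w: "\<And>k. w k \<in> car DX" "\<And>k. (case w k of (x, y) \<Rightarrow> x) = 0" "x \<in> car DX"
    and lim: "(\<lambda>k. mnorm DX (mat 1 1 (\<lambda>_. w k - x))) \<longlonglongrightarrow> 0"
  have fx: "fst x \<in> car XT" using DX_car_subset w(3) by (cases x) auto
  have "mnorm XT (mat 1 1 (\<lambda>_. fst x)) \<le> mnorm DX (mat 1 1 (\<lambda>_. w k - x))" for k
  proof -
    have "map_mat (\<lambda>(x, y). x) (mat 1 1 (\<lambda>_. w k - x)) = mat 1 1 (\<lambda>_. - fst x)"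
      using w(2)[of k] by (intro eq_matI) (auto simp: split_def)
    then show ?thesis
      using fst_le[OF DX.one_by_one_mats[OF DX.carrier_diff[OF w(1) w(3)]], of k] XT.norm.nrm_minus[of "fst x"] fx by simp
  qed
  then have "mnorm XT (mat 1 1 (\<lambda>_. fst x)) \<le> 0" by (intro tendsto_lowerbound[OF lim]) auto
  then show "(case x of (x, y) \<Rightarrow> x) = 0"
    using XT.norm.nrm_nonneg[of "fst x"] XT.norm.nrm_eq_0[of "fst x"] fx by (simp add: split_def)
qed auto

lemma q_quotient: "complete_quotient_map DX XT (\<lambda>(x, y). x)"
proof -
  let ?q = "\<lambda>(x :: 'a, y :: 'a). x"
  have car: "car q.Q = car XT" using fst_image by simp
  have inv: "inv_into (car q.Q) (\<lambda>z. z) u = u" if "u \<in> car XT" for u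
    using inv_into_f_f[of "\<lambda>z. z" "car q.Q" u] that car by simp
  have mats: "mats q.Q n = mats XT n" for n using car by (simp add: mats_def)
  have id: "map_mat (\<lambda>z. z) z = z" for z :: "'a mat" by auto
  have "completely_bounded q.Q XT (\<lambda>z. z)"
  proof (rule completely_boundedI[where C = 1])
    fix n :: nat and z assume n: "n \<ge> 1" and z: "z \<in> mats q.Q n"
    have "mnorm XT z \<le> mnorm q.Q z"
      by (rule q.Q_mnorm_geI[OF z]) (use fst_le[OF _ n] in auto)
    then show "mnorm XT (map_mat (\<lambda>z. z) z) \<le> 1 * mnorm q.Q z" by (simp add: id)
  qed (use car in auto)
  moreover have "completely_bounded XT q.Q (inv_into (car q.Q) (\<lambda>z. z))"
  proof (rule completely_boundedI[where C = 1])
    fix n :: nat and z assume n: "n \<ge> 1" and z: "z \<in> mats XT n"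
    have e: "map_mat (inv_into (car q.Q) (\<lambda>z. z)) z = z"
      using z inv by (intro eq_matI) (auto simp: mats_iff simp del: q.Q_simps XT_car)
    have "mnorm q.Q z \<le> mnorm I.Q z"
    proof (rule I.Q_mnorm_geI)
      show "z \<in> mats I.Q n" using z by (simp add: XT_Q)
      fix F assume F: "F \<in> mats CX n" "map_mat (\<lambda>f. f tt) F = z"
      have m: "map_mat jet F \<in> mats DX n" using D.map_mats[OF F(1)] by (simp add: DX_Q)
      have "map_mat ?q (map_mat jet F) = z" unfolding F(2)[symmetric] by auto
      then have "mnorm q.Q z \<le> mnorm DX (map_mat jet F)" using q.Q_mnorm_le[OF n m] by simp
      also have "\<dots> \<le> mnorm CX F" using D.Q_mnorm_le[OF n F(1)] by (simp add: DX_Q)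
      finally show "mnorm q.Q z \<le> mnorm CX F" .
    qed
    then show "mnorm q.Q (map_mat (inv_into (car q.Q) (\<lambda>z. z)) z) \<le> 1 * mnorm XT z" by (simp only: e mult_1 XT_Q)
  qed (use car inv in \<open>auto simp: carrier_add carrier_scale simp del: q.Q_simps(1)\<close>)
  ultimately have "complete_isomorphism q.Q XT (\<lambda>z. z)"
    unfolding complete_isomorphism_def using car by (auto simp: bij_betw_def)
  then show ?thesis unfolding complete_quotient_map_def XT_scl using cb_q fst_image by blast
qed

theorem extension_sequence_interpolation:
  "extension_sequence XT DX XT (\<lambda>y. (0, y)) (\<lambda>(x, y). x)"
proof -
  have "(\<lambda>y. (0, y)) ` car XT = {x \<in> car DX. (case x of (x, y) \<Rightarrow> x) = 0}"
    using zero_pair_car DX_car_subset by auto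
  then show ?thesis
    unfolding extension_sequence_def
    using XT.operator_space DX.operator_space cb_j cb_q fst_image j_isomorphism q_quotient
    by (auto simp: inj_on_def simp del: XT_car)
qed

section \<open>Extremal functions and twisted functionals\<close>

text \<open>The function \<open>z \<mapsto> (N\<^sub>0 / N\<^sub>1)^(z - \<theta>) x\<close> has the value \<open>x\<close> and the derivative \<open>ln (N\<^sub>0 / N\<^sub>1) x\<close>
  at \<open>\<theta>\<close>, and the exponent is chosen so that its bounds on the two boundary lines coincide.\<close>

lemma extremal_function:
  assumes x: "x \<in> mats N n" and n: "n \<ge> 1" and pos: "N0 > 0" "N1 > 0"
    and N0: "mnorm X0 x \<le> N0" and N1: "mnorm X1 x \<le> N1"
  shows "map_mat (\<lambda>x. (x, scl N (complex_of_real (ln (N0 / N1))) x)) x \<in> mats DX n" (is "?in")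
    and "mnorm DX (map_mat (\<lambda>x. (x, scl N (complex_of_real (ln (N0 / N1))) x)) x) \<le> N0 powr (1 - \<theta>) * N1 powr \<theta>" (is "?D")
    and "mnorm XT x \<le> N0 powr (1 - \<theta>) * N1 powr \<theta>" (is "?X")
proof -
  define c where "c = ln (N0 / N1)"
  define g where "g z = exp (complex_of_real c * (z - tt))" for z
  define e where "e x = (\<lambda>z. scl N (g z) (strip_const x z))" for x
  have ng: "cmod (g z) = exp (c * (Re z - \<theta>))" for z by (simp add: g_def)
  have bg: "cmod (g z) \<le> exp \<bar>c\<bar>" if "z \<in> strip" for z
  proof -
    have "\<bar>Re z - \<theta>\<bar> \<le> 1" using that \<theta>0 \<theta>1 by (auto simp: strip_def)
    then have "\<bar>c * (Re z - \<theta>)\<bar> \<le> \<bar>c\<bar>" unfolding abs_mult by (intro mult_left_le) auto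
    then show ?thesis unfolding ng by simp
  qed
  have cg: "continuous_on strip g" "g holomorphic_on interior strip"
    unfolding g_def by (intro continuous_intros holomorphic_intros)+
  have dg: "(g has_field_derivative complex_of_real c) (at tt)"
    unfolding g_def by (auto intro!: derivative_eq_intros)
  have gt: "g tt = 1" by (simp add: g_def)
  have se: "strip_fun (e x)" if "x \<in> car N" for x
    unfolding e_def by (rule strip_fun_mult[OF strip_fun_const[OF that] cg bg])
  have et: "e x tt = x" for x by (simp add: e_def gt strip_const_def)
  have je: "jet (e x) = (x, scl N (complex_of_real c) x)" if x: "x \<in> car N" for x
  proof -
    have "has_complex_deriv N (strip_const x) 0 tt"
    proof -
      have "eventually (\<lambda>w. w \<in> interior strip) (at tt)"
        using tt_interior open_interior by (intro eventually_at_in_open') auto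
      then have "eventually (\<lambda>w. 0 = nrm N (scl N (inverse (w - tt)) (strip_const x w - strip_const x tt) - 0)) (at tt)"
        by eventually_elim (auto simp: strip_const_def nrm_zero dest: interior_strip_subset)
      then show ?thesis unfolding has_complex_deriv_def using carrier_zero by (auto intro: Lim_transform_eventually[OF tendsto_const])
    qed
    then have "complex_deriv N (strip_const x) tt = 0"
      by (rule complex_deriv_eq) (rule strip_fun_carrier[OF strip_fun_const[OF x]])
    then have "complex_deriv N (e x) tt = scl N (complex_of_real c) x"
      using strip_fun_mult_deriv[OF strip_fun_const[OF x] se[OF x, unfolded e_def] tt_interior dg]
      by (simp add: e_def) (simp add: strip_const_def)
    then show ?thesis using jet_eq[OF se[OF x]] et by simp
  qed
  let ?G = "map_mat e x"
  have G: "?G \<in> mats CX n" using x se unfolding matsC_iff by (auto simp: mats_iff)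
  have ev: "ev z ?G = map_mat (scl N (g z)) x" if "z \<in> strip" for z
    using that by (auto simp: e_def strip_const_def)
  have x0: "x \<in> mats X0 n" "x \<in> mats X1 n" using x by (auto simp: mats_iff)
  let ?M = "N0 powr (1 - \<theta>) * N1 powr \<theta>"
  have lnc: "c = ln N0 - ln N1" using pos by (simp add: c_def ln_div)
  have M: "mnorm CX ?G \<le> ?M"
  proof (rule calderon_mnorm_leI; unfold ev[OF boundary_in_strip(1)] ev[OF boundary_in_strip(2)])
    fix t
    have "mnorm X0 (map_mat (scl N (g (Complex 0 t))) x) = exp (- c * \<theta>) * mnorm X0 x"
      using X0.mnorm_scale[OF n x0(1), of "g (Complex 0 t)"] by (simp add: ng)
    also have "\<dots> \<le> exp (- c * \<theta>) * N0" using N0 by simp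
    also have "\<dots> = exp (- c * \<theta>) * exp (ln N0)" using pos by simp
    also have "\<dots> = ?M"
      using pos by (simp only: powr_def lnc exp_add[symmetric]) (simp add: exp_add[symmetric] algebra_simps)
    finally show "mnorm X0 (map_mat (scl N (g (Complex 0 t))) x) \<le> ?M" .
    have "mnorm X1 (map_mat (scl N (g (Complex 1 t))) x) = exp (c * (1 - \<theta>)) * mnorm X1 x"
      using X1.mnorm_scale[OF n x0(2), of "g (Complex 1 t)"] by (simp add: ng)
    also have "\<dots> \<le> exp (c * (1 - \<theta>)) * N1" using N1 by simp
    also have "\<dots> = exp (c * (1 - \<theta>)) * exp (ln N1)" using pos by simp
    also have "\<dots> = ?M"
      using pos by (simp only: powr_def lnc exp_add[symmetric]) (simp add: exp_add[symmetric] algebra_simps)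
    finally show "mnorm X1 (map_mat (scl N (g (Complex 1 t))) x) \<le> ?M" .
  qed
  have j: "map_mat jet ?G = map_mat (\<lambda>x. (x, scl N (complex_of_real c) x)) x"
    using x je by (intro eq_matI) (auto simp: mats_iff)
  have k: "map_mat (\<lambda>f. f tt) ?G = x" using et by (intro eq_matI) auto
  show ?in using D.map_mats[OF G] unfolding j by (simp add: DX_Q c_def)
  show ?D using D.Q_mnorm_le[OF n G] M unfolding j by (simp add: DX_Q c_def)
  show ?X using I.Q_mnorm_le[OF n G] M unfolding k by (simp add: XT_Q)
qed

text \<open>The case \<open>N\<^sub>0 = N\<^sub>1\<close> of the extremal function, that is, a constant function; the norms are perturbed by
  \<open>r > 0\<close> to allow for \<open>x = 0\<close>.\<close>

lemma pair_zero:
  assumes x: "x \<in> car N"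
  shows "(x, 0) \<in> car DX" "mnorm DX (mat 1 1 (\<lambda>_. (x, 0))) \<le> nrm N x" "mnorm XT (mat 1 1 (\<lambda>_. x)) \<le> nrm N x"
proof -
  have m: "mat 1 1 (\<lambda>_. x) \<in> mats N 1" using x by (auto intro: matsI)
  have e: "map_mat (\<lambda>x. (x, scl N (complex_of_real (ln (N0 / N0))) x)) (mat 1 1 (\<lambda>_. x)) = mat 1 1 (\<lambda>_. (x, 0))"
    if "N0 > 0" for N0 :: real using that by (intro eq_matI) auto
  note E = extremal_function[OF m le_refl, unfolded nrm0[OF x] nrm1[OF x]]
  have p: "N0 powr (1 - \<theta>) * N0 powr \<theta> = N0" if "N0 > 0" for N0 using that by (simp add: powr_add[symmetric])
  have le: "mnorm DX (mat 1 1 (\<lambda>_. (x, 0))) \<le> nrm N x + r" "mnorm XT (mat 1 1 (\<lambda>_. x)) \<le> nrm N x + r"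
    "mat 1 1 (\<lambda>_. (x, 0)) \<in> mats DX 1" if "r > 0" for r
    using E[of "nrm N x + r" "nrm N x + r"] e[of "nrm N x + r"] p[of "nrm N x + r"] that nrm_nonneg[OF x] by simp_all
  show "mnorm DX (mat 1 1 (\<lambda>_. (x, 0))) \<le> nrm N x" "mnorm XT (mat 1 1 (\<lambda>_. x)) \<le> nrm N x"
    using le by (auto intro: field_le_epsilon)
  show "(x, 0) \<in> car DX" using matsD[OF le(3)[of 1], of 0 0] by simp
qed

text \<open>Let \<open>H\<close> be the functional \<open>y \<mapsto> \<Sum>\<^sub>i f\<^sub>i(y\<^sub>i\<^sub>0)\<close>, with norms at most \<open>K\<^sub>0\<close> and \<open>K\<^sub>1\<close> over \<open>X\<^sub>0\<close> and \<open>X\<^sub>1\<close>. The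
  factor \<open>(K\<^sub>0 / K\<^sub>1)^(z - \<theta>)\<close> equalises the bounds for \<open>H(F(z))\<close> on the two boundary lines. The first
  estimate is the three lines theorem. The second one is Cauchy's estimate for the derivative of the
  product at \<open>\<theta>\<close>, in which the derivative of the factor produces the logarithm.\<close>

lemma column_functional_calderon:
  assumes f: "\<And>i. i < n \<Longrightarrow> f i \<in> dual_ball N" and n: "n \<ge> 1" and pos: "K0 > 0" "K1 > 0"
    and K0: "\<And>y. y \<in> mats N n \<Longrightarrow> cmod (\<Sum>i<n. f i (y $$ (i, 0))) \<le> K0 * mnorm X0 y"
    and K1: "\<And>y. y \<in> mats N n \<Longrightarrow> cmod (\<Sum>i<n. f i (y $$ (i, 0))) \<le> K1 * mnorm X1 y"
    and F: "F \<in> mats CX n"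
  shows "cmod (\<Sum>i<n. f i ((F $$ (i, 0)) tt)) \<le> K0 powr (1 - \<theta>) * K1 powr \<theta> * mnorm CX F"
    and "cmod ((\<Sum>i<n. f i (complex_deriv N (F $$ (i, 0)) tt)) + complex_of_real (ln (K0 / K1)) * (\<Sum>i<n. f i ((F $$ (i, 0)) tt)))
      \<le> K0 powr (1 - \<theta>) * K1 powr \<theta> * mnorm CX F / rad"
proof -
  define c where "c = ln (K0 / K1)"
  define g where "g z = exp (complex_of_real c * (z - tt))" for z
  define h where "h z = (\<Sum>i<n. f i ((F $$ (i, 0)) z))" for z
  let ?M = "K0 powr (1 - \<theta>) * K1 powr \<theta> * mnorm CX F"
  have sF: "strip_fun (F $$ (i, 0))" if "i < n" for i using F that n by (auto simp: matsC_iff)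
  have dim: "dim_row F = n" "dim_col F = n" using F by (auto simp: matsC_iff)
  have ng: "cmod (g z) = exp (c * (Re z - \<theta>))" for z by (simp add: g_def)
  have bg: "cmod (g z) \<le> exp \<bar>c\<bar>" if "z \<in> strip" for z
  proof -
    have "\<bar>Re z - \<theta>\<bar> \<le> 1" using that \<theta>0 \<theta>1 by (auto simp: strip_def)
    then have "\<bar>c * (Re z - \<theta>)\<bar> \<le> \<bar>c\<bar>" unfolding abs_mult by (intro mult_left_le) auto
    then show ?thesis unfolding ng by simp
  qed
  have hev: "h z = (\<Sum>i<n. f i (ev z F $$ (i, 0)))" for z using dim n by (simp add: h_def)
  have ch: "continuous_on strip h" "h holomorphic_on interior strip"
    unfolding h_def using f sF
    by (auto intro!: continuous_on_sum holomorphic_on_sum dual_strip_fun_continuous dual_strip_fun_holomorphic)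
  have bh: "cmod (h z) \<le> real n * mnorm CX F" if z: "z \<in> strip" for z
  proof -
    have "cmod (h z) \<le> (\<Sum>i<n. mnorm CX F)"
      unfolding h_def
    proof (rule order_trans[OF norm_sum sum_mono])
      fix i assume "i \<in> {..<n}"
      then have "cmod (f i ((F $$ (i, 0)) z)) \<le> nrm N ((F $$ (i, 0)) z)"
        using dual_le[OF f strip_fun_carrier[OF sF]] by simp
      also have "\<dots> \<le> mnorm CX F" using calderon_entry_le[OF F n, of i 0 z] z n \<open>i \<in> {..<n}\<close> by simp
      finally show "cmod (f i ((F $$ (i, 0)) z)) \<le> mnorm CX F" .
    qed
    then show ?thesis by simp
  qed
  have lnc: "c = ln K0 - ln K1" using pos by (simp add: c_def ln_div)
  have gh: "cmod (g z * h z) \<le> ?M" if z: "z \<in> strip" for z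
  proof (rule strip_maximum_principle[OF _ _ _ _ _ z])
    show "continuous_on strip (\<lambda>z. g z * h z)" "(\<lambda>z. g z * h z) holomorphic_on interior strip"
      unfolding g_def using ch by (auto intro!: continuous_intros holomorphic_intros)
    show "cmod (g z * h z) \<le> exp \<bar>c\<bar> * (real n * mnorm CX F)" if "z \<in> strip" for z
      unfolding norm_mult using bg[OF that] bh[OF that] by (intro mult_mono) auto
    fix t
    have "cmod (h (Complex 0 t)) \<le> K0 * mnorm CX F"
      using K0[OF ev_mats(1)[OF F], of "Complex 0 t"] mult_left_mono[OF calderon_mnorm_ge(1)[OF F n], of K0 t] pos
      unfolding hev by linarith
    then have "cmod (g (Complex 0 t) * h (Complex 0 t)) \<le> exp (- c * \<theta>) * (K0 * mnorm CX F)"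
      unfolding norm_mult ng by (simp add: mult_left_mono)
    also have "\<dots> = exp (- c * \<theta>) * exp (ln K0) * mnorm CX F" using pos by simp
    also have "exp (- c * \<theta>) * exp (ln K0) = K0 powr (1 - \<theta>) * K1 powr \<theta>"
      using pos by (simp only: powr_def lnc exp_add[symmetric]) (simp add: exp_add[symmetric] algebra_simps)
    finally show "cmod (g (Complex 0 t) * h (Complex 0 t)) \<le> ?M" .
    have "cmod (h (Complex 1 t)) \<le> K1 * mnorm CX F"
      using K1[OF ev_mats(1)[OF F], of "Complex 1 t"] mult_left_mono[OF calderon_mnorm_ge(2)[OF F n], of K1 t] pos
      unfolding hev by linarith
    then have "cmod (g (Complex 1 t) * h (Complex 1 t)) \<le> exp (c * (1 - \<theta>)) * (K1 * mnorm CX F)"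
      unfolding norm_mult ng by (simp add: mult_left_mono)
    also have "\<dots> = exp (c * (1 - \<theta>)) * exp (ln K1) * mnorm CX F" using pos by simp
    also have "exp (c * (1 - \<theta>)) * exp (ln K1) = K0 powr (1 - \<theta>) * K1 powr \<theta>"
      using pos by (simp only: powr_def lnc exp_add[symmetric]) (simp add: exp_add[symmetric] algebra_simps)
    finally show "cmod (g (Complex 1 t) * h (Complex 1 t)) \<le> ?M" .
  qed
  show "cmod (\<Sum>i<n. f i ((F $$ (i, 0)) tt)) \<le> ?M"
    using gh[OF tt_strip] by (simp add: g_def h_def)
  have dh: "(h has_field_derivative (\<Sum>i<n. f i (complex_deriv N (F $$ (i, 0)) tt))) (at tt)"
    unfolding h_def by (intro DERIV_sum dual_strip_fun_deriv sF f tt_interior) auto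
  have "((\<lambda>z. g z * h z) has_field_derivative (\<Sum>i<n. f i (complex_deriv N (F $$ (i, 0)) tt)) + complex_of_real c * h tt) (at tt)"
    unfolding g_def by (auto intro!: derivative_eq_intros dh)
  then have d: "deriv (\<lambda>z. g z * h z) tt = (\<Sum>i<n. f i (complex_deriv N (F $$ (i, 0)) tt)) + complex_of_real c * h tt"
    by (rule DERIV_imp_deriv)
  have hol: "(\<lambda>z. g z * h z) holomorphic_on cball tt rad"
    unfolding g_def using holomorphic_on_subset[OF ch(2) rad_cball] by (intro holomorphic_intros)
  have "norm ((deriv ^^ 1) (\<lambda>z. g z * h z) tt) \<le> fact 1 * ?M / rad ^ 1"
  proof (rule Cauchy_inequality[OF _ _ rad_pos])
    show "(\<lambda>w. g w * h w) holomorphic_on ball tt rad" using hol by (rule holomorphic_on_subset) auto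
    show "continuous_on (cball tt rad) (\<lambda>w. g w * h w)" by (rule holomorphic_on_imp_continuous_on[OF hol])
    fix x assume "cmod (tt - x) = rad"
    then have "x \<in> strip" using rad_cball interior_strip_subset by (auto simp: dist_norm subset_iff)
    then show "cmod (g x * h x) \<le> ?M" by (rule gh)
  qed
  then show "cmod ((\<Sum>i<n. f i (complex_deriv N (F $$ (i, 0)) tt)) + complex_of_real (ln (K0 / K1)) * (\<Sum>i<n. f i ((F $$ (i, 0)) tt)))
      \<le> ?M / rad"
    using d by (simp add: c_def h_def One_nat_def)
qed

text \<open>The estimates for functions pass to the quotients, as they hold for every lifting.\<close>

lemma column_functional_le:
  assumes f: "\<And>i. i < n \<Longrightarrow> f i \<in> dual_ball N" and n: "n \<ge> 1" and pos: "K0 > 0" "K1 > 0"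
    and K0: "\<And>y. y \<in> mats N n \<Longrightarrow> cmod (\<Sum>i<n. f i (y $$ (i, 0))) \<le> K0 * mnorm X0 y"
    and K1: "\<And>y. y \<in> mats N n \<Longrightarrow> cmod (\<Sum>i<n. f i (y $$ (i, 0))) \<le> K1 * mnorm X1 y"
  shows "w \<in> mats XT n \<Longrightarrow> cmod (\<Sum>i<n. f i (w $$ (i, 0))) \<le> K0 powr (1 - \<theta>) * K1 powr \<theta> * mnorm XT w"
    and "z \<in> mats DX n \<Longrightarrow>
      cmod ((\<Sum>i<n. f i (snd (z $$ (i, 0)))) + complex_of_real (ln (K0 / K1)) * (\<Sum>i<n. f i (fst (z $$ (i, 0)))))
      \<le> K0 powr (1 - \<theta>) * K1 powr \<theta> / rad * mnorm DX z"
proof -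
  let ?K = "K0 powr (1 - \<theta>) * K1 powr \<theta>"
  have K: "?K > 0" using pos by simp
  note C = column_functional_calderon[OF f n pos K0 K1]
  show "cmod (\<Sum>i<n. f i (w $$ (i, 0))) \<le> ?K * mnorm XT w" if w: "w \<in> mats XT n"
  proof -
    have "cmod (\<Sum>i<n. f i (w $$ (i, 0))) / ?K \<le> mnorm I.Q w"
    proof (rule I.Q_mnorm_geI)
      fix F assume F: "F \<in> mats CX n" "map_mat (\<lambda>f. f tt) F = w"
      have "w $$ (i, 0) = (F $$ (i, 0)) tt" if "i < n" for i
        unfolding F(2)[symmetric] using F(1) that n by (auto simp: matsC_iff)
      then show "cmod (\<Sum>i<n. f i (w $$ (i, 0))) / ?K \<le> mnorm CX F"
        using C(1)[OF _ _ _ F(1)] K by (simp add: divide_le_eq mult.commute)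
    qed (use w in \<open>simp add: XT_Q\<close>)
    then show ?thesis using K by (simp add: XT_Q divide_le_eq mult.commute)
  qed
  show "cmod ((\<Sum>i<n. f i (snd (z $$ (i, 0)))) + complex_of_real (ln (K0 / K1)) * (\<Sum>i<n. f i (fst (z $$ (i, 0)))))
      \<le> ?K / rad * mnorm DX z" (is "?l \<le> _") if z: "z \<in> mats DX n"
  proof -
    have Kr: "?K / rad > 0" using K rad_pos by simp
    have "?l / (?K / rad) \<le> mnorm D.Q z"
    proof (rule D.Q_mnorm_geI)
      fix F assume F: "F \<in> mats CX n" "map_mat jet F = z"
      have "fst (z $$ (i, 0)) = (F $$ (i, 0)) tt" "snd (z $$ (i, 0)) = complex_deriv N (F $$ (i, 0)) tt" if "i < n" for i
        unfolding F(2)[symmetric] using F(1) that n by (auto simp: matsC_iff jet_eq)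
      then have "?l \<le> ?K / rad * mnorm CX F"
        using C(2)[OF _ _ _ F(1)] by simp
      then show "?l / (?K / rad) \<le> mnorm CX F" using Kr by (subst divide_le_eq) (simp add: mult.commute)
    qed (use z in \<open>simp add: DX_Q\<close>)
    then have "?l \<le> mnorm D.Q z * (?K / rad)" using Kr by (subst (asm) divide_le_eq) simp
    then show ?thesis by (simp add: DX_Q mult.commute)
  qed
qed

end

section \<open>The minimal and the maximal operator space of a Banach space\<close>

lemma matrix_normsI:
  assumes V: "complex_vector_space X"
    and nonneg: "\<And>n x. n \<ge> 1 \<Longrightarrow> x \<in> mats X n \<Longrightarrow> 0 \<le> mnorm X x"
    and definite: "\<And>n x. n \<ge> 1 \<Longrightarrow> x \<in> mats X n \<Longrightarrow> mnorm X x = 0 \<Longrightarrow> x = 0\<^sub>m n n"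
    and scale: "\<And>n x c. n \<ge> 1 \<Longrightarrow> x \<in> mats X n \<Longrightarrow> mnorm X (map_mat (scl X c) x) \<le> cmod c * mnorm X x"
    and add: "\<And>n x y. n \<ge> 1 \<Longrightarrow> x \<in> mats X n \<Longrightarrow> y \<in> mats X n \<Longrightarrow> mnorm X (x + y) \<le> mnorm X x + mnorm X y"
  shows "matrix_norms X"
proof -
  interpret cvs_locale "car X" "scl X" using V by (simp add: cvs_locale_def complex_vector_space_def)
  have 0: "mnorm X (0\<^sub>m n n) = 0" if n: "n \<ge> 1" for n
  proof -
    have z: "0\<^sub>m n n \<in> mats X n" by (auto simp: mats_iff carrier_zero)
    have "map_mat (scl X 0) (0\<^sub>m n n) = 0\<^sub>m n n" by auto
    then show ?thesis using scale[OF n z, of 0] nonneg[OF n z] by simp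
  qed
  have eq: "mnorm X (map_mat (scl X c) x) = cmod c * mnorm X x" if n: "n \<ge> 1" and x: "x \<in> mats X n" for n x c
  proof (cases "c = 0")
    case True
    have "map_mat (scl X c) x = 0\<^sub>m n n" using x True by (auto simp: mats_iff)
    then show ?thesis using True 0[OF n] by simp
  next
    case False
    have cx: "map_mat (scl X c) x \<in> mats X n" using x by (auto simp: mats_iff carrier_scale)
    have "map_mat (scl X (inverse c)) (map_mat (scl X c) x) = x" using False by (intro eq_matI) auto
    then have "mnorm X x \<le> cmod (inverse c) * mnorm X (map_mat (scl X c) x)"
      using scale[OF n cx, of "inverse c"] by simp
    then have "cmod c * mnorm X x \<le> mnorm X (map_mat (scl X c) x)" using False by (simp add: norm_divide field_simps)
    then show ?thesis using scale[OF n x, of c] by simp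
  qed
  show ?thesis
    unfolding matrix_norms_def
  proof (intro allI impI ballI conjI)
    fix n :: nat and x assume n: "n \<ge> 1" and x: "x \<in> mats X n"
    show "0 \<le> mnorm X x" by (rule nonneg[OF n x])
    show "(mnorm X x = 0) = (x = 0\<^sub>m n n)" using definite[OF n x] 0[OF n] by auto
    show "mnorm X (map_mat (scl X c) x) = cmod c * mnorm X x" for c by (rule eq[OF n x])
    show "mnorm X (x + y) \<le> mnorm X x + mnorm X y" if "y \<in> mats X n" for y by (rule add[OF n x that])
  qed
qed

text \<open>The lower estimate for block diagonal matrices follows from compression to the blocks.\<close>

lemma ruan_axiomsI:
  assumes V: "complex_vector_space X"
    and nonneg: "\<And>n x. n \<ge> 1 \<Longrightarrow> x \<in> mats X n \<Longrightarrow> 0 \<le> mnorm X x"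
    and block: "\<And>n m x y. n \<ge> 1 \<Longrightarrow> m \<ge> 1 \<Longrightarrow> x \<in> mats X n \<Longrightarrow> y \<in> mats X m \<Longrightarrow>
        mnorm X (four_block_mat x (0\<^sub>m n m) (0\<^sub>m m n) y) \<le> max (mnorm X x) (mnorm X y)"
    and prods: "\<And>n m x \<alpha> \<beta>. n \<ge> 1 \<Longrightarrow> m \<ge> 1 \<Longrightarrow> x \<in> mats X m \<Longrightarrow> \<alpha> \<in> carrier_mat n m \<Longrightarrow> \<beta> \<in> carrier_mat m n \<Longrightarrow>
        mnorm X (scalar_prods X \<alpha> x \<beta>) \<le> scalar_mat_norm \<alpha> * mnorm X x * scalar_mat_norm \<beta>"
  shows "ruan_axioms X"
  unfolding ruan_axioms_def
proof (intro conjI allI impI ballI)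
  fix n m :: nat and x y assume n: "n \<ge> 1" and m: "m \<ge> 1" and x: "x \<in> mats X n" and y: "y \<in> mats X m"
  interpret cvs_locale "car X" "scl X" using V by (simp add: cvs_locale_def complex_vector_space_def)
  let ?B = "four_block_mat x (0\<^sub>m n m) (0\<^sub>m m n) y"
  have B: "?B \<in> mats X (n + m)" using x y by (auto simp: mats_iff four_block_mat_def Let_def carrier_zero)
  have sel: "mnorm X (mat k k (\<lambda>(i, j). ?B $$ (s i, s j))) \<le> mnorm X ?B"
    if k: "k \<ge> 1" and s: "inj_on s {..<k}" "\<And>i. i < k \<Longrightarrow> s i < n + m" for k s
  proof -
    have "inj_on s {i. i < k \<and> s i < n + m}" using s by (auto intro: inj_on_subset)
    note a = scalar_mat_norm_partial_permutation[OF this]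
    let ?\<alpha> = "mat k (n + m) (\<lambda>(i, l). if l = s i then 1 else (0::complex))"
    let ?\<beta> = "mat (n + m) k (\<lambda>(l, j). if l = s j then 1 else (0::complex))"
    have "scalar_prods X ?\<alpha> ?B ?\<beta> = mat k k (\<lambda>(i, j). ?B $$ (s i, s j))"
      by (rule scalar_prods_select[OF vector_space_scale mats_carrier[OF B]]) (use s in auto)
    moreover have "mnorm X (scalar_prods X ?\<alpha> ?B ?\<beta>) \<le> scalar_mat_norm ?\<alpha> * mnorm X ?B * scalar_mat_norm ?\<beta>"
      using n by (intro prods[OF k _ B]) auto
    moreover have "scalar_mat_norm ?\<alpha> * mnorm X ?B * scalar_mat_norm ?\<beta> \<le> 1 * mnorm X ?B * 1"
      using a nonneg[OF _ B] n by (intro mult_mono) auto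
    ultimately show ?thesis by simp
  qed
  have "mat n n (\<lambda>(i, j). ?B $$ (i, j)) = x" using mats_dim[OF x] mats_dim[OF y] by (intro eq_matI) auto
  then have 1: "mnorm X x \<le> mnorm X ?B" using sel[OF n, of "\<lambda>i. i"] by simp
  have "mat m m (\<lambda>(i, j). ?B $$ (n + i, n + j)) = y" using mats_dim[OF x] mats_dim[OF y] by (intro eq_matI) auto
  then have 2: "mnorm X y \<le> mnorm X ?B" using sel[OF m, of "\<lambda>i. n + i"] by simp
  show "mnorm X ?B = max (mnorm X x) (mnorm X y)" using block[OF n m x y] 1 2 by (intro antisym) auto
qed (rule prods)

lemma complete_norm_cong:
  assumes "complete_norm N" "car M = car N" "\<And>x. x \<in> car N \<Longrightarrow> nrm M x = nrm N x"
    and "\<And>x y. x \<in> car N \<Longrightarrow> y \<in> car N \<Longrightarrow> x - y \<in> car N"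
  shows "complete_norm M"
proof -
  have *: "nrm M (x - y) = nrm N (x - y)" if "x \<in> car N" "y \<in> car N" for x y using assms that by simp
  show ?thesis unfolding complete_norm_def assms(2)
  proof (intro allI impI, elim conjE)
    fix s :: "nat \<Rightarrow> 'a" assume s: "\<forall>k. s k \<in> car N" and c: "\<forall>e>0. \<exists>K. \<forall>k\<ge>K. \<forall>l\<ge>K. nrm M (s k - s l) < e"
    then have "\<forall>e>0. \<exists>K. \<forall>k\<ge>K. \<forall>l\<ge>K. nrm N (s k - s l) < e" by (simp add: *)
    then obtain x where x: "x \<in> car N" "(\<lambda>k. nrm N (s k - x)) \<longlonglongrightarrow> 0"
      using assms(1) s unfolding complete_norm_def by blast
    have e: "(\<lambda>k. nrm M (s k - x)) = (\<lambda>k. nrm N (s k - x))" using s x(1) * by auto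
    show "\<exists>x\<in>car N. (\<lambda>k. nrm M (s k - x)) \<longlonglongrightarrow> 0"
      by (rule bexI[OF _ x(1)]) (simp only: e x(2))
  qed
qed

lemma scalar_mat_norm_le_sum:
  "scalar_mat_norm \<alpha> \<le> (\<Sum>i<dim_row \<alpha>. \<Sum>j<dim_col \<alpha>. cmod (\<alpha> $$ (i, j)))"
proof (rule scalar_mat_norm_leI)
  fix u v :: "nat \<Rightarrow> complex"
  have "cmod (bilin \<alpha> u v) \<le> (\<Sum>i<dim_row \<alpha>. \<Sum>j<dim_col \<alpha>. cmod (u i * \<alpha> $$ (i, j) * v j))"
    unfolding bilin_def by (rule order_trans[OF norm_sum sum_mono[OF norm_sum]])
  also have "\<dots> \<le> (\<Sum>i<dim_row \<alpha>. \<Sum>j<dim_col \<alpha>. cmod (\<alpha> $$ (i, j)) * l2 (dim_row \<alpha>) u * l2 (dim_col \<alpha>) v)"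
  proof (intro sum_mono)
    fix i j assume "i \<in> {..<dim_row \<alpha>}" "j \<in> {..<dim_col \<alpha>}"
    then have "cmod (u i) * cmod (\<alpha> $$ (i, j)) * cmod (v j) \<le> l2 (dim_row \<alpha>) u * cmod (\<alpha> $$ (i, j)) * l2 (dim_col \<alpha>) v"
      using entry_le_l2[of i _ u] entry_le_l2[of j _ v] by (intro mult_mono) auto
    then show "cmod (u i * \<alpha> $$ (i, j) * v j) \<le> cmod (\<alpha> $$ (i, j)) * l2 (dim_row \<alpha>) u * l2 (dim_col \<alpha>) v"
      by (simp add: norm_mult ac_simps)
  qed
  finally show "cmod (bilin \<alpha> u v) \<le> (\<Sum>i<dim_row \<alpha>. \<Sum>j<dim_col \<alpha>. cmod (\<alpha> $$ (i, j))) * l2 (dim_row \<alpha>) u * l2 (dim_col \<alpha>) v"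
    by (simp add: sum_distrib_right)
qed (auto intro!: sum_nonneg)

lemma sum_lessThan_add: "(\<Sum>i<n + m. f i) = (\<Sum>i<n. f i) + (\<Sum>i<m. f (n + i :: nat))"
  for f :: "nat \<Rightarrow> 'b::comm_monoid_add"
  by (induction m) (auto simp: ac_simps)

context banach
begin

abbreviation "NMIN \<equiv> min_os N"
abbreviation "NMAX \<equiv> max_os N"

lemma min_simps [simp]: "car NMIN = car N" "scl NMIN = scl N"
  and max_simps [simp]: "car NMAX = car N" "scl NMAX = scl N"
  by (simp_all add: min_os_def max_os_def)

lemma mats_min: "mats NMIN n = mats N n" and mats_max: "mats NMAX n = mats N n"
  by (simp_all add: mats_def)

lemma min_mnorm: "mnorm NMIN x = (SUP f\<in>dual_ball N. scalar_mat_norm (map_mat f x))"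
  by (simp add: min_os_def)

lemma dual_ball_nonempty: "dual_ball N \<noteq> {}"
proof -
  have "(\<lambda>_. 0) \<in> dual_ball N" by (auto simp: dual_ball_iff nrm_nonneg)
  then show ?thesis by blast
qed

lemma min_bdd: "x \<in> mats N n \<Longrightarrow> bdd_above ((\<lambda>f. scalar_mat_norm (map_mat f x)) ` dual_ball N)"
proof (rule bdd_aboveI2)
  fix f assume x: "x \<in> mats N n" and f: "f \<in> dual_ball N"
  show "scalar_mat_norm (map_mat f x) \<le> (\<Sum>i<n. \<Sum>j<n. nrm N (x $$ (i, j)))"
    by (rule order_trans[OF scalar_mat_norm_le_sum]) (use x dual_le[OF f] in \<open>auto simp: mats_iff intro!: sum_mono\<close>)
qed

lemma min_ge: "x \<in> mats N n \<Longrightarrow> f \<in> dual_ball N \<Longrightarrow> scalar_mat_norm (map_mat f x) \<le> mnorm NMIN x"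
  unfolding min_mnorm by (rule cSUP_upper[OF _ min_bdd])

lemma min_leI: "(\<And>f. f \<in> dual_ball N \<Longrightarrow> scalar_mat_norm (map_mat f x) \<le> C) \<Longrightarrow> mnorm NMIN x \<le> C"
  unfolding min_mnorm by (rule cSUP_least[OF dual_ball_nonempty])

lemma min_nonneg: "x \<in> mats N n \<Longrightarrow> 0 \<le> mnorm NMIN x"
  using min_ge dual_ball_nonempty scalar_mat_norm_nonneg order_trans by blast

text \<open>The operator norm of \<open>(f(x\<^sub>i\<^sub>j))\<close> dominates \<open>f(x\<^sub>i\<^sub>j)\<close>, for a functional \<open>f\<close> that norms the entry.\<close>

lemma min_entry:
  assumes x: "x \<in> mats N n" and ij: "i < n" "j < n"
  shows "nrm N (x $$ (i, j)) \<le> mnorm NMIN x"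
proof (rule nrm_leI[OF matsD[OF x ij]])
  fix f assume f: "f \<in> dual_ball N"
  have "cmod (map_mat f x $$ (i, j)) \<le> scalar_mat_norm (map_mat f x)"
    using mats_dim[OF x] ij by (intro entry_le_scalar_mat_norm) auto
  also have "\<dots> \<le> mnorm NMIN x" by (rule min_ge[OF x f])
  finally show "cmod (f (x $$ (i, j))) \<le> mnorm NMIN x" using mats_dim[OF x] ij by simp
qed

lemma min_one: "x \<in> car N \<Longrightarrow> mnorm NMIN (mat 1 1 (\<lambda>_. x)) = nrm N x"
proof (rule antisym)
  assume x: "x \<in> car N"
  then have m: "mat 1 1 (\<lambda>_. x) \<in> mats N 1" by (auto intro: matsI)
  show "nrm N x \<le> mnorm NMIN (mat 1 1 (\<lambda>_. x))" using min_entry[OF m, of 0 0] by simp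
  show "mnorm NMIN (mat 1 1 (\<lambda>_. x)) \<le> nrm N x"
  proof (rule min_leI)
    fix f assume f: "f \<in> dual_ball N"
    show "scalar_mat_norm (map_mat f (mat 1 1 (\<lambda>_. x))) \<le> nrm N x"
      by (rule order_trans[OF scalar_mat_norm_le_sum]) (use dual_le[OF f x] in \<open>simp add: lessThan_1\<close>)
  qed
qed

lemma map_dual_scalar_prods:
  assumes f: "f \<in> dual_ball N" and x: "x \<in> mats N m" and ab: "\<alpha> \<in> carrier_mat n m" "\<beta> \<in> carrier_mat m n"
    and ij: "i < n" "j < n"
  shows "f (scalar_prods N \<alpha> x \<beta> $$ (i, j)) = (\<Sum>k<m. \<Sum>l<m. \<alpha> $$ (i, k) * f (x $$ (k, l)) * \<beta> $$ (l, j))"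
proof -
  have "f (scalar_prods N \<alpha> x \<beta> $$ (i, j)) = f (\<Sum>k<m. \<Sum>l<m. scl N (\<alpha> $$ (i, k) * \<beta> $$ (l, j)) (x $$ (k, l)))"
    using ab ij mats_dim[OF x] by (simp add: scalar_prods_def)
  also have "\<dots> = (\<Sum>k<m. f (\<Sum>l<m. scl N (\<alpha> $$ (i, k) * \<beta> $$ (l, j)) (x $$ (k, l))))"
    using matsD[OF x] by (intro dual_sum[OF f]) (auto intro!: carrier_sum carrier_scale)
  also have "\<dots> = (\<Sum>k<m. \<Sum>l<m. f (scl N (\<alpha> $$ (i, k) * \<beta> $$ (l, j)) (x $$ (k, l))))"
    using matsD[OF x] by (intro sum.cong refl dual_sum[OF f]) (auto intro!: carrier_scale)
  also have "\<dots> = (\<Sum>k<m. \<Sum>l<m. \<alpha> $$ (i, k) * f (x $$ (k, l)) * \<beta> $$ (l, j))"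
    using matsD[OF x] f by (intro sum.cong refl) (simp add: dual_scale)
  finally show ?thesis .
qed

text \<open>The form of \<open>\<alpha> y \<beta>\<close> at \<open>u, v\<close> is the form of \<open>y\<close> at \<open>u \<alpha>, \<beta> v\<close>.\<close>

lemma scalar_mat_norm_prods:
  assumes y: "y \<in> carrier_mat m m" and ab: "\<alpha> \<in> carrier_mat n m" "\<beta> \<in> carrier_mat m n"
    and z: "z \<in> carrier_mat n n" "\<And>i j. i < n \<Longrightarrow> j < n \<Longrightarrow> z $$ (i, j) = (\<Sum>k<m. \<Sum>l<m. \<alpha> $$ (i, k) * y $$ (k, l) * \<beta> $$ (l, j))"
  shows "scalar_mat_norm z \<le> scalar_mat_norm \<alpha> * scalar_mat_norm y * scalar_mat_norm \<beta>"
proof (rule scalar_mat_norm_leI)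
  fix u v :: "nat \<Rightarrow> complex"
  let ?u = "\<lambda>k. \<Sum>i<n. u i * \<alpha> $$ (i, k)" and ?v = "\<lambda>l. \<Sum>j<n. \<beta> $$ (l, j) * v j"
  have "bilin z u v = (\<Sum>i<n. \<Sum>j<n. \<Sum>k<m. \<Sum>l<m. u i * \<alpha> $$ (i, k) * y $$ (k, l) * \<beta> $$ (l, j) * v j)"
    using z unfolding bilin_def by (simp add: sum_distrib_left sum_distrib_right mult.assoc)
  also have "\<dots> = (\<Sum>k<m. \<Sum>l<m. \<Sum>i<n. \<Sum>j<n. u i * \<alpha> $$ (i, k) * y $$ (k, l) * \<beta> $$ (l, j) * v j)"
  proof -
    have rot: "(\<Sum>j<n. \<Sum>k<m. \<Sum>l<m. g j k l) = (\<Sum>k<m. \<Sum>l<m. \<Sum>j<n. g j k l)" for g :: "nat \<Rightarrow> nat \<Rightarrow> nat \<Rightarrow> complex"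
      by (subst sum.swap) (intro sum.cong refl sum.swap)
    show ?thesis unfolding rot ..
  qed
  also have "\<dots> = (\<Sum>k<m. \<Sum>l<m. ?u k * y $$ (k, l) * ?v l)"
    by (intro sum.cong refl) (simp add: sum_distrib_left sum_distrib_right mult.assoc, rule sum.swap)
  also have "\<dots> = bilin y ?u ?v" using y by (simp add: bilin_def)
  finally have "cmod (bilin z u v) \<le> scalar_mat_norm y * l2 m ?u * l2 m ?v"
    using bilin_le[of y ?u ?v] y by simp
  also have "\<dots> \<le> scalar_mat_norm y * (scalar_mat_norm \<alpha> * l2 n u) * (scalar_mat_norm \<beta> * l2 n v)"
    using l2_vec_mat_le[of \<alpha> u] l2_mat_vec_le[of \<beta> v] ab by (intro mult_mono) auto
  finally show "cmod (bilin z u v) \<le> scalar_mat_norm \<alpha> * scalar_mat_norm y * scalar_mat_norm \<beta> * l2 (dim_row z) u * l2 (dim_col z) v"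
    using z(1) by (simp add: ac_simps)
qed auto

lemma min_matrix_norms: "matrix_norms NMIN"
proof (rule matrix_normsI; (unfold mats_min)?)
  show "complex_vector_space NMIN" using cvs_N by (simp add: complex_vector_space_def)
next
  fix n :: nat and x assume "n \<ge> 1" and x: "x \<in> mats N n"
  show "0 \<le> mnorm NMIN x" by (rule min_nonneg[OF x])
  show "x = 0\<^sub>m n n" if "mnorm NMIN x = 0"
  proof (rule eq_matI)
    fix i j assume ij: "i < dim_row (0\<^sub>m n n :: 'a mat)" "j < dim_col (0\<^sub>m n n :: 'a mat)"
    then have "nrm N (x $$ (i, j)) \<le> 0" "x $$ (i, j) \<in> car N" using min_entry[OF x, of i j] matsD[OF x] that by auto
    then show "x $$ (i, j) = 0\<^sub>m n n $$ (i, j)" using nrm_nonneg[of "x $$ (i, j)"] nrm_eq_0[of "x $$ (i, j)"] ij by simp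
  qed (use mats_dim[OF x] in auto)
  fix c
  show "mnorm NMIN (map_mat (scl NMIN c) x) \<le> cmod c * mnorm NMIN x"
  proof (rule min_leI)
    fix f assume f: "f \<in> dual_ball N"
    have "scalar_mat_norm (map_mat f (map_mat (scl NMIN c) x)) \<le> cmod c * scalar_mat_norm (map_mat f x)"
    proof (rule scalar_mat_norm_leI)
      fix u v :: "nat \<Rightarrow> complex"
      have "bilin (map_mat f (map_mat (scl NMIN c) x)) u v = c * bilin (map_mat f x) u v"
        unfolding bilin_def using x f by (auto simp: mats_iff dual_scale sum_distrib_left intro!: sum.cong)
      then show "cmod (bilin (map_mat f (map_mat (scl NMIN c) x)) u v) \<le> cmod c * scalar_mat_norm (map_mat f x) *
          l2 (dim_row (map_mat f (map_mat (scl NMIN c) x))) u * l2 (dim_col (map_mat f (map_mat (scl NMIN c) x))) v"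
        using mult_left_mono[OF bilin_le[of "map_mat f x" u v], of "cmod c"] by (simp add: norm_mult ac_simps)
    qed simp
    also have "\<dots> \<le> cmod c * mnorm NMIN x" by (intro mult_left_mono min_ge[OF x f]) simp
    finally show "scalar_mat_norm (map_mat f (map_mat (scl NMIN c) x)) \<le> cmod c * mnorm NMIN x" .
  qed
next
  fix n :: nat and x y assume "n \<ge> 1" and x: "x \<in> mats N n" and y: "y \<in> mats N n"
  show "mnorm NMIN (x + y) \<le> mnorm NMIN x + mnorm NMIN y"
  proof (rule min_leI)
    fix f assume f: "f \<in> dual_ball N"
    have "scalar_mat_norm (map_mat f (x + y)) \<le> scalar_mat_norm (map_mat f x) + scalar_mat_norm (map_mat f y)"
    proof (rule scalar_mat_norm_leI)
      fix u v :: "nat \<Rightarrow> complex"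
      have "bilin (map_mat f (x + y)) u v = bilin (map_mat f x) u v + bilin (map_mat f y) u v"
        unfolding bilin_def using x y f
        by (auto simp: mats_iff dual_add sum.distrib[symmetric] algebra_simps intro!: sum.cong)
      then show "cmod (bilin (map_mat f (x + y)) u v) \<le> (scalar_mat_norm (map_mat f x) + scalar_mat_norm (map_mat f y)) *
          l2 (dim_row (map_mat f (x + y))) u * l2 (dim_col (map_mat f (x + y))) v"
        using norm_triangle_mono[OF bilin_le[of "map_mat f x" u v] bilin_le[of "map_mat f y" u v]] mats_dim[OF x] mats_dim[OF y]
        by (simp add: algebra_simps)
    qed simp
    also have "\<dots> \<le> mnorm NMIN x + mnorm NMIN y" by (intro add_mono min_ge[OF x f] min_ge[OF y f])
    finally show "scalar_mat_norm (map_mat f (x + y)) \<le> mnorm NMIN x + mnorm NMIN y" .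
  qed
qed

lemma scalar_mat_norm_block:
  assumes x: "x \<in> carrier_mat n n" and y: "y \<in> carrier_mat m m"
  shows "scalar_mat_norm (four_block_mat x (0\<^sub>m n m) (0\<^sub>m m n) y) \<le> max (scalar_mat_norm x) (scalar_mat_norm y)"
    (is "scalar_mat_norm ?B \<le> ?M")
proof (rule scalar_mat_norm_leI)
  fix u v :: "nat \<Rightarrow> complex"
  let ?u = "\<lambda>i. u (n + i)" and ?v = "\<lambda>i. v (n + i)"
  have d: "dim_row ?B = n + m" "dim_col ?B = n + m" using x y by auto
  have "bilin ?B u v = bilin x u v + bilin y ?u ?v"
    unfolding bilin_def d using x y by (simp add: sum_lessThan_add)
  then have "cmod (bilin ?B u v) \<le> scalar_mat_norm x * l2 n u * l2 n v + scalar_mat_norm y * l2 m ?u * l2 m ?v"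
    using norm_triangle_mono[OF bilin_le[of x u v] bilin_le[of y ?u ?v]] x y by simp
  also have "\<dots> \<le> ?M * l2 n u * l2 n v + ?M * l2 m ?u * l2 m ?v"
    by (intro add_mono mult_right_mono) auto
  also have "\<dots> = ?M * (l2 n u * l2 n v + l2 m ?u * l2 m ?v)" by (simp add: algebra_simps)
  also have "\<dots> \<le> ?M * (l2 (n + m) u * l2 (n + m) v)"
  proof (rule mult_left_mono)
    have "(l2 n u * l2 n v + l2 m ?u * l2 m ?v)\<^sup>2 \<le> ((l2 n u)\<^sup>2 + (l2 m ?u)\<^sup>2) * ((l2 n v)\<^sup>2 + (l2 m ?v)\<^sup>2)"
    proof -
      have "0 \<le> (l2 n u * l2 m ?v - l2 m ?u * l2 n v)\<^sup>2" by simp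
      then show ?thesis by (simp add: power2_eq_square algebra_simps)
    qed
    also have "\<dots> = (l2 (n + m) u * l2 (n + m) v)\<^sup>2" by (simp add: power_mult_distrib l2_add)
    finally show "l2 n u * l2 n v + l2 m ?u * l2 m ?v \<le> l2 (n + m) u * l2 (n + m) v"
      by (rule power2_le_imp_le) simp
  qed (simp add: le_max_iff_disj)
  finally show "cmod (bilin ?B u v) \<le> ?M * l2 (dim_row ?B) u * l2 (dim_col ?B) v" by (simp only: d mult.assoc)
qed (simp add: le_max_iff_disj)

lemma min_ruan: "ruan_axioms NMIN"
proof (rule ruan_axiomsI; (unfold mats_min)?)
  show "complex_vector_space NMIN" using cvs_N by (simp add: complex_vector_space_def)
  show "0 \<le> mnorm NMIN x" if "x \<in> mats N n" for x n by (rule min_nonneg[OF that])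
next
  fix n m :: nat and x y assume x: "x \<in> mats N n" and y: "y \<in> mats N m"
  show "mnorm NMIN (four_block_mat x (0\<^sub>m n m) (0\<^sub>m m n) y) \<le> max (mnorm NMIN x) (mnorm NMIN y)"
  proof (rule min_leI)
    fix f assume f: "f \<in> dual_ball N"
    have "map_mat f (four_block_mat x (0\<^sub>m n m) (0\<^sub>m m n) y) = four_block_mat (map_mat f x) (0\<^sub>m n m) (0\<^sub>m m n) (map_mat f y)"
      using mats_dim[OF x] mats_dim[OF y] by (intro eq_matI) (auto simp: four_block_mat_def Let_def dual_zero[OF f])
    then have "scalar_mat_norm (map_mat f (four_block_mat x (0\<^sub>m n m) (0\<^sub>m m n) y)) \<le> max (scalar_mat_norm (map_mat f x)) (scalar_mat_norm (map_mat f y))"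
      using scalar_mat_norm_block[of "map_mat f x" n "map_mat f y" m] mats_carrier[OF x] mats_carrier[OF y] by simp
    also have "\<dots> \<le> max (mnorm NMIN x) (mnorm NMIN y)" by (intro max.mono min_ge[OF x f] min_ge[OF y f])
    finally show "scalar_mat_norm (map_mat f (four_block_mat x (0\<^sub>m n m) (0\<^sub>m m n) y)) \<le> max (mnorm NMIN x) (mnorm NMIN y)" .
  qed
next
  fix n m :: nat and x and \<alpha> \<beta> :: "complex mat" assume x: "x \<in> mats N m" and ab: "\<alpha> \<in> carrier_mat n m" "\<beta> \<in> carrier_mat m n"
  show "mnorm NMIN (scalar_prods NMIN \<alpha> x \<beta>) \<le> scalar_mat_norm \<alpha> * mnorm NMIN x * scalar_mat_norm \<beta>"
  proof (rule min_leI)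
    fix f assume f: "f \<in> dual_ball N"
    have e: "scalar_prods NMIN = scalar_prods N" by (rule scalar_prods_scl_cong) simp
    have "scalar_mat_norm (map_mat f (scalar_prods N \<alpha> x \<beta>)) \<le> scalar_mat_norm \<alpha> * scalar_mat_norm (map_mat f x) * scalar_mat_norm \<beta>"
    proof (rule scalar_mat_norm_prods[of _ m _ n])
      show "map_mat f (scalar_prods N \<alpha> x \<beta>) $$ (i, j) = (\<Sum>k<m. \<Sum>l<m. \<alpha> $$ (i, k) * map_mat f x $$ (k, l) * \<beta> $$ (l, j))"
        if "i < n" "j < n" for i j
        using map_dual_scalar_prods[OF f x ab that] ab that mats_dim[OF x] by (simp add: scalar_prods_def)
    qed (use mats_carrier[OF x] ab in \<open>auto simp: scalar_prods_def\<close>)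
    also have "\<dots> \<le> scalar_mat_norm \<alpha> * mnorm NMIN x * scalar_mat_norm \<beta>"
      by (intro mult_right_mono mult_left_mono min_ge[OF x f]) auto
    finally show "scalar_mat_norm (map_mat f (scalar_prods NMIN \<alpha> x \<beta>)) \<le> scalar_mat_norm \<alpha> * mnorm NMIN x * scalar_mat_norm \<beta>"
      by (simp add: e)
  qed
qed

theorem min_operator_space: "operator_space NMIN"
  unfolding operator_space_def
proof (intro conjI min_matrix_norms min_ruan)
  show "complex_vector_space NMIN" using cvs_N by (simp add: complex_vector_space_def)
  show "complete_norm (normed_space_of NMIN)"
    by (rule complete_norm_cong[OF complete_N]) (auto simp: normed_space_of_def min_one carrier_diff)
qed

text \<open>Factorisations \<open>x = A D B\<close> with \<open>D\<close> in the unit ball, \<open>A\<close> of norm at most \<open>a\<close> and \<open>B\<close> of norm at most \<open>b\<close>.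
  Separate bounds for the three factors are stable under sums and under block sums, where the norms of
  \<open>A\<close> and \<open>B\<close> have to be combined independently. Indexed families instead of matrices save the
  bookkeeping of their dimensions.\<close>

definition factorises :: "nat \<Rightarrow> 'a mat \<Rightarrow> real \<Rightarrow> real \<Rightarrow> bool" where
  "factorises n x a b \<longleftrightarrow> 0 \<le> a \<and> 0 \<le> b \<and> (\<exists>K A B d. K \<ge> 1 \<and>
     (\<forall>i<n. \<forall>j<n. x $$ (i, j) = (\<Sum>k<K. scl N (A i k * B k j) (d k))) \<and>
     (\<forall>k<K. d k \<in> car N \<and> nrm N (d k) \<le> 1) \<and>
     (\<forall>u. l2 K (\<lambda>k. \<Sum>i<n. u i * A i k) \<le> a * l2 n u) \<and>
     (\<forall>v. l2 K (\<lambda>k. \<Sum>j<n. B k j * v j) \<le> b * l2 n v))"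

lemma factorisesE:
  assumes "factorises n x a b"
  obtains K A B d where "0 \<le> a" "0 \<le> b" "K \<ge> 1"
    "\<And>i j. i < n \<Longrightarrow> j < n \<Longrightarrow> x $$ (i, j) = (\<Sum>k<K. scl N (A i k * B k j) (d k))"
    "\<And>k. k < K \<Longrightarrow> d k \<in> car N" "\<And>k. k < K \<Longrightarrow> nrm N (d k) \<le> 1"
    "\<And>u. l2 K (\<lambda>k. \<Sum>i<n. u i * A i k) \<le> a * l2 n u"
    "\<And>v. l2 K (\<lambda>k. \<Sum>j<n. B k j * v j) \<le> b * l2 n v"
proof -
  have ab: "0 \<le> a" "0 \<le> b" using assms by (simp_all add: factorises_def)
  from assms have "\<exists>K A B d. K \<ge> 1 \<and>
     (\<forall>i<n. \<forall>j<n. x $$ (i, j) = (\<Sum>k<K. scl N (A i k * B k j) (d k))) \<and>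
     (\<forall>k<K. d k \<in> car N \<and> nrm N (d k) \<le> 1) \<and>
     (\<forall>u. l2 K (\<lambda>k. \<Sum>i<n. u i * A i k) \<le> a * l2 n u) \<and>
     (\<forall>v. l2 K (\<lambda>k. \<Sum>j<n. B k j * v j) \<le> b * l2 n v)"
    unfolding factorises_def by (elim conjE)
  then obtain K A B d where *: "K \<ge> 1 \<and>
     (\<forall>i<n. \<forall>j<n. x $$ (i, j) = (\<Sum>k<K. scl N (A i k * B k j) (d k))) \<and>
     (\<forall>k<K. d k \<in> car N \<and> nrm N (d k) \<le> 1) \<and>
     (\<forall>u. l2 K (\<lambda>k. \<Sum>i<n. u i * A i k) \<le> a * l2 n u) \<and>
     (\<forall>v. l2 K (\<lambda>k. \<Sum>j<n. B k j * v j) \<le> b * l2 n v)"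
    by (elim exE) (rule that)
  show ?thesis by (rule that[of K A B d]) (use ab * in auto)
qed

lemma factorisesI:
  assumes "0 \<le> a" "0 \<le> b" "K \<ge> 1"
    "\<And>i j. i < n \<Longrightarrow> j < n \<Longrightarrow> x $$ (i, j) = (\<Sum>k<K. scl N (A i k * B k j) (d k))"
    "\<And>k. k < K \<Longrightarrow> d k \<in> car N" "\<And>k. k < K \<Longrightarrow> nrm N (d k) \<le> 1"
    "\<And>u. l2 K (\<lambda>k. \<Sum>i<n. u i * A i k) \<le> a * l2 n u"
    "\<And>v. l2 K (\<lambda>k. \<Sum>j<n. B k j * v j) \<le> b * l2 n v"
  shows "factorises n x a b"
  unfolding factorises_def using assms by blast

abbreviation max_values :: "'a mat \<Rightarrow> real set" where
  "max_values x \<equiv> {scalar_mat_norm A * (MAX i\<in>{..<k}. nrm N (D $$ (i, i))) * scalar_mat_norm B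
       | A D B k. k \<ge> 1 \<and> A \<in> carrier_mat (dim_row x) k \<and> B \<in> carrier_mat k (dim_col x) \<and>
           D \<in> mats N k \<and> diagonal_mat D \<and> x = scalar_prods N A D B}"

lemma max_mnorm: "mnorm NMAX x = Inf (max_values x)"
  by (simp add: max_os_def)

lemma max_diag_ge: "(i::nat) < k \<Longrightarrow> g i \<le> (MAX i\<in>{..<k}. g i)" for g :: "nat \<Rightarrow> real"
  by (rule Max_ge) auto

lemma max_diag_nonneg:
  assumes "k \<ge> 1" "D \<in> mats N k"
  shows "0 \<le> (MAX i\<in>{..<k}. nrm N (D $$ (i, i)))"
proof -
  have k: "0 < k" using assms(1) by linarith
  have "0 \<le> nrm N (D $$ (0, 0))" by (rule nrm_nonneg[OF matsD[OF assms(2) k k]])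
  then show ?thesis using max_diag_ge[OF k, of "\<lambda>i. nrm N (D $$ (i, i))"] by simp
qed

lemma max_values_nonneg: "v \<in> max_values x \<Longrightarrow> 0 \<le> v"
  using max_diag_nonneg by auto

lemma max_values_bdd: "bdd_below (max_values x)"
  by (rule bdd_belowI[of _ 0]) (rule max_values_nonneg)

lemma scalar_prods_diag:
  assumes "A \<in> carrier_mat n k" "B \<in> carrier_mat k n" "D \<in> carrier_mat k k" "diagonal_mat D" "i < n" "j < n"
  shows "scalar_prods N A D B $$ (i, j) = (\<Sum>l<k. scl N (A $$ (i, l) * B $$ (l, j)) (D $$ (l, l)))"
proof -
  have "(\<Sum>m<k. scl N (A $$ (i, l) * B $$ (m, j)) (D $$ (l, m))) = scl N (A $$ (i, l) * B $$ (l, j)) (D $$ (l, l))"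
    if l: "l < k" for l
  proof -
    have "(\<Sum>m<k. scl N (A $$ (i, l) * B $$ (m, j)) (D $$ (l, m))) = (\<Sum>m\<in>{l}. scl N (A $$ (i, l) * B $$ (m, j)) (D $$ (l, m)))"
      using assms l by (intro sum.mono_neutral_right) (auto simp: diagonal_mat_def)
    then show ?thesis by simp
  qed
  then show ?thesis using assms by (simp add: scalar_prods_def)
qed

lemma max_le_factorises:
  assumes x: "x \<in> mats N n" and f: "factorises n x a b"
  shows "mnorm NMAX x \<le> a * b" "max_values x \<noteq> {}"
proof -
  obtain K A B d where f: "0 \<le> a" "0 \<le> b" "K \<ge> 1"
    "\<And>i j. i < n \<Longrightarrow> j < n \<Longrightarrow> x $$ (i, j) = (\<Sum>k<K. scl N (A i k * B k j) (d k))"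
    "\<And>k. k < K \<Longrightarrow> d k \<in> car N" "\<And>k. k < K \<Longrightarrow> nrm N (d k) \<le> 1"
    "\<And>u. l2 K (\<lambda>k. \<Sum>i<n. u i * A i k) \<le> a * l2 n u"
    "\<And>v. l2 K (\<lambda>k. \<Sum>j<n. B k j * v j) \<le> b * l2 n v"
    by (rule factorisesE[OF f]) (rule that)
  let ?A = "mat n K (\<lambda>(i, k). A i k)" and ?B = "mat K n (\<lambda>(k, j). B k j)"
  let ?D = "mat K K (\<lambda>(k, l). if k = l then d k else 0)"
  have D: "?D \<in> mats N K" "diagonal_mat ?D" using f(5) carrier_zero by (auto intro!: matsI simp: diagonal_mat_def)
  have e: "x = scalar_prods N ?A ?D ?B"
  proof (rule eq_matI)
    fix i j assume "i < dim_row (scalar_prods N ?A ?D ?B)" "j < dim_col (scalar_prods N ?A ?D ?B)"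
    then have "i < n" "j < n" by (simp_all add: scalar_prods_def)
    then show "x $$ (i, j) = scalar_prods N ?A ?D ?B $$ (i, j)"
      by (subst scalar_prods_diag[OF _ _ _ D(2)]) (auto simp: f(4))
  qed (use mats_dim[OF x] in \<open>auto simp: scalar_prods_def\<close>)
  have v: "scalar_mat_norm ?A * (MAX i\<in>{..<K}. nrm N (?D $$ (i, i))) * scalar_mat_norm ?B \<in> max_values x"
    using f(3) D e mats_dim[OF x] by (intro CollectI) (rule exI[of _ ?A], rule exI[of _ ?D], rule exI[of _ ?B], rule exI[of _ K], auto)
  then show "max_values x \<noteq> {}" by blast
  have "scalar_mat_norm ?A \<le> a"
  proof (rule scalar_mat_norm_leI[OF f(1)])
    fix u v :: "nat \<Rightarrow> complex"
    have "cmod (bilin ?A u v) \<le> l2 K (\<lambda>k. \<Sum>i<n. u i * A i k) * l2 K v"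
      using Cauchy_Schwarz_l2[where n = K and u = "\<lambda>k. \<Sum>i<n. u i * A i k" and v = v] by (simp add: bilin_eq')
    also have "\<dots> \<le> a * l2 n u * l2 K v" using f(7) by (intro mult_right_mono) auto
    finally show "cmod (bilin ?A u v) \<le> a * l2 (dim_row ?A) u * l2 (dim_col ?A) v" by simp
  qed
  moreover have "scalar_mat_norm ?B \<le> b"
  proof (rule scalar_mat_norm_leI[OF f(2)])
    fix u v :: "nat \<Rightarrow> complex"
    have "cmod (bilin ?B u v) \<le> l2 K u * l2 K (\<lambda>k. \<Sum>j<n. B k j * v j)"
      using Cauchy_Schwarz_l2[where n = K and u = u and v = "\<lambda>k. \<Sum>j<n. B k j * v j"] by (simp add: bilin_eq)
    also have "\<dots> \<le> l2 K u * (b * l2 n v)" using f(8) by (intro mult_left_mono) auto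
    finally show "cmod (bilin ?B u v) \<le> b * l2 (dim_row ?B) u * l2 (dim_col ?B) v" by (simp add: ac_simps)
  qed
  moreover have "(MAX i\<in>{..<K}. nrm N (?D $$ (i, i))) \<le> 1"
    using f(3,6) by (subst Max_le_iff) (auto simp: lessThan_empty_iff)
  ultimately have "scalar_mat_norm ?A * (MAX i\<in>{..<K}. nrm N (?D $$ (i, i))) * scalar_mat_norm ?B \<le> a * 1 * b"
    using f(1) max_diag_nonneg[OF f(3) D(1)] by (intro mult_mono) auto
  moreover have "mnorm NMAX x \<le> scalar_mat_norm ?A * (MAX i\<in>{..<K}. nrm N (?D $$ (i, i))) * scalar_mat_norm ?B"
    unfolding max_mnorm using v max_values_nonneg by (intro cInf_lower bdd_belowI[of _ 0])
  ultimately show "mnorm NMAX x \<le> a * b" by simp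
qed

lemma factorises_zero:
  assumes "\<And>i j. i < n \<Longrightarrow> j < n \<Longrightarrow> x $$ (i, j) = 0" "0 \<le> a" "0 \<le> b"
  shows "factorises n x a b"
  by (rule factorisesI[of _ _ 1 _ _ "\<lambda>_ _. 0" "\<lambda>_ _. 0" "\<lambda>_. 0"])
    (use assms carrier_zero nrm_zero in \<open>auto simp: l2_def L2_set_def intro!: mult_nonneg_nonneg sum_nonneg\<close>)

text \<open>The trivial factorisation has one diagonal entry for every pair \<open>(i, j)\<close>, coded as \<open>k = i * n + j\<close>.\<close>

lemma max_values_nonempty:
  assumes x: "x \<in> mats N n" and n: "n \<ge> 1"
  shows "max_values x \<noteq> {}"
proof -
  let ?A = "mat n (n * n) (\<lambda>(i, k). if k div n = i then 1 else (0::complex))"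
  let ?B = "mat (n * n) n (\<lambda>(k, j). if k mod n = j then 1 else (0::complex))"
  let ?D = "mat (n * n) (n * n) (\<lambda>(k, l). if k = l then x $$ (k div n, k mod n) else 0)"
  have dm: "k div n < n" "k mod n < n" if "k < n * n" for k using that n by (auto simp: less_mult_imp_div_less)
  have D: "?D \<in> mats N (n * n)" "diagonal_mat ?D"
    using matsD[OF x] carrier_zero dm by (auto intro!: matsI simp: diagonal_mat_def)
  have "x = scalar_prods N ?A ?D ?B"
  proof (rule eq_matI)
    fix i j assume "i < dim_row (scalar_prods N ?A ?D ?B)" "j < dim_col (scalar_prods N ?A ?D ?B)"
    then have ij: "i < n" "j < n" by (simp_all add: scalar_prods_def)
    have lt: "i * n + j < n * n"
    proof -
      have "i * n + j < i * n + n" using ij by simp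
      also have "\<dots> \<le> n * n" using ij mult_le_mono1[of "Suc i" n n] by simp
      finally show ?thesis .
    qed
    have iff: "k div n = i \<and> k mod n = j \<longleftrightarrow> k = i * n + j" for k using ij by auto
    have "scalar_prods N ?A ?D ?B $$ (i, j) = (\<Sum>k<n * n. if k = i * n + j then x $$ (i, j) else 0)"
    proof (subst scalar_prods_diag[OF _ _ _ D(2)])
      have "scl N ((if k div n = i then 1 else 0) * (if k mod n = j then 1 else 0)) (x $$ (k div n, k mod n))
          = (if k = i * n + j then x $$ (i, j) else 0)" for k
        using iff[of k] by (cases "k div n = i"; cases "k mod n = j") auto
      then show "(\<Sum>l<n * n. scl N (?A $$ (i, l) * ?B $$ (l, j)) (?D $$ (l, l))) = (\<Sum>k<n * n. if k = i * n + j then x $$ (i, j) else 0)"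
        using ij by (intro sum.cong) auto
    qed (use ij in auto)
    then show "x $$ (i, j) = scalar_prods N ?A ?D ?B $$ (i, j)" using lt by simp
  qed (use mats_dim[OF x] in \<open>auto simp: scalar_prods_def\<close>)
  then have "scalar_mat_norm ?A * (MAX i\<in>{..<n * n}. nrm N (?D $$ (i, i))) * scalar_mat_norm ?B \<in> max_values x"
    using mult_le_mono[OF n n] D mats_dim[OF x] by (intro CollectI) (rule exI[of _ ?A], rule exI[of _ ?D], rule exI[of _ ?B], rule exI[of _ "n * n"], auto)
  then show ?thesis by blast
qed

lemma max_nonneg: "x \<in> mats N n \<Longrightarrow> n \<ge> 1 \<Longrightarrow> 0 \<le> mnorm NMAX x"
  unfolding max_mnorm by (rule cInf_greatest[OF max_values_nonempty max_values_nonneg])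

text \<open>The product of the three norms is less than \<open>R\<close>; rescaling distributes it so that \<open>D\<close> becomes a
  contraction and both outer factors are bounded by \<open>sqrt R\<close>. This fails only if one of the norms is
  zero, and then \<open>x = 0\<close>.\<close>

lemma max_less_factorises:
  assumes x: "x \<in> mats N n" and n: "n \<ge> 1" and R: "mnorm NMAX x < R"
  shows "factorises n x (sqrt R) (sqrt R)"
proof -
  have R0: "R > 0" using R max_nonneg[OF x n] by simp
  have "\<exists>v\<in>max_values x. v < R"
    using R unfolding max_mnorm cInf_less_iff[OF max_values_nonempty[OF x n] max_values_bdd] .
  then obtain A D B k where f: "k \<ge> 1" "A \<in> carrier_mat n k" "B \<in> carrier_mat k n" "D \<in> mats N k"
      "diagonal_mat D" "x = scalar_prods N A D B"
      and lt: "scalar_mat_norm A * (MAX i\<in>{..<k}. nrm N (D $$ (i, i))) * scalar_mat_norm B < R"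
    using mats_dim[OF x] by auto
  define a where "a = scalar_mat_norm A"
  define b where "b = scalar_mat_norm B"
  define M where "M = (MAX i\<in>{..<k}. nrm N (D $$ (i, i)))"
  have nn: "a \<ge> 0" "b \<ge> 0" "M \<ge> 0" using max_diag_nonneg[OF f(1,4)] by (simp_all add: a_def b_def M_def)
  have dM: "nrm N (D $$ (l, l)) \<le> M" if "l < k" for l unfolding M_def using that by (rule max_diag_ge)
  have dc: "D $$ (l, l) \<in> car N" if "l < k" for l using that by (intro matsD[OF f(4)])
  have xe: "x $$ (i, j) = (\<Sum>l<k. scl N (A $$ (i, l) * B $$ (l, j)) (D $$ (l, l)))" if "i < n" "j < n" for i j
    unfolding f(6) using scalar_prods_diag[OF f(2,3) mats_carrier[OF f(4)] f(5) that] .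
  show ?thesis
  proof (cases "a = 0 \<or> b = 0 \<or> M = 0")
    case True
    have "scl N (A $$ (i, l) * B $$ (l, j)) (D $$ (l, l)) = 0" if "i < n" "j < n" "l < k" for i j l
    proof -
      have "a = 0 \<Longrightarrow> A $$ (i, l) = 0" using entry_le_scalar_mat_norm[of i A l] f(2) that by (simp add: a_def)
      moreover have "b = 0 \<Longrightarrow> B $$ (l, j) = 0" using entry_le_scalar_mat_norm[of l B j] f(3) that by (simp add: b_def)
      moreover have "M = 0 \<Longrightarrow> D $$ (l, l) = 0"
        using dM[OF that(3)] nrm_nonneg[OF dc[OF that(3)]] nrm_eq_0[OF dc[OF that(3)]] by simp
      ultimately show ?thesis using True by auto
    qed
    then show ?thesis using R0 by (intro factorises_zero) (auto simp: xe intro!: sum.neutral)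
  next
    case False
    then have pos: "a > 0" "b > 0" "M > 0" using nn by auto
    define s where "s = sqrt R / a"
    define t where "t = M * a / sqrt R"
    have st: "s > 0" "t > 0" "s * t = M" "s * a = sqrt R" using pos R0 by (auto simp: s_def t_def)
    have tb: "t * b \<le> sqrt R"
    proof -
      have "a * M * b \<le> sqrt R * sqrt R" using lt R0 by (simp add: a_def b_def M_def)
      then show ?thesis using R0 by (simp add: t_def divide_le_eq ac_simps)
    qed
    show ?thesis
    proof (rule factorisesI[of _ _ k _ _ "\<lambda>i l. complex_of_real s * A $$ (i, l)" "\<lambda>l j. complex_of_real t * B $$ (l, j)"
          "\<lambda>l. scl N (complex_of_real (1 / M)) (D $$ (l, l))"])
      show "0 \<le> sqrt R" "0 \<le> sqrt R" "k \<ge> 1" using R0 f(1) by auto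
      fix i j assume ij: "i < n" "j < n"
      have "complex_of_real s * A $$ (i, l) * (complex_of_real t * B $$ (l, j)) * complex_of_real (1 / M) = A $$ (i, l) * B $$ (l, j)" for l
      proof -
        have "complex_of_real s * complex_of_real t * complex_of_real (1 / M) = 1"
          using st(3) pos(3) by (simp only: of_real_mult[symmetric]) simp
        then show ?thesis by (metis (no_types, opaque_lifting) mult.assoc mult.commute mult.right_neutral)
      qed
      then show "x $$ (i, j) = (\<Sum>l<k. scl N (complex_of_real s * A $$ (i, l) * (complex_of_real t * B $$ (l, j))) (scl N (complex_of_real (1 / M)) (D $$ (l, l))))"
        unfolding xe[OF ij] vs.scale_scale by simp
    next
      fix l assume l: "l < k"
      show "scl N (complex_of_real (1 / M)) (D $$ (l, l)) \<in> car N" by (intro carrier_scale dc l)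
      show "nrm N (scl N (complex_of_real (1 / M)) (D $$ (l, l))) \<le> 1"
        unfolding nrm_scale[OF dc[OF l]] using dM[OF l] pos(3) by (simp add: norm_divide divide_le_eq)
    next
      fix u :: "nat \<Rightarrow> complex"
      have "l2 k (\<lambda>l. \<Sum>i<n. u i * (complex_of_real s * A $$ (i, l))) = s * l2 k (\<lambda>l. \<Sum>i<n. u i * A $$ (i, l))"
        using l2_scale[of k "complex_of_real s" "\<lambda>l. \<Sum>i<n. u i * A $$ (i, l)"] st(1)
        by (simp add: sum_distrib_left ac_simps)
      also have "\<dots> \<le> s * (a * l2 n u)" using l2_vec_mat_le[of A u] f(2) st(1) by (intro mult_left_mono) (auto simp: a_def)
      also have "\<dots> = sqrt R * l2 n u" by (simp only: mult.assoc[symmetric] st(4))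
      finally show "l2 k (\<lambda>l. \<Sum>i<n. u i * (complex_of_real s * A $$ (i, l))) \<le> sqrt R * l2 n u" .
    next
      fix v :: "nat \<Rightarrow> complex"
      have "l2 k (\<lambda>l. \<Sum>j<n. complex_of_real t * B $$ (l, j) * v j) = t * l2 k (\<lambda>l. \<Sum>j<n. B $$ (l, j) * v j)"
        using l2_scale[of k "complex_of_real t" "\<lambda>l. \<Sum>j<n. B $$ (l, j) * v j"] st(2)
        by (simp add: sum_distrib_left ac_simps)
      also have "\<dots> \<le> t * (b * l2 n v)" using l2_mat_vec_le[of B v] f(3) st(2) by (intro mult_left_mono) (auto simp: b_def)
      also have "\<dots> \<le> sqrt R * l2 n v" using tb by (simp add: mult.assoc[symmetric] mult_right_mono)
      finally show "l2 k (\<lambda>l. \<Sum>j<n. complex_of_real t * B $$ (l, j) * v j) \<le> sqrt R * l2 n v" .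
    qed
  qed
qed

lemma max_leI:
  assumes x: "x \<in> mats N n" and f: "\<And>e. e > 0 \<Longrightarrow> factorises n x (sqrt (R + e)) (sqrt (R + e))" and R: "0 \<le> R"
  shows "mnorm NMAX x \<le> R"
proof (rule field_le_epsilon)
  fix e :: real assume "e > 0"
  then show "mnorm NMAX x \<le> R + e" using max_le_factorises(1)[OF x f[of e]] R by simp
qed

text \<open>The Cauchy--Schwarz inequality for the \<open>i\<close>-th row of \<open>A\<close> and the \<open>j\<close>-th column of \<open>B\<close>.\<close>

lemma factorises_entry:
  assumes f: "factorises n x a b" and ij: "i < n" "j < n"
  shows "nrm N (x $$ (i, j)) \<le> a * b"
proof -
  obtain K A B d where f: "0 \<le> a" "0 \<le> b" "K \<ge> 1"
    "\<And>i j. i < n \<Longrightarrow> j < n \<Longrightarrow> x $$ (i, j) = (\<Sum>k<K. scl N (A i k * B k j) (d k))"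
    "\<And>k. k < K \<Longrightarrow> d k \<in> car N" "\<And>k. k < K \<Longrightarrow> nrm N (d k) \<le> 1"
    "\<And>u. l2 K (\<lambda>k. \<Sum>i<n. u i * A i k) \<le> a * l2 n u"
    "\<And>v. l2 K (\<lambda>k. \<Sum>j<n. B k j * v j) \<le> b * l2 n v"
    by (rule factorisesE[OF f]) (rule that)
  let ?u = "\<lambda>k. if k = i then 1 else (0::complex)" and ?v = "\<lambda>k. if k = j then 1 else (0::complex)"
  have 1: "(\<Sum>i'<n. ?u i' * A i' k) = A i k" for k using ij by (simp add: if_distrib[of "\<lambda>x. x * _"] cong: if_cong)
  have 2: "(\<Sum>j'<n. B k j' * ?v j') = B k j" for k using ij by (simp add: if_distrib[of "\<lambda>x. _ * x"] cong: if_cong)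
  have A: "l2 K (\<lambda>k. A i k) \<le> a" using f(7)[of ?u] l2_single[OF ij(1), of 1] unfolding 1 by simp
  have B: "l2 K (\<lambda>k. B k j) \<le> b" using f(8)[of ?v] l2_single[OF ij(2), of 1] unfolding 2 by simp
  have "nrm N (x $$ (i, j)) \<le> (\<Sum>k<K. nrm N (scl N (A i k * B k j) (d k)))"
    unfolding f(4)[OF ij] by (intro nrm_sum carrier_scale f(5)) simp
  also have "\<dots> \<le> (\<Sum>k<K. \<bar>cmod (A i k)\<bar> * \<bar>cmod (B k j)\<bar>)"
    by (intro sum_mono) (simp add: nrm_scale f norm_mult mult_left_le)
  also have "\<dots> \<le> l2 K (\<lambda>k. A i k) * l2 K (\<lambda>k. B k j)" unfolding l2_def by (rule L2_set_mult_ineq)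
  also have "\<dots> \<le> a * b" using A B f(1) by (intro mult_mono) auto
  finally show ?thesis .
qed

lemma max_entry:
  assumes x: "x \<in> mats N n" and ij: "i < n" "j < n"
  shows "nrm N (x $$ (i, j)) \<le> mnorm NMAX x"
proof (rule field_le_epsilon)
  fix e :: real assume "e > 0"
  moreover have n: "n \<ge> 1" using ij by simp
  ultimately show "nrm N (x $$ (i, j)) \<le> mnorm NMAX x + e"
    using factorises_entry[OF max_less_factorises[OF x n, of "mnorm NMAX x + e"] ij] max_nonneg[OF x n] by simp
qed

lemma max_one: "x \<in> car N \<Longrightarrow> mnorm NMAX (mat 1 1 (\<lambda>_. x)) = nrm N x"
proof (rule antisym)
  assume x: "x \<in> car N"
  then have m: "mat 1 1 (\<lambda>_. x) \<in> mats N 1" by (auto intro: matsI)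
  show "nrm N x \<le> mnorm NMAX (mat 1 1 (\<lambda>_. x))" using max_entry[OF m, of 0 0] by simp
  let ?r = "nrm N x"
  show "mnorm NMAX (mat 1 1 (\<lambda>_. x)) \<le> ?r"
  proof (cases "?r = 0")
    case True
    then have "x = 0" using nrm_eq_0[OF x] by simp
    then show ?thesis using max_le_factorises(1)[OF m factorises_zero[of 1 _ 0 0]] True by simp
  next
    case False
    then have r: "?r > 0" using nrm_nonneg[OF x] by simp
    have "factorises 1 (mat 1 1 (\<lambda>_. x)) ?r 1"
      by (rule factorisesI[of _ _ 1 _ _ "\<lambda>_ _. complex_of_real ?r" "\<lambda>_ _. 1" "\<lambda>_. scl N (complex_of_real (1 / ?r)) x"])
        (use r x in \<open>auto simp: lessThan_1 carrier_scale nrm_scale l2_def norm_mult norm_divide mult.commute\<close>)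
    then show ?thesis using max_le_factorises(1)[OF m] by fastforce
  qed
qed

text \<open>Put the factors side by side: \<open>x + y = (A A') (D \<oplus> D') (B B')\<close>. With \<open>a = b = sqrt R\<close> and
  \<open>a' = b' = sqrt R'\<close> both bounds become \<open>sqrt (R + R')\<close>, which is the triangle inequality.\<close>

lemma factorises_add:
  assumes x: "factorises n x a b" and y: "factorises n y a' b'" and dim: "x \<in> carrier_mat n n" "y \<in> carrier_mat n n"
  shows "factorises n (x + y) (sqrt (a\<^sup>2 + a'\<^sup>2)) (sqrt (b\<^sup>2 + b'\<^sup>2))"
proof -
  obtain K A B d where f: "0 \<le> a" "0 \<le> b" "K \<ge> 1"
    "\<And>i j. i < n \<Longrightarrow> j < n \<Longrightarrow> x $$ (i, j) = (\<Sum>k<K. scl N (A i k * B k j) (d k))"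
    "\<And>k. k < K \<Longrightarrow> d k \<in> car N" "\<And>k. k < K \<Longrightarrow> nrm N (d k) \<le> 1"
    "\<And>u. l2 K (\<lambda>k. \<Sum>i<n. u i * A i k) \<le> a * l2 n u"
    "\<And>v. l2 K (\<lambda>k. \<Sum>j<n. B k j * v j) \<le> b * l2 n v"
    by (rule factorisesE[OF x]) (rule that)
  obtain K' A' B' d' where g: "0 \<le> a'" "0 \<le> b'" "K' \<ge> 1"
    "\<And>i j. i < n \<Longrightarrow> j < n \<Longrightarrow> y $$ (i, j) = (\<Sum>k<K'. scl N (A' i k * B' k j) (d' k))"
    "\<And>k. k < K' \<Longrightarrow> d' k \<in> car N" "\<And>k. k < K' \<Longrightarrow> nrm N (d' k) \<le> 1"
    "\<And>u. l2 K' (\<lambda>k. \<Sum>i<n. u i * A' i k) \<le> a' * l2 n u"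
    "\<And>v. l2 K' (\<lambda>k. \<Sum>j<n. B' k j * v j) \<le> b' * l2 n v"
    by (rule factorisesE[OF y]) (rule that)
  have comb: "l2 (K + K') w \<le> sqrt (c\<^sup>2 + c'\<^sup>2) * r"
    if "l2 K w \<le> c * r" "l2 K' (\<lambda>k. w (K + k)) \<le> c' * r" "0 \<le> r" for w c c' r
  proof (rule power2_le_imp_le)
    have "(l2 (K + K') w)\<^sup>2 \<le> (c * r)\<^sup>2 + (c' * r)\<^sup>2"
      unfolding l2_add using that by (intro add_mono power_mono) auto
    also have "\<dots> = (sqrt (c\<^sup>2 + c'\<^sup>2) * r)\<^sup>2" by (simp add: power_mult_distrib algebra_simps)
    finally show "(l2 (K + K') w)\<^sup>2 \<le> (sqrt (c\<^sup>2 + c'\<^sup>2) * r)\<^sup>2" .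
  qed (use that in auto)
  have cong: "l2 K w = l2 K w'" if "\<And>k. k < K \<Longrightarrow> w k = w' k" for w w' K using that by (rule l2_cong)
  show ?thesis
  proof (rule factorisesI[of _ _ "K + K'" _ _ "\<lambda>i k. if k < K then A i k else A' i (k - K)"
        "\<lambda>k j. if k < K then B k j else B' (k - K) j" "\<lambda>k. if k < K then d k else d' (k - K)"])
    show "0 \<le> sqrt (a\<^sup>2 + a'\<^sup>2)" "0 \<le> sqrt (b\<^sup>2 + b'\<^sup>2)" "K + K' \<ge> 1" using f(3) by auto
    show "(x + y) $$ (i, j) = (\<Sum>k<K + K'. scl N ((if k < K then A i k else A' i (k - K)) * (if k < K then B k j else B' (k - K) j))
        (if k < K then d k else d' (k - K)))" if "i < n" "j < n" for i j
      using f(4)[OF that] g(4)[OF that] dim that by (simp add: sum_lessThan_add)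
    fix u :: "nat \<Rightarrow> complex"
    show "l2 (K + K') (\<lambda>k. \<Sum>i<n. u i * (if k < K then A i k else A' i (k - K))) \<le> sqrt (a\<^sup>2 + a'\<^sup>2) * l2 n u"
      by (rule comb) (use f(7)[of u] g(7)[of u] in \<open>auto cong: l2_cong\<close>)
    show "l2 (K + K') (\<lambda>k. \<Sum>j<n. (if k < K then B k j else B' (k - K) j) * u j) \<le> sqrt (b\<^sup>2 + b'\<^sup>2) * l2 n u"
      by (rule comb) (use f(8)[of u] g(8)[of u] in \<open>auto cong: l2_cong\<close>)
  qed (use f(5,6) g(5,6) in auto)
qed

lemma factorises_scale:
  assumes x: "factorises n x a b" and c: "\<And>i j. i < n \<Longrightarrow> j < n \<Longrightarrow> y $$ (i, j) = scl N c (x $$ (i, j))"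
  shows "factorises n y (cmod c * a) b"
proof -
  obtain K A B d where f: "0 \<le> a" "0 \<le> b" "K \<ge> 1"
    "\<And>i j. i < n \<Longrightarrow> j < n \<Longrightarrow> x $$ (i, j) = (\<Sum>k<K. scl N (A i k * B k j) (d k))"
    "\<And>k. k < K \<Longrightarrow> d k \<in> car N" "\<And>k. k < K \<Longrightarrow> nrm N (d k) \<le> 1"
    "\<And>u. l2 K (\<lambda>k. \<Sum>i<n. u i * A i k) \<le> a * l2 n u"
    "\<And>v. l2 K (\<lambda>k. \<Sum>j<n. B k j * v j) \<le> b * l2 n v"
    by (rule factorisesE[OF x]) (rule that)
  show ?thesis
  proof (rule factorisesI[of _ _ K _ _ "\<lambda>i k. c * A i k" B d])
    show "y $$ (i, j) = (\<Sum>k<K. scl N (c * A i k * B k j) (d k))" if "i < n" "j < n" for i j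
      unfolding c[OF that] f(4)[OF that] by (simp add: vs.scale_sum_right mult.assoc)
    fix u :: "nat \<Rightarrow> complex"
    have "l2 K (\<lambda>k. \<Sum>i<n. u i * (c * A i k)) = cmod c * l2 K (\<lambda>k. \<Sum>i<n. u i * A i k)"
      using l2_scale[of K c "\<lambda>k. \<Sum>i<n. u i * A i k"] by (simp add: sum_distrib_left ac_simps)
    also have "\<dots> \<le> cmod c * (a * l2 n u)" by (intro mult_left_mono f(7)) simp
    finally show "l2 K (\<lambda>k. \<Sum>i<n. u i * (c * A i k)) \<le> cmod c * a * l2 n u" by (simp add: mult.assoc)
  qed (use f in auto)
qed

lemma factorises_scalar_prods:
  assumes x: "factorises m x a b" and xm: "x \<in> mats N m" and ab: "\<alpha> \<in> carrier_mat n m" "\<beta> \<in> carrier_mat m n"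
  shows "factorises n (scalar_prods N \<alpha> x \<beta>) (scalar_mat_norm \<alpha> * a) (scalar_mat_norm \<beta> * b)"
proof -
  obtain K A B d where f: "0 \<le> a" "0 \<le> b" "K \<ge> 1"
    "\<And>i j. i < m \<Longrightarrow> j < m \<Longrightarrow> x $$ (i, j) = (\<Sum>k<K. scl N (A i k * B k j) (d k))"
    "\<And>k. k < K \<Longrightarrow> d k \<in> car N" "\<And>k. k < K \<Longrightarrow> nrm N (d k) \<le> 1"
    "\<And>u. l2 K (\<lambda>k. \<Sum>i<m. u i * A i k) \<le> a * l2 m u"
    "\<And>v. l2 K (\<lambda>k. \<Sum>j<m. B k j * v j) \<le> b * l2 m v"
    by (rule factorisesE[OF x]) (rule that)
  show ?thesis
  proof (rule factorisesI[of _ _ K _ _ "\<lambda>i k. \<Sum>p<m. \<alpha> $$ (i, p) * A p k" "\<lambda>k j. \<Sum>q<m. B k q * \<beta> $$ (q, j)" d])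
    fix i j assume ij: "i < n" "j < n"
    have "scalar_prods N \<alpha> x \<beta> $$ (i, j) = (\<Sum>p<m. \<Sum>q<m. \<Sum>k<K. scl N (\<alpha> $$ (i, p) * \<beta> $$ (q, j) * (A p k * B k q)) (d k))"
      using ab ij mats_dim[OF xm] f(4) by (simp add: scalar_prods_def vs.scale_sum_right)
    also have "\<dots> = (\<Sum>k<K. \<Sum>p<m. \<Sum>q<m. scl N (\<alpha> $$ (i, p) * \<beta> $$ (q, j) * (A p k * B k q)) (d k))"
      by (subst sum.swap[of _ "{..<K}" "{..<m}"], subst sum.swap[of _ "{..<K}" "{..<m}"]) simp
    also have "\<dots> = (\<Sum>k<K. scl N ((\<Sum>p<m. \<alpha> $$ (i, p) * A p k) * (\<Sum>q<m. B k q * \<beta> $$ (q, j))) (d k))"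
      by (intro sum.cong refl) (simp add: sum_product vs.scale_sum_left ac_simps)
    finally show "scalar_prods N \<alpha> x \<beta> $$ (i, j) = (\<Sum>k<K. scl N ((\<Sum>p<m. \<alpha> $$ (i, p) * A p k) * (\<Sum>q<m. B k q * \<beta> $$ (q, j))) (d k))" .
  next
    fix u :: "nat \<Rightarrow> complex"
    have "(\<Sum>i<n. u i * (\<Sum>p<m. \<alpha> $$ (i, p) * A p k)) = (\<Sum>p<m. (\<Sum>i<n. u i * \<alpha> $$ (i, p)) * A p k)" for k
      by (simp add: sum_distrib_left sum_distrib_right mult.assoc) (rule sum.swap)
    then have "l2 K (\<lambda>k. \<Sum>i<n. u i * (\<Sum>p<m. \<alpha> $$ (i, p) * A p k)) \<le> a * l2 m (\<lambda>p. \<Sum>i<n. u i * \<alpha> $$ (i, p))"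
      using f(7) by simp
    also have "\<dots> \<le> a * (scalar_mat_norm \<alpha> * l2 n u)"
      using l2_vec_mat_le[of \<alpha> u] ab f(1) by (intro mult_left_mono) auto
    finally show "l2 K (\<lambda>k. \<Sum>i<n. u i * (\<Sum>p<m. \<alpha> $$ (i, p) * A p k)) \<le> scalar_mat_norm \<alpha> * a * l2 n u" by (simp add: ac_simps)
    have "(\<Sum>j<n. (\<Sum>q<m. B k q * \<beta> $$ (q, j)) * u j) = (\<Sum>q<m. B k q * (\<Sum>j<n. \<beta> $$ (q, j) * u j))" for k
      by (simp add: sum_distrib_left sum_distrib_right mult.assoc) (rule sum.swap)
    then have "l2 K (\<lambda>k. \<Sum>j<n. (\<Sum>q<m. B k q * \<beta> $$ (q, j)) * u j) \<le> b * l2 m (\<lambda>q. \<Sum>j<n. \<beta> $$ (q, j) * u j)"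
      using f(8) by simp
    also have "\<dots> \<le> b * (scalar_mat_norm \<beta> * l2 n u)"
      using l2_mat_vec_le[of \<beta> u] ab f(2) by (intro mult_left_mono) auto
    finally show "l2 K (\<lambda>k. \<Sum>j<n. (\<Sum>q<m. B k q * \<beta> $$ (q, j)) * u j) \<le> scalar_mat_norm \<beta> * b * l2 n u" by (simp add: ac_simps)
  qed (use f in auto)
qed

lemma factorises_block:
  assumes x: "factorises n x a b" and y: "factorises m y a b" and dim: "x \<in> carrier_mat n n" "y \<in> carrier_mat m m"
  shows "factorises (n + m) (four_block_mat x (0\<^sub>m n m) (0\<^sub>m m n) y) a b"
proof -
  obtain K A B d where f: "0 \<le> a" "0 \<le> b" "K \<ge> 1"
    "\<And>i j. i < n \<Longrightarrow> j < n \<Longrightarrow> x $$ (i, j) = (\<Sum>k<K. scl N (A i k * B k j) (d k))"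
    "\<And>k. k < K \<Longrightarrow> d k \<in> car N" "\<And>k. k < K \<Longrightarrow> nrm N (d k) \<le> 1"
    "\<And>u. l2 K (\<lambda>k. \<Sum>i<n. u i * A i k) \<le> a * l2 n u"
    "\<And>v. l2 K (\<lambda>k. \<Sum>j<n. B k j * v j) \<le> b * l2 n v"
    by (rule factorisesE[OF x]) (rule that)
  obtain K' A' B' d' where g: "0 \<le> a" "0 \<le> b" "K' \<ge> 1"
    "\<And>i j. i < m \<Longrightarrow> j < m \<Longrightarrow> y $$ (i, j) = (\<Sum>k<K'. scl N (A' i k * B' k j) (d' k))"
    "\<And>k. k < K' \<Longrightarrow> d' k \<in> car N" "\<And>k. k < K' \<Longrightarrow> nrm N (d' k) \<le> 1"
    "\<And>u. l2 K' (\<lambda>k. \<Sum>i<m. u i * A' i k) \<le> a * l2 m u"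
    "\<And>v. l2 K' (\<lambda>k. \<Sum>j<m. B' k j * v j) \<le> b * l2 m v"
    by (rule factorisesE[OF y]) (rule that)
  have comb: "l2 (K + K') w \<le> c * l2 (n + m) u"
    if "l2 K w \<le> c * l2 n u" "l2 K' (\<lambda>k. w (K + k)) \<le> c * l2 m (\<lambda>i. u (n + i))" "0 \<le> c" for w c u
  proof (rule power2_le_imp_le)
    have "(l2 (K + K') w)\<^sup>2 \<le> (c * l2 n u)\<^sup>2 + (c * l2 m (\<lambda>i. u (n + i)))\<^sup>2"
      unfolding l2_add using that by (intro add_mono power_mono) auto
    also have "\<dots> = (c * l2 (n + m) u)\<^sup>2" by (simp only: power_mult_distrib l2_add distrib_left)
    finally show "(l2 (K + K') w)\<^sup>2 \<le> (c * l2 (n + m) u)\<^sup>2" .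
  qed (use that in auto)
  let ?A = "\<lambda>i k. if i < n then (if k < K then A i k else 0) else (if k < K then 0 else A' (i - n) (k - K))"
  let ?B = "\<lambda>k j. if j < n then (if k < K then B k j else 0) else (if k < K then 0 else B' (k - K) (j - n))"
  show ?thesis
  proof (rule factorisesI[of _ _ "K + K'" _ _ ?A ?B "\<lambda>k. if k < K then d k else d' (k - K)"])
    fix i j assume ij: "i < n + m" "j < n + m"
    have e: "(\<Sum>k<K + K'. scl N (?A i k * ?B k j) (if k < K then d k else d' (k - K))) =
      (if i < n \<and> j < n then x $$ (i, j) else if i \<ge> n \<and> j \<ge> n then y $$ (i - n, j - n) else 0)"
      unfolding sum_lessThan_add using f(4)[of i j] g(4)[of "i - n" "j - n"] ij by auto
    show "four_block_mat x (0\<^sub>m n m) (0\<^sub>m m n) y $$ (i, j) = (\<Sum>k<K + K'. scl N (?A i k * ?B k j) (if k < K then d k else d' (k - K)))"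
      unfolding e using dim ij by auto
  next
    fix u :: "nat \<Rightarrow> complex"
    show "l2 (K + K') (\<lambda>k. \<Sum>i<n + m. u i * ?A i k) \<le> a * l2 (n + m) u"
      by (rule comb) (use f(1) f(7)[of u] g(7)[of "\<lambda>i. u (n + i)"] in \<open>auto simp: sum_lessThan_add cong: l2_cong\<close>)
    show "l2 (K + K') (\<lambda>k. \<Sum>j<n + m. ?B k j * u j) \<le> b * l2 (n + m) u"
      by (rule comb) (use f(2) f(8)[of u] g(8)[of "\<lambda>i. u (n + i)"] in \<open>auto simp: sum_lessThan_add cong: l2_cong\<close>)
  qed (use f g in auto)
qed

lemma max_matrix_norms: "matrix_norms NMAX"
proof (rule matrix_normsI; (unfold mats_max)?)
  show "complex_vector_space NMAX" using cvs_N by (simp add: complex_vector_space_def)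
next
  fix n :: nat and x assume n: "n \<ge> 1" and x: "x \<in> mats N n"
  show nn: "0 \<le> mnorm NMAX x" by (rule max_nonneg[OF x n])
  show "x = 0\<^sub>m n n" if "mnorm NMAX x = 0"
  proof (rule eq_matI)
    fix i j assume ij: "i < dim_row (0\<^sub>m n n :: 'a mat)" "j < dim_col (0\<^sub>m n n :: 'a mat)"
    then have "nrm N (x $$ (i, j)) \<le> 0" "x $$ (i, j) \<in> car N" using max_entry[OF x, of i j] matsD[OF x] that by auto
    then show "x $$ (i, j) = 0\<^sub>m n n $$ (i, j)" using nrm_nonneg[of "x $$ (i, j)"] nrm_eq_0[of "x $$ (i, j)"] ij by simp
  qed (use mats_dim[OF x] in auto)
  fix c
  have cx: "map_mat (scl N c) x \<in> mats N n" using x by (auto simp: mats_iff carrier_scale)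
  have *: "mnorm NMAX (map_mat (scl N c) x) \<le> cmod c * R" if "R > mnorm NMAX x" for R
  proof -
    have "factorises n (map_mat (scl N c) x) (cmod c * sqrt R) (sqrt R)"
      using mats_dim[OF x] by (intro factorises_scale[OF max_less_factorises[OF x n that]]) auto
    from max_le_factorises(1)[OF cx this] show ?thesis using that nn by (simp add: mult.assoc)
  qed
  have "((\<lambda>R. cmod c * R) \<longlongrightarrow> cmod c * mnorm NMAX x) (at_right (mnorm NMAX x))"
    by (intro tendsto_intros)
  then show "mnorm NMAX (map_mat (scl NMAX c) x) \<le> cmod c * mnorm NMAX x"
    using * by (intro tendsto_lowerbound) (auto simp: eventually_at_right_field intro!: exI[of _ "mnorm NMAX x + 1"])
next
  fix n :: nat and x y assume n: "n \<ge> 1" and x: "x \<in> mats N n" and y: "y \<in> mats N n"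
  have xy: "x + y \<in> mats N n" using x y by (auto simp: mats_iff carrier_add)
  note nn = max_nonneg[OF x n] max_nonneg[OF y n]
  show "mnorm NMAX (x + y) \<le> mnorm NMAX x + mnorm NMAX y"
  proof (rule max_leI[OF xy])
    fix e :: real assume e: "e > 0"
    have "factorises n (x + y) (sqrt ((sqrt (mnorm NMAX x + e/2))\<^sup>2 + (sqrt (mnorm NMAX y + e/2))\<^sup>2)) (sqrt ((sqrt (mnorm NMAX x + e/2))\<^sup>2 + (sqrt (mnorm NMAX y + e/2))\<^sup>2))"
      using e x y by (intro factorises_add max_less_factorises n) (auto dest: mats_carrier)
    then show "factorises n (x + y) (sqrt (mnorm NMAX x + mnorm NMAX y + e)) (sqrt (mnorm NMAX x + mnorm NMAX y + e))"
      using nn e by (simp add: ac_simps)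
  qed (use nn in simp)
qed

lemma max_ruan: "ruan_axioms NMAX"
proof (rule ruan_axiomsI; (unfold mats_max)?)
  show "complex_vector_space NMAX" using cvs_N by (simp add: complex_vector_space_def)
  show "0 \<le> mnorm NMAX x" if "n \<ge> 1" "x \<in> mats N n" for x n by (rule max_nonneg[OF that(2,1)])
next
  fix n m :: nat and x y assume n: "n \<ge> 1" and m: "m \<ge> 1" and x: "x \<in> mats N n" and y: "y \<in> mats N m"
  let ?M = "max (mnorm NMAX x) (mnorm NMAX y)"
  show "mnorm NMAX (four_block_mat x (0\<^sub>m n m) (0\<^sub>m m n) y) \<le> ?M"
  proof (rule max_leI)
    show "four_block_mat x (0\<^sub>m n m) (0\<^sub>m m n) y \<in> mats N (n + m)"
      using x y by (auto simp: mats_iff four_block_mat_def Let_def carrier_zero)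
    show "factorises (n + m) (four_block_mat x (0\<^sub>m n m) (0\<^sub>m m n) y) (sqrt (?M + e)) (sqrt (?M + e))" if "e > 0" for e
      using that by (intro factorises_block max_less_factorises x y n m mats_carrier[OF x] mats_carrier[OF y]) auto
  qed (use max_nonneg[OF x n] in simp)
next
  fix n m :: nat and x and \<alpha> \<beta> :: "complex mat" assume n: "n \<ge> 1" and m: "m \<ge> 1" and x: "x \<in> mats N m"
    and ab: "\<alpha> \<in> carrier_mat n m" "\<beta> \<in> carrier_mat m n"
  have e: "scalar_prods NMAX = scalar_prods N" by (rule scalar_prods_scl_cong) simp
  let ?c = "scalar_mat_norm \<alpha> * scalar_mat_norm \<beta>"
  have ax: "scalar_prods N \<alpha> x \<beta> \<in> mats N n"
    using x ab by (auto simp: mats_iff scalar_prods_def intro!: carrier_sum carrier_scale)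
  have *: "mnorm NMAX (scalar_prods N \<alpha> x \<beta>) \<le> ?c * R" if R: "R > mnorm NMAX x" for R
  proof -
    have "mnorm NMAX (scalar_prods N \<alpha> x \<beta>) \<le> (scalar_mat_norm \<alpha> * sqrt R) * (scalar_mat_norm \<beta> * sqrt R)"
      by (rule max_le_factorises(1)[OF ax factorises_scalar_prods[OF max_less_factorises[OF x m R] x ab]])
    also have "\<dots> = ?c * (sqrt R * sqrt R)" by (simp add: ac_simps)
    also have "sqrt R * sqrt R = R" using R max_nonneg[OF x m] by simp
    finally show ?thesis .
  qed
  have "((\<lambda>R. ?c * R) \<longlongrightarrow> ?c * mnorm NMAX x) (at_right (mnorm NMAX x))"
    by (intro tendsto_intros)
  then have "mnorm NMAX (scalar_prods N \<alpha> x \<beta>) \<le> ?c * mnorm NMAX x"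
    using * by (intro tendsto_lowerbound) (auto simp: eventually_at_right_field intro!: exI[of _ "mnorm NMAX x + 1"])
  then show "mnorm NMAX (scalar_prods NMAX \<alpha> x \<beta>) \<le> scalar_mat_norm \<alpha> * mnorm NMAX x * scalar_mat_norm \<beta>"
    by (simp add: e ac_simps)
qed

theorem max_operator_space: "operator_space NMAX"
  unfolding operator_space_def
proof (intro conjI max_matrix_norms max_ruan)
  show "complex_vector_space NMAX" using cvs_N by (simp add: complex_vector_space_def)
  show "complete_norm (normed_space_of NMAX)"
    by (rule complete_norm_cong[OF complete_N]) (auto simp: normed_space_of_def max_one carrier_diff)
qed

theorem min_max_couple: "couple N NMIN NMAX"
  by (intro couple.intro couple_axioms.intro banach_axioms min_operator_space max_operator_space)
    (auto simp: min_one max_one)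

end

section \<open>The space of p-summable sequences\<close>

lemma powr_convex_nonneg:
  assumes p: "p \<ge> 1"
  shows "convex_on {0..} (\<lambda>x::real. x powr p)"
proof (rule convex_onI)
  fix t x y :: real assume t: "0 < t" "t < 1" and xy: "x \<in> {0..}" "y \<in> {0..}"
  have one: "u powr p \<le> u" if "0 < u" "u < 1" for u :: real
    using powr_mono'[of 1 p u] that p by simp
  show "((1 - t) *\<^sub>R x + t *\<^sub>R y) powr p \<le> (1 - t) * x powr p + t * y powr p"
  proof (cases "x = 0 \<or> y = 0")
    case True
    then show ?thesis
    proof
      assume "x = 0"
      then show ?thesis using t xy one[OF t] by (simp add: powr_mult mult_right_mono)
    next
      assume "y = 0"
      then show ?thesis using t xy one[of "1 - t"] by (simp add: powr_mult mult_right_mono)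
    qed
  next
    case False
    then show ?thesis using convex_onD[OF powr_convex[OF p], of t x y] t xy by simp
  qed
qed (simp add: convex_real_interval)

locale lp =
  fixes p :: real
  assumes p: "1 < p"
begin

abbreviation "L \<equiv> lp_space p"

lemma lp_simps [simp]: "scl L = (\<lambda>c x n. c * x n)" "x \<in> car L \<longleftrightarrow> summable (\<lambda>n. cmod (x n) powr p)"
  by (simp_all add: lp_space_def)

lemma lp_nrm: "nrm L x = (\<Sum>n. cmod (x n) powr p) powr (1 / p)"
  by (simp add: lp_space_def)

lemma lp_nrm_nonneg [simp]: "0 \<le> nrm L x"
  by (simp add: lp_nrm)

lemma lp_nrm_powr: "x \<in> car L \<Longrightarrow> nrm L x powr p = (\<Sum>n. cmod (x n) powr p)"
  using p by (simp add: lp_nrm powr_powr suminf_nonneg)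

lemma le_of_powr_le: "0 \<le> b \<Longrightarrow> a powr p \<le> b powr p \<Longrightarrow> a \<le> b"
  using p powr_less_mono2[of p b a] by (cases "a \<le> b") auto

lemma lp_partial_sum:
  assumes "x \<in> car L" "finite A"
  shows "(\<Sum>n\<in>A. cmod (x n) powr p) \<le> nrm L x powr p"
  unfolding lp_nrm_powr[OF assms(1)] using assms by (intro sum_le_suminf) auto

lemma lp_leI:
  assumes C: "0 \<le> C" and le: "\<And>m. (\<Sum>n<m. cmod (x n) powr p) \<le> C powr p"
  shows "x \<in> car L" "nrm L x \<le> C"
proof -
  show x: "x \<in> car L"
  proof (unfold lp_simps, rule bounded_imp_summable)
    show "(\<Sum>n\<le>m. cmod (x n) powr p) \<le> C powr p" for m
      using le[of "Suc m"] unfolding lessThan_Suc_atMost .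
  qed simp
  then have "(\<Sum>n. cmod (x n) powr p) \<le> C powr p"
    using le by (intro suminf_le_const) auto
  then have "nrm L x \<le> (C powr p) powr (1 / p)"
    unfolding lp_nrm using p x by (intro powr_mono2) (auto intro: suminf_nonneg)
  then show "nrm L x \<le> C" using C p by (simp add: powr_powr)
qed

lemma lp_coord: "x \<in> car L \<Longrightarrow> cmod (x n) \<le> nrm L x"
proof -
  assume x: "x \<in> car L"
  have "cmod (x n) powr p \<le> nrm L x powr p" using lp_partial_sum[OF x, of "{n}"] by simp
  then show ?thesis by (rule le_of_powr_le[rotated]) simp
qed

text \<open>Minkowski's inequality, from the convexity of the \<open>p\<close>-th power.\<close>

lemma lp_add:
  assumes x: "x \<in> car L" and y: "y \<in> car L"
  shows "x + y \<in> car L" "nrm L (x + y) \<le> nrm L x + nrm L y"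
proof -
  have key: "(\<Sum>n<m. cmod ((x + y) n) powr p) \<le> (a + b) powr p"
    if a: "a > 0" "nrm L x \<le> a" and b: "b > 0" "nrm L y \<le> b" for a b m
  proof -
    define t where "t = b / (a + b)"
    have t: "0 \<le> t" "t \<le> 1" "1 - t = a / (a + b)" using a b by (auto simp: t_def field_simps)
    have "cmod ((x + y) n) powr p \<le> (a + b) powr p * ((1 - t) * (cmod (x n) / a) powr p + t * (cmod (y n) / b) powr p)" for n
    proof -
      have "cmod ((x + y) n) \<le> cmod (x n) + cmod (y n)" by (simp add: norm_triangle_ineq)
      also have "\<dots> = (a + b) * ((1 - t) * (cmod (x n) / a) + t * (cmod (y n) / b))"
      proof -
        have "(a + b) * (a / (a + b) * (cmod (x n) / a)) = cmod (x n)"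
          "(a + b) * (b / (a + b) * (cmod (y n) / b)) = cmod (y n)" using a b by simp_all
        then show ?thesis unfolding t(3) distrib_left by (simp add: t_def)
      qed
      finally have "cmod ((x + y) n) powr p \<le> ((a + b) * ((1 - t) * (cmod (x n) / a) + t * (cmod (y n) / b))) powr p"
        using p by (intro powr_mono2) auto
      also have "\<dots> = (a + b) powr p * ((1 - t) * (cmod (x n) / a) + t * (cmod (y n) / b)) powr p"
        using a b t by (intro powr_mult)
      also have "\<dots> \<le> (a + b) powr p * ((1 - t) * (cmod (x n) / a) powr p + t * (cmod (y n) / b) powr p)"
        using convex_onD[OF powr_convex_nonneg, of p t "cmod (x n) / a" "cmod (y n) / b"] p t a b
        by (intro mult_left_mono) auto
      finally show ?thesis .
    qed
    then have "(\<Sum>n<m. cmod ((x + y) n) powr p) \<le> (\<Sum>n<m. (a + b) powr p * ((1 - t) * (cmod (x n) / a) powr p + t * (cmod (y n) / b) powr p))"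
      by (intro sum_mono)
    also have "\<dots> = (a + b) powr p * ((1 - t) * ((\<Sum>n<m. cmod (x n) powr p) / a powr p) + t * ((\<Sum>n<m. cmod (y n) powr p) / b powr p))"
      using a b by (simp add: powr_divide sum_distrib_left sum.distrib sum_divide_distrib algebra_simps)
    also have "\<dots> \<le> (a + b) powr p * ((1 - t) * 1 + t * 1)"
    proof -
      have "(\<Sum>n<m. cmod (x n) powr p) \<le> a powr p" "(\<Sum>n<m. cmod (y n) powr p) \<le> b powr p"
        using lp_partial_sum[OF x, of "{..<m}"] lp_partial_sum[OF y, of "{..<m}"] powr_mono2[of p "nrm L x" a] powr_mono2[of p "nrm L y" b] a b p
        by auto
      then show ?thesis using a b t by (intro mult_left_mono add_mono) (auto simp: divide_le_eq)
    qed
    finally show ?thesis by simp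
  qed
  have e: "x + y \<in> car L \<and> nrm L (x + y) \<le> (nrm L x + e) + (nrm L y + e)" if "e > 0" for e
    using lp_leI[of "(nrm L x + e) + (nrm L y + e)" "x + y"] key[of "nrm L x + e" "nrm L y + e"] that
      lp_nrm_nonneg[of x] lp_nrm_nonneg[of y] by (auto simp: add_nonneg_pos simp del: lp_simps)
  show "x + y \<in> car L" using e[of 1] by (simp del: lp_simps)
  show "nrm L (x + y) \<le> nrm L x + nrm L y"
  proof (rule field_le_epsilon)
    fix e :: real assume "e > 0"
    then show "nrm L (x + y) \<le> nrm L x + nrm L y + e" using e[of "e / 2"] by simp
  qed
qed

lemma lp_scale:
  assumes x: "x \<in> car L"
  shows "(\<lambda>n. c * x n) \<in> car L" "nrm L (\<lambda>n. c * x n) = cmod c * nrm L x"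
proof -
  have s: "summable (\<lambda>n. cmod c powr p * cmod (x n) powr p)" using x by (simp add: summable_mult)
  then show "(\<lambda>n. c * x n) \<in> car L" by (simp add: norm_mult powr_mult)
  have "nrm L (\<lambda>n. c * x n) = (cmod c powr p * (\<Sum>n. cmod (x n) powr p)) powr (1 / p)"
    using x by (simp add: lp_nrm norm_mult powr_mult suminf_mult)
  also have "\<dots> = cmod c * nrm L x"
    using x p by (subst powr_mult) (auto simp: lp_nrm powr_powr suminf_nonneg)
  finally show "nrm L (\<lambda>n. c * x n) = cmod c * nrm L x" .
qed

lemma lp_vector_space: "vector_space (\<lambda>c (x :: nat \<Rightarrow> complex) n. c * x n)"
  by unfold_locales (auto simp: fun_eq_iff algebra_simps)

lemma lp_cvs: "complex_vector_space L"
proof -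
  interpret v: vector_space "\<lambda>c (x :: nat \<Rightarrow> complex) n. c * x n" by (rule lp_vector_space)
  have "v.subspace (car L)"
    unfolding v.subspace_def using lp_add lp_scale p by auto
  then show ?thesis using lp_vector_space by (simp add: complex_vector_space_def del: lp_simps(2))
qed

lemma lp_complete: "complete_norm L"
  unfolding complete_norm_def
proof (intro allI impI, elim conjE)
  fix s :: "nat \<Rightarrow> nat \<Rightarrow> complex" assume s: "\<forall>k. s k \<in> car L"
    and cauchy: "\<forall>e>0. \<exists>K. \<forall>k\<ge>K. \<forall>l\<ge>K. nrm L (s k - s l) < e"
  have minus: "x - y \<in> car L" if "x \<in> car L" "y \<in> car L" for x y :: "nat \<Rightarrow> complex"
  proof -
    have "x + (\<lambda>n. -1 * y n) = x - y" by auto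
    then show ?thesis using lp_add(1)[OF that(1) lp_scale(1)[OF that(2), of "-1"]] by (simp del: lp_simps)
  qed
  have "Cauchy (\<lambda>k. s k n)" for n
  proof (rule CauchyI)
    fix e :: real assume "e > 0"
    then obtain K where K: "\<forall>k\<ge>K. \<forall>l\<ge>K. nrm L (s k - s l) < e" using cauchy by blast
    have "cmod (s k n - s l n) < e" if "k \<ge> K" "l \<ge> K" for k l
      using lp_coord[OF minus[of "s k" "s l"], of n] s K that by (auto simp del: lp_simps intro: le_less_trans)
    then show "\<exists>K. \<forall>k\<ge>K. \<forall>l\<ge>K. norm (s k n - s l n) < e" by blast
  qed
  then have "\<forall>n. \<exists>y. (\<lambda>k. s k n) \<longlonglongrightarrow> y" using Cauchy_convergent convergent_def by blast
  then obtain x where x: "\<And>n. (\<lambda>k. s k n) \<longlonglongrightarrow> x n" by metis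
  have lim: "s k - x \<in> car L \<and> nrm L (s k - x) \<le> e"
    if e: "e > 0" and K: "\<forall>k\<ge>K. \<forall>l\<ge>K. nrm L (s k - s l) < e" and k: "k \<ge> K" for e K k
  proof -
    have "(\<Sum>n<m. cmod ((s k - x) n) powr p) \<le> e powr p" for m
    proof (rule tendsto_upperbound)
      show "(\<lambda>l. \<Sum>n<m. cmod (s k n - s l n) powr p) \<longlonglongrightarrow> (\<Sum>n<m. cmod ((s k - x) n) powr p)"
        unfolding fun_diff_def using x p by (intro tendsto_sum tendsto_powr' tendsto_intros) auto
      have "(\<Sum>n<m. cmod (s k n - s l n) powr p) \<le> e powr p" if "l \<ge> K" for l
      proof -
        have "(\<Sum>n<m. cmod ((s k - s l) n) powr p) \<le> nrm L (s k - s l) powr p"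
          by (rule lp_partial_sum[OF minus]) (use s in \<open>auto simp del: lp_simps\<close>)
        also have "\<dots> \<le> e powr p" using K k that p by (intro powr_mono2) (auto intro: less_imp_le)
        finally show ?thesis by simp
      qed
      then show "\<forall>\<^sub>F l in sequentially. (\<Sum>n<m. cmod (s k n - s l n) powr p) \<le> e powr p"
        unfolding eventually_sequentially by blast
    qed simp
    then show ?thesis using lp_leI[of e "s k - x"] e by (auto simp del: lp_simps)
  qed
  have "\<exists>K. \<forall>k\<ge>K. \<forall>l\<ge>K. nrm L (s k - s l) < 1" using cauchy by (rule allE[of _ 1]) simp
  then obtain K1 where K1: "\<forall>k\<ge>K1. \<forall>l\<ge>K1. nrm L (s k - s l) < 1" by (rule exE)
  have "s K1 - x \<in> car L" using lim[of 1 K1 K1] K1 by (simp del: lp_simps)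
  from minus[OF _ this, of "s K1"] have "s K1 - (s K1 - x) \<in> car L" using s by blast
  then have xL: "x \<in> car L" by (simp add: fun_diff_def del: lp_simps)
  have "(\<lambda>k. nrm L (s k - x)) \<longlonglongrightarrow> 0"
  proof (rule LIMSEQ_I)
    fix e :: real assume e: "e > 0"
    then obtain K where K: "\<forall>k\<ge>K. \<forall>l\<ge>K. nrm L (s k - s l) < e / 2" using cauchy half_gt_zero by blast
    have "norm (nrm L (s k - x) - 0) < e" if "k \<ge> K" for k
      using lim[OF half_gt_zero[OF e] K that] e by simp
    then show "\<exists>K. \<forall>k\<ge>K. norm (nrm L (s k - x) - 0) < e" by blast
  qed
  then show "\<exists>x\<in>car L. (\<lambda>k. nrm L (s k - x)) \<longlonglongrightarrow> 0" using xL by blast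
qed

sublocale banach L
proof
  show "nrm L (scl L c x) = cmod c * nrm L x" if "x \<in> car L" for c x using lp_scale(2)[OF that] by simp
  show "nrm L (x + y) \<le> nrm L x + nrm L y" if "x \<in> car L" "y \<in> car L" for x y by (rule lp_add(2)[OF that])
  show "x = 0" if "x \<in> car L" "nrm L x = 0" for x
  proof
    fix n show "x n = 0 n" using lp_coord[OF that(1), of n] that(2) by simp
  qed
qed (rule lp_cvs lp_complete lp_nrm_nonneg)+

definition rst :: "nat set \<Rightarrow> (nat \<Rightarrow> complex) \<Rightarrow> nat \<Rightarrow> complex" where
  "rst A x n = (if n \<in> A then x n else 0)"

lemma rst_powr: "cmod (rst A x n) powr p = (if n \<in> A then cmod (x n) powr p else 0)"
  by (simp add: rst_def)

lemma rst_carrier: "x \<in> car L \<Longrightarrow> rst A x \<in> car L"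
  by (auto simp: rst_powr intro: summable_comparison_test')

lemma sum_rst_le:
  assumes x: "x \<in> car L" and I: "finite I" and disj: "\<And>i j. i \<in> I \<Longrightarrow> j \<in> I \<Longrightarrow> i \<noteq> j \<Longrightarrow> A i \<inter> A j = {}"
  shows "(\<Sum>i\<in>I. nrm L (rst (A i) x) powr p) \<le> nrm L x powr p"
proof -
  have "(\<Sum>i\<in>I. nrm L (rst (A i) x) powr p) = (\<Sum>i\<in>I. \<Sum>n. cmod (rst (A i) x n) powr p)"
    by (intro sum.cong refl lp_nrm_powr rst_carrier x)
  also have "\<dots> = (\<Sum>n. \<Sum>i\<in>I. cmod (rst (A i) x n) powr p)"
    using rst_carrier[OF x] by (intro suminf_sum[symmetric]) simp
  also have "\<dots> \<le> (\<Sum>n. cmod (x n) powr p)"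
  proof (rule suminf_le)
    show "(\<Sum>i\<in>I. cmod (rst (A i) x n) powr p) \<le> cmod (x n) powr p" for n
    proof (cases "\<exists>i\<in>I. n \<in> A i")
      case True
      then obtain i where i: "i \<in> I" "n \<in> A i" by blast
      have "(\<Sum>j\<in>I. cmod (rst (A j) x n) powr p) = (\<Sum>j\<in>{i}. cmod (rst (A j) x n) powr p)"
        using I i disj by (intro sum.mono_neutral_right) (auto simp: rst_powr)
      then show ?thesis by (simp add: rst_powr)
    next
      case False
      then have "(\<Sum>j\<in>I. cmod (rst (A j) x n) powr p) = 0" by (intro sum.neutral) (auto simp: rst_powr)
      then show ?thesis by simp
    qed
    show "summable (\<lambda>n. \<Sum>i\<in>I. cmod (rst (A i) x n) powr p)" using rst_carrier[OF x] by (intro summable_sum) simp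
    show "summable (\<lambda>n. cmod (x n) powr p)" using x by simp
  qed
  also have "\<dots> = nrm L x powr p" by (rule lp_nrm_powr[OF x, symmetric])
  finally show ?thesis .
qed

lemma rst_le: "x \<in> car L \<Longrightarrow> nrm L (rst A x) \<le> nrm L x"
proof -
  assume x: "x \<in> car L"
  have "(\<Sum>i\<in>{0::nat}. nrm L (rst A x) powr p) \<le> nrm L x powr p"
    by (rule sum_rst_le[OF x]) auto
  then show ?thesis by (intro le_of_powr_le[OF lp_nrm_nonneg]) simp
qed

text \<open>The norm of \<open>\<ell>\<^sub>p^n\<close>, taken from \<open>\<ell>\<^sub>p\<close> so that its triangle inequality need not be proved again.\<close>

definition lpn :: "nat \<Rightarrow> (nat \<Rightarrow> complex) \<Rightarrow> real" where
  "lpn n c = nrm L (rst {..<n} c)"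

lemma rst_finite_carrier: "finite A \<Longrightarrow> rst A c \<in> car L"
  by (simp add: rst_powr)

lemma lpn_nonneg [simp]: "0 \<le> lpn n c"
  by (simp add: lpn_def)

lemma lpn_powr: "lpn n c powr p = (\<Sum>i<n. cmod (c i) powr p)"
  unfolding lpn_def lp_nrm_powr[OF rst_finite_carrier[OF finite_lessThan]]
  by (subst suminf_finite[of "{..<n}"]) (auto simp: rst_powr)

lemma lpn_leI: "0 \<le> C \<Longrightarrow> (\<Sum>i<n. cmod (c i) powr p) \<le> C powr p \<Longrightarrow> lpn n c \<le> C"
  unfolding lpn_powr[symmetric] by (rule le_of_powr_le)

lemma lpn_add: "lpn n (\<lambda>i. c i + d i) \<le> lpn n c + lpn n d"
proof -
  have "rst {..<n} (\<lambda>i. c i + d i) = rst {..<n} c + rst {..<n} d" by (auto simp: rst_def)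
  then show ?thesis unfolding lpn_def using nrm_add[OF rst_finite_carrier rst_finite_carrier, of "{..<n}" "{..<n}" c d] by simp
qed

lemma lpn_mono: "(\<And>i. i < n \<Longrightarrow> cmod (c i) \<le> cmod (d i)) \<Longrightarrow> lpn n c \<le> lpn n d"
  using p by (intro lpn_leI) (auto simp: lpn_powr intro!: sum_mono powr_mono2)

lemma lpn_entry: "i < n \<Longrightarrow> cmod (c i) \<le> lpn n c"
  using lp_coord[OF rst_finite_carrier, of "{..<n}" c i] by (simp add: lpn_def rst_def)

lemma lpn_le_sum: "lpn n c \<le> (\<Sum>i<n. cmod (c i))"
proof (induction n)
  case 0
  then show ?case by (intro lpn_leI) auto
next
  case (Suc n)
  have "lpn (Suc n) c \<le> lpn (Suc n) (\<lambda>i. if i < n then c i else 0) + lpn (Suc n) (\<lambda>i. if i < n then 0 else c i)"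
    by (rule order_trans[OF _ lpn_add]) (rule lpn_mono, simp)
  moreover have "lpn (Suc n) (\<lambda>i. if i < n then c i else 0) \<le> lpn n c"
    by (intro lpn_leI) (auto simp: lpn_powr)
  moreover have "lpn (Suc n) (\<lambda>i. if i < n then 0 else c i) \<le> cmod (c n)"
    by (intro lpn_leI) auto
  ultimately show ?case using Suc by simp
qed

text \<open>At each coordinate at most one summand is nonzero.\<close>

lemma disjoint_sum_le:
  assumes x: "\<And>i. i < n \<Longrightarrow> x i \<in> car L" "\<And>i. i < n \<Longrightarrow> nrm L (x i) \<le> 1"
    and supp: "\<And>i. i < n \<Longrightarrow> rst (A i) (x i) = x i"
    and disj: "\<And>i j. i < n \<Longrightarrow> j < n \<Longrightarrow> i \<noteq> j \<Longrightarrow> A i \<inter> A j = {}"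
  shows "nrm L (\<Sum>i<n. scl L (c i) (x i)) \<le> lpn n c"
proof (rule lp_leI(2))
  fix m
  let ?y = "\<Sum>i<n. scl L (c i) (x i)"
  have "cmod (?y k) powr p \<le> (\<Sum>i<n. cmod (c i) powr p * cmod (x i k) powr p)" for k
  proof -
    have e: "?y k = (\<Sum>i<n. c i * x i k)" by (simp add: sum_fun_apply)
    show ?thesis
    proof (cases "\<exists>i<n. k \<in> A i")
      case True
      then obtain i where i: "i < n" "k \<in> A i" by blast
      have z: "x j k = 0" if "j < n" "j \<noteq> i" for j
        using supp[OF that(1)] disj[OF that(1) i(1) that(2)] i(2) by (metis disjoint_iff rst_def)
      have "?y k = (\<Sum>j\<in>{i}. c j * x j k)"
        unfolding e using i z by (intro sum.mono_neutral_right) auto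
      then have "cmod (?y k) powr p = cmod (c i) powr p * cmod (x i k) powr p" by (simp add: norm_mult powr_mult)
      also have "\<dots> \<le> (\<Sum>i<n. cmod (c i) powr p * cmod (x i k) powr p)"
        using i by (intro member_le_sum) auto
      finally show ?thesis .
    next
      case False
      then have "x i k = 0" if "i < n" for i using supp[OF that] that by (metis rst_def)
      then show ?thesis unfolding e by simp
    qed
  qed
  then have "(\<Sum>k<m. cmod (?y k) powr p) \<le> (\<Sum>k<m. \<Sum>i<n. cmod (c i) powr p * cmod (x i k) powr p)"
    by (intro sum_mono)
  also have "\<dots> = (\<Sum>i<n. cmod (c i) powr p * (\<Sum>k<m. cmod (x i k) powr p))"
    by (subst sum.swap) (simp add: sum_distrib_left)
  also have "\<dots> \<le> (\<Sum>i<n. cmod (c i) powr p * 1)"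
  proof (intro sum_mono mult_left_mono)
    fix i assume "i \<in> {..<n}"
    then have "(\<Sum>k<m. cmod (x i k) powr p) \<le> nrm L (x i) powr p"
      by (intro lp_partial_sum x) auto
    also have "\<dots> \<le> 1 powr p"
      using x(2)[of i] \<open>i \<in> {..<n}\<close> p by (intro powr_mono2) auto
    finally show "(\<Sum>k<m. cmod (x i k) powr p) \<le> 1" by simp
  qed simp
  finally show "(\<Sum>k<m. cmod (?y k) powr p) \<le> lpn n c powr p" by (simp add: lpn_powr)
qed simp

lemma tail_small:
  assumes x: "x \<in> car L" and e: "e > 0"
  obtains m where "\<And>k. k \<ge> m \<Longrightarrow> nrm L (rst {k..} x) \<le> e"
proof -
  have "summable (\<lambda>n. cmod (x n) powr p)" using x by simp
  then obtain m where m: "\<And>k. k \<ge> m \<Longrightarrow> norm (\<Sum>i. cmod (x (i + k)) powr p) < e powr p"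
    using suminf_exist_split[of "e powr p" "\<lambda>n. cmod (x n) powr p"] e by auto
  have "nrm L (rst {k..} x) \<le> e" if k: "k \<ge> m" for k
  proof (rule le_of_powr_le)
    have "nrm L (rst {k..} x) powr p = (\<Sum>n. cmod (rst {k..} x n) powr p)" by (rule lp_nrm_powr[OF rst_carrier[OF x]])
    also have "\<dots> = (\<Sum>n. cmod (rst {k..} x (n + k)) powr p) + (\<Sum>n<k. cmod (rst {k..} x n) powr p)"
      using rst_carrier[OF x, of "{k..}"] by (intro suminf_split_initial_segment) simp
    also have "(\<Sum>n<k. cmod (rst {k..} x n) powr p) = 0" by (intro sum.neutral) (auto simp: rst_def)
    also have "(\<Sum>n. cmod (rst {k..} x (n + k)) powr p) = (\<Sum>n. cmod (x (n + k)) powr p)" by (simp add: rst_def)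
    finally show "nrm L (rst {k..} x) powr p \<le> e powr p" using m[OF k] by simp
  qed (use e in simp)
  then show ?thesis by (rule that)
qed

section \<open>Power means\<close>

text \<open>Jensen's inequality.\<close>

lemma power_mean:
  assumes s: "s \<ge> 1" and a: "\<And>i. i < n \<Longrightarrow> 0 \<le> a i" and n: "n \<ge> (1::nat)"
  shows "(\<Sum>i<n. a i) powr s \<le> real n powr (s - 1) * (\<Sum>i<n. a i powr s)"
proof -
  have n0: "real n > 0" using n by simp
  have "(\<Sum>i<n. (1 / real n) *\<^sub>R a i) powr s \<le> (\<Sum>i<n. (1 / real n) * a i powr s)"
    by (rule convex_on_sum[OF _ _ powr_convex_nonneg[OF s]]) (use a n in \<open>auto simp: lessThan_empty_iff\<close>)
  also have "(\<Sum>i<n. (1 / real n) *\<^sub>R a i) = (\<Sum>i<n. a i) / real n" by (simp add: sum_divide_distrib)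
  also have "(\<Sum>i<n. (1 / real n) * a i powr s) = (\<Sum>i<n. a i powr s) / real n" by (simp add: sum_divide_distrib)
  also have "((\<Sum>i<n. a i) / real n) powr s = (\<Sum>i<n. a i) powr s / real n powr s"
    by (rule powr_divide)
  finally have "(\<Sum>i<n. a i) powr s \<le> real n powr s * ((\<Sum>i<n. a i powr s) / real n)"
    using n0 by (simp add: divide_le_eq mult.commute)
  also have "\<dots> = real n powr (s - 1) * (\<Sum>i<n. a i powr s)"
    using n0 by (simp add: powr_diff)
  finally show ?thesis .
qed

lemma sum_le_lpn:
  assumes n: "n \<ge> 1"
  shows "(\<Sum>i<n. cmod (c i)) \<le> real n powr (1 - 1 / p) * lpn n c"
proof (rule le_of_powr_le)
  have "(\<Sum>i<n. cmod (c i)) powr p \<le> real n powr (p - 1) * lpn n c powr p"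
    unfolding lpn_powr using power_mean[of p n "\<lambda>i. cmod (c i)"] p n by simp
  also have "\<dots> = (real n powr (1 - 1 / p) * lpn n c) powr p"
  proof -
    have "(1 - 1 / p) * p = p - 1" using p by (simp add: field_simps)
    then show ?thesis by (simp add: powr_mult powr_powr)
  qed
  finally show "(\<Sum>i<n. cmod (c i)) powr p \<le> (real n powr (1 - 1 / p) * lpn n c) powr p" .
qed simp

lemma powr_two: "0 \<le> x \<Longrightarrow> x powr 2 = x\<^sup>2" for x :: real
  using powr_realpow'[of x 2] by simp

lemma sq_powr: "0 \<le> x \<Longrightarrow> (x\<^sup>2) powr (r / 2) = x powr r" for x r :: real
proof -
  assume "0 \<le> x"
  moreover have "(x powr 2) powr (r / 2) = x powr r" by (simp only: powr_powr) simp
  ultimately show ?thesis using powr_two[of x] by (simp only:)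
qed

lemma l2_powr2: "l2 n c powr 2 = (\<Sum>i<n. cmod (c i) powr 2)"
  using l2_power2[of n c] by (simp add: powr_two)

text \<open>The four comparisons of \<open>\<ell>\<^sub>2^n\<close> with \<open>\<ell>\<^sub>p^n\<close>: the contractive ones bound the surplus power of each
  entry by that of the norm, the others come from the power mean inequality.\<close>

lemma l2_le_lpn_small:
  assumes p2: "p \<le> 2"
  shows "l2 n c \<le> lpn n c"
proof (rule power2_le_imp_le)
  have "(l2 n c)\<^sup>2 = (\<Sum>i<n. cmod (c i) powr p * cmod (c i) powr (2 - p))"
    unfolding l2_power2 by (simp add: powr_add[symmetric] powr_two)
  also have "\<dots> \<le> (\<Sum>i<n. cmod (c i) powr p * lpn n c powr (2 - p))"
    using p2 lpn_entry[of _ n c] by (intro sum_mono mult_left_mono powr_mono2) auto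
  also have "\<dots> = (lpn n c)\<^sup>2"
    by (simp add: sum_distrib_right[symmetric] lpn_powr[symmetric] powr_add[symmetric] powr_two)
  finally show "(l2 n c)\<^sup>2 \<le> (lpn n c)\<^sup>2" .
qed simp

lemma lpn_le_l2_large:
  assumes p2: "p \<ge> 2"
  shows "lpn n c \<le> l2 n c"
proof (rule lpn_leI)
  have "(\<Sum>i<n. cmod (c i) powr p) = (\<Sum>i<n. cmod (c i) powr 2 * cmod (c i) powr (p - 2))"
    by (intro sum.cong refl) (simp only: powr_add[symmetric], simp)
  also have "\<dots> \<le> (\<Sum>i<n. cmod (c i) powr 2 * l2 n c powr (p - 2))"
    using p2 entry_le_l2[of _ n c] by (intro sum_mono mult_left_mono powr_mono2) auto
  also have "\<dots> = l2 n c powr p"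
    by (simp only: sum_distrib_right[symmetric] l2_powr2[symmetric] powr_add[symmetric]) simp
  finally show "(\<Sum>i<n. cmod (c i) powr p) \<le> l2 n c powr p" .
qed simp

lemma lpn_le_l2_small:
  assumes p2: "p \<le> 2" and n: "n \<ge> 1"
  shows "lpn n c \<le> real n powr (1 / p - 1 / 2) * l2 n c"
proof (rule lpn_leI)
  have "(\<Sum>i<n. cmod (c i) powr p) = ((\<Sum>i<n. cmod (c i) powr p) powr (2 / p)) powr (p / 2)"
    using p by (simp add: powr_powr sum_nonneg)
  also have "\<dots> \<le> (real n powr (2 / p - 1) * (l2 n c powr 2)) powr (p / 2)"
    using power_mean[of "2 / p" n "\<lambda>i. cmod (c i) powr p"] p p2 n
    by (intro powr_mono2) (auto simp: powr_powr l2_powr2)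
  also have "\<dots> = (real n powr (1 / p - 1 / 2) * l2 n c) powr p"
    using p by (simp add: powr_mult powr_powr sq_powr field_simps)
  finally show "(\<Sum>i<n. cmod (c i) powr p) \<le> (real n powr (1 / p - 1 / 2) * l2 n c) powr p" .
qed simp

lemma l2_le_lpn_large:
  assumes p2: "p \<ge> 2" and n: "n \<ge> 1"
  shows "l2 n c \<le> real n powr (1 / 2 - 1 / p) * lpn n c"
proof (rule le_of_powr_le)
  have "l2 n c powr p = (\<Sum>i<n. cmod (c i) powr 2) powr (p / 2)"
    unfolding l2_powr2[symmetric] by (simp only: powr_powr) simp
  also have "\<dots> \<le> real n powr (p / 2 - 1) * (\<Sum>i<n. (cmod (c i) powr 2) powr (p / 2))"
    using power_mean[of "p / 2" n "\<lambda>i. cmod (c i) powr 2"] p2 n by simp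
  also have "\<dots> = real n powr (p / 2 - 1) * lpn n c powr p"
    by (simp add: sq_powr lpn_powr)
  also have "\<dots> = (real n powr (1 / 2 - 1 / p) * lpn n c) powr p"
  proof -
    have "(1 / 2 - 1 / p) * p = p / 2 - 1" using p by (simp add: field_simps)
    then show ?thesis by (simp add: powr_mult powr_powr)
  qed
  finally show "l2 n c powr p \<le> (real n powr (1 / 2 - 1 / p) * lpn n c) powr p" .
qed simp

end

section \<open>Column matrices over the minimal and the maximal operator space\<close>

definition fourier :: "nat \<Rightarrow> nat \<Rightarrow> nat \<Rightarrow> complex" where
  "fourier n j k = cis (2 * pi * real j / real n) ^ k"

lemma norm_fourier [simp]: "cmod (fourier n j k) = 1"
  by (simp add: fourier_def norm_power)

lemma fourier_orthogonal:
  assumes i: "i < n" and j: "j < n"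
  shows "(\<Sum>k<n. fourier n j k * cnj (fourier n i k)) = (if i = j then of_nat n else 0)"
proof -
  let ?a = "\<lambda>j. cis (2 * pi * real j / real n)"
  define z where "z = ?a j * cnj (?a i)"
  have n: "n > 0" using i by simp
  have inv: "cnj (?a i) * ?a i = 1" using complex_norm_square[of "?a i"] by (simp add: mult.commute)
  have unit: "?a j ^ n = 1" if "j < n" for j
    using Complex.bij_betw_roots_unity[OF n] that by (auto simp: bij_betw_def)
  have zn: "z ^ n = 1" unfolding z_def power_mult_distrib complex_cnj_power[symmetric] unit[OF i] unit[OF j] by simp
  have eq: "(\<Sum>k<n. fourier n j k * cnj (fourier n i k)) = (\<Sum>k<n. z ^ k)"
    by (simp add: fourier_def z_def power_mult_distrib)
  show ?thesis
  proof (cases "i = j")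
    case True
    then have "z = 1" using inv by (simp add: z_def mult.commute)
    then show ?thesis using True eq by simp
  next
    case False
    have "z \<noteq> 1"
    proof
      assume "z = 1"
      then have "?a j * (cnj (?a i) * ?a i) = ?a i" by (simp add: z_def mult.assoc[symmetric])
      then have "?a j = ?a i" using inv by simp
      then have "j = i" using Complex.bij_betw_roots_unity[OF n] i j unfolding bij_betw_def inj_on_def by auto
      then show False using False by simp
    qed
    then show ?thesis using False eq geometric_sum[of z n] zn by simp
  qed
qed

lemma fourier_parseval:
  "l2 n (\<lambda>k. \<Sum>i<n. u i * cnj (fourier n i k)) = sqrt (real n) * l2 n u"
proof -
  let ?w = "\<lambda>k. \<Sum>i<n. u i * cnj (fourier n i k)"
  have "complex_of_real ((l2 n ?w)\<^sup>2) = (\<Sum>k<n. ?w k * cnj (?w k))"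
    unfolding l2_power2 of_real_sum complex_norm_square ..
  also have "\<dots> = (\<Sum>k<n. \<Sum>i<n. \<Sum>j<n. u i * cnj (u j) * (fourier n j k * cnj (fourier n i k)))"
    by (simp add: sum_product ac_simps)
  also have "\<dots> = (\<Sum>i<n. \<Sum>j<n. u i * cnj (u j) * (\<Sum>k<n. fourier n j k * cnj (fourier n i k)))"
    unfolding sum_distrib_left by (subst sum.swap) (intro sum.cong refl sum.swap)
  also have "\<dots> = (\<Sum>i<n. \<Sum>j<n. if i = j then u i * cnj (u i) * of_nat n else 0)"
    by (intro sum.cong refl) (auto simp: fourier_orthogonal)
  also have "\<dots> = (\<Sum>i<n. complex_of_real (real n * (cmod (u i))\<^sup>2))"
    by (intro sum.cong refl) (simp only: of_real_mult complex_norm_square, simp add: sum.delta)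
  also have "\<dots> = complex_of_real (real n * (l2 n u)\<^sup>2)"
    unfolding l2_power2 sum_distrib_left by simp
  finally have "(l2 n ?w)\<^sup>2 = real n * (l2 n u)\<^sup>2" by (simp only: of_real_eq_iff)
  also have "\<dots> = (sqrt (real n) * l2 n u)\<^sup>2" by (simp add: power_mult_distrib)
  finally show ?thesis by (simp add: power2_eq_iff_nonneg)
qed

lemma l2_const: "l2 n (\<lambda>_. c) = sqrt (real n) * cmod c"
  by (simp add: l2_def L2_set_constant)

text \<open>For norms defined as infima, estimates are proved for all \<open>R\<close> above the infimum.\<close>

lemma le_mult_rightI:
  fixes m C h :: real
  assumes "\<And>R. R > m \<Longrightarrow> h \<le> C * R"
  shows "h \<le> C * m"
proof (rule tendsto_lowerbound)
  show "((\<lambda>R. C * R) \<longlongrightarrow> C * m) (at_right m)" by (intro tendsto_intros)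
  show "\<forall>\<^sub>F R in at_right m. h \<le> C * R"
    using assms by (auto simp: eventually_at_right_field intro!: exI[of _ "m + 1"])
qed simp

context banach
begin

definition column :: "nat \<Rightarrow> (nat \<Rightarrow> 'a) \<Rightarrow> 'a mat" where
  "column n x = mat n n (\<lambda>(i, j). if j = 0 then x i else 0)"

lemma column_mats: "(\<And>i. i < n \<Longrightarrow> x i \<in> car N) \<Longrightarrow> column n x \<in> mats N n"
  unfolding column_def by (intro matsI) (auto simp: carrier_zero)

lemma column_index: "i < n \<Longrightarrow> j < n \<Longrightarrow> column n x $$ (i, j) = (if j = 0 then x i else 0)"
  by (simp add: column_def)

lemma column_dim [simp]: "dim_row (column n x) = n" "dim_col (column n x) = n"
  by (simp_all add: column_def)

text \<open>Over the scalars the norm of a column is Euclidean.\<close>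

lemma min_column_le:
  assumes n: "n \<ge> 1" and s: "0 \<le> s" and le: "\<And>f. f \<in> dual_ball N \<Longrightarrow> l2 n (\<lambda>i. f (x i)) \<le> s"
  shows "mnorm NMIN (column n x) \<le> s"
proof (rule min_leI, rule scalar_mat_norm_leI[OF s])
  fix f and u v :: "nat \<Rightarrow> complex" assume f: "f \<in> dual_ball N"
  let ?M = "map_mat f (column n x)"
  have "(\<Sum>j<n. ?M $$ (i, j) * v j) = f (x i) * v 0" if i: "i < n" for i
  proof -
    have "(\<Sum>j<n. ?M $$ (i, j) * v j) = (\<Sum>j\<in>{0}. ?M $$ (i, j) * v j)"
      using n i by (intro sum.mono_neutral_right) (auto simp: column_index dual_zero[OF f])
    then show ?thesis using n i by (simp add: column_index)
  qed
  then have "bilin ?M u v = (\<Sum>i<n. u i * f (x i)) * v 0"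
    unfolding bilin_eq by (simp add: sum_distrib_right mult.assoc)
  then have "cmod (bilin ?M u v) \<le> (l2 n u * l2 n (\<lambda>i. f (x i))) * cmod (v 0)"
    using Cauchy_Schwarz_l2[where n = n and u = u and v = "\<lambda>i. f (x i)"] by (simp add: norm_mult mult_right_mono)
  also have "\<dots> \<le> (l2 n u * s) * l2 n v"
    using le[OF f] entry_le_l2[of 0 n v] n s by (intro mult_mono) auto
  finally show "cmod (bilin ?M u v) \<le> s * l2 (dim_row ?M) u * l2 (dim_col ?M) v" by (simp add: ac_simps)
qed

lemma sum_delta_mult: "i < (n :: nat) \<Longrightarrow> (\<Sum>k<n. u k * (if k = i then 1 else 0)) = (u i :: complex)"
proof -
  assume i: "i < n"
  have "(\<Sum>k<n. u k * (if k = i then 1 else 0)) = (\<Sum>k\<in>{i}. u k * (if k = i then 1 else 0))"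
    using i by (intro sum.mono_neutral_right) auto
  then show ?thesis by simp
qed

lemma sum_first_column: "(n :: nat) \<ge> 1 \<Longrightarrow> (\<Sum>j<n. (if j = 0 then c else 0) * v j) = (c * v 0 :: complex)"
proof -
  assume n: "n \<ge> 1"
  have "(\<Sum>j<n. (if j = 0 then c else 0) * v j) = (\<Sum>j\<in>{0}. (if j = 0 then c else 0) * v j)"
    using n by (intro sum.mono_neutral_right) auto
  then show ?thesis by simp
qed

text \<open>The factorisation with \<open>A = 1\<close>, the entries on the diagonal, and a first column of ones for \<open>B\<close>,
  of norm \<open>sqrt n\<close>.\<close>

lemma max_column_le_entries:
  assumes n: "n \<ge> 1" and M: "M > 0" and x: "\<And>i. i < n \<Longrightarrow> x i \<in> car N" "\<And>i. i < n \<Longrightarrow> nrm N (x i) \<le> M"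
  shows "mnorm NMAX (column n x) \<le> sqrt (real n) * M"
proof -
  have "factorises n (column n x) 1 (sqrt (real n) * M)"
  proof (rule factorisesI[of _ _ n _ _ "\<lambda>i k. if k = i then 1 else 0" "\<lambda>k j. if j = 0 then complex_of_real M else 0"
      "\<lambda>k. scl N (complex_of_real (1 / M)) (x k)"])
    fix i j assume ij: "i < n" "j < n"
    have "(\<Sum>k<n. scl N ((if k = i then 1 else 0) * (if j = 0 then complex_of_real M else 0)) (scl N (complex_of_real (1 / M)) (x k)))
      = (\<Sum>k\<in>{i}. scl N ((if k = i then 1 else 0) * (if j = 0 then complex_of_real M else 0)) (scl N (complex_of_real (1 / M)) (x k)))"
      using ij by (intro sum.mono_neutral_right) auto
    then show "column n x $$ (i, j) = (\<Sum>k<n. scl N ((if k = i then 1 else 0) * (if j = 0 then complex_of_real M else 0)) (scl N (complex_of_real (1 / M)) (x k)))"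
      using ij M by (simp add: column_index)
  next
    fix k assume k: "k < n"
    show "scl N (complex_of_real (1 / M)) (x k) \<in> car N" by (intro carrier_scale x k)
    show "nrm N (scl N (complex_of_real (1 / M)) (x k)) \<le> 1"
      unfolding nrm_scale[OF x(1)[OF k]] using x(2)[OF k] M by (simp add: norm_divide divide_le_eq)
  next
    fix u :: "nat \<Rightarrow> complex"
    have "l2 n (\<lambda>k. \<Sum>i<n. u i * (if k = i then 1 else 0)) = l2 n u"
      by (intro l2_cong) (use sum_delta_mult[of _ n u] in \<open>auto simp: eq_commute\<close>)
    then show "l2 n (\<lambda>k. \<Sum>i<n. u i * (if k = i then 1 else 0)) \<le> 1 * l2 n u" by simp
    have "l2 n (\<lambda>k. \<Sum>j<n. (if j = 0 then complex_of_real M else 0) * u j) = sqrt (real n) * M * cmod (u 0)"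
      using M unfolding sum_first_column[OF n] l2_const by (simp add: norm_mult)
    also have "\<dots> \<le> sqrt (real n) * M * l2 n u" using entry_le_l2[of 0 n u] n M by (intro mult_left_mono) auto
    finally show "l2 n (\<lambda>k. \<Sum>j<n. (if j = 0 then complex_of_real M else 0) * u j) \<le> sqrt (real n) * M * l2 n u" .
  qed (use n M in auto)
  then show ?thesis using max_le_factorises(1)[OF column_mats[OF x(1)]] by fastforce
qed

text \<open>Fourier inversion writes a column as an average of columns with unimodular coefficients, so
  that only the vectors \<open>\<Sum>\<^sub>j c\<^sub>j x\<^sub>j\<close> with \<open>|c\<^sub>j| = 1\<close> occur on the diagonal.\<close>

lemma max_column_le_unimodular:
  assumes n: "n \<ge> 1" and s: "s > 0" and x: "\<And>i. i < n \<Longrightarrow> x i \<in> car N"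
    and le: "\<And>c. (\<And>j. cmod (c j) = 1) \<Longrightarrow> nrm N (\<Sum>j<n. scl N (c j) (x j)) \<le> s"
  shows "mnorm NMAX (column n x) \<le> s"
proof -
  let ?r = "complex_of_real (1 / sqrt (real n))"
  let ?v = "\<lambda>k. \<Sum>j<n. scl N (fourier n j k) (x j)"
  have v: "?v k \<in> car N" for k using x by (intro carrier_sum carrier_scale) auto
  have rr: "?r * ?r * of_nat n = 1"
  proof -
    have "?r * ?r = complex_of_real (1 / real n)" by (simp only: of_real_mult[symmetric]) simp
    then show ?thesis using n by simp
  qed
  \<comment> \<open>By orthogonality of the characters, \<open>x\<^sub>i\<close> is \<open>1/n\<close> times the sum of \<open>cnj (fourier n i k) ?v k\<close> over \<open>k\<close>.
    One factor \<open>1 / sqrt n\<close> makes the Fourier matrix unitary, the other one normalises the column of ones.\<close>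
  have "factorises n (column n x) 1 s"
  proof (rule factorisesI[of _ _ n _ _ "\<lambda>i k. cnj (fourier n i k) * ?r" "\<lambda>k j. if j = 0 then complex_of_real s * ?r else 0"
      "\<lambda>k. scl N (complex_of_real (1 / s)) (?v k)"])
    fix i j assume ij: "i < n" "j < n"
    have "(\<Sum>k<n. scl N (cnj (fourier n i k) * ?r * (complex_of_real s * ?r)) (scl N (complex_of_real (1 / s)) (?v k))) = x i"
    proof -
      have "scl N (cnj (fourier n i k) * ?r * (complex_of_real s * ?r)) (scl N (complex_of_real (1 / s)) (?v k))
          = (\<Sum>j<n. scl N (?r * ?r * (fourier n j k * cnj (fourier n i k))) (x j))" for k
        using s by (simp add: vs.scale_sum_right ac_simps)
      then have "(\<Sum>k<n. scl N (cnj (fourier n i k) * ?r * (complex_of_real s * ?r)) (scl N (complex_of_real (1 / s)) (?v k)))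
          = (\<Sum>k<n. \<Sum>j<n. scl N (?r * ?r * (fourier n j k * cnj (fourier n i k))) (x j))" by simp
      also have "\<dots> = (\<Sum>j<n. scl N (?r * ?r * (\<Sum>k<n. fourier n j k * cnj (fourier n i k))) (x j))"
        unfolding sum_distrib_left vs.scale_sum_left by (rule sum.swap)
      also have "\<dots> = (\<Sum>j\<in>{i}. scl N (?r * ?r * (\<Sum>k<n. fourier n j k * cnj (fourier n i k))) (x j))"
        using ij by (intro sum.mono_neutral_right) (auto simp: fourier_orthogonal)
      also have "\<dots> = x i" using ij rr by (simp add: fourier_orthogonal)
      finally show ?thesis .
    qed
    then show "column n x $$ (i, j) = (\<Sum>k<n. scl N (cnj (fourier n i k) * ?r * (if j = 0 then complex_of_real s * ?r else 0)) (scl N (complex_of_real (1 / s)) (?v k)))"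
      using ij by (simp add: column_index)
  next
    fix k
    show "scl N (complex_of_real (1 / s)) (?v k) \<in> car N" by (intro carrier_scale v)
    show "nrm N (scl N (complex_of_real (1 / s)) (?v k)) \<le> 1"
      unfolding nrm_scale[OF v] using le[of "\<lambda>j. fourier n j k"] s by (simp add: norm_divide divide_le_eq)
  next
    fix u :: "nat \<Rightarrow> complex"
    have "l2 n (\<lambda>k. \<Sum>i<n. u i * (cnj (fourier n i k) * ?r)) = l2 n (\<lambda>k. ?r * (\<Sum>i<n. u i * cnj (fourier n i k)))"
      by (intro l2_cong) (simp only: sum_distrib_left ac_simps)
    also have "\<dots> = l2 n u" unfolding l2_scale fourier_parseval using n by (simp add: norm_divide)
    finally show "l2 n (\<lambda>k. \<Sum>i<n. u i * (cnj (fourier n i k) * ?r)) \<le> 1 * l2 n u" by simp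
    have "l2 n (\<lambda>k. \<Sum>j<n. (if j = 0 then complex_of_real s * ?r else 0) * u j) = s * cmod (u 0)"
      using s n unfolding sum_first_column[OF n] l2_const by (simp add: norm_mult norm_divide)
    also have "\<dots> \<le> s * l2 n u" using entry_le_l2[of 0 n u] n s by (intro mult_left_mono) auto
    finally show "l2 n (\<lambda>k. \<Sum>j<n. (if j = 0 then complex_of_real s * ?r else 0) * u j) \<le> s * l2 n u" .
  qed (use n s in auto)
  then show ?thesis using max_le_factorises(1)[OF column_mats[OF x]] by fastforce
qed

text \<open>For a factorisation \<open>y = A D B\<close>, the Cauchy--Schwarz inequality separates the column of \<open>B\<close> from the
  Hilbert--Schmidt norm of \<open>A\<close>, which is at most \<open>sqrt n\<close> times the operator norm.\<close>

lemma max_column_functional: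
  assumes n: "n \<ge> 1" and s: "0 \<le> s" and f: "\<And>i. i < n \<Longrightarrow> f i \<in> dual_ball N"
    and le: "\<And>d. d \<in> car N \<Longrightarrow> l2 n (\<lambda>i. f i d) \<le> s * nrm N d" and y: "y \<in> mats N n"
  shows "cmod (\<Sum>i<n. f i (y $$ (i, 0))) \<le> sqrt (real n) * s * mnorm NMAX y"
proof (rule le_mult_rightI)
  fix R assume R: "R > mnorm NMAX y"
  have R0: "R > 0" using R max_nonneg[OF y n] by simp
  obtain K A B d where F: "0 \<le> sqrt R" "0 \<le> sqrt R" "K \<ge> 1"
    "\<And>i j. i < n \<Longrightarrow> j < n \<Longrightarrow> y $$ (i, j) = (\<Sum>k<K. scl N (A i k * B k j) (d k))"
    "\<And>k. k < K \<Longrightarrow> d k \<in> car N" "\<And>k. k < K \<Longrightarrow> nrm N (d k) \<le> 1"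
    "\<And>u. l2 K (\<lambda>k. \<Sum>i<n. u i * A i k) \<le> sqrt R * l2 n u"
    "\<And>v. l2 K (\<lambda>k. \<Sum>j<n. B k j * v j) \<le> sqrt R * l2 n v"
    by (rule factorisesE[OF max_less_factorises[OF y n R]]) (rule that)
  have n0: "0 < n" using n by simp
  have "f i (y $$ (i, 0)) = (\<Sum>k<K. B k 0 * (A i k * f i (d k)))" if i: "i < n" for i
  proof -
    have "f i (y $$ (i, 0)) = (\<Sum>k<K. f i (scl N (A i k * B k 0) (d k)))"
      unfolding F(4)[OF i n0] by (intro dual_sum[OF f[OF i]] carrier_scale F(5)) simp
    also have "\<dots> = (\<Sum>k<K. B k 0 * (A i k * f i (d k)))"
      by (intro sum.cong refl) (simp add: dual_scale[OF f[OF i] F(5)])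
    finally show ?thesis .
  qed
  then have "(\<Sum>i<n. f i (y $$ (i, 0))) = (\<Sum>i<n. \<Sum>k<K. B k 0 * (A i k * f i (d k)))" by simp
  also have "\<dots> = (\<Sum>k<K. B k 0 * (\<Sum>i<n. A i k * f i (d k)))"
    unfolding sum_distrib_left by (rule sum.swap)
  finally have "cmod (\<Sum>i<n. f i (y $$ (i, 0))) \<le> l2 K (\<lambda>k. B k 0) * l2 K (\<lambda>k. \<Sum>i<n. A i k * f i (d k))"
    using Cauchy_Schwarz_l2 by simp
  also have "\<dots> \<le> sqrt R * (s * (sqrt (real n) * sqrt R))"
  proof (rule mult_mono)
    have "(\<Sum>j<n. B k j * (if j = 0 then 1 else 0)) = B k 0" for k using sum_delta_mult[OF n0, of "B k"] .
    then show "l2 K (\<lambda>k. B k 0) \<le> sqrt R" using F(8)[of "\<lambda>j. if j = 0 then 1 else 0"] l2_single[OF n0, of 1] by simp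
    have row: "(l2 K (\<lambda>k. A i k))\<^sup>2 \<le> R" if i: "i < n" for i
    proof -
      have "(\<Sum>j<n. (if j = i then 1 else 0) * A j k) = A i k" for k
        using sum_delta_mult[OF i, of "\<lambda>j. A j k"] by (simp add: mult.commute)
      then have "l2 K (\<lambda>k. A i k) \<le> sqrt R"
        using F(7)[of "\<lambda>j. if j = i then 1 else 0"] l2_single[OF i, of 1] by simp
      then have "(l2 K (\<lambda>k. A i k))\<^sup>2 \<le> (sqrt R)\<^sup>2" by (intro power_mono) auto
      then show ?thesis using R0 by simp
    qed
    have "cmod (\<Sum>i<n. A i k * f i (d k)) \<le> s * l2 n (\<lambda>i. A i k)" if k: "k < K" for k
    proof -
      have "cmod (\<Sum>i<n. A i k * f i (d k)) \<le> l2 n (\<lambda>i. A i k) * l2 n (\<lambda>i. f i (d k))" by (rule Cauchy_Schwarz_l2)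
      also have "\<dots> \<le> l2 n (\<lambda>i. A i k) * (s * 1)"
        using le[OF F(5)[OF k]] mult_left_mono[OF F(6)[OF k] s] by (intro mult_left_mono) auto
      finally show ?thesis by (simp add: mult.commute)
    qed
    then have "(l2 K (\<lambda>k. \<Sum>i<n. A i k * f i (d k)))\<^sup>2 \<le> (\<Sum>k<K. (s * l2 n (\<lambda>i. A i k))\<^sup>2)"
      unfolding l2_power2[of K] by (intro sum_mono power_mono) auto
    also have "\<dots> = s\<^sup>2 * (\<Sum>i<n. (l2 K (\<lambda>k. A i k))\<^sup>2)"
      unfolding power_mult_distrib sum_distrib_left[symmetric] l2_power2 by (subst sum.swap) simp
    also have "\<dots> \<le> s\<^sup>2 * (\<Sum>i<n. R)" using row by (intro mult_left_mono sum_mono) auto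
    also have "\<dots> = (s * (sqrt (real n) * sqrt R))\<^sup>2" using R0 by (simp add: power_mult_distrib)
    finally show "l2 K (\<lambda>k. \<Sum>i<n. A i k * f i (d k)) \<le> s * (sqrt (real n) * sqrt R)"
      by (rule power2_le_imp_le) (use s R0 in auto)
  qed (use R0 in auto)
  also have "\<dots> = sqrt (real n) * s * (sqrt R * sqrt R)" by (simp only: ac_simps)
  also have "sqrt R * sqrt R = R" using R0 by simp
  finally show "cmod (\<Sum>i<n. f i (y $$ (i, 0))) \<le> sqrt (real n) * s * R" .
qed

text \<open>This is of the right order for \<open>p \<ge> 2\<close>. For \<open>p \<le> 2\<close> the next lemma is better, as it exploits the
  size of the unimodular combinations of the \<open>f\<^sub>i\<close>.\<close>

lemma min_column_functional_entries:
  assumes f: "\<And>i. i < n \<Longrightarrow> f i \<in> dual_ball N" and y: "y \<in> mats N n"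
  shows "cmod (\<Sum>i<n. f i (y $$ (i, 0))) \<le> real n * mnorm NMIN y"
proof -
  have "cmod (\<Sum>i<n. f i (y $$ (i, 0))) \<le> (\<Sum>i<n. mnorm NMIN y)"
  proof (rule order_trans[OF norm_sum sum_mono])
    fix i assume "i \<in> {..<n}"
    then show "cmod (f i (y $$ (i, 0))) \<le> mnorm NMIN y"
      using dual_le[OF f matsD[OF y, of i 0]] min_entry[OF y, of i 0] by force
  qed
  then show ?thesis by simp
qed

text \<open>By Fourier inversion \<open>\<Sum>\<^sub>i f\<^sub>i(y\<^sub>i\<^sub>0)\<close> is the average over \<open>k\<close> of the forms
  \<open>\<Sum>\<^sub>i cnj (fourier n i k) g\<^sub>k(y\<^sub>i\<^sub>0)\<close> with \<open>g\<^sub>k = \<Sum>\<^sub>j fourier n j k f\<^sub>j\<close>. Each of them involves a single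
  functional, so that the minimal norm applies.\<close>

lemma min_column_functional_unimodular:
  assumes n: "n \<ge> 1" and s: "s > 0" and f: "\<And>i. i < n \<Longrightarrow> f i \<in> dual_ball N"
    and le: "\<And>c d. (\<And>j. cmod (c j) = 1) \<Longrightarrow> d \<in> car N \<Longrightarrow> cmod (\<Sum>j<n. c j * f j d) \<le> s * nrm N d"
    and y: "y \<in> mats N n"
  shows "cmod (\<Sum>i<n. f i (y $$ (i, 0))) \<le> sqrt (real n) * s * mnorm NMIN y"
proof -
  have n0: "0 < n" using n by simp
  define g where "g k d = complex_of_real (1 / s) * (\<Sum>j<n. fourier n j k * f j d)" for k d
  have g: "g k \<in> dual_ball N" for k
    unfolding dual_ball_iff
  proof (intro conjI ballI allI)
    fix a b c assume a: "a \<in> car N"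
    show "cmod (g k a) \<le> nrm N a"
      using le[of "\<lambda>j. fourier n j k" a] a s by (simp add: g_def norm_mult norm_divide divide_le_eq mult.commute)
    show "g k (scl N c a) = c * g k a"
      unfolding g_def using a f by (simp add: dual_scale sum_distrib_left ac_simps)
    assume b: "b \<in> car N"
    show "g k (a + b) = g k a + g k b"
      unfolding g_def using a b f by (simp add: dual_add distrib_left sum.distrib)
  qed
  have b: "cmod (\<Sum>i<n. \<Sum>j<n. (fourier n j k * cnj (fourier n i k)) * f j (y $$ (i, 0))) \<le> s * (sqrt (real n) * mnorm NMIN y)" for k
  proof -
    let ?u = "\<lambda>i. cnj (fourier n i k)" and ?v = "\<lambda>j. if j = 0 then 1 else (0::complex)"
    have "bilin (map_mat (g k) y) ?u ?v = (\<Sum>i<n. ?u i * g k (y $$ (i, 0)))"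
      unfolding bilin_eq using mats_dim[OF y] sum_delta_mult[OF n0] n0 by simp
    then have "cmod (\<Sum>i<n. ?u i * g k (y $$ (i, 0))) \<le> scalar_mat_norm (map_mat (g k) y) * l2 n ?u * l2 n ?v"
      using bilin_le[of "map_mat (g k) y" ?u ?v] mats_dim[OF y] by simp
    also have "\<dots> \<le> mnorm NMIN y * sqrt (real n) * 1"
    proof (intro mult_mono min_ge[OF y g])
      have "l2 n ?u = l2 n (\<lambda>_. 1)" by (simp add: l2_def)
      then show "l2 n ?u \<le> sqrt (real n)" by (simp add: l2_const)
      show "l2 n ?v \<le> 1" using l2_single[OF n0, of 1] by simp
    qed (use min_nonneg[OF y] in auto)
    finally have "cmod (\<Sum>i<n. ?u i * g k (y $$ (i, 0))) \<le> sqrt (real n) * mnorm NMIN y" by (simp add: mult.commute)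
    moreover have "(\<Sum>i<n. \<Sum>j<n. (fourier n j k * cnj (fourier n i k)) * f j (y $$ (i, 0)))
        = complex_of_real s * (\<Sum>i<n. ?u i * g k (y $$ (i, 0)))"
      unfolding g_def sum_distrib_left using s by (intro sum.cong refl) simp
    ultimately show ?thesis using s by (simp add: norm_mult)
  qed
  have "(\<Sum>k<n. \<Sum>i<n. \<Sum>j<n. (fourier n j k * cnj (fourier n i k)) * f j (y $$ (i, 0)))
      = (\<Sum>i<n. \<Sum>j<n. (\<Sum>k<n. fourier n j k * cnj (fourier n i k)) * f j (y $$ (i, 0)))"
    unfolding sum_distrib_right by (subst sum.swap) (intro sum.cong refl sum.swap)
  also have "\<dots> = (\<Sum>i<n. \<Sum>j<n. if i = j then of_nat n * f i (y $$ (i, 0)) else 0)"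
    by (intro sum.cong refl) (auto simp: fourier_orthogonal)
  also have "\<dots> = of_nat n * (\<Sum>i<n. f i (y $$ (i, 0)))" by (simp add: sum_distrib_left)
  finally have "real n * cmod (\<Sum>i<n. f i (y $$ (i, 0))) = cmod (\<Sum>k<n. \<Sum>i<n. \<Sum>j<n. (fourier n j k * cnj (fourier n i k)) * f j (y $$ (i, 0)))"
    by (simp add: norm_mult)
  also have "\<dots> \<le> (\<Sum>k<n. s * (sqrt (real n) * mnorm NMIN y))"
    by (rule order_trans[OF norm_sum sum_mono[OF b]])
  also have "\<dots> = real n * (sqrt (real n) * s * mnorm NMIN y)" by simp
  finally show ?thesis using n0 by simp
qed

end

section \<open>Columns over the minimal and the maximal structure on p-summable sequences\<close>

context lp
begin

text \<open>The column of the first \<open>n\<close> unit vectors of \<open>\<ell>\<^sub>p\<close> has norms of the orders \<open>1\<close> and \<open>n^(1/p)\<close> over the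
  minimal and the maximal structure if \<open>p \<ge> 2\<close>, and of the orders \<open>n^(1/p - 1/2)\<close> and \<open>n^(1/2)\<close> if
  \<open>p \<le> 2\<close>. In both cases the ratio is of the order \<open>n^gap\<close>.\<close>

definition gap :: real where
  "gap = min (1 / p) (1 - 1 / p)"

lemma gap_pos: "gap > 0"
  using p by (simp add: gap_def)

text \<open>The \<open>x\<^sub>i\<close> satisfy an upper \<open>\<ell>\<^sub>p\<close>-estimate and the \<open>f\<^sub>i\<close> the dual one. The factor \<open>2\<close> makes room for the
  perturbations of disjointly supported systems that gliding humps produce. The diagonal values
  \<open>f\<^sub>i(x\<^sub>i)\<close> are controlled separately.\<close>

definition biorthogonal_bound :: "nat \<Rightarrow> (nat \<Rightarrow> nat \<Rightarrow> complex) \<Rightarrow> (nat \<Rightarrow> (nat \<Rightarrow> complex) \<Rightarrow> complex) \<Rightarrow> bool" where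
  "biorthogonal_bound n x f \<longleftrightarrow> (\<forall>i<n. x i \<in> car L) \<and> (\<forall>i<n. f i \<in> dual_ball L) \<and>
     (\<forall>c. nrm L (\<Sum>i<n. scl L (c i) (x i)) \<le> 2 * lpn n c) \<and>
     (\<forall>y\<in>car L. lpn n (\<lambda>i. f i y) \<le> 2 * nrm L y)"

lemma lpn_unimodular: "(\<And>j. cmod (c j) = 1) \<Longrightarrow> n \<ge> 1 \<Longrightarrow> lpn n c \<le> real n powr (1 / p)"
  using p by (intro lpn_leI) (auto simp: powr_powr)

text \<open>The minimal norm of the column is the norm of \<open>u \<mapsto> \<Sum>\<^sub>i u\<^sub>i x\<^sub>i\<close> on \<open>\<ell>\<^sub>2^n\<close>. For the maximal norm, the
  Fourier factorisation is the better one for \<open>p \<ge> 2\<close> and the diagonal one for \<open>p \<le> 2\<close>. The constants are adjusted so that both products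
  equal \<open>4 n\<close> and both ratios are exact powers of \<open>n\<close>.\<close>

lemma column_estimates:
  assumes n: "n \<ge> 1" and S: "biorthogonal_bound n x f"
  obtains K0 K1 N0 N1 :: real where "K0 > 0" "K1 > 0" "N0 > 0" "N1 > 0"
    and "K0 * N0 = 4 * real n" "K1 * N1 = 4 * real n"
    and "ln (K0 / K1) = gap * ln (real n)" "ln (N0 / N1) = - gap * ln (real n)"
    and "mnorm NMIN (column n x) \<le> N0" "mnorm NMAX (column n x) \<le> N1"
    and "\<And>y. y \<in> mats L n \<Longrightarrow> cmod (\<Sum>i<n. f i (y $$ (i, 0))) \<le> K0 * mnorm NMIN y"
    and "\<And>y. y \<in> mats L n \<Longrightarrow> cmod (\<Sum>i<n. f i (y $$ (i, 0))) \<le> K1 * mnorm NMAX y"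
proof -
  have x: "\<And>i. i < n \<Longrightarrow> x i \<in> car L" and f: "\<And>i. i < n \<Longrightarrow> f i \<in> dual_ball L"
    and S1: "\<And>c. nrm L (\<Sum>i<n. scl L (c i) (x i)) \<le> 2 * lpn n c"
    and S2: "\<And>y. y \<in> car L \<Longrightarrow> lpn n (\<lambda>i. f i y) \<le> 2 * nrm L y"
    using S unfolding biorthogonal_bound_def by blast+
  have n0: "real n > 0" using n by simp
  have dual: "cmod (\<Sum>i<n. u i * g (x i)) \<le> 2 * lpn n u" if g: "g \<in> dual_ball L" for g u
  proof -
    have "(\<Sum>i<n. u i * g (x i)) = g (\<Sum>i<n. scl L (u i) (x i))"
      using x by (subst dual_sum[OF g]) (auto simp: dual_scale[OF g] carrier_scale simp del: lp_simps)
    also have "cmod \<dots> \<le> nrm L (\<Sum>i<n. scl L (u i) (x i))"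
      using x by (intro dual_le[OF g] carrier_sum carrier_scale) auto
    also have "\<dots> \<le> 2 * lpn n u" by (rule S1)
    finally show ?thesis .
  qed
  show ?thesis
  proof (cases "p \<ge> 2")
    case True
    have gap: "gap = 1 / p" using True by (simp add: gap_def min_def field_simps)
    let ?K0 = "2 * real n" and ?K1 = "2 * real n powr (1 - 1 / p)" and ?N0 = "2 :: real" and ?N1 = "2 * real n powr (1 / p)"
    show ?thesis
    proof (rule that[of ?K0 ?K1 ?N0 ?N1])
      show "?K0 > 0" "?K1 > 0" "?N0 > 0" "?N1 > 0" "?K0 * ?N0 = 4 * real n" using n0 by simp_all
      show "?K1 * ?N1 = 4 * real n" using n0 by (simp add: powr_add[symmetric])
      show "ln (?K0 / ?K1) = gap * ln (real n)" using n0 by (simp add: ln_div ln_mult ln_powr gap algebra_simps)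
      show "ln (?N0 / ?N1) = - gap * ln (real n)" using n0 by (simp add: ln_div ln_mult ln_powr gap)
      show "mnorm NMIN (column n x) \<le> ?N0"
      proof (rule min_column_le[OF n])
        fix g assume g: "g \<in> dual_ball L"
        show "l2 n (\<lambda>i. g (x i)) \<le> 2"
          by (rule l2_leI) (use dual[OF g] lpn_le_l2_large[OF True] in \<open>fastforce intro: order_trans\<close>)+
      qed simp
      show "mnorm NMAX (column n x) \<le> ?N1"
      proof (rule max_column_le_unimodular[OF n _ x])
        fix c :: "nat \<Rightarrow> complex" assume c: "\<And>j. cmod (c j) = 1"
        have "lpn n c \<le> real n powr (1 / p)" by (rule lpn_unimodular[OF _ n]) (rule c)
        then show "nrm L (\<Sum>j<n. scl L (c j) (x j)) \<le> ?N1" using S1[of c] by linarith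
      qed (use n0 in auto)
      fix y assume y: "y \<in> mats L n"
      show "cmod (\<Sum>i<n. f i (y $$ (i, 0))) \<le> ?K0 * mnorm NMIN y"
      proof -
        have "cmod (\<Sum>i<n. f i (y $$ (i, 0))) \<le> real n * mnorm NMIN y"
          by (rule min_column_functional_entries[OF _ y]) (rule f)
        moreover have "0 \<le> real n * mnorm NMIN y" using min_nonneg[OF y] by simp
        ultimately show ?thesis by linarith
      qed
      have s: "l2 n (\<lambda>i. f i d) \<le> 2 * real n powr (1 / 2 - 1 / p) * nrm L d" if d: "d \<in> car L" for d
      proof -
        have "l2 n (\<lambda>i. f i d) \<le> real n powr (1 / 2 - 1 / p) * lpn n (\<lambda>i. f i d)" by (rule l2_le_lpn_large[OF True n])
        also have "\<dots> \<le> real n powr (1 / 2 - 1 / p) * (2 * nrm L d)" by (intro mult_left_mono S2 d) simp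
        finally show ?thesis by (simp add: ac_simps)
      qed
      have "cmod (\<Sum>i<n. f i (y $$ (i, 0))) \<le> sqrt (real n) * (2 * real n powr (1 / 2 - 1 / p)) * mnorm NMAX y"
        by (rule max_column_functional[OF n _ f s y]) auto
      also have "sqrt (real n) * (2 * real n powr (1 / 2 - 1 / p)) = ?K1"
        using n0 by (simp add: powr_half_sqrt[symmetric] powr_add[symmetric])
      finally show "cmod (\<Sum>i<n. f i (y $$ (i, 0))) \<le> ?K1 * mnorm NMAX y" .
    qed
  next
    case False
    then have p2: "p \<le> 2" by simp
    have gap: "gap = 1 - 1 / p" using False p by (simp add: gap_def min_def field_simps)
    let ?K0 = "2 * real n powr (3 / 2 - 1 / p)" and ?K1 = "2 * sqrt (real n)" and ?N0 = "2 * real n powr (1 / p - 1 / 2)" and ?N1 = "2 * sqrt (real n)"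
    show ?thesis
    proof (rule that[of ?K0 ?K1 ?N0 ?N1])
      show "?K0 > 0" "?K1 > 0" "?N0 > 0" "?N1 > 0" using n0 by simp_all
      show "?K0 * ?N0 = 4 * real n" using n0 by (simp add: powr_add[symmetric])
      show "?K1 * ?N1 = 4 * real n" using n0 by simp
      show "ln (?K0 / ?K1) = gap * ln (real n)" using n0 by (simp add: ln_div ln_mult ln_powr ln_sqrt gap algebra_simps)
      show "ln (?N0 / ?N1) = - gap * ln (real n)" using n0 by (simp add: ln_div ln_mult ln_powr ln_sqrt gap algebra_simps)
      show "mnorm NMIN (column n x) \<le> ?N0"
      proof (rule min_column_le[OF n])
        fix g assume g: "g \<in> dual_ball L"
        show "l2 n (\<lambda>i. g (x i)) \<le> ?N0"
        proof (rule l2_leI)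
          show "cmod (\<Sum>i<n. u i * g (x i)) \<le> ?N0 * l2 n u" for u
            using dual[OF g, of u] lpn_le_l2_small[OF p2 n, of u] by simp
        qed simp
      qed simp
      show "mnorm NMAX (column n x) \<le> ?N1"
      proof -
        have "nrm L (x i) \<le> 2" if i: "i < n" for i
        proof -
          let ?c = "\<lambda>j. if j = i then 1 else (0 :: complex)"
          have "(\<Sum>j<n. scl L (?c j) (x j)) = (\<Sum>j\<in>{i}. scl L (?c j) (x j))"
            using i by (intro sum.mono_neutral_right) (auto simp: fun_eq_iff)
          then have "nrm L (x i) \<le> 2 * lpn n ?c" using S1[of ?c] by simp
          also have "lpn n ?c \<le> 1"
          proof (rule lpn_leI)
            have "(\<Sum>j<n. cmod (?c j) powr p) = (\<Sum>j\<in>{i}. cmod (?c j) powr p)"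
              using i by (intro sum.mono_neutral_right) auto
            then show "(\<Sum>j<n. cmod (?c j) powr p) \<le> 1 powr p" by simp
          qed simp
          finally show ?thesis by simp
        qed
        then show ?thesis using max_column_le_entries[OF n, of 2 x] x by (simp add: mult.commute)
      qed
      fix y assume y: "y \<in> mats L n"
      have s0: "cmod (\<Sum>j<n. c j * f j d) \<le> 2 * real n powr (1 - 1 / p) * nrm L d"
        if c: "\<And>j. cmod (c j) = 1" and d: "d \<in> car L" for c d
      proof -
        have "cmod (\<Sum>j<n. c j * f j d) \<le> (\<Sum>j<n. cmod (f j d))"
          by (rule order_trans[OF norm_sum]) (simp add: norm_mult c)
        also have "\<dots> \<le> real n powr (1 - 1 / p) * lpn n (\<lambda>i. f i d)" by (rule sum_le_lpn[OF n])
        also have "\<dots> \<le> real n powr (1 - 1 / p) * (2 * nrm L d)" by (intro mult_left_mono S2 d) simp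
        finally show ?thesis by (simp add: ac_simps)
      qed
      have "cmod (\<Sum>i<n. f i (y $$ (i, 0))) \<le> sqrt (real n) * (2 * real n powr (1 - 1 / p)) * mnorm NMIN y"
        by (rule min_column_functional_unimodular[OF n _ f s0 y]) (use n0 in auto)
      also have "sqrt (real n) * (2 * real n powr (1 - 1 / p)) = ?K0"
        using n0 by (simp add: powr_half_sqrt[symmetric] powr_add[symmetric])
      finally show "cmod (\<Sum>i<n. f i (y $$ (i, 0))) \<le> ?K0 * mnorm NMIN y" .
      have s: "l2 n (\<lambda>i. f i d) \<le> 2 * nrm L d" if d: "d \<in> car L" for d
        using l2_le_lpn_small[OF p2, of n "\<lambda>i. f i d"] S2[OF d] by linarith
      have "cmod (\<Sum>i<n. f i (y $$ (i, 0))) \<le> sqrt (real n) * 2 * mnorm NMAX y"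
        by (rule max_column_functional[OF n _ f s y]) auto
      then show "cmod (\<Sum>i<n. f i (y $$ (i, 0))) \<le> ?K1 * mnorm NMAX y" by (simp add: ac_simps)
    qed
  qed
qed

end

section \<open>Infinite-dimensional spaces and finitely many functionals\<close>

text \<open>The common kernel of \<open>m\<close> functionals has finite codimension, hence it is itself infinite-dimensional.\<close>

lemma infinite_dim_common_zero:
  fixes \<phi> :: "nat \<Rightarrow> 'a::ab_group_add \<Rightarrow> complex"
  assumes V: "vector_space s" and W: "module.subspace s W"
    and inf: "\<not> (\<exists>B. finite B \<and> W = module.span s B)"
    and add: "\<And>k x y. x \<in> W \<Longrightarrow> y \<in> W \<Longrightarrow> \<phi> k (x + y) = \<phi> k x + \<phi> k y"
    and scale: "\<And>k c x. x \<in> W \<Longrightarrow> \<phi> k (s c x) = c * \<phi> k x"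
  obtains x where "x \<in> W" "x \<noteq> 0" "\<And>k. k < m \<Longrightarrow> \<phi> k x = 0"
proof -
  interpret vector_space s by (rule V)
  define U where "U n = {x \<in> W. \<forall>k<n. \<phi> k x = 0}" for n :: nat
  have z: "\<phi> k 0 = 0" for k using scale[OF subspace_0[OF W], of k 0] by simp
  have sub: "subspace (U n)" for n
    unfolding subspace_def U_def
    using subspace_0[OF W] subspace_add[OF W] subspace_scale[OF W] add scale z by auto
  have "\<not> (\<exists>B. finite B \<and> U n = span B)" for n
  proof (induction n)
    case 0
    then show ?case using inf by (simp add: U_def)
  next
    case (Suc n)
    show ?case
    proof
      assume "\<exists>B. finite B \<and> U (Suc n) = span B"
      then obtain B where B: "finite B" "U (Suc n) = span B" by blast
      show False
      proof (cases "\<exists>v\<in>U n. \<phi> n v \<noteq> 0")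
        case True
        then obtain v where v: "v \<in> U n" "\<phi> n v \<noteq> 0" by blast
        have "U n = span (insert v B)"
        proof (rule antisym)
          show "span (insert v B) \<subseteq> U n"
          proof (rule span_minimal[OF _ sub])
            have "B \<subseteq> U (Suc n)" unfolding B(2) by (rule span_superset)
            then show "insert v B \<subseteq> U n" using v(1) by (auto simp: U_def)
          qed
          show "U n \<subseteq> span (insert v B)"
          proof
            fix x assume x: "x \<in> U n"
            define c where "c = \<phi> n x / \<phi> n v"
            have xv: "x \<in> W" "v \<in> W" using x v by (auto simp: U_def)
            have e: "x - s c v = x + s (- c) v" by simp
            have "x - s c v \<in> U (Suc n)"
              unfolding U_def mem_Collect_eq
            proof (intro conjI allI impI)
              show "x - s c v \<in> W" by (intro subspace_diff[OF W] subspace_scale[OF W] xv)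
              fix k assume k: "k < Suc n"
              have "\<phi> k (x - s c v) = \<phi> k x + (- c) * \<phi> k v"
                unfolding e using xv subspace_scale[OF W xv(2)] by (simp only: add scale)
              then show "\<phi> k (x - s c v) = 0"
                using k x v by (cases "k = n") (auto simp: U_def c_def)
            qed
            then have "x - s c v \<in> span (insert v B)" using B(2) span_mono[of B "insert v B"] by auto
            moreover have "s c v \<in> span (insert v B)" by (intro span_scale span_base) simp
            ultimately show "x \<in> span (insert v B)" using span_add by fastforce
          qed
        qed
        then show False using Suc B(1) by blast
      next
        case False
        then have "U n = U (Suc n)" by (auto simp: U_def less_Suc_eq)
        then show False using Suc B by blast
      qed
    qed
  qed
  then have "U m \<noteq> {0}" using span_empty by (metis finite.emptyI)
  moreover have "0 \<in> U m" by (rule subspace_0[OF sub])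
  ultimately obtain x where "x \<in> U m" "x \<noteq> 0" by blast
  then show ?thesis using that by (auto simp: U_def)
qed

text \<open>The previous lemma, applied to the space of bounded functionals and to the evaluations at the points
  \<open>z k\<close>. If finitely many functionals spanned the dual, then a norming functional of a nonzero common
  zero would vanish there as well.\<close>

lemma (in banach) functional_vanishing_on_finite_set:
  assumes inf: "\<not> (\<exists>B. finite B \<and> car N = module.span (scl N) B)"
    and z: "\<And>k. k < (m::nat) \<Longrightarrow> z k \<in> car N"
  obtains \<phi> C where "\<And>x y. x \<in> car N \<Longrightarrow> y \<in> car N \<Longrightarrow> \<phi> (x + y) = \<phi> x + \<phi> y"
    "\<And>c x. x \<in> car N \<Longrightarrow> \<phi> (scl N c x) = c * \<phi> x"
    "\<And>x. x \<in> car N \<Longrightarrow> cmod (\<phi> x) \<le> C * nrm N x"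
    "\<And>k. k < m \<Longrightarrow> \<phi> (z k) = (0 :: complex)" "\<exists>x\<in>car N. \<phi> x \<noteq> 0"
proof -
  define sc where "sc c \<phi> x = c * \<phi> x" for c and \<phi> :: "'a \<Rightarrow> complex" and x
  interpret F: vector_space sc by unfold_locales (auto simp: sc_def fun_eq_iff algebra_simps)
  define D where "D = {\<phi> :: 'a \<Rightarrow> complex. (\<forall>x. x \<notin> car N \<longrightarrow> \<phi> x = 0) \<and>
     (\<forall>x\<in>car N. \<forall>y\<in>car N. \<phi> (x + y) = \<phi> x + \<phi> y) \<and> (\<forall>c. \<forall>x\<in>car N. \<phi> (scl N c x) = c * \<phi> x) \<and>
     (\<exists>C. \<forall>x\<in>car N. cmod (\<phi> x) \<le> C * nrm N x)}"
  have D: "F.subspace D"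
    unfolding F.subspace_def
  proof (intro conjI ballI allI)
    show "0 \<in> D" unfolding D_def by (auto intro!: exI[of _ 0])
    fix f assume f: "f \<in> D"
    then have "\<exists>C. \<forall>x\<in>car N. cmod (f x) \<le> C * nrm N x" unfolding D_def by blast
    then obtain C where C0: "\<forall>x\<in>car N. cmod (f x) \<le> C * nrm N x" ..
    note C = bspec[OF C0]
    show "sc c f \<in> D" for c
    proof -
      have "cmod (sc c f x) \<le> (cmod c * C) * nrm N x" if "x \<in> car N" for x
        using mult_left_mono[OF C[OF that], of "cmod c"] by (simp add: sc_def norm_mult mult.assoc)
      then have "\<exists>B. \<forall>x\<in>car N. cmod (sc c f x) \<le> B * nrm N x" by blast
      moreover have "(\<forall>x. x \<notin> car N \<longrightarrow> sc c f x = 0) \<and>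
          (\<forall>x\<in>car N. \<forall>y\<in>car N. sc c f (x + y) = sc c f x + sc c f y) \<and> (\<forall>d. \<forall>x\<in>car N. sc c f (scl N d x) = d * sc c f x)"
        using f by (simp add: D_def sc_def algebra_simps)
      ultimately show ?thesis by (simp add: D_def)
    qed
    fix g assume g: "g \<in> D"
    then have "\<exists>C. \<forall>x\<in>car N. cmod (g x) \<le> C * nrm N x" unfolding D_def by blast
    then obtain C' where C0': "\<forall>x\<in>car N. cmod (g x) \<le> C' * nrm N x" ..
    note C' = bspec[OF C0']
    have "cmod ((f + g) x) \<le> (C + C') * nrm N x" if "x \<in> car N" for x
      using norm_triangle_mono[OF C[OF that] C'[OF that]] by (simp add: algebra_simps)
    then have "\<exists>B. \<forall>x\<in>car N. cmod ((f + g) x) \<le> B * nrm N x" by blast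
    moreover have "(\<forall>x. x \<notin> car N \<longrightarrow> (f + g) x = 0) \<and>
        (\<forall>x\<in>car N. \<forall>y\<in>car N. (f + g) (x + y) = (f + g) x + (f + g) y) \<and> (\<forall>d. \<forall>x\<in>car N. (f + g) (scl N d x) = d * (f + g) x)"
      using f g by (simp add: D_def algebra_simps)
    ultimately show "f + g \<in> D" by (simp only: D_def mem_Collect_eq simp_thms)
  qed
  have infD: "\<not> (\<exists>B. finite B \<and> D = F.span B)"
  proof
    assume "\<exists>B. finite B \<and> D = F.span B"
    then obtain B where B: "finite B" "D = F.span B" by blast
    obtain l b where b: "B = b ` {i. i < (l::nat)}" using iffD1[OF finite_conv_nat_seg_image B(1)] by (elim exE)
    have bD: "b k \<in> D" if "k < l" for k using F.span_superset[of B] B(2) b that by auto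
    obtain x where x: "x \<in> car N" "x \<noteq> 0" "\<And>k. k < l \<Longrightarrow> (if k < l then b k x else 0) = 0"
    proof (rule infinite_dim_common_zero[OF vector_space_scale subspace_carrier inf, of "\<lambda>k x. if k < l then b k x else 0" l])
      fix k c x y assume "x \<in> car N"
      then show "(if k < l then b k (scl N c x) else 0) = c * (if k < l then b k x else 0)"
        using bD[of k] by (simp add: D_def)
      assume "y \<in> car N"
      with \<open>x \<in> car N\<close> show "(if k < l then b k (x + y) else 0) = (if k < l then b k x else 0) + (if k < l then b k y else 0)"
        using bD[of k] by (simp add: D_def)
    qed (rule that)
    have "\<phi> x = 0" if "\<phi> \<in> F.span B" for \<phi>
      using that
    proof (induction rule: F.span_induct_alt)
      case (step c f g)
      then show ?case using x(3) b by (auto simp: sc_def)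
    qed simp
    moreover obtain f where f: "f \<in> dual_ball N" "f x = complex_of_real (nrm N x)" using norming_functional[OF x(1)] .
    moreover have "(\<lambda>y. if y \<in> car N then f y else 0) \<in> D"
      unfolding D_def using f(1) by (auto simp: dual_add dual_scale carrier_add carrier_scale intro!: exI[of _ 1] dual_le)
    ultimately have "nrm N x = 0" using x(1) B(2) by fastforce
    then show False using nrm_eq_0[OF x(1)] x(2) by simp
  qed
  obtain \<phi> where \<phi>: "\<phi> \<in> D" "\<phi> \<noteq> 0" "\<And>k. k < m \<Longrightarrow> \<phi> (z k) = 0"
    by (rule infinite_dim_common_zero[OF F.vector_space_axioms D infD, of "\<lambda>k \<phi>. \<phi> (z k)" m])
      (simp_all add: sc_def)
  have "\<exists>x\<in>car N. \<phi> x \<noteq> 0"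
  proof (rule ccontr)
    assume "\<not> (\<exists>x\<in>car N. \<phi> x \<noteq> 0)"
    then have "\<phi> x = 0" for x using \<phi>(1) by (cases "x \<in> car N") (auto simp: D_def)
    then show False using \<phi>(2) by (simp add: fun_eq_iff)
  qed
  moreover obtain C where "\<forall>x\<in>car N. cmod (\<phi> x) \<le> C * nrm N x" using \<phi>(1) by (auto simp: D_def)
  ultimately show ?thesis using \<phi>(1,3) by (intro that[of \<phi> C]) (simp_all add: D_def)
qed

section \<open>Gliding humps\<close>

lemma sum_half_powers: "(\<Sum>i<n. (1/2::real)^Suc i) \<le> 1"
proof -
  have "(\<Sum>i<n. (1/2::real)^Suc i) = 1 - (1/2)^n" by (induction n) auto
  then show ?thesis by simp
qed

lemma incseq_blocks_disjoint:
  assumes "\<And>i. N i \<le> N (Suc i)" "i \<noteq> j"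
  shows "{N i..<N (Suc i)} \<inter> {N j..<N (Suc j)} = ({} :: nat set)"
proof -
  have m: "N a \<le> N b" if "a \<le> b" for a b using assms(1) that by (rule lift_Suc_mono_le)
  have *: "{N i..<N (Suc i)} \<inter> {N j..<N (Suc j)} = {}" if "i < j" for i j using m[of "Suc i" j] that by auto
  show ?thesis using *[of i j] *[of j i] assms(2) by (cases "i < j") auto
qed

context lp
begin

lemma rst_add: "rst A (x + y) = rst A x + rst A y"
  and rst_scale: "rst A (scl L c x) = scl L c (rst A x)"
  and rst_rst: "rst A (rst B x) = rst (A \<inter> B) x"
  by (auto simp: rst_def)

lemma dual_rst: "f \<in> dual_ball L \<Longrightarrow> (\<lambda>y. f (rst A y)) \<in> dual_ball L"
  unfolding dual_ball_iff
proof (intro conjI ballI allI; elim conjE)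
  fix x y c assume f: "\<forall>x\<in>car L. \<forall>y\<in>car L. f (x + y) = f x + f y" "\<forall>c. \<forall>x\<in>car L. f (scl L c x) = c * f x"
    "\<forall>x\<in>car L. cmod (f x) \<le> nrm L x" and x: "x \<in> car L"
  show "f (rst A (scl L c x)) = c * f (rst A x)" using f(2) rst_carrier[OF x] unfolding rst_scale by blast
  show "cmod (f (rst A x)) \<le> nrm L x" using f(3) rst_carrier[OF x] rst_le[OF x] order_trans by blast
  assume y: "y \<in> car L"
  show "f (rst A (x + y)) = f (rst A x) + f (rst A y)" using f(1) rst_carrier[OF x] rst_carrier[OF y] unfolding rst_add by blast
qed

lemma rotate_to_positive:
  assumes f: "f \<in> dual_ball L" and y: "y \<in> car L"
  obtains c where "cmod c = 1" "f (scl L c y) = complex_of_real (cmod (f y))"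
proof (cases "f y = 0")
  case True
  then show ?thesis using that[of 1] by simp
next
  case False
  have "f (scl L (cnj (f y) / cmod (f y)) y) = cnj (f y) / cmod (f y) * f y" by (rule dual_scale[OF f y])
  also have "\<dots> = complex_of_real (cmod (f y))"
    using False complex_norm_square[of "f y"] by (simp add: field_simps power2_eq_square)
  finally show ?thesis using that[of "cnj (f y) / cmod (f y)"] False by (simp add: norm_divide)
qed

lemma sum_scl_le:
  assumes t: "\<And>i. i < n \<Longrightarrow> t i \<in> car L" "\<And>i. i < n \<Longrightarrow> nrm L (t i) \<le> (1/2)^Suc i"
  shows "nrm L (\<Sum>i<n. scl L (c i) (t i)) \<le> lpn n c"
proof -
  have "nrm L (\<Sum>i<n. scl L (c i) (t i)) \<le> (\<Sum>i<n. nrm L (scl L (c i) (t i)))"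
    using t by (intro nrm_sum carrier_scale) auto
  also have "\<dots> \<le> (\<Sum>i<n. lpn n c * (1/2)^Suc i)"
  proof (intro sum_mono)
    fix i assume "i \<in> {..<n}"
    then show "nrm L (scl L (c i) (t i)) \<le> lpn n c * (1/2)^Suc i"
      unfolding nrm_scale[OF t(1)[of i]] using lpn_entry[of i n c] t(2)[of i]
      by (subst nrm_scale) (auto intro!: mult_mono simp del: power_Suc lp_simps simp: t)
  qed
  also have "\<dots> = lpn n c * (\<Sum>i<n. (1/2)^Suc i)" by (simp only: sum_distrib_left)
  also have "\<dots> \<le> lpn n c * 1" by (intro mult_left_mono sum_half_powers) simp
  finally show ?thesis by simp
qed

lemma lpn_blocks_le:
  assumes y: "y \<in> car L" and N: "\<And>i. N i \<le> N (Suc i)"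
    and le: "\<And>i. i < n \<Longrightarrow> cmod (c i) \<le> nrm L (rst {N i..<N (Suc i)} y)"
  shows "lpn n c \<le> nrm L y"
proof (rule lpn_leI)
  have "(\<Sum>i<n. cmod (c i) powr p) \<le> (\<Sum>i<n. nrm L (rst {N i..<N (Suc i)} y) powr p)"
    using le p by (intro sum_mono powr_mono2) auto
  also have "\<dots> \<le> nrm L y powr p"
    by (rule sum_rst_le[OF y]) (use incseq_blocks_disjoint[of N] N in auto)
  finally show "(\<Sum>i<n. cmod (c i) powr p) \<le> nrm L y powr p" .
qed simp

text \<open>The \<open>i\<close>-th vector is normalised, vanishes before the \<open>i\<close>-th block of coordinates, and its part after
  the block has norm at most \<open>2^-(i + 1)\<close>, so that the perturbations sum to at most one. The
  functionals are norming functionals of the block parts, restricted to the blocks; the block parts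
  have norm at least \<open>1/2\<close>.\<close>

lemma gliding_hump_vectors:
  assumes V: "V \<subseteq> car L" "\<And>c x. x \<in> V \<Longrightarrow> scl L c x \<in> V"
    and hump: "\<And>m. \<exists>x\<in>V. x \<noteq> 0 \<and> (\<forall>k<m. x k = 0)"
  obtains x f where "\<And>n. biorthogonal_bound n x f" "\<And>i. x i \<in> V" "\<And>i. nrm L (x i) \<le> 1"
    "\<And>i. \<exists>a\<ge>1/4. f i (x i) = complex_of_real a"
proof -
  have "\<exists>x m'. x \<in> V \<and> nrm L x = 1 \<and> (\<forall>k<m. x k = 0) \<and> m \<le> m' \<and> nrm L (rst {m'..} x) \<le> (1/2)^Suc i" for m i
  proof -
    obtain y where y: "y \<in> V" "y \<noteq> 0" "\<forall>k<m. y k = 0" using hump by blast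
    have yL: "y \<in> car L" using y(1) V(1) by blast
    have ny: "nrm L y > 0" using nrm_nonneg[OF yL] nrm_eq_0[OF yL] y(2) by (auto simp: less_le)
    define x where "x = scl L (complex_of_real (1 / nrm L y)) y"
    have "nrm L x = cmod (complex_of_real (1 / nrm L y)) * nrm L y" unfolding x_def by (rule nrm_scale[OF yL])
    also have "\<dots> = 1" unfolding norm_of_real using ny by simp
    finally have nx: "nrm L x = 1" .
    have xV: "x \<in> V" unfolding x_def by (rule V(2)[OF y(1)])
    have xL: "x \<in> car L" using xV V(1) by blast
    have x0: "\<forall>k<m. x k = 0" using y(3) by (simp add: x_def)
    note x = xV xL nx x0
    obtain m0 where "\<And>k. k \<ge> m0 \<Longrightarrow> nrm L (rst {k..} x) \<le> (1/2)^Suc i" using tail_small[OF x(2), of "(1/2)^Suc i"] by auto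
    then have "nrm L (rst {max m m0..} x) \<le> (1/2)^Suc i" by simp
    then show ?thesis using x by (intro exI[of _ x] exI[of _ "max m m0"]) auto
  qed
  then obtain X M where XM: "\<And>m i. X m i \<in> V" "\<And>m i. nrm L (X m i) = 1" "\<And>m i k. k < m \<Longrightarrow> X m i k = 0"
    "\<And>m i. m \<le> M m i" "\<And>m i. nrm L (rst {M m i..} (X m i)) \<le> (1/2)^Suc i" by metis
  define N where "N = rec_nat 0 (\<lambda>i m. M m i)"
  have N: "N (Suc i) = M (N i) i" "N i \<le> N (Suc i)" for i using XM(4) by (simp_all add: N_def)
  define x where "x i = X (N i) i" for i
  let ?A = "\<lambda>i. {N i..<N (Suc i)}"
  define u where "u i = rst (?A i) (x i)" for i
  define t where "t i = rst {N (Suc i)..} (x i)" for i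
  have x: "x i \<in> V" "x i \<in> car L" "nrm L (x i) = 1" for i
    using XM(1,2)[of "N i" i] V(1) unfolding x_def by blast+
  have t: "t i \<in> car L" "nrm L (t i) \<le> (1/2)^Suc i" for i using XM(5)[of "N i" i] rst_carrier[OF x(2)] N(1)[of i] by (simp_all add: t_def x_def)
  have u: "u i \<in> car L" "nrm L (u i) \<le> 1" for i
    using rst_carrier[OF x(2)] rst_le[OF x(2)] x(3) unfolding u_def by metis+
  have xut: "x i = u i + t i" for i
    using XM(3)[of _ "N i" i] N(2)[of i] by (auto simp: u_def t_def rst_def x_def fun_eq_iff not_le not_less)
  have "nrm L (x i) \<le> nrm L (u i) + nrm L (t i)" for i unfolding xut[of i] by (rule nrm_add[OF u(1) t(1)])
  moreover have "(1/2::real)^Suc i \<le> 1/2" for i using power_decreasing[of 1 "Suc i" "1/2::real"] by simp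
  ultimately have u2: "nrm L (u i) \<ge> 1/2" for i using x(3)[of i] t(2)[of i] by (smt (verit) field_sum_of_halves)
  have "\<exists>g. g \<in> dual_ball L \<and> g (u i) = complex_of_real (nrm L (u i))" for i
    using norming_functional[OF u(1)[of i]] by metis
  then obtain g where g: "\<And>i. g i \<in> dual_ball L" "\<And>i. g i (u i) = complex_of_real (nrm L (u i))" by metis
  define f where "f i y = g i (rst (?A i) y)" for i y
  have f: "f i \<in> dual_ball L" for i unfolding f_def[abs_def] by (rule dual_rst[OF g(1)])
  show ?thesis
  proof (rule that[of x f])
    show "biorthogonal_bound n x f" for n
      unfolding biorthogonal_bound_def
    proof (intro conjI allI impI ballI)
      fix c
      have "(\<Sum>i<n. scl L (c i) (x i)) = (\<Sum>i<n. scl L (c i) (u i)) + (\<Sum>i<n. scl L (c i) (t i))"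
        unfolding xut by (simp add: sum.distrib[symmetric] vs.scale_right_distrib del: lp_simps)
      then have "nrm L (\<Sum>i<n. scl L (c i) (x i)) \<le> nrm L (\<Sum>i<n. scl L (c i) (u i)) + nrm L (\<Sum>i<n. scl L (c i) (t i))"
        using u t by (metis (no_types, lifting) nrm_add carrier_sum carrier_scale)
      also have "\<dots> \<le> lpn n c + lpn n c"
      proof (rule add_mono)
        show "nrm L (\<Sum>i<n. scl L (c i) (u i)) \<le> lpn n c"
          by (rule disjoint_sum_le[of n u ?A]) (use u incseq_blocks_disjoint[of N] N in \<open>auto simp: u_def rst_rst simp del: lp_simps\<close>)
        show "nrm L (\<Sum>i<n. scl L (c i) (t i)) \<le> lpn n c" by (rule sum_scl_le) (rule t)+
      qed
      finally show "nrm L (\<Sum>i<n. scl L (c i) (x i)) \<le> 2 * lpn n c" by simp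
    next
      fix y assume y: "y \<in> car L"
      have "lpn n (\<lambda>i. f i y) \<le> nrm L y"
        by (rule lpn_blocks_le[where N = N, OF y N(2)]) (use dual_le[OF g(1) rst_carrier[OF y]] in \<open>simp add: f_def\<close>)
      then show "lpn n (\<lambda>i. f i y) \<le> 2 * nrm L y" using nrm_nonneg[OF y] by linarith
    qed (use x f in auto)
    show "x i \<in> V" "nrm L (x i) \<le> 1" for i using x by simp_all
    show "\<exists>a\<ge>1/4. f i (x i) = complex_of_real a" for i
      using u2[of i] g(2)[of i] by (intro exI[of _ "nrm L (u i)"]) (simp add: f_def u_def)
  qed
qed

text \<open>A bounded functional is small on tails: otherwise the sum of \<open>n\<close> disjoint blocks would have
  values of order \<open>n\<close>, while its norm is of order \<open>n\<^sup>1\<^sup>/\<^sup>p\<close>.\<close>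

lemma functional_tail_small:
  assumes f: "f \<in> dual_ball L" and e: "e > 0"
  obtains m where "\<And>k y. k \<ge> m \<Longrightarrow> y \<in> car L \<Longrightarrow> cmod (f (rst {k..} y)) \<le> e * nrm L y"
proof (rule ccontr)
  assume neg: "\<not> thesis"
  have "\<exists>v m'. m \<le> m' \<and> v \<in> car L \<and> nrm L v \<le> 1 \<and> rst {m..<m'} v = v \<and> (\<exists>a\<ge>e/2. f v = complex_of_real a)" for m
  proof -
    have "\<exists>k y. k \<ge> m \<and> y \<in> car L \<and> cmod (f (rst {k..} y)) > e * nrm L y"
      using neg that[of m] by (meson not_less)
    then obtain k y where k: "k \<ge> m" and y: "y \<in> car L" and big: "cmod (f (rst {k..} y)) > e * nrm L y"
      by blast
    have ty: "rst {k..} y \<in> car L" by (rule rst_carrier[OF y])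
    have ny: "nrm L y > 0"
    proof (rule ccontr)
      assume "\<not> nrm L y > 0"
      then have "nrm L y = 0" using nrm_nonneg[OF y] by simp
      then have "cmod (f (rst {k..} y)) \<le> 0" using dual_le[OF f ty] rst_le[OF y, of "{k..}"] by linarith
      then show False using big \<open>nrm L y = 0\<close> by simp
    qed
    define w where "w = scl L (complex_of_real (1 / nrm L y)) (rst {k..} y)"
    have w: "w \<in> car L" unfolding w_def by (rule carrier_scale[OF ty])
    have nw: "nrm L w \<le> 1"
      unfolding w_def nrm_scale[OF ty] using rst_le[OF y, of "{k..}"] ny by (simp add: norm_divide divide_le_eq)
    have fw: "cmod (f w) > e"
      unfolding w_def dual_scale[OF f ty] using big ny by (simp add: norm_mult norm_divide less_divide_eq mult.commute)
    obtain m0 where m0: "\<And>k. k \<ge> m0 \<Longrightarrow> nrm L (rst {k..} w) \<le> e / 2" using tail_small[OF w, of "e / 2"] e by auto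
    define m' where "m' = max k m0"
    define v0 where "v0 = rst {k..<m'} w"
    have v0: "v0 \<in> car L" "nrm L v0 \<le> 1" using rst_carrier[OF w] rst_le[OF w, of "{k..<m'}"] nw by (simp_all add: v0_def)
    have "w = v0 + rst {m'..} w" by (auto simp: w_def v0_def rst_def fun_eq_iff m'_def)
    then have "f w = f v0 + f (rst {m'..} w)" using dual_add[OF f v0(1) rst_carrier[OF w]] by metis
    moreover have "cmod (f (rst {m'..} w)) \<le> e / 2"
      using dual_le[OF f rst_carrier[OF w], of "{m'..}"] m0[of m'] unfolding m'_def by linarith
    ultimately have fv0: "cmod (f v0) \<ge> e / 2" using fw norm_triangle_ineq[of "f v0" "f (rst {m'..} w)"] by simp
    obtain c where c: "cmod c = 1" "f (scl L c v0) = complex_of_real (cmod (f v0))" using rotate_to_positive[OF f v0(1)] .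
    show ?thesis
    proof (intro exI[of _ "scl L c v0"] exI[of _ m'] conjI)
      show "nrm L (scl L c v0) \<le> 1" unfolding nrm_scale[OF v0(1)] using c v0 by simp
      show "rst {m..<m'} (scl L c v0) = scl L c v0"
        unfolding rst_scale using k by (auto simp: v0_def rst_def fun_eq_iff)
    qed (use k c fv0 carrier_scale[OF v0(1)] in \<open>auto simp: m'_def\<close>)
  qed
  then obtain v M where vM: "\<And>m. m \<le> M m" "\<And>m. v m \<in> car L" "\<And>m. nrm L (v m) \<le> 1" "\<And>m. rst {m..<M m} (v m) = v m"
    "\<And>m. \<exists>a\<ge>e/2. f (v m) = complex_of_real a" by metis
  define N where "N = rec_nat 0 (\<lambda>i m. M m)"
  have N: "N (Suc i) = M (N i)" "N i \<le> N (Suc i)" for i using vM(1) by (simp_all add: N_def)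
  have le: "real n * (e / 2) \<le> real n powr (1 / p)" if n: "n \<ge> 1" for n
  proof -
    let ?y = "\<Sum>i<n. scl L 1 (v (N i))"
    have "nrm L ?y \<le> lpn n (\<lambda>_. 1)"
      by (rule disjoint_sum_le[of n "\<lambda>i. v (N i)" "\<lambda>i. {N i..<N (Suc i)}"])
        (use vM N incseq_blocks_disjoint[of N] in \<open>auto simp del: lp_simps\<close>)
    also have "\<dots> \<le> real n powr (1 / p)" by (rule lpn_unimodular[OF _ n]) simp
    finally have ny: "nrm L ?y \<le> real n powr (1 / p)" .
    obtain a where a: "\<And>m. a m \<ge> e / 2" "\<And>m. f (v m) = complex_of_real (a m)" using vM(5) by metis
    have "f ?y = (\<Sum>i<n. complex_of_real (a (N i)))"
      using vM(2) by (subst dual_sum[OF f]) (auto simp: a(2))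
    then have "cmod (f ?y) = \<bar>\<Sum>i<n. a (N i)\<bar>" by (simp only: of_real_sum[symmetric] norm_of_real)
    moreover have "(\<Sum>i<n. e / 2) \<le> (\<Sum>i<n. a (N i))" by (intro sum_mono a)
    moreover have "cmod (f ?y) \<le> nrm L ?y" using vM(2) by (intro dual_le[OF f] carrier_sum carrier_scale)
    ultimately show ?thesis using ny by simp
  qed
  have "((\<lambda>n. real n powr (1 / p) / real n) \<longlongrightarrow> 0) sequentially" using p by real_asymp
  then have "eventually (\<lambda>n. real n powr (1 / p) / real n < e / 2) sequentially" using e by (intro order_tendstoD) auto
  then have "eventually (\<lambda>n. real n powr (1 / p) / real n < e / 2 \<and> n \<ge> 1) sequentially"
    by (intro eventually_conj eventually_ge_at_top)
  then obtain n where "real n powr (1 / p) / real n < e / 2" "n \<ge> 1"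
    using eventually_happens'[OF sequentially_bot] by blast
  then show False using le[of n] by (simp add: divide_less_eq mult.commute)
qed

text \<open>The dual construction: the functionals vanish before their block and are small after it, and the
  vectors lie in the block exactly. The predicate \<open>P\<close> collects the functionals that are admitted. Of the value \<open>1/2\<close> at most \<open>1/4\<close> is lost by cutting off the tail of \<open>y\<close>.\<close>

lemma gliding_hump_functionals:
  assumes hump: "\<And>m. \<exists>f\<in>dual_ball L. P f \<and> (\<forall>y\<in>car L. f (rst {..<m} y) = 0) \<and>
      (\<exists>y\<in>car L. nrm L y \<le> 1 \<and> cmod (f y) \<ge> 1/2)"
  obtains x f where "\<And>n. biorthogonal_bound n x f" "\<And>i. P (f i)" "\<And>i. nrm L (x i) \<le> 1"
    "\<And>i. \<exists>a\<ge>1/4. f i (x i) = complex_of_real a"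
proof -
  have "\<exists>f x m'. f \<in> dual_ball L \<and> P f \<and> (\<forall>y\<in>car L. f (rst {..<m} y) = 0) \<and> m \<le> m' \<and>
     (\<forall>y\<in>car L. cmod (f (rst {m'..} y)) \<le> (1/2)^Suc i * nrm L y) \<and>
     x \<in> car L \<and> nrm L x \<le> 1 \<and> rst {m..<m'} x = x \<and> (\<exists>a\<ge>1/4. f x = complex_of_real a)" for m i
  proof -
    obtain f y where f: "f \<in> dual_ball L" "P f" "\<forall>y\<in>car L. f (rst {..<m} y) = 0"
      and y: "y \<in> car L" "nrm L y \<le> 1" "cmod (f y) \<ge> 1/2" using hump[of m] by blast
    obtain m1 where m1: "\<And>k y. k \<ge> m1 \<Longrightarrow> y \<in> car L \<Longrightarrow> cmod (f (rst {k..} y)) \<le> (1/2)^Suc i * nrm L y"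
      using functional_tail_small[OF f(1), of "(1/2)^Suc i"] by auto
    obtain m2 where m2: "\<And>k. k \<ge> m2 \<Longrightarrow> nrm L (rst {k..} y) \<le> 1/4" using tail_small[OF y(1), of "1/4"] by auto
    define m' where "m' = max m (max m1 m2)"
    define x0 where "x0 = rst {m..<m'} y"
    have x0: "x0 \<in> car L" "nrm L x0 \<le> 1"
      using rst_carrier[OF y(1)] rst_le[OF y(1), of "{m..<m'}"] y(2) by (simp_all add: x0_def)
    have "y = rst {..<m} y + (x0 + rst {m'..} y)" by (auto simp: x0_def rst_def fun_eq_iff m'_def)
    then have "f y = f (rst {..<m} y) + (f x0 + f (rst {m'..} y))"
      using dual_add[OF f(1)] rst_carrier[OF y(1)] x0(1) carrier_add by metis
    then have "f y = f x0 + f (rst {m'..} y)" using f(3) y(1) by simp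
    moreover have "cmod (f (rst {m'..} y)) \<le> 1/4"
      using dual_le[OF f(1) rst_carrier[OF y(1)], of "{m'..}"] m2[of m'] unfolding m'_def by linarith
    ultimately have fx0: "cmod (f x0) \<ge> 1/4" using y(3) norm_triangle_ineq[of "f x0" "f (rst {m'..} y)"] by simp
    obtain c where c: "cmod c = 1" "f (scl L c x0) = complex_of_real (cmod (f x0))" using rotate_to_positive[OF f(1) x0(1)] .
    show ?thesis
    proof (intro exI[of _ f] exI[of _ "scl L c x0"] exI[of _ m'] conjI f)
      show "nrm L (scl L c x0) \<le> 1" unfolding nrm_scale[OF x0(1)] using c x0 by simp
      show "rst {m..<m'} (scl L c x0) = scl L c x0" by (auto simp: x0_def rst_def fun_eq_iff)
      show "\<forall>y\<in>car L. cmod (f (rst {m'..} y)) \<le> (1/2)^Suc i * nrm L y" using m1[of m'] by (auto simp: m'_def)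
    qed (use c fx0 carrier_scale[OF x0(1)] in \<open>auto simp: m'_def\<close>)
  qed
  then obtain F X M where FXM: "\<And>m i. F m i \<in> dual_ball L" "\<And>m i. P (F m i)"
    "\<And>m i y. y \<in> car L \<Longrightarrow> F m i (rst {..<m} y) = 0" "\<And>m i. m \<le> M m i"
    "\<And>m i y. y \<in> car L \<Longrightarrow> cmod (F m i (rst {M m i..} y)) \<le> (1/2)^Suc i * nrm L y"
    "\<And>m i. X m i \<in> car L" "\<And>m i. nrm L (X m i) \<le> 1" "\<And>m i. rst {m..<M m i} (X m i) = X m i"
    "\<And>m i. \<exists>a\<ge>1/4. F m i (X m i) = complex_of_real a" by metis
  define N where "N = rec_nat 0 (\<lambda>i m. M m i)"
  have N: "N (Suc i) = M (N i) i" "N i \<le> N (Suc i)" for i using FXM(4) by (simp_all add: N_def)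
  define x where "x i = X (N i) i" for i
  define f where "f i = F (N i) i" for i
  let ?A = "\<lambda>i. {N i..<N (Suc i)}"
  have x: "x i \<in> car L" "nrm L (x i) \<le> 1" "rst (?A i) (x i) = x i" for i using FXM by (simp_all add: x_def N(1) del: lp_simps)
  have f: "f i \<in> dual_ball L" for i using FXM(1) by (simp add: f_def)
  have fy: "cmod (f i y) \<le> nrm L (rst (?A i) y) + (1/2)^Suc i * nrm L y" if y: "y \<in> car L" for i y
  proof -
    have "y = rst {..<N i} y + (rst (?A i) y + rst {N (Suc i)..} y)" using N(2)[of i] by (auto simp: rst_def fun_eq_iff)
    then have "f i y = f i (rst {..<N i} y) + (f i (rst (?A i) y) + f i (rst {N (Suc i)..} y))"
      using dual_add[OF f] rst_carrier[OF y] carrier_add by metis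
    then have "f i y = f i (rst (?A i) y) + f i (rst {N (Suc i)..} y)" using FXM(3)[OF y] by (simp add: f_def)
    moreover have "cmod (f i (rst {N (Suc i)..} y)) \<le> (1/2)^Suc i * nrm L y"
      using FXM(5)[OF y, of "N i" i] unfolding f_def N(1) .
    moreover have "cmod (f i (rst (?A i) y)) \<le> nrm L (rst (?A i) y)" by (rule dual_le[OF f rst_carrier[OF y]])
    ultimately show ?thesis using norm_triangle_ineq[of "f i (rst (?A i) y)" "f i (rst {N (Suc i)..} y)"] by (simp del: power_Suc lp_simps)
  qed
  show ?thesis
  proof (rule that[of x f])
    show "biorthogonal_bound n x f" for n
      unfolding biorthogonal_bound_def
    proof (intro conjI allI impI ballI)
      fix c
      have "nrm L (\<Sum>i<n. scl L (c i) (x i)) \<le> lpn n c"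
        by (rule disjoint_sum_le[of n x ?A]) (use x incseq_blocks_disjoint[of N] N in \<open>auto simp del: lp_simps\<close>)
      then show "nrm L (\<Sum>i<n. scl L (c i) (x i)) \<le> 2 * lpn n c" using lpn_nonneg[of n c] by linarith
    next
      fix y assume y: "y \<in> car L"
      let ?a = "\<lambda>i. complex_of_real (nrm L (rst (?A i) y))" and ?b = "\<lambda>i. complex_of_real ((1/2)^Suc i * nrm L y)"
      have "lpn n (\<lambda>i. f i y) \<le> lpn n (\<lambda>i. ?a i + ?b i)"
      proof (rule lpn_mono)
        fix i
        have "cmod (?a i + ?b i) = nrm L (rst (?A i) y) + (1/2)^Suc i * nrm L y"
          unfolding of_real_add[symmetric] norm_of_real using nrm_nonneg[OF y] by (intro abs_of_nonneg add_nonneg_nonneg) auto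
        then show "cmod (f i y) \<le> cmod (?a i + ?b i)" using fy[OF y, of i] by simp
      qed
      also have "\<dots> \<le> lpn n ?a + lpn n ?b" by (rule lpn_add)
      also have "\<dots> \<le> nrm L y + nrm L y"
      proof (rule add_mono)
        show "lpn n ?a \<le> nrm L y" by (rule lpn_blocks_le[where N = N, OF y N(2)]) simp
        have "lpn n ?b \<le> (\<Sum>i<n. cmod (?b i))" by (rule lpn_le_sum)
        also have "\<dots> = (\<Sum>i<n. (1/2)^Suc i) * nrm L y"
          unfolding sum_distrib_right norm_of_real using nrm_nonneg[OF y] by (intro sum.cong refl abs_of_nonneg) auto
        also have "\<dots> \<le> 1 * nrm L y" by (intro mult_right_mono sum_half_powers nrm_nonneg y)
        finally show "lpn n ?b \<le> nrm L y" by simp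
      qed
      finally show "lpn n (\<lambda>i. f i y) \<le> 2 * nrm L y" by simp
    qed (use x f in auto)
    show "P (f i)" "nrm L (x i) \<le> 1" "\<exists>a\<ge>1/4. f i (x i) = complex_of_real a" for i
      using FXM x(2) by (simp_all add: f_def x_def)
  qed
qed

end

section \<open>Singularity and cosingularity\<close>

context interpolation
begin

lemma XT_norm_ge:
  assumes x: "x \<in> car N"
  shows "nrm N x \<le> mnorm XT (mat 1 1 (\<lambda>_. x))"
proof (rule field_le_epsilon)
  fix e :: real assume "e > 0"
  then obtain f where f: "f \<in> car CX" "f tt = x" "mnorm CX (mat 1 1 (\<lambda>_. f)) < mnorm XT (mat 1 1 (\<lambda>_. x)) + e"
    using I.Q_one_lift[of x "mnorm XT (mat 1 1 (\<lambda>_. x)) + e"] x XT_car by (auto simp: XT_Q simp del: I.Q_simps)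
  then show "nrm N x \<le> mnorm XT (mat 1 1 (\<lambda>_. x)) + e"
    using calderon_bounds(1)[of f] by (simp add: calderon_car)
qed

lemma DX_norm_ge:
  assumes d: "d \<in> car DX"
  shows "nrm N (snd d) \<le> mnorm DX (mat 1 1 (\<lambda>_. d)) / rad"
proof (rule field_le_epsilon)
  fix e :: real assume e: "e > 0"
  then have "e * rad > 0" using rad_pos by simp
  then obtain f where f: "f \<in> car CX" "jet f = d" "mnorm CX (mat 1 1 (\<lambda>_. f)) < mnorm DX (mat 1 1 (\<lambda>_. d)) + e * rad"
    using D.Q_one_lift[of d "mnorm DX (mat 1 1 (\<lambda>_. d)) + e * rad"] d by (auto simp: DX_Q simp del: D.Q_simps)
  have sf: "strip_fun f" using f(1) by (simp add: calderon_car)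
  have "snd d = complex_deriv N f tt" using f(2) jet_eq[OF sf] by auto
  then have "nrm N (snd d) \<le> mnorm CX (mat 1 1 (\<lambda>_. f)) / rad" using calderon_bounds(2)[OF sf] by simp
  also have "\<dots> \<le> (mnorm DX (mat 1 1 (\<lambda>_. d)) + e * rad) / rad" using f(3) rad_pos by (intro divide_right_mono) auto
  also have "\<dots> = mnorm DX (mat 1 1 (\<lambda>_. d)) / rad + e" using rad_pos by (simp add: add_divide_distrib)
  finally show "nrm N (snd d) \<le> mnorm DX (mat 1 1 (\<lambda>_. d)) / rad + e" .
qed

end

locale lp_interpolation = lp p for p +
  fixes \<theta> :: real
  assumes th: "0 < \<theta>" "\<theta> < 1"
begin

sublocale interpolation L NMIN NMAX \<theta>
  by (intro interpolation.intro min_max_couple interpolation_axioms.intro th)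

lemma powr_balance:
  assumes "K0 > 0" "K1 > 0" "N0 > 0" "N1 > 0" "K0 * N0 = c" "K1 * N1 = c"
  shows "K0 powr (1 - \<theta>) * K1 powr \<theta> * (N0 powr (1 - \<theta>) * N1 powr \<theta>) = c"
proof -
  have "K0 powr (1 - \<theta>) * K1 powr \<theta> * (N0 powr (1 - \<theta>) * N1 powr \<theta>) = (K0 * N0) powr (1 - \<theta>) * (K1 * N1) powr \<theta>"
    using assms(1-4) by (simp add: powr_mult)
  also have "\<dots> = c powr (1 - \<theta> + \<theta>)" unfolding assms(5,6) by (simp only: powr_add)
  also have "\<dots> = c" using assms by (metis diff_add_cancel mult_pos_pos powr_one less_imp_le)
  finally show ?thesis .
qed

lemma diagonal_sum:
  fixes f :: "nat \<Rightarrow> (nat \<Rightarrow> complex) \<Rightarrow> complex"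
  assumes "\<And>i. i < n \<Longrightarrow> \<exists>a\<ge>1/4. f i (x i) = complex_of_real a"
  obtains A where "A \<ge> real n / 4" "(\<Sum>i<n. f i (x i)) = complex_of_real A"
proof -
  obtain a where a: "\<And>i. i < n \<Longrightarrow> a i \<ge> 1/4 \<and> f i (x i) = complex_of_real (a i)" using assms by metis
  have "(\<Sum>i<n. 1/4) \<le> (\<Sum>i<n. a i)" using a by (intro sum_mono) auto
  moreover have "(\<Sum>i<n. f i (x i)) = complex_of_real (\<Sum>i<n. a i)" using a by simp
  ultimately show ?thesis by (intro that) auto
qed

lemma ln_large:
  obtains n :: nat where "n \<ge> 1" "gap * ln (real n) / 4 > R"
proof -
  have "filterlim (\<lambda>n. gap * ln (real n) / 4) at_top sequentially" using gap_pos by real_asymp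
  then have "eventually (\<lambda>n. gap * ln (real n) / 4 > R) sequentially" by (simp add: filterlim_at_top_dense)
  then have "eventually (\<lambda>n. gap * ln (real n) / 4 > R \<and> n \<ge> 1) sequentially"
    by (intro eventually_conj eventually_ge_at_top)
  then show ?thesis using that eventually_happens'[OF sequentially_bot] by blast
qed

text \<open>The quantitative obstruction to lifting along \<open>q\<close>: a lifting of the column with complete bound \<open>C\<close>
  forces second components that grow like \<open>ln n\<close>.\<close>

lemma lifted_columns_estimate:
  assumes n: "n \<ge> 1" and S: "biorthogonal_bound n x f"
    and diag: "\<And>i. i < n \<Longrightarrow> \<exists>a\<ge>1/4. f i (x i) = complex_of_real a"
    and z: "z \<in> mats DX n" and fst_z: "\<And>i. i < n \<Longrightarrow> fst (z $$ (i, 0)) = x i"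
    and C: "0 \<le> C" "mnorm DX z \<le> C * mnorm XT (column n x)"
    and B: "\<And>i. i < n \<Longrightarrow> cmod (f i (snd (z $$ (i, 0)))) \<le> B"
  shows "gap * ln (real n) / 4 \<le> B + 4 * C / rad"
proof -
  have x: "\<And>i. i < n \<Longrightarrow> x i \<in> car L" and f: "\<And>i. i < n \<Longrightarrow> f i \<in> dual_ball L"
    using S unfolding biorthogonal_bound_def by blast+
  obtain K0 K1 N0 N1 :: real where K: "K0 > 0" "K1 > 0" "N0 > 0" "N1 > 0"
    "K0 * N0 = 4 * real n" "K1 * N1 = 4 * real n"
    "ln (K0 / K1) = gap * ln (real n)" "ln (N0 / N1) = - gap * ln (real n)"
    "mnorm NMIN (column n x) \<le> N0" "mnorm NMAX (column n x) \<le> N1"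
    and F0: "\<And>y. y \<in> mats L n \<Longrightarrow> cmod (\<Sum>i<n. f i (y $$ (i, 0))) \<le> K0 * mnorm NMIN y"
    and F1: "\<And>y. y \<in> mats L n \<Longrightarrow> cmod (\<Sum>i<n. f i (y $$ (i, 0))) \<le> K1 * mnorm NMAX y"
    by (rule column_estimates[OF n S]) (rule that)
  let ?K = "K0 powr (1 - \<theta>) * K1 powr \<theta>" and ?N = "N0 powr (1 - \<theta>) * N1 powr \<theta>"
  have col: "column n x \<in> mats L n" by (rule column_mats[OF x])
  have "mnorm DX z \<le> C * ?N"
    using C mult_left_mono[OF extremal_function(3)[OF col n K(3,4,9,10)] C(1)] by linarith
  then have "?K / rad * mnorm DX z \<le> ?K / rad * (C * ?N)" using K rad_pos by (intro mult_left_mono) auto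
  also have "\<dots> = C / rad * (?K * ?N)" by simp
  also have "?K * ?N = 4 * real n" by (rule powr_balance[OF K(1-6)])
  finally have KN: "?K / rad * mnorm DX z \<le> real n * (4 * C / rad)" by (simp add: ac_simps)
  obtain A where A: "A \<ge> real n / 4" "(\<Sum>i<n. f i (x i)) = complex_of_real A" by (rule diagonal_sum[of n f x]) (rule diag)
  let ?b = "\<Sum>i<n. f i (snd (z $$ (i, 0)))"
  have "cmod (?b + complex_of_real (ln (K0 / K1)) * (\<Sum>i<n. f i (fst (z $$ (i, 0))))) \<le> ?K / rad * mnorm DX z"
    by (rule column_functional_le(2)[OF f n K(1,2) F0 F1 z])
  then have "cmod (?b + complex_of_real (gap * ln (real n) * A)) \<le> real n * (4 * C / rad)"
    using KN by (simp add: fst_z A(2) K(7))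
  moreover have "cmod ?b \<le> (\<Sum>i<n. B)" by (rule order_trans[OF norm_sum sum_mono]) (use B in auto)
  ultimately have "cmod (complex_of_real (gap * ln (real n) * A)) \<le> real n * (4 * C / rad) + real n * B"
    using norm_triangle_ineq4[of "?b + complex_of_real (gap * ln (real n) * A)" ?b] by simp
  then have "gap * ln (real n) * A \<le> real n * (4 * C / rad) + real n * B" unfolding norm_of_real by linarith
  moreover have "gap * ln (real n) * (real n / 4) \<le> gap * ln (real n) * A"
    using A(1) gap_pos n by (intro mult_left_mono) auto
  ultimately have "real n * (gap * ln (real n) / 4) \<le> real n * (4 * C / rad) + real n * B" by (simp only: ac_simps times_divide_eq_right times_divide_eq_left)
  then have "real n * (gap * ln (real n) / 4) \<le> real n * (B + 4 * C / rad)" unfolding distrib_left by linarith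
  then show ?thesis using n by simp
qed

text \<open>The dual obstruction. Here \<open>w\<close> is the column that lifts the image of the extremal pairs in the
  quotient; the lifting is assumed for all \<open>l\<close> because the value \<open>ln (N\<^sub>0 / N\<^sub>1)\<close> that matters depends on
  the constants from \<open>column_estimates\<close>.\<close>

lemma quotient_columns_estimate:
  assumes n: "n \<ge> 1" and S: "biorthogonal_bound n x f"
    and diag: "\<And>i. i < n \<Longrightarrow> \<exists>a\<ge>1/4. f i (x i) = complex_of_real a"
    and lift: "\<And>l \<nu>. \<nu> > 0 \<Longrightarrow> map_mat (\<lambda>x. (x, scl L (complex_of_real l) x)) (column n x) \<in> mats DX n \<Longrightarrow>
       mnorm DX (map_mat (\<lambda>x. (x, scl L (complex_of_real l) x)) (column n x)) \<le> \<nu> \<Longrightarrow>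
       \<exists>w\<in>mats XT n. mnorm XT w \<le> C * \<nu> \<and> (\<forall>i<n. f i (w $$ (i, 0)) = b i + complex_of_real l * f i (x i))"
    and B: "\<And>i. i < n \<Longrightarrow> cmod (b i) \<le> B"
  shows "gap * ln (real n) / 4 \<le> B + 4 * C"
proof -
  have x: "\<And>i. i < n \<Longrightarrow> x i \<in> car L" and f: "\<And>i. i < n \<Longrightarrow> f i \<in> dual_ball L"
    using S unfolding biorthogonal_bound_def by blast+
  obtain K0 K1 N0 N1 :: real where K: "K0 > 0" "K1 > 0" "N0 > 0" "N1 > 0"
    "K0 * N0 = 4 * real n" "K1 * N1 = 4 * real n"
    "ln (K0 / K1) = gap * ln (real n)" "ln (N0 / N1) = - gap * ln (real n)"
    "mnorm NMIN (column n x) \<le> N0" "mnorm NMAX (column n x) \<le> N1"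
    and F0: "\<And>y. y \<in> mats L n \<Longrightarrow> cmod (\<Sum>i<n. f i (y $$ (i, 0))) \<le> K0 * mnorm NMIN y"
    and F1: "\<And>y. y \<in> mats L n \<Longrightarrow> cmod (\<Sum>i<n. f i (y $$ (i, 0))) \<le> K1 * mnorm NMAX y"
    by (rule column_estimates[OF n S]) (rule that)
  let ?K = "K0 powr (1 - \<theta>) * K1 powr \<theta>" and ?N = "N0 powr (1 - \<theta>) * N1 powr \<theta>"
  have col: "column n x \<in> mats L n" by (rule column_mats[OF x])
  have "?N > 0" using K by simp
  then obtain w where w: "w \<in> mats XT n" "mnorm XT w \<le> C * ?N"
      "\<forall>i<n. f i (w $$ (i, 0)) = b i + complex_of_real (ln (N0 / N1)) * f i (x i)"
    using lift[OF _ extremal_function(1,2)[OF col n K(3,4,9,10)]] by blast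
  obtain A where A: "A \<ge> real n / 4" "(\<Sum>i<n. f i (x i)) = complex_of_real A" by (rule diagonal_sum[of n f x]) (rule diag)
  let ?b = "\<Sum>i<n. b i"
  have "(\<Sum>i<n. f i (w $$ (i, 0))) = ?b + complex_of_real (ln (N0 / N1)) * (\<Sum>i<n. f i (x i))"
    using w(3) by (simp add: sum.distrib sum_distrib_left)
  also have "\<dots> = ?b - complex_of_real (gap * ln (real n) * A)" by (simp add: A(2) K(8))
  finally have "cmod (?b - complex_of_real (gap * ln (real n) * A)) \<le> ?K * mnorm XT w"
    using column_functional_le(1)[OF f n K(1,2) F0 F1 w(1)] by simp
  also have "\<dots> \<le> ?K * (C * ?N)" using w(2) by (intro mult_left_mono) auto
  also have "\<dots> = C * (?K * ?N)" by simp
  also have "?K * ?N = 4 * real n" by (rule powr_balance[OF K(1-6)])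
  finally have "cmod (?b - complex_of_real (gap * ln (real n) * A)) \<le> real n * (4 * C)" by (simp only: ac_simps)
  moreover have "cmod ?b \<le> (\<Sum>i<n. B)" by (rule order_trans[OF norm_sum sum_mono]) (use B in auto)
  ultimately have "cmod (complex_of_real (gap * ln (real n) * A)) \<le> real n * (4 * C) + real n * B"
    using norm_triangle_ineq4[of ?b "?b - complex_of_real (gap * ln (real n) * A)"] by simp
  then have "gap * ln (real n) * A \<le> real n * (4 * C) + real n * B" unfolding norm_of_real by linarith
  moreover have "gap * ln (real n) * (real n / 4) \<le> gap * ln (real n) * A"
    using A(1) gap_pos n by (intro mult_left_mono) auto
  ultimately have "real n * (gap * ln (real n) / 4) \<le> real n * (B + 4 * C)" by (simp add: algebra_simps)
  then show ?thesis using n by simp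
qed

theorem completely_strictly_singular_q: "completely_strictly_singular DX XT (\<lambda>(x, y). x)"
  unfolding completely_strictly_singular_def
proof (intro allI impI notI, elim conjE)
  let ?q = "\<lambda>(x :: nat \<Rightarrow> complex, y :: nat \<Rightarrow> complex). x"
  fix W assume W: "closed_subspace DX W" and inf: "\<not> finite_dim (DX\<lparr>car := W\<rparr>)"
    and iso: "complete_isomorphism_onto_image (DX\<lparr>car := W\<rparr>) XT ?q"
  let ?V = "?q ` W"
  \<comment> \<open>The completely bounded lifting.\<close>
  define S where "S = inv_into W ?q"
  have inj: "inj_on ?q W" and cb: "completely_bounded (XT\<lparr>car := ?V\<rparr>) (DX\<lparr>car := W\<rparr>) S"
    using iso by (auto simp: complete_isomorphism_onto_image_def complete_isomorphism_def bij_betw_def S_def)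
  have sub: "module.subspace (scl DX) W" and WD: "W \<subseteq> car DX" using W by (auto simp: closed_subspace_def)
  interpret W: cvs_locale W "scl DX" using sub DX.vector_space_scale by (simp add: cvs_locale_def)
  obtain C0 where C0: "\<And>n z. n \<ge> 1 \<Longrightarrow> z \<in> mats (XT\<lparr>car := ?V\<rparr>) n \<Longrightarrow> mnorm DX (map_mat S z) \<le> C0 * mnorm XT z"
    using cb unfolding completely_bounded_def by auto
  define C where "C = max C0 0"
  have CC: "mnorm DX (map_mat S z) \<le> C * mnorm XT z" if "n \<ge> 1" "z \<in> mats (XT\<lparr>car := ?V\<rparr>) n" "z \<in> mats XT n" for n z
    using C0[OF that(1,2)] mult_right_mono[of C0 C "mnorm XT z"] XT.mnorm_nonneg[OF that(1,3)] by (auto simp: C_def)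
  have V: "?V \<subseteq> car L" using WD DX_car_subset by fastforce
  have S: "S v \<in> W" "?q (S v) = v" if "v \<in> ?V" for v
    using that unfolding S_def by (auto intro: inv_into_into f_inv_into_f simp del: split_conv)
  obtain x f where sys: "\<And>n. biorthogonal_bound n x f" and xV: "\<And>i. x i \<in> ?V" and nx: "\<And>i. nrm L (x i) \<le> 1"
    and diag: "\<And>i. \<exists>a\<ge>1/4. f i (x i) = complex_of_real a"
  proof (rule gliding_hump_vectors[OF V])
    show "scl L c v \<in> ?V" if vV: "v \<in> ?V" for c v
    proof -
      obtain a b where ab: "(a, b) \<in> W" "v = a" using vV by auto
      have "scl DX c (a, b) \<in> W" by (rule W.carrier_scale[OF ab(1)])
      then show ?thesis unfolding ab(2) by (intro image_eqI) (auto simp: split_def)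
    qed
    fix m
    obtain d where d: "d \<in> W" "d \<noteq> 0" "\<And>k. k < m \<Longrightarrow> fst d k = 0"
      using infinite_dim_common_zero[OF DX.vector_space_scale sub, of "\<lambda>k d. fst d k" m] inf
      by (auto simp: finite_dim_def split_def)
    \<comment> \<open>\<open>q\<close> is injective on \<open>W\<close>, so that vectors of \<open>W\<close> whose first components vanish up to \<open>m\<close> provide the hump.\<close>
    have "?q d \<noteq> 0"
    proof
      assume "?q d = 0"
      then have "?q d = ?q 0" by (simp add: split_def)
      then have "d = 0" using inj d(1) W.carrier_zero by (auto dest: inj_onD)
      then show False using d(2) by simp
    qed
    then show "\<exists>v\<in>?V. v \<noteq> 0 \<and> (\<forall>k<m. v k = 0)" using d(1,3) by (intro bexI[of _ "?q d"]) (auto simp: split_def)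
  qed (rule that)
  have xL: "x i \<in> car L" for i using xV V by blast
  have Sx: "S (x i) \<in> car DX" "fst (S (x i)) = x i" for i using S[OF xV[of i]] WD by (auto simp: split_def)
  have bound: "nrm L (snd (S (x i))) \<le> C / rad" for i
  proof -
    have m: "mat 1 1 (\<lambda>_. x i) \<in> mats (XT\<lparr>car := ?V\<rparr>) 1" "mat 1 1 (\<lambda>_. x i) \<in> mats XT 1"
      using xV[of i] xL[of i] by (auto intro!: matsI simp del: lp_simps)
    have "map_mat S (mat 1 1 (\<lambda>_. x i)) = mat 1 1 (\<lambda>_. S (x i))" by auto
    then have "mnorm DX (mat 1 1 (\<lambda>_. S (x i))) \<le> C * mnorm XT (mat 1 1 (\<lambda>_. x i))" using CC[OF _ m] by simp
    also have "\<dots> \<le> C * 1"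
      using pair_zero(3)[OF xL[of i]] nx[of i] by (intro mult_left_mono) (auto simp: C_def)
    finally have "mnorm DX (mat 1 1 (\<lambda>_. S (x i))) / rad \<le> C / rad" using rad_pos by (intro divide_right_mono) auto
    then show ?thesis using DX_norm_ge[OF Sx(1), of i] by linarith
  qed
  obtain n :: nat where n: "n \<ge> 1" "gap * ln (real n) / 4 > C / rad + 4 * C / rad" by (rule ln_large)
  have col: "column n x \<in> mats XT n" using column_mats[of n x] xL by (auto simp: mats_def)
  have "0 \<in> ?V" using W.carrier_zero by (intro image_eqI[of _ _ 0]) (auto simp: split_def)
  then have colV: "column n x \<in> mats (XT\<lparr>car := ?V\<rparr>) n" unfolding column_def using xV by (intro matsI) auto
  have "gap * ln (real n) / 4 \<le> C / rad + 4 * C / rad"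
  proof (rule lifted_columns_estimate[OF n(1) sys diag])
    have "map_mat S (column n x) \<in> mats (DX\<lparr>car := W\<rparr>) n"
      using colV S(1) by (auto simp: mats_iff)
    then show "map_mat S (column n x) \<in> mats DX n" using WD by (auto simp: mats_iff)
    show "fst (map_mat S (column n x) $$ (i, 0)) = x i" if "i < n" for i
      using that Sx by (simp add: column_index)
    show "mnorm DX (map_mat S (column n x)) \<le> C * mnorm XT (column n x)" by (rule CC[OF n(1) colV col])
    show "cmod (f i (snd (map_mat S (column n x) $$ (i, 0)))) \<le> C / rad" if i: "i < n" for i
    proof -
      have "snd (S (x i)) \<in> car L" using Sx(1)[of i] DX_car_subset by (cases "S (x i)") auto
      moreover have "f i \<in> dual_ball L" using sys[of n] i by (auto simp: biorthogonal_bound_def)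
      ultimately have "cmod (f i (snd (S (x i)))) \<le> nrm L (snd (S (x i)))" by (intro dual_le)
      then show ?thesis using bound[of i] i by (simp add: column_index)
    qed
  qed (simp add: C_def)
  then show False using n(2) by simp
qed

theorem completely_strictly_cosingular_j:
  "completely_strictly_cosingular TYPE('e::ab_group_add) XT DX (\<lambda>y. (0, y))"
  unfolding completely_strictly_cosingular_def
proof (intro allI impI, elim conjE)
  fix E :: "'e opspace" and r assume E: "operator_space E" and r: "complete_quotient_map DX E r"
    and rj: "complete_quotient_map XT E (r \<circ> (\<lambda>y. (0, y)))"
  interpret E: opspace E by unfold_locales (rule E)
  define T where "T y = r (0, y)" for y
  have T_eq: "r \<circ> (\<lambda>y. (0, y)) = T" by (auto simp: T_def)
  have r_lin: "\<And>d. d \<in> car DX \<Longrightarrow> r d \<in> car E" "\<And>d d'. d \<in> car DX \<Longrightarrow> d' \<in> car DX \<Longrightarrow> r (d + d') = r d + r d'"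
      "\<And>c d. d \<in> car DX \<Longrightarrow> r (scl DX c d) = scl E c (r d)"
    using r unfolding complete_quotient_map_def completely_bounded_def linear_map_def by blast+
  have T_lin: "\<And>y. y \<in> car L \<Longrightarrow> T y \<in> car E" "\<And>y y'. y \<in> car L \<Longrightarrow> y' \<in> car L \<Longrightarrow> T (y + y') = T y + T y'"
      "\<And>c y. y \<in> car L \<Longrightarrow> T (scl L c y) = scl E c (T y)"
    using rj unfolding T_eq complete_quotient_map_def completely_bounded_def linear_map_def XT_car XT_scl by blast+
  have T_onto: "T ` car L = car E" using rj unfolding T_eq complete_quotient_map_def XT_car by blast
  obtain Cr where Cr0: "\<And>n z. n \<ge> 1 \<Longrightarrow> z \<in> mats DX n \<Longrightarrow> mnorm E (map_mat r z) \<le> Cr * mnorm DX z"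
    using r unfolding complete_quotient_map_def completely_bounded_def by blast
  define C1 where "C1 = max Cr 0"
  have C1: "mnorm E (map_mat r z) \<le> C1 * mnorm DX z" if "n \<ge> 1" "z \<in> mats DX n" for n z
    using Cr0[OF that] mult_right_mono[of Cr C1 "mnorm DX z"] DX.mnorm_nonneg[OF that] by (auto simp: C1_def)
  have T_diff: "T (y - y') = T y - T y'" if "y \<in> car L" "y' \<in> car L" for y y'
    using T_lin(2)[of "y - y'" y'] that carrier_diff[OF that] by (simp del: lp_simps)
  obtain CT where CT0: "\<And>n z. n \<ge> 1 \<Longrightarrow> z \<in> mats XT n \<Longrightarrow> mnorm E (map_mat T z) \<le> CT * mnorm XT z"
    using rj unfolding T_eq complete_quotient_map_def completely_bounded_def by blast
  define C2 where "C2 = max CT 0"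
  have T_bound: "mnorm E (mat 1 1 (\<lambda>_. T y)) \<le> C2 * nrm L y" if y: "y \<in> car L" for y
  proof -
    have m: "mat 1 1 (\<lambda>_. y) \<in> mats XT 1" using y by (auto intro!: matsI simp del: lp_simps)
    have e: "map_mat T (mat 1 1 (\<lambda>_. y)) = mat 1 1 (\<lambda>_. T y)" by auto
    have "mnorm E (mat 1 1 (\<lambda>_. T y)) \<le> CT * mnorm XT (mat 1 1 (\<lambda>_. y))" using CT0[OF _ m] unfolding e by simp
    also have "\<dots> \<le> C2 * nrm L y"
      using pair_zero(3)[OF y] XT.mnorm_nonneg[OF _ m] by (intro mult_mono) (auto simp: C2_def)
    finally show ?thesis .
  qed
  interpret Q: quotient XT T "scl E"
  proof (intro quotient.intro quotient_axioms.intro XT.opspace_axioms E.vector_space_scale)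
    fix w y assume w: "\<And>k. w k \<in> car XT" "\<And>k. T (w k) = 0" "y \<in> car XT"
      and lim: "(\<lambda>k. mnorm XT (mat 1 1 (\<lambda>_. w k - y))) \<longlonglongrightarrow> 0"
    have yL: "y \<in> car L" "w k \<in> car L" for k using w(1,3) by (simp_all del: lp_simps)
    have "mnorm E (mat 1 1 (\<lambda>_. T y)) \<le> C2 * mnorm XT (mat 1 1 (\<lambda>_. w k - y))" for k
    proof -
      have "T (y - w k) = T y" using T_diff[OF yL] w(2) by simp
      then have "mnorm E (mat 1 1 (\<lambda>_. T y)) \<le> C2 * nrm L (y - w k)"
        using T_bound[OF carrier_diff[OF yL], of k] by simp
      also have "\<dots> \<le> C2 * mnorm XT (mat 1 1 (\<lambda>_. w k - y))"
        using XT_norm_ge[OF carrier_diff[OF yL(2,1)], of k] nrm_diff_commute[OF yL, of k]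
        by (intro mult_left_mono) (auto simp: C2_def)
      finally show ?thesis .
    qed
    then have "mnorm E (mat 1 1 (\<lambda>_. T y)) \<le> 0"
      by (intro tendsto_lowerbound[OF tendsto_mult_right_zero[OF lim, of C2]]) auto
    then show "T y = 0" using E.norm.nrm_nonneg[of "T y"] E.norm.nrm_eq_0[of "T y"] T_lin(1)[OF yL(1)] by simp
  qed (use T_lin in \<open>auto simp del: lp_simps(2)\<close>)
  have carQ: "car Q.Q = car E" using T_onto by simp
  have "completely_bounded E Q.Q (inv_into (car Q.Q) (\<lambda>z. z))"
    using rj unfolding T_eq complete_quotient_map_def complete_isomorphism_def by blast
  then obtain CQ where CQ: "\<And>n z. n \<ge> 1 \<Longrightarrow> z \<in> mats E n \<Longrightarrow> mnorm Q.Q (map_mat (inv_into (car Q.Q) (\<lambda>z. z)) z) \<le> CQ * mnorm E z"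
    unfolding completely_bounded_def by blast
  define C3 where "C3 = max CQ 0"
  have C3: "z \<in> mats Q.Q n" "mnorm Q.Q z \<le> C3 * mnorm E z" if n: "n \<ge> 1" and z: "z \<in> mats E n" for n z
  proof -
    show "z \<in> mats Q.Q n" using z carQ by (simp add: mats_def)
    have "map_mat (inv_into (car Q.Q) (\<lambda>z. z)) z = z"
      using z carQ inv_into_f_f[of "\<lambda>z. z" "car Q.Q"] by (intro eq_matI) (auto simp: mats_iff simp del: Q.Q_simps)
    then have "mnorm Q.Q z \<le> CQ * mnorm E z" using CQ[OF n z] by simp
    then show "mnorm Q.Q z \<le> C3 * mnorm E z"
      using mult_right_mono[of CQ C3 "mnorm E z"] E.mnorm_nonneg[OF n z] by (auto simp: C3_def)
  qed
  have nn: "C1 \<ge> 0" "C2 \<ge> 0" "C3 \<ge> 0" by (simp_all add: C1_def C2_def C3_def)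
  \<comment> \<open>The summand \<open>1\<close> makes the inequality strict, as the infimum over liftings through \<open>T\<close> need not be
    attained.\<close>
  define C where "C = C3 * C1 + 1"
  have lift: "\<exists>w\<in>mats XT n. map_mat T w = map_mat r z \<and> mnorm XT w \<le> C * \<nu>"
    if n: "n \<ge> 1" and z: "z \<in> mats DX n" and \<nu>: "\<nu> > 0" "mnorm DX z \<le> \<nu>" for n z \<nu>
  proof -
    have rz: "map_mat r z \<in> mats E n" using z unfolding mats_iff by (auto intro!: r_lin(1))
    have "mnorm Q.Q (map_mat r z) \<le> C3 * (C1 * mnorm DX z)"
      using C3(2)[OF n rz] mult_left_mono[OF C1[OF n z] nn(3)] by linarith
    also have "\<dots> \<le> C3 * (C1 * \<nu>)" using \<nu>(2) nn by (intro mult_left_mono) auto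
    also have "\<dots> < C * \<nu>" using \<nu>(1) by (simp add: C_def algebra_simps)
    finally show ?thesis using Q.Q_lift_less[OF n C3(1)[OF n rz]] by (metis less_imp_le)
  qed
  show "finite_dim E"
  proof (rule ccontr)
    assume inf: "\<not> finite_dim E"
    \<comment> \<open>\<open>f\<close> factors through \<open>T\<close>.\<close>
    define P where "P f = (\<forall>y\<in>car L. \<forall>y'\<in>car L. T y = T y' \<longrightarrow> f y = (f y' :: complex))" for f
    have hump: "\<exists>f\<in>dual_ball L. P f \<and> (\<forall>y\<in>car L. f (rst {..<m} y) = 0) \<and> (\<exists>y\<in>car L. nrm L y \<le> 1 \<and> cmod (f y) \<ge> 1/2)" for m
    proof -
      define e where "e k = rst {k} (\<lambda>_. 1)" for k
      have e: "e k \<in> car L" for k unfolding e_def by (rule rst_finite_carrier) simp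
      obtain \<phi> C\<phi> where \<phi>: "\<And>a b. a \<in> car E \<Longrightarrow> b \<in> car E \<Longrightarrow> \<phi> (a + b) = \<phi> a + \<phi> b"
        "\<And>c a. a \<in> car E \<Longrightarrow> \<phi> (scl E c a) = c * \<phi> a"
        "\<And>a. a \<in> car E \<Longrightarrow> cmod (\<phi> a) \<le> C\<phi> * mnorm E (mat 1 1 (\<lambda>_. a))"
        "\<And>k. k < m \<Longrightarrow> \<phi> (T (e k)) = (0 :: complex)" "\<exists>a\<in>car E. \<phi> a \<noteq> 0"
      proof (rule E.norm.functional_vanishing_on_finite_set[of m "\<lambda>k. T (e k)", unfolded E.NX_simps])
        show "\<not> (\<exists>B. finite B \<and> car E = module.span (scl E) B)" using inf by (simp add: finite_dim_def)
        show "T (e k) \<in> car E" for k by (rule T_lin(1)[OF e])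
      qed (rule that)
      define g where "g y = \<phi> (T y)" for y
      have g_add: "g (y + y') = g y + g y'" if "y \<in> car L" "y' \<in> car L" for y y'
        using that T_lin \<phi>(1) by (simp add: g_def del: lp_simps)
      have g_scale: "g (scl L c y) = c * g y" if "y \<in> car L" for c y using that T_lin(1,3) \<phi>(2) by (simp add: g_def del: lp_simps)
      define D where "D = max C\<phi> 0 * C2"
      have g_le: "cmod (g y) \<le> D * nrm L y" if y: "y \<in> car L" for y
      proof -
        have "cmod (g y) \<le> C\<phi> * mnorm E (mat 1 1 (\<lambda>_. T y))" unfolding g_def by (rule \<phi>(3)[OF T_lin(1)[OF y]])
        also have "\<dots> \<le> max C\<phi> 0 * mnorm E (mat 1 1 (\<lambda>_. T y))"
          using E.norm.nrm_nonneg[of "T y"] T_lin(1)[OF y] by (intro mult_right_mono) auto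
        also have "\<dots> \<le> max C\<phi> 0 * (C2 * nrm L y)" by (intro mult_left_mono T_bound y) simp
        finally show ?thesis by (simp add: D_def mult.assoc)
      qed
      have g_zero: "g (rst {..<k} y) = 0" if "k \<le> m" for k y
        using that
      proof (induction k)
        case 0
        have "rst {..<0} y = scl L 0 0" by (auto simp: rst_def)
        then show ?case using g_scale[OF carrier_zero, of 0] by (simp only: mult_zero_left)
      next
        case (Suc k)
        have "rst {..<Suc k} y = rst {..<k} y + scl L (y k) (e k)" by (auto simp: rst_def e_def fun_eq_iff less_Suc_eq)
        then have "g (rst {..<Suc k} y) = g (rst {..<k} y) + y k * g (e k)"
          using g_add[OF rst_finite_carrier carrier_scale[OF e]] g_scale[OF e] by (metis finite_lessThan)
        then show ?case using Suc \<phi>(4)[of k] by (simp add: g_def)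
      qed
      \<comment> \<open>Normalise \<open>g\<close> in the dual, so that it takes a value of modulus at least \<open>1/2\<close> on the unit ball.\<close>
      define M where "M = (SUP y\<in>{y \<in> car L. nrm L y \<le> 1}. cmod (g y))"
      have D0: "D \<ge> 0" using nn(2) by (simp add: D_def)
      have bdd: "bdd_above ((\<lambda>y. cmod (g y)) ` {y \<in> car L. nrm L y \<le> 1})"
      proof (rule bdd_aboveI2)
        fix y assume "y \<in> {y \<in> car L. nrm L y \<le> 1}"
        then show "cmod (g y) \<le> D" using g_le[of y] mult_left_mono[of "nrm L y" 1 D] D0 by (simp del: lp_simps)
      qed
      have Mup: "cmod (g y) \<le> M" if "y \<in> car L" "nrm L y \<le> 1" for y
        unfolding M_def using that by (intro cSUP_upper[OF _ bdd]) simp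
      have gM: "cmod (g y) \<le> M * nrm L y" if y: "y \<in> car L" for y
      proof (cases "nrm L y = 0")
        case True
        then show ?thesis using g_le[OF y] by simp
      next
        case False
        then have ny: "nrm L y > 0" using nrm_nonneg[OF y] by linarith
        have "cmod (g (scl L (complex_of_real (1 / nrm L y)) y)) \<le> M"
          by (rule Mup[OF carrier_scale[OF y]]) (use ny in \<open>simp add: nrm_scale[OF y] norm_divide del: lp_simps\<close>)
        then show ?thesis unfolding g_scale[OF y] using ny by (simp add: norm_mult norm_divide divide_le_eq)
      qed
      have Mpos: "M > 0"
      proof -
        obtain a where "a \<in> car E" "\<phi> a \<noteq> 0" using \<phi>(5) by blast
        then have "a \<in> T ` car L" by (simp only: T_onto)
        then obtain y where y: "y \<in> car L" "g y \<noteq> 0" using \<open>\<phi> a \<noteq> 0\<close> unfolding g_def by blast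
        then have "0 < cmod (g y)" by simp
        also have "\<dots> \<le> M * nrm L y" by (rule gM[OF y(1)])
        finally have "0 < M * nrm L y" .
        then show ?thesis using nrm_nonneg[OF y(1)] by (simp add: zero_less_mult_iff)
      qed
      define f where "f y = complex_of_real (1 / M) * g y" for y
      have f: "f \<in> dual_ball L"
        unfolding dual_ball_iff
      proof (intro conjI ballI allI)
        fix x y c assume x: "x \<in> car L"
        show "f (scl L c x) = c * f x" by (simp only: f_def g_scale[OF x] ac_simps)
        show "cmod (f x) \<le> nrm L x" using gM[OF x] Mpos by (simp add: f_def norm_mult norm_divide divide_le_eq mult.commute)
        assume y: "y \<in> car L"
        show "f (x + y) = f x + f y" by (simp only: f_def g_add[OF x y] distrib_left)
      qed
      have "\<exists>y\<in>{y \<in> car L. nrm L y \<le> 1}. M / 2 < cmod (g y)"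
      proof (rule ccontr)
        assume "\<not> (\<exists>y\<in>{y \<in> car L. nrm L y \<le> 1}. M / 2 < cmod (g y))"
        then have le: "cmod (g y) \<le> M / 2" if "y \<in> {y \<in> car L. nrm L y \<le> 1}" for y using that by (meson not_less)
        have ne: "{y \<in> car L. nrm L y \<le> 1} \<noteq> {}"
          using carrier_zero nrm_zero zero_le_one by (metis (mono_tags, lifting) empty_iff mem_Collect_eq)
        have "M \<le> K" if "\<And>y. y \<in> {y \<in> car L. nrm L y \<le> 1} \<Longrightarrow> cmod (g y) \<le> K" for K
          unfolding M_def by (rule cSUP_least[OF ne that])
        from this[OF le] have "M \<le> M / 2" .
        then show False using Mpos by simp
      qed
      then obtain y where y: "y \<in> car L" "nrm L y \<le> 1" "M / 2 < cmod (g y)" by blast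
      have "cmod (f y) \<ge> 1/2" using y(3) Mpos by (simp add: f_def norm_mult norm_divide le_divide_eq)
      moreover have "P f" by (auto simp: P_def f_def g_def)
      moreover have "\<forall>y\<in>car L. f (rst {..<m} y) = 0" using g_zero[OF order_refl] by (simp add: f_def)
      ultimately show ?thesis using f y(1,2) by blast
    qed
    obtain x f where sys: "\<And>n. biorthogonal_bound n x f" and Pf: "\<And>i. P (f i)" and nx: "\<And>i. nrm L (x i) \<le> 1"
      and diag: "\<And>i. \<exists>a\<ge>1/4. f i (x i) = complex_of_real a"
      by (rule gliding_hump_functionals[OF hump]) (rule that)
    have xL: "x i \<in> car L" for i using sys[of "Suc i"] by (auto simp: biorthogonal_bound_def simp del: lp_simps)
    have fD: "f i \<in> dual_ball L" for i using sys[of "Suc i"] by (auto simp: biorthogonal_bound_def simp del: lp_simps)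
    have "\<exists>y. y \<in> car L \<and> T y = r (x i, 0) \<and> nrm L y \<le> C" for i
    proof -
      have m: "mat 1 1 (\<lambda>_. (x i, 0)) \<in> mats DX 1" using pair_zero(1)[OF xL[of i]] by (auto intro!: matsI)
      have "mnorm DX (mat 1 1 (\<lambda>_. (x i, 0))) \<le> 1" using pair_zero(2)[OF xL[of i]] nx[of i] by linarith
      then have "\<exists>w\<in>mats XT 1. map_mat T w = map_mat r (mat 1 1 (\<lambda>_. (x i, 0))) \<and> mnorm XT w \<le> C * 1"
        by (intro lift m) simp_all
      then obtain w where w: "w \<in> mats XT 1" "map_mat T w = map_mat r (mat 1 1 (\<lambda>_. (x i, 0)))" "mnorm XT w \<le> C * 1"
        by (elim bexE conjE) (rule that)
      have w0: "w $$ (0, 0) \<in> car L" using matsD[OF w(1), of 0 0] by (simp del: lp_simps)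
      have "mat 1 1 (\<lambda>_. w $$ (0, 0)) = w" using mats_dim[OF w(1)] by (intro eq_matI) auto
      then have "nrm L (w $$ (0, 0)) \<le> C" using XT_norm_ge[OF w0] w(3) by simp
      moreover have "T (w $$ (0, 0)) = r (x i, 0)"
        using arg_cong[OF w(2), of "\<lambda>m. m $$ (0, 0)"] mats_dim[OF w(1)] by simp
      ultimately show ?thesis using w0 by blast
    qed
    then obtain b where b: "\<And>i. b i \<in> car L" "\<And>i. T (b i) = r (x i, 0)" "\<And>i. nrm L (b i) \<le> C" by metis
    obtain n :: nat where n: "n \<ge> 1" "gap * ln (real n) / 4 > C + 4 * C" by (rule ln_large)
    have "gap * ln (real n) / 4 \<le> C + 4 * C"
    proof (rule quotient_columns_estimate[OF n(1) sys diag, where b = "\<lambda>i. f i (b i)"])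
      fix l \<nu> :: real
      let ?z = "map_mat (\<lambda>x. (x, scl L (complex_of_real l) x)) (column n x)"
      assume \<nu>: "\<nu> > 0" and z: "?z \<in> mats DX n" "mnorm DX ?z \<le> \<nu>"
      obtain w where w: "w \<in> mats XT n" "map_mat T w = map_mat r ?z" "mnorm XT w \<le> C * \<nu>"
        using lift[OF n(1) z(1) \<nu> z(2)] by blast
      have "f i (w $$ (i, 0)) = f i (b i) + complex_of_real l * f i (x i)" if i: "i < n" for i
      proof -
        have n0: "0 < n" using i by simp
        have w0: "w $$ (i, 0) \<in> car L" using matsD[OF w(1) i n0] by (simp del: lp_simps)
        have lx: "scl L (complex_of_real l) (x i) \<in> car L" by (rule carrier_scale[OF xL])
        have "T (w $$ (i, 0)) = r (x i, scl L (complex_of_real l) (x i))"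
          using arg_cong[OF w(2), of "\<lambda>m. m $$ (i, 0)"] mats_dim[OF w(1)] i n0 by (simp add: column_index del: lp_simps)
        also have "(x i, scl L (complex_of_real l) (x i)) = (x i, 0) + (0, scl L (complex_of_real l) (x i))" by simp
        also have "r \<dots> = r (x i, 0) + r (0, scl L (complex_of_real l) (x i))"
          by (rule r_lin(2)[OF pair_zero(1)[OF xL] zero_pair_car[OF lx]])
        also have "\<dots> = T (b i) + T (scl L (complex_of_real l) (x i))" by (simp only: b(2)[symmetric] T_def)
        also have "\<dots> = T (b i + scl L (complex_of_real l) (x i))" by (rule T_lin(2)[OF b(1) lx, symmetric])
        finally have "f i (w $$ (i, 0)) = f i (b i + scl L (complex_of_real l) (x i))"
          using Pf[of i] w0 carrier_add[OF b(1) lx] unfolding P_def by blast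
        also have "\<dots> = f i (b i) + complex_of_real l * f i (x i)"
          by (simp only: dual_add[OF fD b(1) lx] dual_scale[OF fD xL])
        finally show ?thesis .
      qed
      then show "\<exists>w\<in>mats XT n. mnorm XT w \<le> C * \<nu> \<and> (\<forall>i<n. f i (w $$ (i, 0)) = f i (b i) + complex_of_real l * f i (x i))"
        using w(1,3) by blast
    next
      show "cmod (f i (b i)) \<le> C" for i using dual_le[OF fD b(1), of i i] b(3)[of i] by linarith
    qed
    then show False using n(2) by simp
  qed
qed

end

theorem theorem4p1:
  fixes p \<theta> :: real
  assumes "1 < p" and "0 < \<theta>" and "\<theta> < 1"
  shows "completely_singular_sequence (o_lp p \<theta>) (do_lp p \<theta>) (o_lp p \<theta>) (\<lambda>y. (0, y)) (\<lambda>(x, y). x) \<and>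
         completely_cosingular_sequence TYPE('e::ab_group_add)
           (o_lp p \<theta>) (do_lp p \<theta>) (o_lp p \<theta>) (\<lambda>y. (0, y)) (\<lambda>(x, y). x)"
proof -
  interpret lp_interpolation p \<theta> by unfold_locales (rule assms)+
  show ?thesis
    unfolding completely_singular_sequence_def completely_cosingular_sequence_def o_lp_def do_lp_def
    using extension_sequence_interpolation completely_strictly_singular_q completely_strictly_cosingular_j by blast
qed

end
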